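(* For all $c,t\in\mathbb{N}$, there is a constant $\Gamma=\Gamma(c,t)$ such that every $t$-clean graph $G$ of treewidth more than $\Gamma$ contains a $c$-hassle.
   Context: $G$ contains $H$ if $H$ is isomorphic to an induced subgraph of $G$. A $t$-basic obstruction is a graph isomorphic to $K_{t+1}$, $K_{t,t}$, a subdivision of the $t$-by-$t$ wall $W_{t\times t}$ (hexagonal grid), or the line graph of such a subdivision; $G$ is $t$-clean if it contains no $t$-basic obstruction. A walk is a graph $W$ with $n_W\in\mathbb{N}$ and a surjection $\varphi_W:\{1,\dots,n_W\}\to V(W)$ with $\varphi_W(i)\varphi_W(i+1)\in E(W)$ for all $i<n_W$; its first $c$ vertices are $\varphi_W(\{1,\dots,c\})$, its last $c$ vertices are $\varphi_W(\{n_W-c+1,\dots,n_W\})$. $W$ is $c$-stretched if for every set $S\subseteq\{1,\dots,n_W\}$ of at most $c$ consecutive integers, $W[\varphi_W(S)]$ is a path. A $c$-hassle is a graph obtained from at least $c$ pairwise disjoint $c$-stretched walks by adding arbitrary edges between different walks and then adding a vertex $x$ (the neck) that has a neighbor in each walk and is non-adjacent to the first $c$ and last $c$ vertices of each walk. *)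

theory Defs
  imports "Graph_Theory.Kuratowski" "Graph_Theory.Digraph_Isomorphism"
begin

text \<open>
  Finite simple graphs are the symmetric, loopless, finite pair digraphs
  (\<^locale>\<open>pair_graph\<close>): every edge \<open>uv\<close> is represented by the two arcs \<open>(u, v)\<close> and \<open>(v, u)\<close>.
\<close>

definition contains :: "'a pair_pre_digraph \<Rightarrow> 'b pair_pre_digraph \<Rightarrow> bool" where
  "contains G H \<longleftrightarrow>
     (\<exists>I. induced_subgraph I (with_proj G) \<and> digraph_iso (with_proj H) I)"


subsection \<open>Treewidth\<close>

text \<open>
  The library's \<open>tree\<close> is of no use for symmetric digraphs: there the two arcs of an
  edge already form a cycle \<open>u, v, u\<close>. The cycles of an undirected graph are the cycles of
  length at least 3 of its symmetric digraph.
\<close>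
definition undirected_tree :: "'a pair_pre_digraph \<Rightarrow> bool" where
  "undirected_tree T \<longleftrightarrow>
     pair_graph T \<and> Digraph_Component.connected (with_proj T) \<and>
     \<not> (\<exists>p. pre_digraph.cycle (with_proj T) p \<and> 3 \<le> length p)"

definition tree_decomposition ::
    "'a pair_pre_digraph \<Rightarrow> 'b pair_pre_digraph \<Rightarrow> ('b \<Rightarrow> 'a set) \<Rightarrow> bool" where
  "tree_decomposition G T \<beta> \<longleftrightarrow>
     undirected_tree T \<and>
     (\<Union>s \<in> pverts T. \<beta> s) = pverts G \<and>
     (\<forall>(u, v) \<in> parcs G. \<exists>s \<in> pverts T. u \<in> \<beta> s \<and> v \<in> \<beta> s) \<and>
     (\<forall>v \<in> pverts G.
        Digraph_Component.connected (with_proj T \<restriction> {s \<in> pverts T. v \<in> \<beta> s}))"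

definition width :: "'b pair_pre_digraph \<Rightarrow> ('b \<Rightarrow> 'a set) \<Rightarrow> nat" where
  "width T \<beta> = Max ((\<lambda>s. card (\<beta> s)) ` pverts T) - 1"

text \<open>
  Decomposition trees are finite, so it suffices to take their nodes from \<^typ>\<open>nat\<close>.
  The null graph gets treewidth 0 instead of -1.
\<close>
definition treewidth :: "'a pair_pre_digraph \<Rightarrow> nat" where
  "treewidth G = (LEAST w. \<exists>(T :: nat pair_pre_digraph) \<beta>.
     tree_decomposition G T \<beta> \<and> width T \<beta> = w)"


subsection \<open>Basic obstructions\<close>

text \<open>
  Row \<open>i < t\<close> is a path on the \<open>2t\<close> vertices \<open>(i, 0), \<dots>, (i, 2t - 1)\<close>; rows \<open>i\<close> and \<open>i + 1\<close> are
  joined in column \<open>j\<close> if and only if \<open>i + j\<close> is even.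
\<close>
definition brick_arcs :: "nat \<Rightarrow> (nat \<times> nat) rel" where
  "brick_arcs t = {((i, j), (i', j')) | i j i' j'.
     i < t \<and> i' < t \<and> j < 2 * t \<and> j' < 2 * t \<and>
     (i = i' \<and> (j' = Suc j \<or> j = Suc j') \<or>
      j = j' \<and> (i' = Suc i \<and> even (i + j) \<or> i = Suc i' \<and> even (i' + j)))}"

text \<open>
  The wall arises by deleting the vertices of degree 1 (two corners); \<open>wall 2\<close> is a hexagon.
  For \<open>t = 1\<close> nothing is deleted, as otherwise the null graph would remain.
\<close>
definition wall_verts :: "nat \<Rightarrow> (nat \<times> nat) set" where
  "wall_verts t =
     {v \<in> {..<t} \<times> {..<2 * t}. 2 \<le> t \<longrightarrow> card {u. (v, u) \<in> brick_arcs t} \<noteq> 1}"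

definition wall :: "nat \<Rightarrow> (nat \<times> nat) pair_pre_digraph" where
  "wall t = \<lparr> pverts = wall_verts t,
              parcs = brick_arcs t \<inter> wall_verts t \<times> wall_verts t \<rparr>"

definition line_graph :: "'a pair_pre_digraph \<Rightarrow> 'a set pair_pre_digraph" where
  "line_graph G =
     (let E = {{u, v} | u v. (u, v) \<in> parcs G}
      in \<lparr> pverts = E, parcs = {(e, f). e \<in> E \<and> f \<in> E \<and> e \<noteq> f \<and> e \<inter> f \<noteq> {}} \<rparr>)"

definition basic_obstruction :: "nat \<Rightarrow> 'a pair_pre_digraph \<Rightarrow> bool" where
  "basic_obstruction t B \<longleftrightarrow>
     complete_digraph (t + 1) (with_proj B) \<or>
     complete_bipartite_digraph t t (with_proj B) \<or>
     (\<exists>S. subdivision_pair (wall t) S \<and>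
        (digraph_iso (with_proj S) (with_proj B) \<or>
         digraph_iso (with_proj (line_graph S)) (with_proj B)))"

text \<open>
  Basic obstructions are closed under isomorphism, so those contained in \<open>G\<close> may be taken
  to have vertices of the same type as \<open>G\<close>.
\<close>
definition clean :: "nat \<Rightarrow> 'a pair_pre_digraph \<Rightarrow> bool" where
  "clean t G \<longleftrightarrow> \<not> (\<exists>B :: 'a pair_pre_digraph. basic_obstruction t B \<and> contains G B)"


subsection \<open>Hassles\<close>

definition path_graph :: "('a, 'b) pre_digraph \<Rightarrow> bool" where
  "path_graph P \<longleftrightarrow>
     (\<exists>xs. xs \<noteq> [] \<and> distinct xs \<and> verts P = set xs \<and>
        arcs_ends P = {(xs ! i, xs ! j) | i j.
          i < length xs \<and> j < length xs \<and> (j = Suc i \<or> i = Suc j)})"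

text \<open>
  Only the values of \<open>\<phi>\<close> on \<open>{1..n}\<close> matter. \<open>W\<close> may have edges other than those
  traversed by \<open>\<phi>\<close>.
\<close>
definition graph_walk :: "'a pair_pre_digraph \<Rightarrow> nat \<Rightarrow> (nat \<Rightarrow> 'a) \<Rightarrow> bool" where
  "graph_walk W n \<phi> \<longleftrightarrow>
     pair_graph W \<and> \<phi> ` {1..n} = pverts W \<and>
     (\<forall>i. 1 \<le> i \<and> i < n \<longrightarrow> (\<phi> i, \<phi> (Suc i)) \<in> parcs W)"

definition first_verts :: "nat \<Rightarrow> nat \<Rightarrow> (nat \<Rightarrow> 'a) \<Rightarrow> 'a set" where
  "first_verts c n \<phi> = \<phi> ` {i \<in> {1..n}. i \<le> c}"

definition last_verts :: "nat \<Rightarrow> nat \<Rightarrow> (nat \<Rightarrow> 'a) \<Rightarrow> 'a set" where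
  "last_verts c n \<phi> = \<phi> ` {i \<in> {1..n}. n + 1 \<le> i + c}"

definition stretched :: "nat \<Rightarrow> 'a pair_pre_digraph \<Rightarrow> nat \<Rightarrow> (nat \<Rightarrow> 'a) \<Rightarrow> bool" where
  "stretched c W n \<phi> \<longleftrightarrow>
     (\<forall>a b. 1 \<le> a \<and> a \<le> b \<and> b \<le> n \<and> card {a..b} \<le> c \<longrightarrow>
        path_graph (with_proj W \<restriction> \<phi> ` {a..b}))"

text \<open>
  Edges are added only between different walks: this is the condition that each walk is
  the subgraph of \<open>H\<close> induced by its vertices.
\<close>
definition hassle :: "nat \<Rightarrow> 'a pair_pre_digraph \<Rightarrow> bool" where
  "hassle c H \<longleftrightarrow> pair_graph H \<and>
     (\<exists>k W n \<phi> x. c \<le> k \<and>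
        (\<forall>i<k. graph_walk (W i) (n i) (\<phi> i) \<and> stretched c (W i) (n i) (\<phi> i)) \<and>
        (\<forall>i<k. \<forall>j<k. i \<noteq> j \<longrightarrow> pverts (W i) \<inter> pverts (W j) = {}) \<and>
        x \<notin> (\<Union>i<k. pverts (W i)) \<and>
        pverts H = insert x (\<Union>i<k. pverts (W i)) \<and>
        (\<forall>i<k. with_proj H \<restriction> pverts (W i) = with_proj (W i)) \<and>
        (\<forall>i<k. (\<exists>v \<in> pverts (W i). (x, v) \<in> parcs H) \<and>
           (\<forall>v \<in> first_verts c (n i) (\<phi> i) \<union> last_verts c (n i) (\<phi> i). (x, v) \<notin> parcs H)))"

end

theory Submission
  imports Defs "HOL-Library.Ramsey"
begin

text \<open>
  A walk may turn around. Hence a vertex \<open>x\<close> with \<open>c\<close> induced paths of length \<open>c + 1\<close> that start in \<open>x\<close> and are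
  otherwise disjoint (a \<open>spider\<close>) is already a \<open>c\<close>-hassle: traverse each leg from its far end towards \<open>x\<close> and back.
  If there is no spider, then every vertex has a bounded set of other vertices that meets all its long induced paths.

  Large treewidth gives a bramble of large order. Call a vertex a \<open>hub\<close> if every connected set around it with few
  neighbours includes a set of the bramble. Two hubs can be linked around any small set. By Ramsey's theorem, many
  hubs would thus yield an induced path that is too long, so there are boundedly many hubs, which can be deleted.

  Now the graph is covered by connected sets with few neighbours that include no set of the bramble. A partition
  into the least number of connected subsets of them has a quotient of bounded degree with a bramble of large order.
  In such a quotient, the grid theorem and repeated contractions of scattered balls produce an induced subgraph
  that is almost subcubic (\<open>sparse\<close>) and still has a large grid minor. There, an edge-minimal minor model of a
  subdivided grid is an induced one, and it lifts to the original graph. In a branch set, the induced paths to three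
  neighbours meet in a claw or in a triangle. A subgrid on which only one of these types occurs yields an induced
  subdivision of a wall or the line graph of one, a contradiction.
\<close>

subsection \<open>Connectivity\<close>

definition conn :: "'a rel => 'a set => bool" where
  "conn E S = (S ~= {} & (ALL x:S. ALL y:S. (x, y):(E Int S \<times> S)^*))"

definition touch :: "'a rel => 'a set => 'a set => bool" where
  "touch E A B = (A Int B ~= {} | (EX a:A. EX b:B. (a, b):E))"

definition compo :: "'a rel => 'a set => 'a => 'a set" where
  "compo E S x = {y. (x, y):(E Int S \<times> S)^*}"

definition path :: "'a rel => 'a list => bool" where
  "path E xs = (xs ~= [] & distinct xs & successively (%x y. (x, y):E) xs)"

definition ipath :: "'a rel => 'a list => bool" where
  "ipath E xs = (path E xs & (ALL i<length xs. ALL j<length xs. (xs ! i, xs ! j):E --> j = Suc i | i = Suc j))"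

lemma conn_nonempty: "conn E S ==> S ~= {}" by (simp add: conn_def)

lemma conn_sing [simp]: "conn E {x}" by (simp add: conn_def)

lemma sym_restr: "sym E ==> sym (E Int S \<times> S)" by (auto simp: sym_def)

lemma sym_rtrancl_restr: "sym E ==> (x, y):(E Int S \<times> S)^* ==> (y, x):(E Int S \<times> S)^*" using sym_rtrancl[OF sym_restr[of E S]] by (meson symD)

lemma rtrancl_restr_mono: "(x, y):(E Int S \<times> S)^* ==> E <= F ==> S <= T ==> (x, y):(F Int T \<times> T)^*" by (rule subsetD[OF rtrancl_mono]) auto

lemma connI:
  assumes "sym E" "x:S" "!!y. y:S ==> (x, y):(E Int S \<times> S)^*"
  shows "conn E S"
  unfolding conn_def using assms by (metis empty_iff rtrancl_trans sym_rtrancl_restr)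

lemma conn_edge_mono: "conn E S ==> E <= F ==> conn F S" unfolding conn_def by (metis order_refl rtrancl_restr_mono)

lemma touch_sym: "sym E ==> touch E A B ==> touch E B A" unfolding touch_def sym_def by auto

lemma touch_mono: "touch E A B ==> E <= F ==> A <= A' ==> B <= B' ==> touch F A' B'" unfolding touch_def by blast

lemma conn_Un: assumes "sym E" "conn E A" "conn E B" "touch E A B" shows "conn E (A Un B)"
proof -
 let ?R = "(E Int (A Un B) \<times> (A Un B))^*"
 have A: "(x, y) : ?R" if "x:A" "y:A" for x y using assms(2) that unfolding conn_def by (metis rtrancl_restr_mono order_refl sup_ge1)
 have B: "(x, y) : ?R" if "x:B" "y:B" for x y using assms(3) that unfolding conn_def by (metis rtrancl_restr_mono order_refl sup_ge2)
 from assms(4) obtain a b where ab: "a:A" "b:B" "(a, b) : ?R" unfolding touch_def by auto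
 have AB: "(x, y) : ?R" if "x:A" "y:B" for x y using A[OF that(1) ab(1)] ab(3) B[OF ab(2) that(2)] by simp
 have BA: "(y, x) : ?R" if "x:A" "y:B" for x y using AB[OF that] assms(1) by (metis sym_rtrancl_restr)
 show ?thesis unfolding conn_def using A B AB BA assms(2) conn_nonempty by blast
qed

lemma conn_insert: "sym E ==> conn E A ==> a:A ==> (a, x):E ==> conn E (insert x A)" using conn_Un[of E A "{x}"] by (auto simp: touch_def)

lemma conn_UN: assumes "sym E" "conn E A" "!!i. i:I ==> conn E (B i)" "!!i. i:I ==> touch E A (B i)" shows "conn E (A Un (UN i:I. B i))"
proof -
 obtain a where a: "a:A" using assms(2) conn_nonempty by auto
 show ?thesis
 proof (rule connI[OF assms(1), of a])
  show "a:A Un (UN i:I. B i)" using a by simp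
  fix y
  assume y: "y:A Un (UN i:I. B i)"
  show "(a, y):(E Int (A Un (UN i:I. B i)) \<times> (A Un (UN i:I. B i)))^*"
  proof (cases "y:A")
   case True
   thus ?thesis using assms(2) a unfolding conn_def by (metis rtrancl_restr_mono order_refl sup_ge1)
  next
   case False
   then obtain i where i: "i:I" "y:B i" using y by auto
   have "(a, y):(E Int (A Un B i) \<times> (A Un B i))^*" using conn_Un[OF assms(1,2)] assms(3,4) i a unfolding conn_def by auto
   thus ?thesis by (rule rtrancl_restr_mono) (use i in auto)
  qed
 qed
qed

lemma conn_cut: assumes "conn E S" "x:S" "x:A" "y:S" "y~:A" obtains a b where "a:S" "a:A" "b:S" "b~:A" "(a, b):E"
proof -
 have "(x, y):(E Int S \<times> S)^*" using assms unfolding conn_def by simp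
 hence "y~:A --> (EX a b. a:S & a:A & b:S & b~:A & (a, b):E)" by (induction rule: rtrancl_induct) (use assms(3) in blast)+
 thus ?thesis using that assms(5) by auto
qed

lemma compo_in: "x:S ==> compo E S x <= S"
proof
 fix y
 assume "x:S" "y:compo E S x"
 hence "(x, y):(E Int S \<times> S)^*" by (simp add: compo_def)
 thus "y:S" using \<open>x:S\<close> by (induction rule: rtrancl_induct) auto
qed

lemma compo_self [simp]: "x:compo E S x" by (simp add: compo_def)

lemma compo_closed: "y:compo E S x ==> x:S ==> (y, z):E ==> z:S ==> z:compo E S x"
  using compo_in[of x S E] unfolding compo_def by (auto intro: rtrancl_into_rtrancl)

lemma compo_conn: assumes "sym E" "x:S" shows "conn E (compo E S x)"
proof (rule connI[OF assms(1) compo_self])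
 fix y
 assume "y:compo E S x"
 hence "(x, y):(E Int S \<times> S)^*" by (simp add: compo_def)
 thus "(x, y):(E Int compo E S x \<times> compo E S x)^*"
 proof (induction rule: rtrancl_induct)
  case (step y z)
  have "y:compo E S x" "z:compo E S x" using step(1,2) unfolding compo_def by (auto intro: rtrancl_into_rtrancl)
  with step show ?case by (auto intro: rtrancl_into_rtrancl)
 qed simp
qed

lemma conn_sub_compo: assumes "conn E B" "B <= S" "y:B" "y:compo E S x" shows "B <= compo E S x"
proof
 fix z
 assume "z:B"
 hence "(y, z):(E Int B \<times> B)^*" using assms unfolding conn_def by simp
 hence "(y, z):(E Int S \<times> S)^*" by (rule rtrancl_restr_mono) (use assms in auto)
 thus "z:compo E S x" using assms(4) unfolding compo_def by auto
qed

lemma successively_conn: assumes "sym E" "xs ~= []" "successively (%x y. (x, y):E) xs" shows "conn E (set xs)" using assms(2,3)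
proof (induction xs)
 case (Cons x xs)
 show ?case
 proof (cases "xs = []")
  case False
  hence "conn E (set xs)" "(x, hd xs):E" using Cons by (auto simp: successively_Cons)
  thus ?thesis using conn_insert[OF assms(1), of "set xs" "hd xs" x] assms(1) False by (auto simp: sym_def)
 qed simp
qed simp

lemma path_conn: "sym E ==> path E xs ==> conn E (set xs)" by (simp add: path_def successively_conn)

lemma path_nth: "path E xs ==> Suc i < length xs ==> (xs ! i, xs ! Suc i):E" by (simp add: path_def successively_conv_nth)

lemma path_append: "path E xs ==> path E ys ==> set xs Int set ys = {} ==> (last xs, hd ys):E ==> path E (xs @ ys)"
  by (auto simp: path_def successively_append_iff)

lemma path_appendD1: "path E (xs @ ys) ==> xs ~= [] ==> path E xs" by (auto simp: path_def successively_append_iff)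

lemma path_appendD2: "path E (xs @ ys) ==> ys ~= [] ==> path E ys" by (auto simp: path_def successively_append_iff)

lemma path_take: "path E xs ==> n > 0 ==> path E (take n xs)" using path_appendD1[of E "take n xs" "drop n xs"] by (auto simp: path_def)

lemma path_drop: "path E xs ==> n < length xs ==> path E (drop n xs)" using path_appendD2[of E "take n xs" "drop n xs"] by simp

lemma path_rev: "sym E ==> path E xs ==> path E (rev xs)" unfolding path_def sym_def by (auto elim: successively_mono)

lemma path_edge_mono: "path E xs ==> E <= F ==> path F xs" unfolding path_def by (auto elim!: successively_mono)

lemma path_sing [simp]: "path E [x]" by (simp add: path_def)

lemma path_in_field: "path E xs ==> E <= V \<times> V ==> hd xs:V ==> set xs <= V"
proof
 fix x
 assume p: "path E xs" "E <= V \<times> V" "hd xs:V" "x:set xs"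
 then obtain i where i: "i < length xs" "x = xs ! i" by (metis in_set_conv_nth)
 show "x:V" using p i hd_conv_nth less_nat_zero_code path_nth by (cases i; fastforce)
qed

lemma rtrancl_path:
  assumes "(x, y):(E Int S \<times> S)^*" "x:S"
  obtains xs where "successively (%x y. (x, y):E) xs" "xs ~= []" "hd xs = x" "last xs = y" "set xs <= S"
proof -
 have "EX xs. successively (%x y. (x, y):E) xs & xs ~= [] & hd xs = x & last xs = y & set xs <= S" using assms(1)
 proof (induction rule: rtrancl_induct)
  case base
  thus ?case using assms(2) by (intro exI[of _ "[x]"]) auto
 next
  case (step y z)
  then obtain xs where "successively (%x y. (x, y):E) xs" "xs ~= []" "hd xs = x" "last xs = y" "set xs <= S" by auto
  thus ?case using step(2) by (intro exI[of _ "xs @ [z]"]) (auto simp: successively_append_iff)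
 qed
 thus ?thesis using that by auto
qed

text \<open>A shortest walk is an induced path.\<close>

lemma conn_ipath: assumes "conn E S" "x:S" "y:S" "irrefl E" "sym E" obtains xs where "ipath E xs" "hd xs = x" "last xs = y" "set xs <= S"
proof -
 define P where "P xs \<longleftrightarrow> successively (%x y. (x, y):E) xs & xs ~= [] & hd xs = x & last xs = y & set xs <= S" for xs
 have "EX xs. P xs" using assms unfolding conn_def using rtrancl_path[of x y E S] unfolding P_def by auto
 then obtain xs where xs: "P xs" and mn: "!!ys. P ys ==> length xs <= length ys" using ex_has_least_nat[of P _ length] by auto
 have ts: "successively (%x y. (x, y):E) (take n xs)" "successively (%x y. (x, y):E) (drop n xs)" for n using xs unfolding P_def
   by (metis append_take_drop_id successively_append_iff)+
 have lt: "last (take (Suc n) xs) = xs ! n" if "n < length xs" for n using that by (simp add: take_Suc_conv_app_nth)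
 have x0: "xs ! 0 = x" "xs ~= []" using xs unfolding P_def by (auto simp: hd_conv_nth)
 have shortcut: False if "i + 1 < j" "j < length xs" "(xs ! i, xs ! j):E" for i j
 proof -
  let ?ys = "take (Suc i) xs @ drop j xs"
  have "P ?ys" using xs that ts lt[of i] x0 unfolding P_def by (auto simp: successively_append_iff hd_drop_conv_nth hd_append dest: in_set_takeD in_set_dropD)
  thus False using mn[of ?ys] that by simp
 qed
 have eq: False if "i < j" "j < length xs" "xs ! i = xs ! j" for i j
 proof -
  let ?ys = "take i xs @ drop j xs"
  have "(last (take i xs), hd (drop j xs)):E" if ne: "take i xs ~= []"
  proof -
   obtain k where k: "i = Suc k" using ne by (cases i) auto
   have "(xs ! k, xs ! Suc k):E" using xs \<open>i < j\<close> \<open>j < length xs\<close> k unfolding P_def successively_conv_nth by simp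
   thus ?thesis using k \<open>i < j\<close> \<open>j < length xs\<close> \<open>xs ! i = xs ! j\<close> lt[of k] by (simp add: hd_drop_conv_nth)
  qed
  moreover have "hd ?ys = x"
  proof (cases i)
   case 0
   thus ?thesis using x0 that by (simp add: hd_drop_conv_nth)
  next
   case (Suc k)
   thus ?thesis using xs unfolding P_def by simp
  qed
  ultimately have "P ?ys" using xs that ts unfolding P_def by (auto simp: successively_append_iff dest: in_set_takeD in_set_dropD)
  thus False using mn[of ?ys] that by simp
 qed
 have "j = Suc i | i = Suc j" if ij: "i < length xs" "j < length xs" "(xs ! i, xs ! j):E" for i j
   using shortcut[of i j] shortcut[of j i] ij assms(4,5) unfolding irrefl_def sym_def by (metis Suc_eq_plus1 Suc_lessI linorder_neqE_nat)
 hence "ipath E xs" unfolding ipath_def using xs eq unfolding distinct_conv_nth P_def path_def by (metis linorder_neqE_nat)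
 thus ?thesis using that xs unfolding P_def by simp
qed

subsection \<open>Menger's theorem\<close>

definition walk :: "'a rel => 'a set => 'a set => 'a list => bool" where
  "walk E A B p = (p ~= [] & successively (%x y. (x, y):E) p & hd p:A & last p:B)"

definition separates :: "'a rel => 'a set => 'a set => 'a set => bool" where
  "separates E A B S = ((ALL p. walk E A B p --> set p Int S ~= {}))"

definition linkage :: "'a rel => 'a set => 'a set => 'a list set => bool" where
  "linkage E A B Ps = (finite Ps & (ALL p:Ps. path E p & set p Int A = {hd p} & set p Int B = {last p}) & (ALL p:Ps. ALL q:Ps. p ~= q --> set p Int set q =
    {}))"

lemma separatesD: "separates E A B S ==> walk E A B p ==> EX v. v:set p & v:S" unfolding separates_def by auto

lemma hd_app1: "hd (xs @ x # ys) = hd (xs @ [x])" by (cases xs) auto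

lemma walk_split_first: assumes "walk E A B p" "x:set p" obtains q r where "p = q @ x # r" "x~:set q" "walk E A {x} (q @ [x])" "walk E {x} B (x # r)"
proof -
 obtain q r where p: "p = q @ x # r" "x~:set q" using split_list_first[OF assms(2)] by auto
 thus ?thesis using that[of q r] assms(1) by (cases q; cases r) (auto simp: walk_def successively_append_iff successively_Cons hd_app1[of _ _ "_ # _"])
qed

lemma walk_join:
  assumes "walk E A {x} p" "walk E {x} B q"
  shows "walk E A B (p @ tl q)"
  using assms by (cases q; cases "tl q") (auto simp: walk_def successively_append_iff)

lemma set_join: "p ~= [] ==> last p = hd q ==> q ~= [] ==> set (p @ tl q) = set p Un set q" by (cases q) (auto)

lemma linkageD:
  assumes "linkage E A B Ps" "p:Ps"
  shows "path E p" "set p Int A = {hd p}" "set p Int B = {last p}" "p ~= []" "hd p:A" "last p:B" "distinct p" "walk E A B p"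
  using assms unfolding linkage_def path_def walk_def by auto

lemma linkage_disj: "linkage E A B Ps ==> p:Ps ==> q:Ps ==> v:set p ==> v:set q ==> p = q" unfolding linkage_def by blast

lemma linkage_edge_mono: "linkage E A B Ps ==> E <= F ==> linkage F A B Ps" unfolding linkage_def by (auto intro: path_edge_mono)

lemma linkage_subset: "linkage E A B Ps ==> Qs <= Ps ==> linkage E A B Qs" unfolding linkage_def by (meson finite_subset subsetD)

lemma linkage_last_bij: assumes "linkage E A B Ps" "finite B" "card B <= card Ps" shows "bij_betw last Ps B"
proof -
 have inj: "inj_on last Ps" by (rule inj_onI) (metis assms(1) linkageD(4) linkage_disj last_in_set)
 have "last ` Ps <= B" using linkageD(6)[OF assms(1)] by auto
 moreover have "card (last ` Ps) = card Ps" using inj by (rule card_image)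
 ultimately have "last ` Ps = B" using assms by (metis card_seteq)
 thus ?thesis using inj by (simp add: bij_betw_def)
qed

lemma linkage_hd_bij: assumes "linkage E A B Ps" "finite A" "card A <= card Ps" shows "bij_betw hd Ps A"
proof -
 have inj: "inj_on hd Ps" by (rule inj_onI) (metis assms(1) linkageD(4) linkage_disj hd_in_set)
 have "hd ` Ps <= A" using linkageD(5)[OF assms(1)] by auto
 moreover have "card (hd ` Ps) = card Ps" using inj by (rule card_image)
 ultimately have "hd ` Ps = A" using assms by (metis card_seteq)
 thus ?thesis using inj by (simp add: bij_betw_def)
qed

text \<open>Goering's proof of Menger's theorem: delete an edge \<open>xy\<close>; a smaller separator \<open>S\<close> of the rest becomes a separator of the
  whole graph by adding \<open>x\<close> or \<open>y\<close>, and the linkages from \<open>A\<close> to \<open>S + x\<close> and from \<open>S + y\<close> to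
  \<open>B\<close> fit together.\<close>

theorem menger:
  assumes "finite E" "irrefl E" "finite A" "finite B" and "!!S. finite S ==> separates E A B S ==> k <= card S"
  shows "EX Ps. linkage E A B Ps & card Ps = k"
  using assms
proof (induction "card E" arbitrary: E A B)
 case 0
 hence E: "E = {}" by simp
 have "separates E A B (A Int B)" unfolding separates_def walk_def E
 proof (intro allI impI)
  fix p
  assume p: "p ~= [] & successively (%x y. (x, y) : {}) p & hd p:A & last p:B"
  then obtain x q where "p = x # q" by (cases p) auto
  with p have "p = [x]" by (cases q) auto
  with p show "set p Int (A Int B) ~= {}" by auto
 qed
 hence "k <= card (A Int B)" using 0 by simp
 then obtain T where T: "T <= A Int B" "card T = k" "finite T" using obtain_subset_with_card_n by blast
 have "linkage E A B ((%x. [x]) ` T)" using T unfolding linkage_def by auto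
 moreover have "card ((%x. [x]) ` T) = k" using T by (simp add: card_image inj_on_def)
 ultimately show ?case by auto
next
 case (Suc n)
 then obtain x y where xy: "(x, y):E" by (metis card_eq_0_iff nat.simps(3) subrelI subset_empty)
 let ?F = "E - {(x, y)}"
 have F: "n = card ?F" "finite ?F" "irrefl ?F" using Suc xy by (auto simp: irrefl_def)
 have FE: "?F <= E" by simp
 show ?case
 proof (cases "ALL S. finite S --> separates ?F A B S --> k <= card S")
  case True
  hence "EX Ps. linkage ?F A B Ps & card Ps = k" by (intro Suc(1)[OF F(1,2,3) Suc(5,6)]) simp
  then obtain Ps where "linkage ?F A B Ps" "card Ps = k" by auto
  thus ?thesis by (intro exI[of _ Ps] conjI linkage_edge_mono[OF _ FE])
 next
  case False
  then obtain S where S: "finite S" "separates ?F A B S" "card S < k" by (meson not_le)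
  have through: "EX q r. p = q @ r & walk ?F A {x} q & walk E {y} B r" if "walk E A B p" "~walk ?F A B p" for p using that
  proof (induction p arbitrary: A)
   case Nil
   thus ?case by (simp add: walk_def)
  next
   case (Cons a p)
   hence p: "p ~= []" by (auto simp: walk_def)
   show ?case
   proof (cases "(a, hd p) = (x, y)")
    case True
    thus ?thesis using Cons(2) p by (intro exI[of _ "[a]"] exI[of _ p]) (auto simp: walk_def successively_Cons)
   next
    case False
    hence 1: "(a, hd p) : ?F" using Cons(2) p by (auto simp: walk_def successively_Cons)
    have 2: "walk E {hd p} B p" using Cons(2) p by (simp add: walk_def successively_Cons)
    have 3: "~walk ?F {hd p} B p" using Cons(2,3) 1 by (auto simp: walk_def successively_Cons)
    obtain q r where qr: "p = q @ r" "walk ?F {hd p} {x} q" "walk E {y} B r" using Cons(1)[OF 2 3] by auto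
    have "walk ?F A {x} (a # q)" using qr(2) 1 Cons(2) by (simp add: walk_def successively_Cons)
    thus ?thesis using qr by (intro exI[of _ "a # q"] exI[of _ r]) simp
   qed
  qed
  have through': "EX q r. p = q @ r & walk E A {x} q & walk ?F {y} B r" if "walk E A B p" "~walk ?F A B p" for p using that
  proof (induction p arbitrary: B rule: rev_induct)
   case Nil
   thus ?case by (simp add: walk_def)
  next
   case (snoc a p)
   hence p: "p ~= []" by (auto simp: walk_def)
   show ?case
   proof (cases "(last p, a) = (x, y)")
    case True
    thus ?thesis using snoc(2) p by (intro exI[of _ p] exI[of _ "[a]"]) (auto simp: walk_def successively_append_iff)
   next
    case False
    hence 1: "(last p, a) : ?F" using snoc(2) p by (auto simp: walk_def successively_append_iff)
    have 2: "walk E A {last p} p" using snoc(2) p by (simp add: walk_def successively_append_iff)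
    have 3: "~walk ?F A {last p} p" using snoc(2,3) 1 by (auto simp: walk_def successively_append_iff)
    obtain q r where qr: "p = q @ r" "walk E A {x} q" "walk ?F {y} {last p} r" using snoc(1)[OF 2 3] by auto
    have "walk ?F {y} B (r @ [a])" using qr(3) 1 snoc(2) by (simp add: walk_def successively_append_iff)
    thus ?thesis using qr by auto
   qed
  qed
  have sx: "separates E A B (insert x S)" unfolding separates_def
  proof (intro allI impI)
   fix p
   assume p: "walk E A B p"
   show "set p Int insert x S ~= {}" using S(2) through[OF p] unfolding separates_def walk_def by fastforce
  qed
  have sy: "separates E A B (insert y S)" unfolding separates_def
  proof (intro allI impI)
   fix p
   assume p: "walk E A B p"
   show "set p Int insert y S ~= {}" using S(2) through[OF p] unfolding separates_def walk_def by fastforce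
  qed
  have cS: "x~:S" "y~:S" "card (insert x S) = k" "card (insert y S) = k" using Suc(7)[OF _ sx] Suc(7)[OF _ sy] S by (auto simp: card_insert_if split: if_splits)
  have "EX Ps. linkage ?F A (insert x S) Ps & card Ps = k"
  proof (rule Suc(1)[OF F(1,2,3)])
   fix T
   assume T: "finite T" "separates ?F A (insert x S) T"
   have "separates E A B T" unfolding separates_def
   proof (intro allI impI)
    fix p
    assume p: "walk E A B p"
    show "set p Int T ~= {}"
    proof (cases "walk ?F A B p")
     case True
     then obtain s where "s:set p" "s:S" using S(2) unfolding separates_def by auto
     with True obtain q r where "p = q @ s # r" "walk ?F A {s} (q @ [s])" by (metis walk_split_first)
     moreover hence "walk ?F A (insert x S) (q @ [s])" using \<open>s:S\<close> by (auto simp: walk_def)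
     ultimately show ?thesis using separatesD[OF T(2)] by fastforce
    next
     case False
     then obtain q r where "p = q @ r" "walk ?F A {x} q" using through[OF p] by auto
     moreover hence "walk ?F A (insert x S) q" by (auto simp: walk_def)
     ultimately show ?thesis using separatesD[OF T(2)] by auto
    qed
   qed
   thus "k <= card T" using Suc(7) T by simp
  qed (use Suc S in auto)
  then obtain P where P: "linkage ?F A (insert x S) P" "card P = k" by auto
  have "EX Ps. linkage ?F (insert y S) B Ps & card Ps = k"
  proof (rule Suc(1)[OF F(1,2,3)])
   fix T
   assume T: "finite T" "separates ?F (insert y S) B T"
   have "separates E A B T" unfolding separates_def
   proof (intro allI impI)
    fix p
    assume p: "walk E A B p"
    show "set p Int T ~= {}"
    proof (cases "walk ?F A B p")
     case True
     then obtain s where "s:set p" "s:S" using S(2) unfolding separates_def by auto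
     with True obtain q r where "p = q @ s # r" "walk ?F {s} B (s # r)" by (metis walk_split_first)
     moreover hence "walk ?F (insert y S) B (s # r)" using \<open>s:S\<close> by (auto simp: walk_def)
     ultimately show ?thesis using separatesD[OF T(2)] by fastforce
    next
     case False
     then obtain q r where "p = q @ r" "walk ?F {y} B r" using through'[OF p] by auto
     moreover hence "walk ?F (insert y S) B r" by (auto simp: walk_def)
     ultimately show ?thesis using separatesD[OF T(2)] by auto
    qed
   qed
   thus "k <= card T" using Suc(7) T by simp
  qed (use Suc S in auto)
  then obtain Q where Q: "linkage ?F (insert y S) B Q" "card Q = k" by auto
  have bP: "bij_betw last P (insert x S)" using linkage_last_bij[OF P(1)] P(2) S(1) cS by simp
  have bQ: "bij_betw hd Q (insert y S)" using linkage_hd_bij[OF Q(1)] Q(2) S(1) cS by simp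
  have meet: "v:S & v = last p & v = hd q" if pq: "p:P" "q:Q" "v:set p" "v:set q" for p q v
  proof -
   note p = linkageD[OF P(1) pq(1)] and q = linkageD[OF Q(1) pq(2)]
   obtain p1 p2 where p1: "p = p1 @ v # p2" "v~:set p1" "walk ?F A {v} (p1 @ [v])" using walk_split_first[OF p(8) pq(3)] by metis
   obtain q1 q2 where q1: "q = q1 @ v # q2" "v~:set q1" "walk ?F {v} B (v # q2)" using walk_split_first[OF q(8) pq(4)] by metis
   have "walk ?F A B ((p1 @ [v]) @ tl (v # q2))" using walk_join[OF p1(3) q1(3)] .
   then obtain s where s: "s:S" "s:set p1 Un {v} Un set q2" using separatesD[OF S(2)] by fastforce
   have dq: "distinct (q1 @ v # q2)" using q(7) q1(1) by simp
   have lp: "last p = last (v # p2)" using p1(1) by simp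
   have hqn: "hd q~:set q2" unfolding q1(1) using dq by (cases q1) auto
   have sl: "s = last p" if "s:set p1 Un {v}" using that p1(1) s(1) p(3) by fastforce
   have sh: "s = hd q" if "s : {v} Un set q2" using that q1(1) s(1) q(2) by auto
   show ?thesis using sl last_in_set[of "v # p2"] p(7) p1(1) sh hqn s(2) s(1) by auto
  qed
  define g where "g p = (if last p = x then THE q. q:Q & hd q = y else THE q. q:Q & hd q = last p)" for p
  have uniq: "(THE q. q:Q & hd q = s):Q & hd (THE q. q:Q & hd q = s) = s" if "s:insert y S" for s
  proof (rule theI')
   have "s:hd ` Q" using bQ that by (simp add: bij_betw_def)
   then obtain q where "q:Q" "hd q = s" by auto
   thus "EX! q. q:Q & hd q = s" using bij_betw_imp_inj_on[OF bQ] by (intro ex1I[of _ q]) (auto dest: inj_onD)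
  qed
  have g: "g p:Q" "last p = x ==> hd (g p) = y" "last p ~= x ==> hd (g p) = last p" if "p:P" for p using that uniq bP unfolding g_def bij_betw_def by auto
  define j where "j p = (if last p = x then p @ g p else p @ tl (g p))" for p
  have sj: "set (j p) = set p Un set (g p)" if "p:P" for p using g[OF that] set_join[of p "g p"] linkageD(4)[OF P(1) that] linkageD(4)[OF Q(1), of "g p"]
    unfolding j_def by auto
  have gin: "g p = g p' ==> p = p'" if "p:P" "p':P" for p p'
  proof -
   assume eq: "g p = g p'"
   have "last p:insert x S" "last p':insert x S" using bP that unfolding bij_betw_def by auto
   thus "p = p'" using g[OF that(1)] g[OF that(2)] eq cS bP that unfolding bij_betw_def inj_on_def by (metis insertE)
  qed
  have link: "linkage E A B (j ` P)" unfolding linkage_def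
  proof (intro conjI ballI impI)
   show "finite (j ` P)" using P unfolding linkage_def by simp
  next
   fix r
   assume "r:j ` P"
   then obtain p where p: "p:P" "r = j p" by auto
   note gp = g[OF p(1)]
   note lp = linkageD[OF P(1) p(1)] and lq = linkageD[OF Q(1) gp(1)]
   have pe: "path E p" "path E (g p)" using lp(1) lq(1) path_edge_mono by auto
   show "path E r"
   proof (cases "last p = x")
    case True
    thus ?thesis using meet[OF p(1) gp(1)] cS p(2) path_append[OF pe] gp(2) xy unfolding j_def by auto
   next
    case False
    hence e: "hd (g p) = last p" using gp by simp
    show ?thesis
    proof (cases "tl (g p) = []")
     case True
     thus ?thesis using p False pe unfolding j_def by simp
    next
     case ne: False
     have gq: "g p = hd (g p) # tl (g p)" using lq by simp
     have "path E (tl (g p))" using path_appendD2[of E "[hd (g p)]" "tl (g p)"] pe(2) gq ne by simp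
     moreover have "(last p, hd (tl (g p))):E" using pe(2) gq ne e unfolding path_def by (metis successively_Cons)
     ultimately show ?thesis using lq(7) gq distinct.simps(2) meet[OF p(1) gp(1)] disjoint_iff list.set_intros(2) path_append[OF pe(1)] False p
       unfolding j_def by metis
    qed
   qed
   have lr: "last r = last (g p)" using p lp lq gp unfolding j_def by (cases "g p"; cases "tl (g p)") auto
   have "set (g p) Int A <= {hd p}"
   proof
    fix v
    assume v: "v:set (g p) Int A"
    hence vg: "v:set (g p)" by simp
    obtain q1 q2 where q1: "g p = q1 @ v # q2" "v~:set q1" "walk ?F {v} B (v # q2)" using walk_split_first[OF lq(8) vg] by metis
    hence "walk ?F A B (v # q2)" using v by (simp add: walk_def)
    then obtain s where s: "s:S" "s:set (v # q2)" using separatesD[OF S(2)] by metis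
    have "s:set (g p) Int insert y S" using s q1(1) by auto
    hence sh: "s = hd (g p)" unfolding lq(2) by simp
    have "distinct (q1 @ v # q2)" using lq(7) q1(1) by simp
    hence "q1 = []" using s(2) sh q1(1) by (cases q1) auto
    hence hv: "hd (g p) = v" using q1(1) by simp
    hence "v:set p Int A" using gp(2,3) sh s(1) cS v lp(4) by fastforce
    thus "v : {hd p}" unfolding lp(2) .
   qed
   thus "set r Int A = {hd r}" using sj[OF p(1)] p lp unfolding j_def by auto
   have "set p Int B <= {last (g p)}"
   proof
    fix v
    assume v: "v:set p Int B"
    hence vg: "v:set p" by simp
    obtain q1 q2 where q1: "p = q1 @ v # q2" "v~:set q1" "walk ?F A {v} (q1 @ [v])" using walk_split_first[OF lp(8) vg] by metis
    hence "walk ?F A B (q1 @ [v])" using v by (simp add: walk_def)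
    then obtain s where s: "s:S" "s:set (q1 @ [v])" using separatesD[OF S(2)] by metis
    have "s:set p Int insert x S" using s q1(1) by auto
    hence sh: "s = last p" unfolding lp(3) by simp
    have hv: "last p = v" using lp(7) q1(1) s(2) sh by auto
    hence "v = hd (g p)" using gp(2,3) sh s(1) cS by metis
    hence "v:set (g p) Int B" using v lq(4) by simp
    thus "v : {last (g p)}" unfolding lq(3) .
   qed
   thus "set r Int B = {last r}" using sj[OF p(1)] p(2) lq(3) lr by auto
  next
   fix r r'
   assume "r:j ` P" "r':j ` P" "r ~= r'"
   then obtain p p' where p: "p:P" "r = j p" "p':P" "r' = j p'" "p ~= p'" by auto
   have 1: "set p Int set p' = {}" using linkage_disj[OF P(1) p(1,3)] p(5) by auto
   have 2: "set (g p) Int set (g p') = {}" using linkage_disj[OF Q(1) g(1)[OF p(1)] g(1)[OF p(3)]] gin[OF p(1,3)] p(5) by auto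
   have 3: "set u Int set (g u') = {}" if "u:P" "u':P" "u ~= u'" for u u'
   proof (rule ccontr)
    assume "set u Int set (g u') ~= {}"
    then obtain v where v: "v:set u" "v:set (g u')" by auto
    thus False using meet[OF that(1) g(1)[OF that(2)]] g(2,3)[OF that(2)] cS bP that unfolding bij_betw_def inj_on_def by auto
   qed
   show "set r Int set r' = {}" using sj p 1 2 3[of p p'] 3[of p' p] by auto
  qed
  have "inj_on j P"
  proof (rule inj_onI)
   fix p p'
   assume p: "p:P" "p':P" "j p = j p'"
   have ne: "p ~= []" "p' ~= []" using linkageD(4)[OF P(1)] p by auto
   have "hd (j p) = hd p" "hd (j p') = hd p'" using ne unfolding j_def by auto
   thus "p = p'" using p(3) ne linkage_disj[OF P(1) p(1,2)] by (metis hd_in_set)+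
  qed
  hence "card (j ` P) = k" using P(2) by (simp add: card_image)
  thus ?thesis using link by auto
 qed
qed

subsection \<open>Brambles\<close>

definition bramble :: "'a rel => 'a set => nat => 'a set set => bool" where
  "bramble E V k \<B> = ((ALL B:\<B>. conn E B & B <= V) & (ALL A:\<B>. ALL B:\<B>. touch E A B) & (ALL T. finite T & card T < k --> (EX B:\<B>. B Int T =
    {})))"

lemma bramble_mono: "bramble E V k \<B> ==> l <= k ==> bramble E V l \<B>" unfolding bramble_def by simp

lemma conn_restrict: "conn E S ==> S <= D ==> conn (E Int D \<times> D) S"
proof -
 assume "conn E S" "S <= D"
 moreover from this have "E Int D \<times> D Int S \<times> S = E Int S \<times> S" by auto
 ultimately show ?thesis unfolding conn_def by simp
qed

lemma conn_walk:
  assumes "conn E S" "x:S" "y:S" "x:A" "y:B"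
  obtains p where "walk E A B p" "set p <= S"
  using assms rtrancl_path[OF _ assms(2)] unfolding conn_def walk_def by metis

lemma conn_walk_ex: assumes "conn E S" "S Int A ~= {}" "S Int B ~= {}" shows "EX p. walk E A B p & set p <= S"
proof -
 obtain x where x: "x:S" "x:A" using assms(2) by auto
 obtain y where y: "y:S" "y:B" using assms(3) by auto
 show ?thesis using conn_walk[OF assms(1) x(1) y(1) x(2) y(2)] by metis
qed

lemma bramble_path:
  assumes "finite V" "sym E" "irrefl E" "bramble E V k \<B>" "k >= 1"
  obtains p where "path E p" "set p <= V" "!!B. B:\<B> ==> B Int set p ~= {}"
proof -
 have BV: "conn E B" "B <= V" if "B:\<B>" for B using assms(4) that unfolding bramble_def by auto
 have tch: "touch E A B" if "A:\<B>" "B:\<B>" for A B using assms(4) that unfolding bramble_def by auto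
 have fB: "finite \<B>" using BV assms(1) by (meson PowI finite_Pow_iff finite_subset subsetI)
 define P where "P p \<longleftrightarrow> path E p & set p <= V & (EX B:\<B>. set p Int B = {last p})" for p
 obtain B0 where B0: "B0:\<B>" using assms(4,5) unfolding bramble_def by auto
 then obtain x0 where x0: "x0:B0" using conn_nonempty[OF BV(1)] by auto
 have "P [x0]" unfolding P_def using BV[OF B0] B0 x0 by auto
 moreover have "ALL p. P p --> card {B:\<B>. B Int set p ~= {}} <= card \<B>" using fB by (auto intro: card_mono)
 ultimately obtain p where p: "P p" and mx: "ALL q. P q --> card {B:\<B>. B Int set q ~= {}} <= card {B:\<B>. B Int set p ~= {}}"
   using ex_has_greatest_nat[where P=P and k="[x0]" and f="%p. card {B:\<B>. B Int set p ~= {}}" and b="Suc (card \<B>)"] by fastforce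
 have "B' Int set p ~= {}" if B': "B':\<B>" for B'
 proof (rule ccontr)
  assume "~B' Int set p ~= {}"
  hence un: "B' Int set p = {}" by simp
  obtain B where B: "B:\<B>" "set p Int B = {last p}" using p unfolding P_def by auto
  have cu: "conn E (B Un B')" using conn_Un[OF assms(2)] BV tch B B' by simp
  obtain y where y: "y:B'" using BV B' conn_nonempty by blast
  obtain xs where xs: "ipath E xs" "hd xs = last p" "last xs = y" "set xs <= B Un B'" using conn_ipath[OF cu, of "last p" y] y assms(2,3) B by auto
  have xp: "path E xs" using xs unfolding ipath_def by simp
  obtain u z w where u: "xs = u @ z # w" "z:B'" "ALL a:set u. a~:B'" using xs xp unfolding path_def using split_list_first_prop[of xs "%a. a:B'"] y by fastforce
  have "last p~:B'" using un p unfolding P_def by auto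
  then obtain u' where u': "u = last p # u'" using u xs by (cases u) auto
  have uB: "set u' <= B" using u xs(4) u' by auto
  have pu: "path E ((last p # u') @ [z])" using path_appendD1[of E "(last p # u') @ [z]" w] xp u u' by auto
  let ?q = "p @ u' @ [z]"
  have "path E (u' @ [z])" using path_appendD2[of E "[last p]" "u' @ [z]"] pu by auto
  moreover have "last p~:set (u' @ [z])" using pu unfolding path_def by auto
  hence "v~:set p" if "v:set (u' @ [z])" for v
  proof (cases "v = z")
   case True
   thus ?thesis using un u(2) by auto
  next
   case False
   hence "v:B" "v ~= last p" using that uB \<open>last p~:set (u' @ [z])\<close> by auto
   thus ?thesis using B(2) by auto
  qed
  hence "set p Int set (u' @ [z]) = {}" by auto
  moreover have "(last p, hd (u' @ [z])):E" using pu unfolding path_def by (cases u') auto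
  ultimately have q: "path E ?q" using path_append p unfolding P_def by blast
  have "set ?q Int B' = {last ?q}" using un u u' by auto
  moreover have "set ?q <= V" using p uB u(2) BV B B' unfolding P_def by auto
  ultimately have "P ?q" unfolding P_def using q B' by auto
  hence "card {B:\<B>. B Int set ?q ~= {}} <= card {B:\<B>. B Int set p ~= {}}" by (rule mx[THEN spec, THEN mp])
  moreover have "{B:\<B>. B Int set p ~= {}} \<subset> {B:\<B>. B Int set ?q ~= {}}" using B' u(2) un by auto
  hence "card {B:\<B>. B Int set p ~= {}} < card {B:\<B>. B Int set ?q ~= {}}" using fB by (simp add: psubset_card_mono)
  ultimately show False by simp
 qed
 thus ?thesis using that p unfolding P_def by auto
qed

lemma bramble_split:
  assumes "finite V" "sym E" "irrefl E" "bramble E V (2 * s) \<B>" "s >= 1"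
  obtains p where "path E p" "set p <= V" "!!T. finite T ==> card T < s ==> EX B:\<B>. B Int set p ~= {} & B Int T = {}" "!!T. finite T ==> card T < s ==> EX
    B:\<B>. B Int set p = {} & B Int T = {}"
proof -
 obtain p where p: "path E p" "set p <= V" "!!B. B:\<B> ==> B Int set p ~= {}" using bramble_path[OF assms(1-4)] assms(5) by auto
 have ord: "EX B:\<B>. B Int T = {}" if "finite T" "card T < 2 * s" for T using assms(4) that unfolding bramble_def by simp
 define Q where "Q n \<longleftrightarrow> (ALL T. finite T & card T < s --> (EX B:\<B>. B Int set (take n p) ~= {} & B Int T = {}))" for n
 have "Q (length p)" unfolding Q_def using p(3) ord by simp
 then obtain n where n: "Q n" "!!i. i < n ==> ~Q i" using exists_least_iff[of Q] by auto
 have "~Q 0" unfolding Q_def using assms(5) by (auto intro!: exI[of _ "{}"])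
 hence "n ~= 0" using n(1) by metis
 then obtain l where l: "n = Suc l" by (cases n) simp_all
 then obtain T0 where T0: "finite T0" "card T0 < s" "!!B. B:\<B> ==> B Int set (take l p) ~= {} ==> B Int T0 ~= {}" using n(2)[of l] unfolding Q_def by auto
 have ln: "l < length p"
 proof (rule ccontr)
  assume "~l < length p"
  hence "Q l = Q n" using l unfolding Q_def by simp
  thus False using n l by auto
 qed
 show ?thesis
 proof (rule that[of "take n p"])
  show "path E (take n p)" using path_take p(1) l by auto
  show "set (take n p) <= V" using p(2) by (meson order_trans set_take_subset)
  show "EX B:\<B>. B Int set (take n p) ~= {} & B Int T = {}" if "finite T" "card T < s" for T using n(1) that unfolding Q_def by simp
  show "EX B:\<B>. B Int set (take n p) = {} & B Int T = {}" if T: "finite T" "card T < s" for T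
  proof -
   let ?T = "insert (p ! l) (T0 Un T)"
   have "card ?T <= Suc (card T0 + card T)" using T T0 by (metis card_Un_le card_insert_if Suc_le_mono finite_UnI le_SucI)
   then obtain B where B: "B:\<B>" "B Int ?T = {}" using T T0 ord[of ?T] by auto
   thus ?thesis using T0(3) l ln by (auto simp: take_Suc_conv_app_nth)
  qed
 qed
qed

lemma split_marked:
  assumes "finite M" "m * k <= card (set xs Int M)" "distinct xs" "k >= 1"
  shows "EX ss rest. xs = concat ss @ rest & length ss = m & (ALL s:set ss. k <= card (set s Int M))"
  using assms
proof (induction m arbitrary: xs)
 case 0
 thus ?case by simp
next
 case (Suc m)
 let ?Q = "%n. k <= card (set (take n xs) Int M)"
 have "?Q (length xs)" using Suc by simp
 then obtain n where n: "?Q n" "!!i. i < n ==> ~?Q i" using exists_least_iff[of ?Q] by blast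
 obtain l where l: "n = Suc l" using n(1) Suc(5) by (cases n) auto
 have "card (set (take l xs) Int M) < k" using n(2)[of l] l by simp
 moreover have "set (take n xs) Int M <= insert (xs ! l) (set (take l xs) Int M)" using l take_Suc_conv_app_nth by (cases "l < length xs"; fastforce)
 hence "card (set (take n xs) Int M) <= card (insert (xs ! l) (set (take l xs) Int M))" by (rule card_mono[rotated]) simp
 hence "card (set (take n xs) Int M) <= Suc (card (set (take l xs) Int M))" using card_insert_le_m1[of "Suc (card (set (take l xs) Int M))" "set (take l xs)
   Int M" "xs ! l"] by simp
 ultimately have c: "card (set (take n xs) Int M) <= k" by simp
 have "set xs Int M = (set (take n xs) Int M) Un (set (drop n xs) Int M)" by (metis Int_Un_distrib2 append_take_drop_id set_append)
 hence "card (set xs Int M) <= card (set (take n xs) Int M) + card (set (drop n xs) Int M)" by (simp add: card_Un_le)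
 then obtain ss rest where "drop n xs = concat ss @ rest" "length ss = m" "ALL s:set ss. k <= card (set s Int M)"
   using c Suc(3) Suc(1)[of "drop n xs"] Suc(2,4,5) by auto
 thus ?case using n(1) by (intro exI[of _ "take n xs # ss"] exI[of _ rest]) (auto, metis append_take_drop_id)
qed

lemma concat_segments: assumes "path E (concat ss @ rest)" "i < length ss" "ss ! i ~= []" shows "path E (ss ! i)"
proof -
 have "ss = take i ss @ ss ! i # drop (Suc i) ss" using assms(2) by (rule id_take_nth_drop)
 hence "concat ss = concat (take i ss @ ss ! i # drop (Suc i) ss)" by simp
 hence e: "concat ss @ rest = concat (take i ss) @ ss ! i @ (concat (drop (Suc i) ss) @ rest)" by simp
 have "path E (concat (take i ss) @ ss ! i @ (concat (drop (Suc i) ss) @ rest))" using assms(1) unfolding e .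
 thus ?thesis using path_appendD2 assms(3) path_appendD1 by blast
qed

lemma distinct_concat_disj: "distinct (concat ss) ==> i < j ==> j < length ss ==> set (ss ! i) Int set (ss ! j) = {}"
proof (induction ss arbitrary: i j)
 case (Cons s ss)
 show ?case
 proof (cases i)
  case 0
  then obtain k where "j = Suc k" "k < length ss" using Cons(3,4) by (cases j) auto
  thus ?thesis using 0 Cons(2) by (auto dest: nth_mem)
 next
  case (Suc i')
  then obtain k where "j = Suc k" "k < length ss" using Cons(3,4) by (cases j) auto
  thus ?thesis using Suc Cons(1)[of i' k] Cons(2,3) by simp
 qed
qed simp

text \<open>The linked sets \<open>X i\<close> lie outside the path that carries the connected sets \<open>A i\<close>, so the linkages between them cannot
  meet any \<open>A i\<close>.\<close>

lemma mesh:
  assumes "finite V" "E <= V \<times> V" "sym E" "irrefl E" "bramble E V (4 * m * n) \<B>" "m >= 1" "n >= 1"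
  obtains A X D where "ALL i<m. conn E (A i) & A i <= V & A i Int D = {}" "ALL i<m. ALL j<m. i ~= j --> A i Int A j = {}" "ALL i<m. X i <= D & (ALL x:X i. EX
    a:A i. (a, x):E)" "D <= V" "ALL i<m. ALL j<m. EX L. linkage (E Int D \<times> D) (X i) (X j) L & card L = n"
proof -
 define s where "s = m * (2 * n)"
 have s1: "s >= 1" using assms unfolding s_def by simp
 have br: "bramble E V (2 * s) \<B>" using assms(5) unfolding s_def by (simp add: ac_simps)
 have BV: "conn E B" "B <= V" if "B:\<B>" for B using assms(5) that unfolding bramble_def by auto
 have tch: "touch E A B" if "A:\<B>" "B:\<B>" for A B using assms(5) that unfolding bramble_def by auto
 obtain p where p: "path E p" "set p <= V" and hit: "!!T. finite T ==> card T < s ==> EX B:\<B>. B Int set p ~= {} & B Int T = {}" and unhit: "!!T. finite T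
   ==> card T < s ==> EX B:\<B>. B Int set p = {} & B Int T = {}" using bramble_split[OF assms(1,3,4) br s1] by auto
 define D where "D = V - set p"
 define H where "H Y \<longleftrightarrow> Y <= D & (ALL B:\<B>. B Int set p = {} --> B Int Y ~= {})" for Y
 have "H D" unfolding H_def D_def using BV conn_nonempty by fast
 then obtain Y where Y: "H Y" "!!Z. H Z ==> card Y <= card Z" using ex_has_least_nat[of H D card] by auto
 have fD: "finite D" unfolding D_def using assms(1) by simp
 have fY: "finite Y" using Y(1) fD unfolding H_def by (metis finite_subset)
 have Ymin: "EX B:\<B>. B Int set p = {} & B Int T = {}" if T: "finite T" "card T < card Y" for T
   using BV(2) Y(2)[of "T Int D"] T card_mono[of T "T Int D"] unfolding D_def H_def by fastforce
 have fE: "finite E" using assms(1,2) by (meson finite_SigmaI finite_subset)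
 have "EX L. linkage E (set p) Y L & card L = s"
 proof (rule menger[OF fE assms(4) _ fY])
  fix S
  assume S: "finite S" "separates E (set p) Y S"
  show "s <= card S"
  proof (rule ccontr)
   assume "~s <= card S"
   hence c: "card S < s" by simp
   obtain B where B: "B:\<B>" "B Int set p ~= {}" "B Int S = {}" using hit[OF S(1) c] by auto
   obtain B' where B': "B':\<B>" "B' Int set p = {}" "B' Int S = {}" using unhit[OF S(1) c] by auto
   have "conn E (B Un B')" using conn_Un[OF assms(3)] BV tch B B' by simp
   have "(B Un B') Int Y ~= {}" using Y(1) B' unfolding H_def by auto
   moreover have "(B Un B') Int set p ~= {}" using B(2) by auto
   ultimately have "EX w. walk E (set p) Y w & set w <= B Un B'" using \<open>conn E (B Un B')\<close> by (intro conn_walk_ex)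
   then obtain w where "walk E (set p) Y w" "set w <= B Un B'" by auto
   thus False using separatesD[OF S(2)] B B' by blast
  qed
 qed simp
 then obtain L where L: "linkage E (set p) Y L" "card L = s" by auto
 have fL: "finite L" using L(1) unfolding linkage_def by simp
 have inj: "inj_on hd L" by (rule inj_onI) (metis L(1) linkageD(4) linkage_disj hd_in_set)
 have injl: "inj_on last L" by (rule inj_onI) (metis L(1) linkageD(4) linkage_disj last_in_set)
 have tlL: "tl q ~= []" "set (tl q) <= D" "path E (tl q)" "(hd q, hd (tl q)):E" "last (tl q) = last q" if q: "q:L" for q
 proof -
  note lq = linkageD[OF L(1) q]
  show ne: "tl q ~= []"
  proof
   assume "tl q = []"
   hence "hd q = last q" using lq(4) by (metis last_ConsL list.exhaust_sel)
   thus False using lq(5,6) Y(1) unfolding H_def D_def by auto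
  qed
  have qq: "q = hd q # tl q" using lq by simp
  have "set q <= V" using path_in_field[OF lq(1) assms(2)] lq(5) p(2) by auto
  have "hd q~:set (tl q)" using lq(7) qq by (metis distinct.simps(2))
  have "v:D" if "v:set (tl q)" for v
  proof -
   have vq: "v:set q" using that by (rule list.set_sel(2)[OF lq(4)])
   hence "v:V" using \<open>set q <= V\<close> by auto
   moreover have "v~:set p"
   proof
    assume "v:set p"
    thus False using vq lq(2) that \<open>hd q~:set (tl q)\<close> by (metis IntI singletonD)
   qed
   ultimately show ?thesis unfolding D_def by simp
  qed
  thus "set (tl q) <= D" by auto
  show "path E (tl q)" using path_appendD2[of E "[hd q]" "tl q"] lq(1) qq ne by simp
  show "(hd q, hd (tl q)):E" using lq(1) qq ne unfolding path_def by (metis successively_Cons)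
  show "last (tl q) = last q" using ne by (simp add: last_tl)
 qed
 have "set p Int hd ` L = hd ` L" using linkageD(5)[OF L(1)] by auto
 hence "m * (2 * n) <= card (set p Int hd ` L)" using inj L(2) unfolding s_def by (simp add: card_image)
 then obtain ss rest where ss: "p = concat ss @ rest" "length ss = m" "ALL s:set ss. 2 * n <= card (set s Int hd ` L)"
   using split_marked[of "hd ` L" m "2 * n" p] fL p(1) assms(7) unfolding path_def by auto
 define A where "A i = set (ss ! i)" for i
 define K where "K i = {q:L. hd q:A i}" for i
 define X where "X i = (%q. hd (tl q)) ` K i" for i
 have Ai: "A i <= set p" "2 * n <= card (A i Int hd ` L)" if "i < m" for i
 proof -
  have m: "ss ! i:set ss" using ss(2) that by simp
  hence "set (ss ! i) <= set (concat ss @ rest)" by auto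
  thus "A i <= set p" unfolding A_def ss(1) .
  show "2 * n <= card (A i Int hd ` L)" using ss(3) m unfolding A_def by simp
 qed
 have cK: "2 * n <= card (K i)" if "i < m" for i
 proof -
  have "hd ` K i = A i Int hd ` L" unfolding K_def by auto
  moreover have "K i <= L" unfolding K_def by simp
  hence "card (hd ` K i) = card (K i)" by (rule card_image[OF inj_on_subset[OF inj]])
  ultimately show ?thesis using Ai[OF that] by simp
 qed
 show ?thesis
 proof (rule that[of A D X]; (intro allI impI)?)
  fix i
  assume i: "i < m"
  show "conn E (A i) & A i <= V & A i Int D = {}" using Ai(2)[OF i] assms(7) unfolding A_def
    using concat_segments[of E ss rest i] p(1) ss i path_conn[OF assms(3)] Ai[OF i] p(2) unfolding D_def by fastforce
 next
  fix i j
  assume ij: "i < m" "j < m" "i ~= j"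
  show "A i Int A j = {}" using p(1) ss(1) unfolding path_def using distinct_concat_disj[of ss i j] distinct_concat_disj[of ss j i] ij ss(2) unfolding A_def
    by fastforce
 next
  fix i
  assume i: "i < m"
  show "X i <= D & (ALL x:X i. EX a:A i. (a, x):E)" using tlL unfolding X_def K_def by fastforce
 next
  show "D <= V" unfolding D_def by simp
 next
  fix i j
  assume ij: "i < m" "j < m"
  let ?F = "E Int D \<times> D"
  have F: "finite ?F" "irrefl ?F" "sym ?F" using fE assms(3,4) by (auto simp: irrefl_def sym_def)
  have fX: "finite (X i)" "finite (X j)" using fL unfolding X_def K_def by auto
  show "EX L. linkage ?F (X i) (X j) L & card L = n"
  proof (rule menger[OF F(1,2) fX])
   fix S
   assume S: "finite S" "separates ?F (X i) (X j) S"
   show "n <= card S"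
   proof (rule ccontr)
    assume "~n <= card S"
    hence c: "card S < n" by simp
    have reach: "EX W B. conn ?F W & B:\<B> & B Int set p = {} & B <= W & W Int X l ~= {} & W Int S = {}" if l: "l < m" for l
    proof -
     define J where "J = {q:K l. set (tl q) Int S ~= {}}"
     have fJ: "finite J" using fL unfolding J_def K_def by simp
     have "card J <= card S"
     proof -
      have "ALL q:J. EX v. v:set (tl q) Int S" unfolding J_def by auto
      then obtain f where f: "ALL q:J. f q:set (tl q) Int S" by metis
      have "inj_on f J"
      proof (rule inj_onI)
       fix a b
       assume ab: "a:J" "b:J" "f a = f b"
       hence "f a:set a" "f a:set b" using f by (metis Int_iff list.set_sel(2) tl_Nil)+
       thus "a = b" using linkage_disj[OF L(1)] ab unfolding J_def K_def by simp
      qed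
      thus ?thesis using f S(1) card_inj_on_le[of f J S] by auto
     qed
     let ?H = "(Y - last ` K l) Un last ` J Un S"
     have lK: "last ` K l <= Y" using linkageD(6)[OF L(1)] unfolding K_def by auto
     have "K l <= L" unfolding K_def by simp
     hence "card (last ` K l) = card (K l)" by (rule card_image[OF inj_on_subset[OF injl]])
     hence "card (Y - last ` K l) + 2 * n <= card Y" using cK[OF l] lK fY by (metis card_Diff_subset card_mono add_le_mono1 finite_subset le_diff_conv2
       nat_add_left_cancel_le le_add_diff_inverse2)
     moreover have "card ?H <= card (Y - last ` K l) + card (last ` J) + card S" by (meson card_Un_le le_trans add_le_mono1)
     moreover have "card (last ` J) <= card J" using fJ by (rule card_image_le)
     ultimately have "card ?H < card Y" using c \<open>card J <= card S\<close> by simp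
     moreover have "finite ?H" using fY fJ S(1) by simp
     ultimately have "EX B:\<B>. B Int set p = {} & B Int ?H = {}" by (intro Ymin)
     then obtain B where B: "B:\<B>" "B Int set p = {}" "B Int ?H = {}" by auto
     then obtain y where y: "y:B" "y:Y" using Y(1) unfolding H_def by blast
     then obtain q where q: "q:K l" "last q = y" using B(3) by auto
     have qL: "q:L" using q unfolding K_def by simp
     have BD: "B <= D" using BV B unfolding D_def by auto
     have 1: "conn ?F B" using conn_restrict[OF BV(1)[OF B(1)] BD] .
     have 2: "conn ?F (set (tl q))" using conn_restrict[OF path_conn[OF assms(3) tlL(3)[OF qL]] tlL(2)[OF qL]] .
     have "y:set (tl q)" using tlL[OF qL] q(2) by auto
     hence "conn ?F (set (tl q) Un B)" using conn_Un[OF F(3) 2 1] y unfolding touch_def by auto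
     moreover have "hd (tl q):X l" "hd (tl q):set (tl q)" unfolding X_def using q tlL(1)[OF qL] by auto
     hence "(set (tl q) Un B) Int X l ~= {}" by auto
     ultimately show ?thesis using q y B(3) unfolding J_def using B(1,2) by blast
    qed
    obtain W B where W: "conn ?F W" "B:\<B>" "B Int set p = {}" "B <= W" "W Int X i ~= {}" "W Int S = {}" using reach[OF ij(1)] by auto
    obtain W' B' where W': "conn ?F W'" "B':\<B>" "B' Int set p = {}" "B' <= W'" "W' Int X j ~= {}" "W' Int S = {}" using reach[OF ij(2)] by auto
    have "B <= D" "B' <= D" using BV W W' unfolding D_def by auto
    hence "touch ?F B B'" using tch[OF W(2) W'(2)] unfolding touch_def by auto
    hence "touch ?F W W'" using touch_mono[OF _ order_refl W(4) W'(4)] by simp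
    hence "conn ?F (W Un W')" by (rule conn_Un[OF F(3) W(1) W'(1)])
    moreover have "(W Un W') Int X i ~= {}" "(W Un W') Int X j ~= {}" using W(5) W'(5) by auto
    ultimately have "EX w. walk ?F (X i) (X j) w & set w <= W Un W'" by (intro conn_walk_ex)
    then obtain w where "walk ?F (X i) (X j) w" "set w <= W Un W'" by auto
    thus False using separatesD[OF S(2)] W(6) W'(6) by blast
   qed
  qed
 qed
qed

subsection \<open>The grid theorem\<close>

text \<open>The host graph: a grid in which column \<open>j\<close> keeps only the rung between rows \<open>j mod r\<close> and \<open>j mod r +
  1\<close>.\<close>

definition hV :: "nat => nat => (nat * nat) set" where
  "hV r M = {..<r} \<times> {..<M}"

definition hE :: "nat => nat => ((nat * nat) \<times> (nat * nat)) set" where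
  "hE r M = {((s, j), (s', j')) | s j s' j'. s < r & s' < r & j < M & j' < M & (s = s' & (j' = Suc j | j = Suc j') | j = j' & (s' = Suc s & j mod r = s | s =
    Suc s' & j mod r = s'))}"

definition minor_model :: "'a rel => 'a set => 'b set => 'b rel => ('b => 'a set) => bool" where
  "minor_model E V W F mu = ((ALL x:W. conn E (mu x) & mu x <= V) & (ALL x:W. ALL y:W. x ~= y --> mu x Int mu y = {}) & (ALL (x, y):F. EX a:mu x. EX b:mu y.
    (a, b):E))"

definition hostminor :: "'a rel => 'a set => nat => nat => bool" where
  "hostminor E V r M = ((EX mu. minor_model E V (hV r M) (hE r M) mu))"

lemma hE_sym: "(x, y):hE r M ==> (y, x):hE r M" unfolding hE_def by auto

lemma hE_hV: "(x, y):hE r M ==> x:hV r M & y:hV r M" unfolding hE_def hV_def by auto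

definition ed :: "'a list => 'a rel" where
  "ed p = {(p ! i, p ! Suc i) | i. Suc i < length p}"

definition inner :: "'a rel => 'a set set => 'a rel" where
  "inner E \<Q> = {(x, y):E. EX Q:\<Q>. x:Q & y:Q}"

lemma ed_subset: "path E p ==> ed p <= E" unfolding ed_def using path_nth by auto

lemma path_edI: "path E p ==> ed p <= F ==> path F p" unfolding path_def ed_def successively_conv_nth by auto

lemma finite_ed: "finite (ed p)"
proof -
 have "ed p = (%i. (p ! i, p ! Suc i)) ` {i. Suc i < length p}" unfolding ed_def by auto
 moreover have "finite {i. Suc i < length p}" by (rule finite_subset[of _ "{..<length p}"]) auto
 ultimately show ?thesis by simp
qed

lemma walk_segment: assumes "!!l. i <= l ==> l < j ==> (p ! l, p ! Suc l):F" "i <= j" "j < length p" shows "walk F {p ! i} {p ! j} (drop i (take (Suc j) p))"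
proof -
 have "successively (%x y. (x, y):F) (drop i (take (Suc j) p))" unfolding successively_conv_nth using assms by auto
 thus ?thesis using assms unfolding walk_def by (auto simp: hd_drop_conv_nth last_conv_nth)
qed

lemma set_segment: "v:set (drop i (take (Suc j) p)) ==> j < length p ==> EX l. i <= l & l <= j & v = p ! l"
  by (auto simp: in_set_conv_nth) (metis add.commute less_diff_conv less_Suc_eq_le add_leD2 nat_le_linear)

definition outside :: "'a rel => 'a set set => 'a list set => nat" where
  "outside E \<Q> Ps = card (\<Union> (ed ` Ps) - inner E \<Q>)"

text \<open>If the linkage uses as few edges outside the sets \<open>\<Q>\<close> as possible, then each such edge lies in a tight cut, and the sets missing
  the cut are separated by it consistently on all paths.\<close>

lemma sep_order:
  assumes "finite E" "irrefl E" "finite A" "finite B" "linkage E A B Ps" and mn: "!!Ps'. linkage E A B Ps' ==> card Ps' = card Ps ==> outside E \<Q> Ps <=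
    outside E \<Q> Ps'" and p1: "p1:Ps" "Suc a < length p1" "(p1 ! a, p1 ! Suc a)~:inner E \<Q>" and cn: "!!Q. Q:\<Q> ==> conn E Q"
  obtains S where "finite S" "card S < card Ps" "ALL Q:\<Q>. ALL Q':\<Q>. Q Int S = {} --> Q' Int S = {} --> (EX l<=a. p1 ! l:Q) --> (EX l>a. l < length p1 &
    p1 ! l:Q') --> (ALL p:Ps. ALL i<length p. ALL j<length p. p ! i:Q --> p ! j:Q' --> i < j)"
proof -
 let ?e = "(p1 ! a, p1 ! Suc a)"
 define F where "F = (\<Union> (ed ` Ps) Un inner E \<Q>) - {?e}"
 have edE: "ed p <= E" if "p:Ps" for p using ed_subset linkageD(1)[OF assms(5) that] by auto
 have FE: "F <= E" unfolding F_def inner_def using edE by auto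
 have F: "finite F" "irrefl F" using FE assms(1,2) by (auto intro: finite_subset simp: irrefl_def)
 have "~(EX Ps'. linkage F A B Ps' & card Ps' = card Ps)"
 proof
  assume "EX Ps'. linkage F A B Ps' & card Ps' = card Ps"
  then obtain Ps' where P': "linkage F A B Ps'" "card Ps' = card Ps" by auto
  have "\<Union> (ed ` Ps') - inner E \<Q> <= \<Union> (ed ` Ps) - inner E \<Q> - {?e}" using ed_subset linkageD(1)[OF P'(1)] unfolding F_def by auto
  also have "... \<subset> \<Union> (ed ` Ps) - inner E \<Q>" using p1 unfolding ed_def by auto
  finally have "\<Union> (ed ` Ps') - inner E \<Q> \<subset> \<Union> (ed ` Ps) - inner E \<Q>" .
  moreover have "finite (\<Union> (ed ` Ps) - inner E \<Q>)" using finite_ed assms(5) unfolding linkage_def by auto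
  ultimately have "outside E \<Q> Ps' < outside E \<Q> Ps" unfolding outside_def by (rule psubset_card_mono[rotated])
  thus False using mn[of Ps'] linkage_edge_mono[OF P'(1) FE] P'(2) by simp
 qed
 then obtain S where S: "finite S" "separates F A B S" "card S < card Ps" using menger[OF F assms(3,4), of "card Ps"] by (metis not_le)
 have dp: "distinct p" if "p:Ps" for p using linkageD(7)[OF assms(5) that] .
 have edF: "ed p <= F" if p: "p:Ps" "p ~= p1" for p
 proof -
  have "?e~:ed p"
  proof
   assume "?e:ed p"
   hence "p1 ! a:set p" unfolding ed_def by auto
   thus False using p1(2) linkage_disj[OF assms(5) p(1) p1(1)] p(2) by fastforce
  qed
  thus ?thesis unfolding F_def using p by auto
 qed
 have p1F: "(p1 ! l, p1 ! Suc l):F" if "Suc l < length p1" "l ~= a" for l using that p1(2) dp[OF p1(1)] nth_eq_iff_index_eq p1(1) unfolding F_def ed_def by auto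
 have hitS: "EX v. v:set p & v:S" if p: "p:Ps" "p ~= p1" for p using linkageD(8)[OF assms(5) p(1)] path_edI[OF linkageD(1)[OF assms(5) p(1)] edF[OF p]]
   separatesD[OF S(2)] unfolding walk_def path_def by simp
 then obtain f where f: "!!p. p:Ps - {p1} ==> f p:set p & f p:S" by (metis Diff_iff singletonI)
 have finj: "inj_on f (Ps - {p1})" by (rule inj_onI) (metis Diff_iff assms(5) f linkage_disj)
 have "card (f ` (Ps - {p1})) = card Ps - 1" using finj p1(1) by (simp add: card_image)
 moreover have "f ` (Ps - {p1}) <= S" using f by auto
 ultimately have Sf: "S = f ` (Ps - {p1})" using S(1,3) by (metis One_nat_def Suc_pred card_seteq gr_implies_not0 leI less_Suc_eq_le nat.simps(3) gr0I)
 have Sp: "v = f p" if "p:Ps" "p ~= p1" "v:set p" "v:S" for p v using Sf f linkage_disj[OF assms(5)] that by auto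
 define U where "U = {v. EX w. walk F A {v} w & set w Int S = {}}"
 have Ustep: "y:U" if xy: "x:U" "(x, y):F" "y~:S" for x y
 proof -
  obtain w where "walk F A {x} w" "set w Int S = {}" using xy(1) unfolding U_def by auto
  hence "walk F A {y} (w @ [y])" "set (w @ [y]) Int S = {}" using xy by (auto simp: walk_def successively_append_iff)
  thus ?thesis unfolding U_def by blast
 qed
 have noB: False if vw: "v:U" "walk F {v} B w" "set w Int S = {}" for v w
 proof -
  obtain u where u: "walk F A {v} u" "set u Int S = {}" using vw(1) unfolding U_def by auto
  have "walk F A B (u @ tl w)" using walk_join[OF u(1) vw(2)] .
  moreover have "set (tl w) <= set w" by (cases w) auto
  hence "set (u @ tl w) Int S = {}" using u vw(3) by auto
  ultimately show False using separatesD[OF S(2)] by blast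
 qed
 have onp: "i : {..<length p} ==> p ! i:U \<longleftrightarrow> (if p = p1 then i <= a else EX l>i. l < length p & p ! l:S)" if "p:Ps" "p ! i~:S" for p i
 proof -
  assume i: "i : {..<length p}"
  note lp = linkageD[OF assms(5) that(1)]
  have fwd: "p ! i:U" if g: "!!l. l < i ==> (p ! l, p ! Suc l):F" "!!l. l <= i ==> p ! l~:S"
  proof -
   have wk: "walk F {p ! 0} {p ! i} (drop 0 (take (Suc i) p))" by (rule walk_segment) (use g i in auto)
   have "set (drop 0 (take (Suc i) p)) Int S = {}" using g(2) i set_segment[of _ 0 i p] by auto
   moreover have "walk F A {p ! i} (drop 0 (take (Suc i) p))" using wk lp(4,5) by (auto simp: walk_def)
   ultimately show ?thesis unfolding U_def by auto
  qed
  have bwd: "p ! i~:U" if g: "!!l. i <= l ==> Suc l < length p ==> (p ! l, p ! Suc l):F" "!!l. i <= l ==> l < length p ==> p ! l~:S"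
  proof
   assume u: "p ! i:U"
   have "walk F {p ! i} {p ! (length p - 1)} (drop i (take (Suc (length p - 1)) p))" by (rule walk_segment) (use g i in auto)
   moreover have "set (drop i (take (Suc (length p - 1)) p)) Int S = {}" using g(2) set_segment[of _ i "length p - 1" p] by fastforce
   ultimately show False using noB[OF u, of "drop i (take (Suc (length p - 1)) p)"] lp(4,6) by (auto simp: walk_def)
  qed
  show ?thesis
  proof (cases "p = p1")
   case True
   have nS: "p ! l~:S" if "l < length p" for l using True nth_mem[OF that] Sf f linkage_disj[OF assms(5) p1(1)] by fastforce
   show ?thesis
   proof (cases "i <= a")
    case le: True
    have "p ! i:U" by (rule fwd) (use le nS i p1F True p1 in auto)
    thus ?thesis using le True by simp
   next
    case gt: False
    have "p ! i~:U" by (rule bwd) (use gt nS i p1F True in auto)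
    thus ?thesis using gt True by simp
   qed
  next
   case False
   have eF: "(p ! l, p ! Suc l):F" if "Suc l < length p" for l using edF[OF \<open>p:Ps\<close> False] that unfolding ed_def by auto
   obtain c where c: "c < length p" "p ! c = f p" using f[of p] False \<open>p:Ps\<close> by (metis Diff_iff in_set_conv_nth singletonD)
   have cS: "p ! l:S \<longleftrightarrow> l = c" if "l < length p" for l using c Sp[OF \<open>p:Ps\<close> False, of "p ! l"] f[of p] False
     \<open>p:Ps\<close> that dp[OF \<open>p:Ps\<close>] by (metis Diff_iff nth_eq_iff_index_eq nth_mem singletonD)
   show ?thesis
   proof (cases "i < c")
    case True
    have "p ! i:U" by (rule fwd) (use True c eF cS i in auto)
    thus ?thesis using True False c cS by auto
   next
    case ge: False
    have "i ~= c" using cS i that by auto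
    have "p ! i~:U" by (rule bwd) (use ge c eF cS i \<open>i ~= c\<close> in auto)
    thus ?thesis using ge False cS by auto
   qed
  qed
 qed
 have inF: "(x, y):F" if "Q:\<Q>" "x:Q" "y:Q" "(x, y):E" for x y Q unfolding F_def using that p1(3) unfolding inner_def by auto
 have QU: "Q <= U" if Q: "Q:\<Q>" "Q Int S = {}" "x:Q" "x:U" for Q x
 proof (rule ccontr)
  assume "~Q <= U"
  then obtain y where "y:Q" "y~:U" by auto
  then obtain u v where "u:Q" "u:U" "v:Q" "v~:U" "(u, v):E" using conn_cut[OF cn[OF Q(1)], of x U y] Q by auto
  thus False using Ustep[of u v] inF[OF Q(1)] Q by auto
 qed
 show ?thesis
 proof (rule that[OF S(1,3)], intro ballI allI impI)
  fix Q Q' p i j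
  assume Q: "Q:\<Q>" "Q':\<Q>" "Q Int S = {}" "Q' Int S = {}" "EX l<=a. p1 ! l:Q" "EX l>a. l < length p1 & p1 ! l:Q'" and p: "p:Ps" "i < length p" "j < length
    p" "p ! i:Q" "p ! j:Q'"
  obtain l where l: "l <= a" "p1 ! l:Q" using Q by auto
  have u1: "p ! i:U" using onp[OF p1(1), of l] l p1(2) QU Q p by auto
  obtain l' where l': "l' > a" "l' < length p1" "p1 ! l':Q'" using Q by auto
  have u2: "p ! j~:U" using onp[OF p1(1), of l'] l' Q(4) QU[OF Q(2,4) p(5)] by auto
  have nS: "p ! i~:S" "p ! j~:S" using Q p by auto
  have o1: "if p = p1 then i <= a else EX l>i. l < length p & p ! l:S" using onp[OF p(1) nS(1)] u1 p(2) by simp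
  have o2: "~(if p = p1 then j <= a else EX l>j. l < length p & p ! l:S)" using onp[OF p(1) nS(2)] u2 p(3) by simp
  have "i ~= j" using u1 u2 by auto
  moreover have "~j < i"
  proof
   assume ji: "j < i"
   show False using o1 o2 ji by (cases "p = p1"; auto)
  qed
  ultimately show "i < j" by simp
 qed
qed

lemma ordered_blocks:
  assumes "finite E" "irrefl E" "finite A" "finite B" "linkage E A B Ps" and mn: "!!Ps'. linkage E A B Ps' ==> card Ps' = card Ps ==> outside E \<Q> Ps <=
    outside E \<Q> Ps'" and cn: "!!Q. Q:\<Q> ==> conn E Q" and dj: "!!Q Q'. Q:\<Q> ==> Q':\<Q> ==> Q ~= Q' ==> Q Int Q' = {}" and p1: "p1:Ps" and R: "\<R> <=
    \<Q>" "finite \<R>" "!!Q. Q:\<R> ==> Q Int set p1 ~= {}" and c: "W * (W * card Ps + 1) <= card \<R>"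
  obtains f where "ALL b<W. f b:\<R>" "ALL b b'. b < b' --> b' < W --> (ALL p:Ps. ALL i<length p. ALL j<length p. p ! i:f b --> p ! j:f b' --> i < j)"
proof -
 define phi where "phi Q = (LEAST i. i < length p1 & p1 ! i:Q)" for Q
 have phi: "phi Q < length p1" "p1 ! phi Q:Q" if "Q:\<R>" for Q
 proof -
  have "EX i. i < length p1 & p1 ! i:Q" using R(3)[OF that] by (metis Int_emptyI in_set_conv_nth)
  from LeastI_ex[OF this] show "phi Q < length p1" "p1 ! phi Q:Q" unfolding phi_def by auto
 qed
 have inj: "inj_on phi \<R>" by (rule inj_onI) (metis R(1) phi(2) disjoint_iff dj subsetD)
 define G where "G = W * card Ps + 1"
 define xs where "xs = sorted_list_of_set (phi ` \<R>)"
 have xs: "sorted xs" "distinct xs" "set xs = phi ` \<R>" "length xs = card \<R>" unfolding xs_def using R(2) inj by (auto simp: card_image)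
 have len: "W * G <= length xs" using c xs(4) unfolding G_def by simp
 have lt: "xs ! i < xs ! j" if "i < j" "j < length xs" for i j using xs(1,2) that by (simp add: sorted_nth_mono nth_eq_iff_index_eq order_le_neq_trans)
 define q where "q i = the_inv_into \<R> phi (xs ! i)" for i
 have q: "q i:\<R>" "phi (q i) = xs ! i" if "i < length xs" for i
 proof -
  have "xs ! i:phi ` \<R>" using that xs(3) by auto
  thus "q i:\<R>" "phi (q i) = xs ! i" unfolding q_def using the_inv_into_into[OF inj _ order_refl] f_the_inv_into_f[OF inj] by auto
 qed
 have qinj: "q i = q j ==> i = j" if "i < length xs" "j < length xs" for i j using q that xs(2) by (metis nth_eq_iff_index_eq)
 have cut: "EX S. finite S & card S < card Ps & (ALL i<g. ALL i'>=g. i' < length xs --> q i Int S = {} --> q i' Int S = {} --> (ALL p:Ps. ALL a b. a < length p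
   --> b < length p --> p ! a:q i --> p ! b:q i' --> a < b))" if g: "0 < g" "g < length xs" for g
 proof -
  let ?u = "xs ! (g - 1)" and ?v = "xs ! g"
  have gm: "g - 1 < length xs" using g by simp
  note qg1 = q[OF gm] and qg = q[OF g(2)]
  have in1: "p1 ! ?u:q (g - 1)" using phi(2)[OF qg1(1)] unfolding qg1(2) .
  have in2: "p1 ! ?v:q g" using phi(2)[OF qg(1)] unfolding qg(2) .
  have Q1: "q (g - 1):\<Q>" "q g:\<Q>" using qg1(1) qg(1) R(1) by auto
  have vl: "?v < length p1" using phi(1)[OF qg(1)] unfolding qg(2) .
  have "EX a. ?u <= a & a < ?v & (p1 ! a, p1 ! Suc a)~:inner E \<Q>"
  proof (rule ccontr)
   assume *: "~?thesis"
   have "p1 ! a:q (g - 1)" if "?u <= a" "a <= ?v" for a using that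
   proof (induction a rule: dec_induct)
    case base
    thus ?case using in1 by simp
   next
    case (step a)
    have "(p1 ! a, p1 ! Suc a):inner E \<Q>" using * step(1,4) by simp
    then obtain Q where Q: "Q:\<Q>" "p1 ! a:Q" "p1 ! Suc a:Q" unfolding inner_def by auto
    show ?case using step(3,4) dj[OF Q(1) Q1(1)] Q(2) Q(3) by auto
   qed
   hence "p1 ! ?v:q (g - 1)" using lt[of "g - 1" g] g by simp
   thus False using dj[OF Q1] in2 qinj[OF gm g(2)] g by fastforce
  qed
  then obtain a where a: "?u <= a" "a < ?v" "(p1 ! a, p1 ! Suc a)~:inner E \<Q>" by auto
  have al: "Suc a < length p1" using a(2) vl by simp
  obtain S where S: "finite S" "card S < card Ps" "ALL Q:\<Q>. ALL Q':\<Q>. Q Int S = {} --> Q' Int S = {} --> (EX l<=a. p1 ! l:Q) --> (EX l>a. l < length p1 &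
    p1 ! l:Q') --> (ALL p:Ps. ALL i<length p. ALL j<length p. p ! i:Q --> p ! j:Q' --> i < j)" using sep_order[OF assms(1-5) mn p1 al a(3) cn] .
  show ?thesis
  proof (intro exI[of _ S] conjI allI impI ballI S(1,2))
   fix i i' p b b'
   assume i: "i < g" "g <= i'" "i' < length xs" "q i Int S = {}" "q i' Int S = {}" and p: "p:Ps" "b < length p" "b' < length p" "p ! b:q i" "p ! b':q i'"
   have il: "i < length xs" using i by simp
   have "xs ! i <= ?u" using xs(1) i by (simp add: sorted_nth_mono)
   hence 1: "EX l<=a. p1 ! l:q i" using phi(2) q[OF il] a by (metis order_trans)
   have "?v <= xs ! i'" using xs(1) i by (simp add: sorted_nth_mono)
   hence 2: "EX l>a. l < length p1 & p1 ! l:q i'" using phi q[OF i(3)] a by (metis less_le_trans)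
   have Q: "q i:\<Q>" "q i':\<Q>" using q il i(3) R(1) by auto
   show "b < b'" using S(3)[rule_format, OF Q i(4,5) 1 2 p] .
  qed
 qed
 then obtain S where S: "!!g. 0 < g ==> g < length xs ==> finite (S g) & card (S g) < card Ps & (ALL i<g. ALL i'>=g. i' < length xs --> q i Int S g = {} --> q
   i' Int S g = {} --> (ALL p:Ps. ALL a b. a < length p --> b < length p --> p ! a:q i --> p ! b:q i' --> a < b))" by metis
 define T where "T = (UN h:{1..<W}. S (h * G))"
 have hG: "0 < h * G" "h * G < length xs" if "h : {1..<W}" for h
 proof -
  show "0 < h * G" using that unfolding G_def by simp
  have "h * G < W * G" using that by (intro mult_strict_right_mono) (auto simp: G_def)
  thus "h * G < length xs" using len by linarith
 qed
 have fT: "finite T" unfolding T_def using S hG by simp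
 have "card T <= (SUM h:{1..<W}. card (S (h * G)))" unfolding T_def by (rule card_UN_le) simp
 also have "... <= (SUM h:{1..<W}. card Ps)"
 proof (rule sum_mono)
  fix h
  assume h: "h : {1..<W}"
  show "card (S (h * G)) <= card Ps" using S[OF hG[OF h]] by simp
 qed
 also have "... <= W * card Ps" by simp
 finally have cT: "card T < G" unfolding G_def by simp
 have "EX i. h * G <= i & i < Suc h * G & q i Int T = {}" if h: "h < W" for h
 proof (rule ccontr)
  assume "~?thesis"
  then obtain w where w: "ALL i:{h * G..<Suc h * G}. w i:q i Int T" by (meson atLeastLessThan_iff ex_in_conv)
  have il: "i < length xs" if "i < Suc h * G" for i using that h len by (metis Suc_leI less_le_trans mult_le_mono1)
  have "inj_on w {h * G..<Suc h * G}"
  proof (rule inj_onI)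
   fix i j
   assume ij: "i : {h * G..<Suc h * G}" "j : {h * G..<Suc h * G}" "w i = w j"
   hence "q i Int q j ~= {}" using w by (metis Int_iff disjoint_iff)
   thus "i = j" using dj[of "q i" "q j"] R(1) q(1) il ij qinj by (metis atLeastLessThan_iff subsetD)
  qed
  thus False using w fT card_inj_on_le[of w "{h * G..<Suc h * G}" T] cT by auto
 qed
 then obtain z where z: "!!h. h < W ==> h * G <= z h & z h < Suc h * G & q (z h) Int T = {}" by metis
 have zl: "z h < length xs" if "h < W" for h using z[OF that] that len by (metis Suc_leI less_le_trans mult_le_mono1)
 show ?thesis
 proof (rule that[of "%h. q (z h)"]; intro allI impI ballI)
  show "q (z b):\<R>" if "b < W" for b using q zl that by simp
  fix b b' p i j
  assume b: "b < b'" "b' < W" and p: "p:Ps" "i < length p" "j < length p" "p ! i:q (z b)" "p ! j:q (z b')"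
  have bb: "b' : {1..<W}" using b by auto
  hence ST: "S (b' * G) <= T" unfolding T_def by auto
  have "Suc b * G <= b' * G" using b(1) by (intro mult_le_mono1) simp
  hence "z b < b' * G" using z[of b] b by simp
  moreover have "q (z b) Int S (b' * G) = {}" "q (z b') Int S (b' * G) = {}" using z[of b] z[of b'] b ST by auto
  ultimately show "i < j" using zl b z S[OF hG[OF bb], THEN conjunct2, THEN conjunct2, rule_format, of "z b" "z b'" p i j] p by simp
 qed
qed

lemma path_or_star:
  assumes "conn D J" "sym D" "irrefl D" "finite J" "r ^ r < card J" "r >= 1"
  obtains (path) rho where "inj_on rho {..<r}" "!!s. s < r ==> rho s:J" "!!s. Suc s < r ==> (rho s, rho (Suc s)):D" | (star) rho c where "inj_on rho {..<r}"
    "!!s. s < r ==> rho s:J" "c:J" "!!s. s < r ==> rho s ~= c & (rho s, c):D"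
proof (cases "EX c:J. r <= card {v:J. (c, v):D}")
 case True
 then obtain c where c: "c:J" "r <= card {v:J. (c, v):D}" by auto
 then obtain T where T: "T <= {v:J. (c, v):D}" "card T = r" "finite T" using obtain_subset_with_card_n by auto
 obtain rho where "bij_betw rho {..<r} T" using T by (metis ex_bij_betw_nat_finite lessThan_atLeast0)
 thus ?thesis using T c(1) assms(2,3) star[of rho c] unfolding bij_betw_def irrefl_def sym_def by blast
next
 case False
 hence sm: "card {v:J. (c, v):D} < r" if "c:J" for c using that by auto
 obtain v0 where v0: "v0:J" using assms(1) conn_nonempty by auto
 define Bd where "Bd = rec_nat {v0} (%_ X. X Un (UN c:X. {v:J. (c, v):D}))"
 have Bd0: "Bd 0 = {v0}" and BdS: "Bd (Suc n) = Bd n Un (UN c:Bd n. {v:J. (c, v):D})" for n unfolding Bd_def by auto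
 have BJ: "Bd n <= J" for n by (induction n) (use v0 Bd0 BdS in auto)
 have cB: "card (Bd n) <= r ^ n" for n
 proof (induction n)
  case (Suc n)
  have fn: "finite (Bd n)" using BJ assms(4) finite_subset by blast
  have "Bd (Suc n) = (UN c:Bd n. insert c {v:J. (c, v):D})" unfolding BdS by auto
  hence "card (Bd (Suc n)) <= (SUM c:Bd n. card (insert c {v:J. (c, v):D}))" using card_UN_le[OF fn, of "%c. insert c {v:J. (c, v):D}"] by simp
  also have "... <= (SUM c:Bd n. r)"
  proof (rule sum_mono)
   fix c
   assume "c:Bd n"
   hence "c:J" using BJ by auto
   hence "card {v:J. (c, v):D} < r" by (rule sm)
   thus "card (insert c {v:J. (c, v):D}) <= r" using card_insert_le_m1[of r "{v:J. (c, v):D}" c] by simp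
  qed
  also have "... <= r ^ n * r" using Suc by simp
  finally show ?case by (simp add: mult.commute)
 qed (simp add: Bd0)
 have "~J <= Bd r" using cB[of r] assms(4,5) BJ[of r] by auto
 then obtain v where v: "v:J" "v~:Bd r" by auto
 obtain xs where xs: "ipath D xs" "hd xs = v0" "last xs = v" "set xs <= J" using conn_ipath[OF assms(1) v0 v(1) assms(3,2)] by auto
 hence px: "path D xs" unfolding ipath_def by simp
 have xB: "i < length xs ==> xs ! i:Bd i" for i
 proof (induction i)
  case 0
  thus ?case using xs(2) hd_conv_nth unfolding Bd0 by fastforce
 next
  case (Suc i)
  have "xs ! i:Bd i" using Suc by simp
  moreover have "(xs ! i, xs ! Suc i):D" using path_nth[OF px Suc(2)] .
  ultimately show ?case using xs(4) nth_mem[OF Suc(2)] unfolding BdS by auto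
 qed
 have mono: "i <= j ==> Bd i <= Bd j" for i j by (rule lift_Suc_mono_le[of Bd]) (use BdS in auto)
 have len: "r < length xs"
 proof (rule ccontr)
  assume "~r < length xs"
  hence "v:Bd (length xs - 1)" "length xs - 1 <= r" using px unfolding path_def using xB[of "length xs - 1"] xs(3) by (auto simp: last_conv_nth)
  thus False using v mono by auto
 qed
 show ?thesis
 proof (rule path[of "%s. xs ! s"])
  show "inj_on ((!) xs) {..<r}" using px len unfolding path_def inj_on_def by (simp add: nth_eq_iff_index_eq)
  show "xs ! s:J" if "s < r" for s using xs(4) len that by auto
  show "(xs ! s, xs ! Suc s):D" if "Suc s < r" for s using path_nth[OF px] len that by simp
 qed
qed

definition rung :: "'a rel => 'a list set => 'a set => ('a list \<times> 'a list) set" where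
  "rung E J Q = {(p, p'). p:J & p':J & p ~= p' & (EX x ks y. x:set p Int Q & y:set p' Int Q & path E (x # ks @ [y]) & set ks <= Q - \<Union> (set ` J))}"

lemma rung_sym: "sym E ==> sym (rung E J Q)"
proof (rule symI)
 fix p p'
 assume s: "sym E" "(p, p'):rung E J Q"
 then obtain x ks y where "x:set p Int Q" "y:set p' Int Q" "path E (x # ks @ [y])" "set ks <= Q - \<Union> (set ` J)" unfolding rung_def by auto
 moreover from this have "path E (y # rev ks @ [x])" using path_rev[OF s(1), of "x # ks @ [y]"] by simp
 ultimately show "(p', p):rung E J Q" using s(2) unfolding rung_def by fastforce
qed

lemma rung_conn:
  assumes "sym E" "irrefl E" "conn E Q" "J ~= {}" "!!p. p:J ==> set p Int Q ~= {}" "!!p p'. p:J ==> p':J ==> p ~= p' ==> set p Int set p' = {}"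
  shows "conn (rung E J Q) J"
proof -
 have main: "path E w ==> set w <= Q ==> p:J ==> q:J ==> hd w:set p ==> last w:set q ==> (p, q):(rung E J Q Int J \<times> J)^*" for w p q
 proof (induction "length w" arbitrary: w p q rule: less_induct)
  case less
  note w = less.prems
  obtain x w' where xw: "w = x # w'" using w(1) unfolding path_def by (cases w) auto
  show ?case
  proof (cases "w' = []")
   case True
   thus ?thesis using w xw assms(6) by auto
  next
   case False
   then obtain ks y where ks: "w' = ks @ [y]" by (metis append_butlast_last_id)
   show ?thesis
   proof (cases "set ks Int \<Union> (set ` J) = {}")
    case True
    show ?thesis using w xw ks True unfolding rung_def by (cases "p = q"; fastforce)
   next
    case False
    then obtain z u where z: "z:set ks" "u:J" "z:set u" by auto
    obtain k1 k2 where k: "ks = k1 @ z # k2" using z(1) by (meson split_list)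
    have e: "w = (x # k1 @ [z]) @ (k2 @ [y])" "w = (x # k1) @ (z # k2 @ [y])" using xw ks k by auto
    have "path E (x # k1 @ [z])" using path_appendD1[of E "x # k1 @ [z]" "k2 @ [y]"] w(1) e(1) by simp
    hence 1: "(p, u):(rung E J Q Int J \<times> J)^*" by (rule less.hyps[rotated]) (use w z e xw in auto)
    have "path E (z # k2 @ [y])" using path_appendD2[of E "x # k1" "z # k2 @ [y]"] w(1) e(2) by simp
    hence "(u, q):(rung E J Q Int J \<times> J)^*" by (rule less.hyps[rotated]) (use w z e xw in auto)
    with 1 show ?thesis by simp
   qed
  qed
 qed
 show ?thesis unfolding conn_def
 proof (intro conjI ballI assms(4))
  fix p q
  assume pq: "p:J" "q:J"
  obtain x where x: "x:set p Int Q" using assms(5)[OF pq(1)] by auto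
  obtain y where y: "y:set q Int Q" using assms(5)[OF pq(2)] by auto
  obtain xs where "ipath E xs" "hd xs = x" "last xs = y" "set xs <= Q" using conn_ipath[OF assms(3) _ _ assms(2,1), of x y] x y by auto
  thus "(p, q):(rung E J Q Int J \<times> J)^*" using main[of xs p q] x y pq unfolding ipath_def by auto
 qed
qed

lemma pigeonhole_fibre: assumes "finite B" "!!x. x:A ==> f x:B" "n * card B < card A" obtains y where "y:B" "n < card {x:A. f x = y}"
proof -
 have "A = (UN y:B. {x:A. f x = y})" using assms(2) by auto
 hence "card A <= (SUM y:B. card {x:A. f x = y})" using card_UN_le[OF assms(1), of "%y. {x:A. f x = y}"] by simp
 moreover have "(SUM y:B. card {x:A. f x = y}) <= (SUM y:B. n)" if "ALL y:B. card {x:A. f x = y} <= n" by (rule sum_mono) (use that in auto)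
 ultimately have "~(ALL y:B. card {x:A. f x = y} <= n)" using assms(3) by (auto simp: mult.commute)
 thus ?thesis using that by auto
qed

lemma increasing_enum: assumes "finite S" "n <= card (S :: nat set)" shows "EX f :: nat => nat. (ALL i<n. f i:S) & (ALL i j. i < j & j < n --> f i < f j)"
proof -
 let ?l = "sorted_list_of_set S"
 have l: "length ?l = card S" "sorted ?l" "distinct ?l" "set ?l = S" using assms(1) by auto
 show ?thesis
 proof (intro exI[of _ "%i. ?l ! i"] conjI allI impI)
  fix i
  assume "i < n"
  thus "?l ! i:S" using assms(2) l(4) nth_mem by auto
 next
  fix i j
  assume ij: "i < j & j < n"
  hence jl: "j < length ?l" using assms(2) by simp
  have "?l ! i <= ?l ! j" using ij jl by (simp add: sorted_nth_mono)
  moreover have "?l ! i ~= ?l ! j" using ij jl by (simp add: nth_eq_iff_index_eq)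
  ultimately show "?l ! i < ?l ! j" by simp
 qed
qed

definition seg :: "'a list => nat => nat => 'a set" where
  "seg p a b = {p ! t | t. a <= t & t < b}"

lemma seg_conn: assumes "sym E" "path E p" "a < b" "b <= length p" shows "conn E (seg p a b)"
proof -
 have "seg p a b = set (drop a (take b p))"
 proof -
  have "p ! t:set (drop a (take b p))" if "a <= t" "t < b" for t
  proof -
   have "drop a (take b p) ! (t - a) = p ! t" "t - a < length (drop a (take b p))" using that assms(4) by auto
   thus ?thesis by (metis nth_mem)
  qed
  moreover have "EX t. v = p ! t & a <= t & t < b" if "v:set (drop a (take b p))" for v
  proof -
   obtain i where "i < length (drop a (take b p))" "v = drop a (take b p) ! i" using \<open>v:_\<close> by (metis in_set_conv_nth)
   thus ?thesis using assms(4) by auto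
  qed
  ultimately show ?thesis unfolding seg_def by auto
 qed
 thus ?thesis using path_drop[OF path_take[OF assms(2), of b], of a] assms(3,4) path_conn[OF assms(1)] by simp
qed

lemma seg_disj: "distinct p ==> b <= a' ==> b' <= length p ==> seg p a b Int seg p a' b' = {}" unfolding seg_def by (auto simp: nth_eq_iff_index_eq)

lemma seg_subset: "b <= length p ==> seg p a b <= set p" unfolding seg_def by auto

lemma path_Cons_conn: "sym E ==> path E (x # ks @ [y]) ==> conn E (insert x (set ks)) & (EX a:insert x (set ks). (a, y):E)"
proof -
 assume s: "sym E" "path E (x # ks @ [y])"
 hence "path E (x # ks)" using path_appendD1[of E "x # ks" "[y]"] by simp
 moreover have "(last (x # ks), y):E" using s(2) unfolding path_def by (metis append_Cons list.sel(1) list.simps(3) successively_append_iff)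
 ultimately show ?thesis using last_in_set[of "x # ks"] path_conn[OF s(1), of "x # ks"] by auto
qed

lemma grid_build:
  assumes E: "sym E" "irrefl E" and J: "finite J" "r ^ r < card J" "r >= 1" and pJ: "!!p. p:J ==> path E p & set p <= V" and dJ: "!!p p'. p:J ==> p':J ==> p ~=
    p' ==> set p Int set p' = {}" and Q: "!!b. b < W ==> conn E (Q b) & Q b <= V" and dQ: "!!b b'. b < b' ==> b' < W ==> Q b Int Q b' = {}" and JQ: "!!b p. b <
    W ==> p:J ==> set p Int Q b ~= {}" and ord: "!!b b' p i j. b < b' ==> b' < W ==> p:J ==> i < length p ==> j < length p ==> p ! i:Q b ==> p ! j:Q b' ==> i <
    j" and W: "M * 2 ^ (card J * card J) < W"
  shows "hostminor E V r M"
proof -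
 have fP: "finite (Pow (J \<times> J))" using J(1) by simp
 have rP: "rung E J (Q b):Pow (J \<times> J)" if "b : {..<W}" for b unfolding rung_def by auto
 have cP: "M * card (Pow (J \<times> J)) < card {..<W}" using J(1) W by (simp add: card_Pow)
 obtain D where D: "M < card {b : {..<W}. rung E J (Q b) = D}" by (rule pigeonhole_fibre[of _ "{..<W}" "%b. rung E J (Q b)", OF fP rP cP])
 hence "Suc M <= card {b : {..<W}. rung E J (Q b) = D}" by simp
 moreover have "finite {b : {..<W}. rung E J (Q b) = D}" by simp
 ultimately have "EX f. (ALL i<Suc M. f i : {b : {..<W}. rung E J (Q b) = D}) & (ALL i j. i < j & j < Suc M --> f i < f j)" by (intro increasing_enum)
 then obtain bl where bl0: "ALL i<Suc M. bl i : {b : {..<W}. rung E J (Q b) = D}" and blm0: "ALL i j. i < j & j < Suc M --> bl i < bl j" by auto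
 have blm: "bl i < bl j" if "i < j" "j < Suc M" for i j using blm0 that by simp
 have bl: "bl i < W" "rung E J (Q (bl i)) = D" if "i < Suc M" for i using bl0[rule_format, OF that] by auto
 have QQ: "Q (bl i) Int Q (bl j) = {}" if "i < Suc M" "j < Suc M" "i ~= j" for i j
   using dQ[of "bl i" "bl j"] dQ[of "bl j" "bl i"] blm[of i j] blm[of j i] bl that by (metis Int_commute linorder_neqE_nat)
 define st where "st p j = (LEAST t. t < length p & p ! t:Q (bl j))" for p j
 have st: "st p j < length p" "p ! st p j:Q (bl j)" if pj: "p:J" "j < Suc M" for p j
 proof -
  have "EX v. v:set p Int Q (bl j)" using JQ[OF bl(1)[OF pj(2)] pj(1)] by auto
  hence "EX t. t < length p & p ! t:Q (bl j)" by (metis IntE in_set_conv_nth)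
  from LeastI_ex[OF this] show "st p j < length p" "p ! st p j:Q (bl j)" unfolding st_def by auto
 qed
 have stl: "st p j <= t" if "t < length p" "p ! t:Q (bl j)" for p j t unfolding st_def using that by (intro Least_le) simp
 have aft: "t < st p j'" if "p:J" "j < j'" "j' < Suc M" "t < length p" "p ! t:Q (bl j)" for p j j' t
   using ord[OF blm[OF that(2,3)] bl(1)[OF that(3)] that(1,4) st(1)[OF that(1,3)] that(5) st(2)[OF that(1,3)]] .
 have stm: "st p j < st p j'" if "p:J" "j < j'" "j' < Suc M" for p j j' using aft[OF that st[OF that(1)]] that by simp
 have stm': "st p j <= st p j'" if "p:J" "j <= j'" "j' < Suc M" for p j j' using stm[of p j j'] that by (cases "j = j'") auto
 define Iv where "Iv p j = seg p (st p j) (st p (Suc j))" for p j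
 have Ivc: "conn E (Iv p j)" if "p:J" "j < M" for p j unfolding Iv_def using seg_conn[OF E(1), of p] pJ[OF that(1)] stm[OF that(1), of j "Suc j"] st(1)[OF
   that(1), of "Suc j"] that by simp
 have Ivs: "Iv p j <= set p" if "p:J" "j < M" for p j unfolding Iv_def using seg_subset[of "st p (Suc j)" p] st(1)[OF that(1), of "Suc j"] that by simp
 have IvQ: "v:Iv p j" if v: "p:J" "j < M" "v:set p" "v:Q (bl j)" for p j v
 proof -
  obtain t where "t < length p" "v = p ! t" using v(3) by (metis in_set_conv_nth)
  thus ?thesis unfolding Iv_def seg_def using stl[of t p j] aft[of p j "Suc j" t] v by auto
 qed
 have Ivd: "Iv p j Int Iv p j' = {}" if jj: "p:J" "j < M" "j' < M" "j < j'" for p j j' unfolding Iv_def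
   by (rule seg_disj) (use jj pJ st stm'[of p "Suc j" j'] in \<open>auto simp: path_def less_imp_le\<close>)
 have Ivn: "EX a:Iv p j. EX b:Iv p (Suc j). (a, b):E" if pj: "p:J" "Suc j < M" for p j
 proof -
  let ?t = "st p (Suc j) - 1"
  have 1: "st p j < st p (Suc j)" "st p (Suc j) < st p (Suc (Suc j))" using stm[OF pj(1)] pj(2) by auto
  have 2: "Suc ?t = st p (Suc j)" using 1 by simp
  have "(p ! ?t, p ! Suc ?t):E" using st(1)[OF pj(1)] pj(2) path_nth[of E p ?t] pJ[OF pj(1)] 2 by simp
  thus ?thesis unfolding Iv_def seg_def using 1 by fastforce
 qed
 let ?U = "\<Union> (set ` J)"
 have sD: "sym D" using rung_sym[OF E(1), of J "Q (bl 0)"] bl(2)[of 0] by simp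
 have irD: "irrefl D" using bl(2)[of 0] unfolding rung_def irrefl_def by auto
 have cD: "conn D J" using rung_conn[OF E, of "Q (bl 0)" J] Q[OF bl(1)[of 0]] JQ[OF bl(1)[of 0]] dJ bl(2)[of 0] J(2) by fastforce
 have rg: "EX x ks y. x:set p Int Q (bl j) & y:set p' Int Q (bl j) & path E (x # ks @ [y]) & set ks <= Q (bl j) - ?U" if "(p, p'):D" "j < M" for p p' j
   using that bl(2)[of j] unfolding rung_def by auto
 have "EX rho G. inj_on rho {..<r} & (ALL s<r. rho s:J) & (ALL j<M. G j <= V & (ALL s<r. G j Int set (rho s) = {})) & (ALL j<M. ALL j'<M. j < j' --> G j Int G
   j' = {}) & (ALL j<M. ALL s. Suc s < r --> (EX x K y. x:set (rho s) Int Q (bl j) & y:set (rho (Suc s)) Int Q (bl j) & K <= G j & conn E (insert x K) & (EX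
   a:insert x K. (a, y):E)))"
 proof (rule path_or_star[OF cD sD irD J])
  fix rho
  assume rho: "inj_on rho {..<r}" "!!s. s < r ==> rho s:J" "!!s. Suc s < r ==> (rho s, rho (Suc s)):D"
  show ?thesis
  proof (rule exI[of _ rho], rule exI[of _ "%j. Q (bl j) - ?U"], intro conjI allI impI)
   fix j s
   assume j: "j < M" and s: "Suc s < r"
   obtain x ks y where "x:set (rho s) Int Q (bl j)" "y:set (rho (Suc s)) Int Q (bl j)" "path E (x # ks @ [y])" "set ks <= Q (bl j) - ?U"
     using rg[OF rho(3)[OF s] j] by auto
   thus "EX x K y. x:set (rho s) Int Q (bl j) & y:set (rho (Suc s)) Int Q (bl j) & K <= Q (bl j) - ?U & conn E (insert x K) & (EX a:insert x K. (a, y):E)"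
     using path_Cons_conn[OF E(1), of x ks y] by auto
  next
   show "inj_on rho {..<r}" by (rule rho)
  next
   fix s
   assume "s < r"
   thus "rho s:J" by (rule rho)
  next
   fix j
   assume "j < M"
   thus "Q (bl j) - ?U <= V" using Q[OF bl(1)[of j]] by auto
  next
   fix j s
   assume "s < r"
   thus "(Q (bl j) - ?U) Int set (rho s) = {}" using rho(2) by auto
  next
   fix j j'
   assume "j < M" "j' < M" "j < j'"
   thus "(Q (bl j) - ?U) Int (Q (bl j') - ?U) = {}" using QQ[of j j'] by auto
  qed
 next
  fix rho c
  assume rho: "inj_on rho {..<r}" "!!s. s < r ==> rho s:J" "c:J" "!!s. s < r ==> rho s ~= c & (rho s, c):D"
  show ?thesis
  proof (rule exI[of _ rho], rule exI[of _ "%j. (Q (bl j) - ?U) Un Iv c j"], intro conjI allI impI)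
   fix j s
   assume j: "j < M" and s: "Suc s < r"
   have d1: "(rho s, c):D" using rho(4) s by simp
   have d2: "(c, rho (Suc s)):D" using rho(4)[OF s] sD by (auto dest: symD)
   obtain x k1 z where 1: "x:set (rho s) Int Q (bl j)" "z:set c Int Q (bl j)" "path E (x # k1 @ [z])" "set k1 <= Q (bl j) - ?U" using rg[OF d1 j] by auto
   obtain z' k2 y where 2: "z':set c Int Q (bl j)" "y:set (rho (Suc s)) Int Q (bl j)" "path E (z' # k2 @ [y])" "set k2 <= Q (bl j) - ?U" using rg[OF d2 j]
     by auto
   have z: "z:Iv c j" "z':Iv c j" using IvQ[OF rho(3) j] 1 2 by auto
   note c1 = path_Cons_conn[OF E(1) 1(3)] and c2 = path_Cons_conn[OF E(1) 2(3)]
   have t1: "touch E (insert x (set k1)) (Iv c j)" using c1 z unfolding touch_def by auto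
   have "conn E (insert x (set k1) Un Iv c j)" using conn_Un[OF E(1) _ Ivc[OF rho(3) j] t1] c1 by simp
   moreover have "touch E (insert x (set k1) Un Iv c j) (insert z' (set k2))" using z unfolding touch_def by simp
   ultimately have "conn E ((insert x (set k1) Un Iv c j) Un insert z' (set k2))" using conn_Un[OF E(1)] c2 by blast
   moreover have "(insert x (set k1) Un Iv c j) Un insert z' (set k2) = insert x (set k1 Un Iv c j Un set k2)" using z by auto
   ultimately have "conn E (insert x (set k1 Un Iv c j Un set k2))" by simp
   moreover have "set k1 Un Iv c j Un set k2 <= (Q (bl j) - ?U) Un Iv c j" using 1(4) 2(4) by auto
   ultimately show "EX x K y. x:set (rho s) Int Q (bl j) & y:set (rho (Suc s)) Int Q (bl j) & K <= (Q (bl j) - ?U) Un Iv c j & conn E (insert x K) & (EX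
     a:insert x K. (a, y):E)" using c2 z 1(1) 2(2) by blast
  next
   show "inj_on rho {..<r}" by (rule rho)
  next
   fix s
   assume "s < r"
   thus "rho s:J" by (rule rho)
  next
   fix j
   assume "j < M"
   thus "(Q (bl j) - ?U) Un Iv c j <= V" using Q[OF bl(1)[of j]] Ivs[OF rho(3)] pJ[OF rho(3)] by auto
  next
   fix j s
   assume j: "j < M" and s: "s < r"
   show "((Q (bl j) - ?U) Un Iv c j) Int set (rho s) = {}" using dJ[OF rho(2)[OF s] rho(3)] rho(4)[OF s] Ivs[OF rho(3) j] rho(2)[OF s] by auto
  next
   fix j j'
   assume j: "j < M" "j' < M" "j < j'"
   have "(Q (bl j) - ?U) Int (Q (bl j') - ?U) = {}" using QQ[of j j'] j by auto
   moreover have "Iv c j Int Iv c j' = {}" using Ivd[OF rho(3) j] .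
   ultimately show "((Q (bl j) - ?U) Un Iv c j) Int ((Q (bl j') - ?U) Un Iv c j') = {}" using Ivs[OF rho(3) j(2)] rho(3) Ivs[OF rho(3) j(1)] by auto
  qed
 qed
 then obtain rho G where inj: "inj_on rho {..<r}" and rhoJ: "ALL s<r. rho s:J" and G1: "ALL j<M. G j <= V & (ALL s<r. G j Int set (rho s) = {})" and G2: "ALL
   j<M. ALL j'<M. j < j' --> G j Int G j' = {}" and con: "ALL j<M. ALL s. Suc s < r --> (EX x K y. x:set (rho s) Int Q (bl j) & y:set (rho (Suc s)) Int Q (bl
   j) & K <= G j & conn E (insert x K) & (EX a:insert x K. (a, y):E))" by auto
 have "ALL j. EX K. j < M & Suc (j mod r) < r --> (EX x y. x:set (rho (j mod r)) Int Q (bl j) & y:set (rho (Suc (j mod r))) Int Q (bl j) & K <= G j & conn E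
   (insert x K) & (EX a:insert x K. (a, y):E))" using con[rule_format] by metis
 from choice[OF this] obtain K where K0: "ALL j. j < M & Suc (j mod r) < r --> (EX x y. x:set (rho (j mod r)) Int Q (bl j) & y:set (rho (Suc (j mod r))) Int Q
   (bl j) & K j <= G j & conn E (insert x (K j)) & (EX a:insert x (K j). (a, y):E))" by auto
 have K: "EX x y. x:set (rho (j mod r)) Int Q (bl j) & y:set (rho (Suc (j mod r))) Int Q (bl j) & K j <= G j & conn E (insert x (K j)) & (EX a:insert x (K j).
   (a, y):E)" if "j < M" "Suc (j mod r) < r" for j using K0 that by simp
 define mu where "mu = (%(s, j). Iv (rho s) j Un (if j mod r = s & Suc s < r then K j else {}))"
 have muI: "Iv (rho s) j <= mu (s, j)" for s j unfolding mu_def by auto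
 have mus: "mu (s, j) <= Iv (rho s) j Un (if j mod r = s then G j else {})" if sj: "s < r" "j < M" for s j using K[OF sj(2)] unfolding mu_def by auto
 have rowd: "set (rho s) Int set (rho s') = {}" if "s < r" "s' < r" "s ~= s'" for s s' using dJ[of "rho s" "rho s'"] rhoJ inj that
   by (metis inj_onD lessThan_iff)
 have muc: "conn E (mu (s, j)) & mu (s, j) <= V" if sj: "s < r" "j < M" for s j
 proof
  have "Iv (rho s) j <= V" using pJ rhoJ sj Ivs[of "rho s" j] by auto
  moreover have "G j <= V" using G1 sj by simp
  ultimately show "mu (s, j) <= V" using mus[OF sj] by (cases "j mod r = s") auto
  show "conn E (mu (s, j))"
  proof (cases "j mod r = s & Suc s < r")
   case True
   then obtain x where x: "x:set (rho s) Int Q (bl j)" "conn E (insert x (K j))" using K[OF sj(2)] by auto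
   have xi: "x:Iv (rho s) j" using IvQ[of "rho s" j x] rhoJ sj x(1) by auto
   hence "touch E (Iv (rho s) j) (insert x (K j))" unfolding touch_def by simp
   hence "conn E (Iv (rho s) j Un insert x (K j))" using conn_Un[OF E(1) Ivc x(2)] rhoJ sj by simp
   moreover have "Iv (rho s) j Un insert x (K j) = mu (s, j)" unfolding mu_def using True xi by auto
   ultimately show ?thesis by simp
  next
   case False
   thus ?thesis unfolding mu_def using Ivc[of "rho s" j] rhoJ sj by auto
  qed
 qed
 have mud: "mu (s, j) Int mu (s', j') = {}" if h: "s < r" "j < M" "s' < r" "j' < M" "(s, j) ~= (s', j')" for s j s' j'
 proof -
  have I1: "Iv (rho s) j <= set (rho s)" "Iv (rho s') j' <= set (rho s')" using Ivs rhoJ h by auto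
  have "Iv (rho s) j Int Iv (rho s') j' = {}"
  proof (cases "s = s'")
   case True
   thus ?thesis using h Ivd[of "rho s" j j'] Ivd[of "rho s" j' j] rhoJ True by fastforce
  next
   case False
   thus ?thesis using rowd[OF h(1,3)] I1 by auto
  qed
  moreover have "G j Int Iv (rho s') j' = {}" "G j' Int Iv (rho s) j = {}" using G1 h I1 by blast+
  moreover have "G j Int G j' = {}" if "j ~= j'" using G2 h that by (metis Int_commute linorder_neqE_nat)
  hence "(if j mod r = s then G j else {}) Int (if j' mod r = s' then G j' else {}) = {}" using h(5) by auto
  ultimately show ?thesis using mus[OF h(1,2)] mus[OF h(3,4)] by (cases "j mod r = s"; cases "j' mod r = s'") (simp_all, blast+)
 qed
 have rn: "EX a:mu (s, j). EX b:mu (s, Suc j). (a, b):E" if "s < r" "Suc j < M" for s j using Ivn[of "rho s" j] rhoJ muI[of s j] muI[of s "Suc j"] that by blast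
 have vn: "EX a:mu (s, j). EX b:mu (Suc s, j). (a, b):E" if sj: "Suc s < r" "j < M" "j mod r = s" for s j
 proof -
  obtain x y a where x: "x:set (rho s) Int Q (bl j)" "y:set (rho (Suc s)) Int Q (bl j)" "a:insert x (K j)" "(a, y):E" using K[OF sj(2)] sj by auto
  show ?thesis using IvQ[of "rho (Suc s)" j y] rhoJ sj x(2) IvQ[of "rho s" j x] x(1) x(3) unfolding mu_def using x(4) by auto
 qed
 have edge: "EX a:mu u. EX b:mu w. (a, b):E" if uw: "(u, w):hE r M" for u w
 proof -
  obtain s j s' j' where h: "u = (s, j)" "w = (s', j')" "s < r" "s' < r" "j < M" "j' < M" "s = s' & (j' = Suc j | j = Suc j') | j = j' & (s' = Suc s & j mod r
    = s | s = Suc s' & j mod r = s')" using uw unfolding hE_def by auto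
  have flip: "(EX a:X. EX b:Y. (a, b):E) ==> (EX a:Y. EX b:X. (a, b):E)" for X Y using E(1) by (meson symD)
  from h(7) show ?thesis using rn[of s j] h flip[OF rn[of s j']] vn[of s j] flip[OF vn[of s' j]] by auto
 qed
 have "minor_model E V (hV r M) (hE r M) mu" unfolding minor_model_def using muc mud edge unfolding hV_def by auto
 thus ?thesis unfolding hostminor_def by auto
qed

lemma hostminor_mono: assumes "hostminor E V r M" "E <= F" "V <= U" shows "hostminor F U r M"
proof -
 obtain mu where "minor_model E V (hV r M) (hE r M) mu" using assms(1) unfolding hostminor_def by auto
 hence "minor_model F U (hV r M) (hE r M) mu" unfolding minor_model_def using assms(2,3) conn_edge_mono[OF _ assms(2)] by fastforce
 thus ?thesis unfolding hostminor_def by auto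
qed

definition rows :: "nat => nat" where
  "rows r = Suc (r ^ r)"

definition blocks :: "nat => nat => nat" where
  "blocks r M = Suc (M * 2 ^ (rows r * rows r))"

definition crossbound :: "nat => nat => nat => nat" where
  "crossbound r M k = Suc (blocks r M * (blocks r M * k + 1) * 2 ^ k)"

lemma crossing:
  assumes E: "finite E" "sym E" "irrefl E" "E <= V \<times> V" and L: "linkage E A B L" and LV: "\<Union> (set ` L) <= V" and Q: "finite \<Q>" "!!Q. Q:\<Q> ==>
    conn E Q & Q <= V" and dQ: "!!Q Q'. Q:\<Q> ==> Q':\<Q> ==> Q ~= Q' ==> Q Int Q' = {}" and no: "~hostminor E V r M" and r: "r >= 1"
  shows "EX A' B' L'. A' <= A & B' <= B & linkage E A' B' L' & card L' = card L & \<Union> (set ` L') <= \<Union> (set ` L) Un \<Union> \<Q> & card {Q:\<Q>.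
    rows r <= card {p:L'. set p Int Q ~= {}}} < crossbound r M (card L)"
proof -
 define F where "F = \<Union> (ed ` L) Un inner E \<Q>"
 have fL: "finite L" using L unfolding linkage_def by simp
 have edE: "ed p <= E" if "p:L" for p using ed_subset[OF linkageD(1)[OF L that]] .
 have FE: "F <= E" unfolding F_def inner_def using edE by auto
 have F: "finite F" "irrefl F" using FE E by (auto intro: finite_subset simp: irrefl_def)
 let ?A = "hd ` L" and ?B = "last ` L"
 have AB: "finite ?A" "finite ?B" "?A <= A" "?B <= B" using fL linkageD(5)[OF L] linkageD(6)[OF L] by auto
 have LF: "linkage F ?A ?B L" unfolding linkage_def
 proof (intro conjI ballI impI fL)
  fix p
  assume p: "p:L"
  have "ed p <= F" unfolding F_def using p by auto
  thus "path F p" by (rule path_edI[OF linkageD(1)[OF L p]])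
  show "set p Int ?A = {hd p}" using linkageD(2,4)[OF L p] AB(3) p by auto
  show "set p Int ?B = {last p}" using linkageD(3,4)[OF L p] AB(4) p by auto
 next
  fix p q
  assume "p:L" "q:L" "p ~= q"
  thus "set p Int set q = {}" using L unfolding linkage_def by simp
 qed
 have "EX L'. (linkage F ?A ?B L' & card L' = card L) & (ALL Ps. linkage F ?A ?B Ps & card Ps = card L --> outside F \<Q> L' <= outside F \<Q> Ps)"
   by (rule ex_has_least_nat[where P="%L'. linkage F ?A ?B L' & card L' = card L" and k=L]) (simp add: LF)
 then obtain L' where L': "linkage F ?A ?B L'" "card L' = card L" and mn: "ALL Ps. linkage F ?A ?B Ps & card Ps = card L --> outside F \<Q> L' <= outside F
   \<Q> Ps" by blast
 have fL': "finite L'" using L'(1) unfolding linkage_def by simp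
 have cF: "conn F Q" if q: "Q:\<Q>" for Q
 proof -
  have "conn (E Int Q \<times> Q) Q" using conn_restrict[of E Q Q] Q(2)[OF q] by simp
  moreover have "E Int Q \<times> Q <= F" unfolding F_def inner_def using q by auto
  ultimately show ?thesis by (rule conn_edge_mono)
 qed
 have LV': "set p <= \<Union> (set ` L) Un \<Union> \<Q>" if p: "p:L'" for p
 proof -
  have "F <= (\<Union> (set ` L) Un \<Union> \<Q>) \<times> (\<Union> (set ` L) Un \<Union> \<Q>)" unfolding ed_def inner_def F_def by auto
  moreover have "hd p:\<Union> (set ` L) Un \<Union> \<Q>"
  proof -
   obtain q where q: "q:L" "hd p = hd q" using linkageD(5)[OF L'(1) p] by auto
   have "hd q:set q" using linkageD(4)[OF L q(1)] by simp
   thus ?thesis using q by auto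
  qed
  ultimately show ?thesis using path_in_field[OF linkageD(1)[OF L'(1) p]] by simp
 qed
 have "card {Q:\<Q>. rows r <= card {p:L'. set p Int Q ~= {}}} < crossbound r M (card L)"
 proof (rule ccontr)
  let ?S = "{Q:\<Q>. rows r <= card {p:L'. set p Int Q ~= {}}}"
  assume "~?thesis"
  hence big: "blocks r M * (blocks r M * card L + 1) * 2 ^ card L < card ?S" unfolding crossbound_def by simp
  have "EX T. T <= {p:L'. set p Int Q ~= {}} & card T = rows r" if "Q : ?S" for Q using that obtain_subset_with_card_n[of "rows r" "{p:L'. set p Int Q ~= {}}"]
    by auto
  hence "ALL Q:?S. EX T. T <= {p:L'. set p Int Q ~= {}} & card T = rows r" by simp
  from bchoice[OF this] obtain T where T: "ALL Q:?S. T Q <= {p:L'. set p Int Q ~= {}} & card (T Q) = rows r" by blast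
  have fP: "finite (Pow L')" using fL' by simp
  have TP: "T Q:Pow L'" if "Q : ?S" for Q using T that by auto
  have cP: "blocks r M * (blocks r M * card L + 1) * card (Pow L') < card ?S" using big fL' L'(2) by (simp add: card_Pow)
  obtain J where J: "J:Pow L'" "blocks r M * (blocks r M * card L + 1) < card {Q : ?S. T Q = J}" by (rule pigeonhole_fibre[OF fP TP cP])
  let ?R = "{Q : ?S. T Q = J}"
  have "?R ~= {}" using J(2) by (metis card.empty not_less_zero)
  then obtain Q0 where Q0: "Q0 : ?S" "T Q0 = J" by auto
  have cJ: "card J = rows r" using T Q0 by auto
  then obtain p1 where p1: "p1:J" unfolding rows_def by fastforce
  have JR: "set p Int Q ~= {}" if "p:J" "Q : ?R" for p Q using T that by auto
  have R: "?R <= \<Q>" "finite ?R" using Q(1) by auto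
  have pl: "p1:L'" using p1 J(1) by auto
  have Rp: "Q Int set p1 ~= {}" if "Q : ?R" for Q using JR[OF p1 that] by auto
  have cR: "blocks r M * (blocks r M * card L' + 1) <= card ?R" using J(2) L'(2) by simp
  have mn': "outside F \<Q> L' <= outside F \<Q> Ps" if "linkage F ?A ?B Ps" "card Ps = card L'" for Ps using mn that L'(2) by simp
  obtain f where f0: "ALL b<blocks r M. f b : ?R" and ford0: "ALL b b'. b < b' --> b' < blocks r M --> (ALL p:L'. ALL i<length p. ALL j<length p. p ! i:f b -->
    p ! j:f b' --> i < j)" by (rule ordered_blocks[OF F AB(1,2) L'(1) mn' cF dQ pl R Rp cR])
  note f = f0[rule_format]
  note ford = ford0[rule_format]
  have fQ: "f b:\<Q>" if "b < blocks r M" for b using f[OF that] by simp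
  have "hostminor E V r M"
  proof (rule grid_build[OF E(2,3), of J r V "blocks r M" f M])
   show "finite J" using J(1) fL' by (auto intro: finite_subset)
   show "r ^ r < card J" using cJ unfolding rows_def by simp
   show "1 <= r" by (rule r)
   show "path E p & set p <= V" if "p:J" for p
   proof
    have pL: "p:L'" using J(1) that by auto
    show "path E p" using path_edge_mono[OF linkageD(1)[OF L'(1) pL] FE] .
    show "set p <= V" using Q(2) LV LV'[OF pL] by blast
   qed
   show "set p Int set p' = {}" if "p:J" "p':J" "p ~= p'" for p p' using linkage_disj[OF L'(1), of p p'] J(1) that by blast
   show "conn E (f b) & f b <= V" if "b < blocks r M" for b using Q(2)[OF fQ[OF that]] .
   show "set p Int f b ~= {}" if "b < blocks r M" "p:J" for b p using JR[OF that(2) f[OF that(1)]] .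
   show "f b Int f b' = {}" if bb: "b < b'" "b' < blocks r M" for b b'
   proof (rule ccontr)
    assume "f b Int f b' ~= {}"
    hence eq: "f b = f b'" using dQ[OF fQ fQ, of b b'] bb by auto
    obtain v where "v:set p1" "v:f b" using JR[OF p1 f[of b]] bb by auto
    then obtain i where "i < length p1" "p1 ! i:f b" by (metis in_set_conv_nth)
    thus False using ford[OF bb pl, of i i] eq by simp
   qed
   show "i < j" if "b < b'" "b' < blocks r M" "p:J" "i < length p" "j < length p" "p ! i:f b" "p ! j:f b'" for b b' p i j
     using ford[OF that(1,2) _ that(4-7)] that(3) J(1) by auto
   show "M * 2 ^ (card J * card J) < blocks r M" unfolding cJ blocks_def by simp
  qed
  thus False using no by simp
 qed
 moreover have "linkage E ?A ?B L'" using linkage_edge_mono[OF L'(1) FE] .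
 ultimately show ?thesis using LV' AB(3,4) L'(2) by blast
qed primrec seqsize :: "nat => nat => nat => nat" where "seqsize r M 0 = 0" | "seqsize r M (Suc e) = max (seqsize r M e + rows r) (Suc (e * crossbound r M
  (seqsize r M e + rows r)))"

lemma sequential:
  assumes E: "finite E" "sym E" "irrefl E" "E <= V \<times> V" and no: "~hostminor E V r M" and r: "r >= 1" and L: "!!i. i < e ==> linkage E (A i) (B i) (L i)
    & card (L i) = seqsize r M e & \<Union> (set ` L i) <= V"
  shows "EX R. (ALL i<e. conn E (R i) & R i Int A i ~= {} & R i Int B i ~= {} & R i <= (UN i<e. \<Union> (set ` L i))) & (ALL i<e. ALL j<i. R i Int R j = {})"
  using L
proof (induction e arbitrary: A B L)
 case 0
 thus ?case by simp
next
 case (Suc e)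
 let ?k = "seqsize r M e + rows r"
 let ?Nb = "crossbound r M ?k"
 have Le: "linkage E (A e) (B e) (L e)" "card (L e) = seqsize r M (Suc e)" "\<Union> (set ` L e) <= V" using Suc.prems[of e] by auto
 define \<Q> where "\<Q> = set ` L e"
 have fQ: "finite \<Q>" unfolding \<Q>_def using Le(1) unfolding linkage_def by simp
 have cQ: "conn E Q & Q <= V" if q: "Q:\<Q>" for Q
 proof -
  obtain p where p: "p:L e" "Q = set p" using q unfolding \<Q>_def by auto
  thus ?thesis using path_conn[OF E(2) linkageD(1)[OF Le(1) p(1)]] Le(3) by auto
 qed
 have dQ: "Q Int Q' = {}" if q: "Q:\<Q>" "Q':\<Q>" "Q ~= Q'" for Q Q'
 proof -
  obtain a b where ab: "a:L e" "Q = set a" "b:L e" "Q' = set b" using q unfolding \<Q>_def by auto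
  thus ?thesis using linkage_disj[OF Le(1) ab(1,3)] q(3) by auto
 qed
 have "inj_on set (L e)"
 proof (rule inj_onI)
  fix p q
  assume pq: "p:L e" "q:L e" "set p = set q"
  have "hd p:set p" using linkageD(4)[OF Le(1) pq(1)] by simp
  moreover from this have "hd p:set q" unfolding pq(3) .
  ultimately show "p = q" using linkage_disj[OF Le(1) pq(1,2)] by simp
 qed
 hence cardQ: "card \<Q> = seqsize r M (Suc e)" unfolding \<Q>_def using Le(2) by (simp add: card_image)
 have "EX A' B' L'. A' <= A i & B' <= B i & linkage E A' B' L' & card L' = ?k & \<Union> (set ` L') <= \<Union> (set ` L i) Un \<Union> \<Q> & card {Q:\<Q>.
   rows r <= card {p:L'. set p Int Q ~= {}}} < ?Nb" if i: "i < e" for i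
 proof -
  have Li: "linkage E (A i) (B i) (L i)" "card (L i) = seqsize r M (Suc e)" "\<Union> (set ` L i) <= V" using Suc.prems[of i] i by auto
  have "?k <= card (L i)" using Li(2) by simp
  then obtain T where T: "T <= L i" "card T = ?k" using obtain_subset_with_card_n by metis
  have lT: "linkage E (A i) (B i) T" using linkage_subset[OF Li(1) T(1)] .
  have TV: "\<Union> (set ` T) <= V" using Li(3) T(1) by auto
  have "EX A' B' L'. A' <= A i & B' <= B i & linkage E A' B' L' & card L' = card T & \<Union> (set ` L') <= \<Union> (set ` T) Un \<Union> \<Q> & card {Q:\<Q>.
    rows r <= card {p:L'. set p Int Q ~= {}}} < crossbound r M (card T)" by (rule crossing[OF E lT TV fQ cQ dQ no r])
  then obtain A' B' L' where c: "A' <= A i & B' <= B i & linkage E A' B' L' & card L' = card T & \<Union> (set ` L') <= \<Union> (set ` T) Un \<Union> \<Q> &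
    card {Q:\<Q>. rows r <= card {p:L'. set p Int Q ~= {}}} < crossbound r M (card T)" by blast
  have "\<Union> (set ` T) Un \<Union> \<Q> <= \<Union> (set ` L i) Un \<Union> \<Q>" using T(1) by blast
  thus ?thesis using c unfolding T(2) by (meson order_trans)
 qed
 hence "ALL i. EX A' B' L'. i < e --> A' <= A i & B' <= B i & linkage E A' B' L' & card L' = ?k & \<Union> (set ` L') <= \<Union> (set ` L i) Un \<Union> \<Q>
   & card {Q:\<Q>. rows r <= card {p:L'. set p Int Q ~= {}}} < ?Nb" by simp
 from choice[OF this] obtain A' where "ALL i. EX B' L'. i < e --> A' i <= A i & B' <= B i & linkage E (A' i) B' L' & card L' = ?k & \<Union> (set ` L') <=
   \<Union> (set ` L i) Un \<Union> \<Q> & card {Q:\<Q>. rows r <= card {p:L'. set p Int Q ~= {}}} < ?Nb" by blast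
 from choice[OF this] obtain B' where "ALL i. EX L'. i < e --> A' i <= A i & B' i <= B i & linkage E (A' i) (B' i) L' & card L' = ?k & \<Union> (set ` L') <=
   \<Union> (set ` L i) Un \<Union> \<Q> & card {Q:\<Q>. rows r <= card {p:L'. set p Int Q ~= {}}} < ?Nb" by blast
 from choice[OF this] obtain L' where L': "ALL i. i < e --> A' i <= A i & B' i <= B i & linkage E (A' i) (B' i) (L' i) & card (L' i) = ?k & \<Union> (set ` L'
   i) <= \<Union> (set ` L i) Un \<Union> \<Q> & card {Q:\<Q>. rows r <= card {p:L' i. set p Int Q ~= {}}} < ?Nb" by blast
 let ?bad = "%i. {Q:\<Q>. rows r <= card {p:L' i. set p Int Q ~= {}}}"
 have "card (UN i<e. ?bad i) <= (SUM i<e. card (?bad i))" by (rule card_UN_le) simp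
 also have "... <= (SUM i<e. ?Nb)"
 proof (rule sum_mono)
  fix i
  assume "i : {..<e}"
  thus "card (?bad i) <= ?Nb" using L' by auto
 qed
 also have "... = e * ?Nb" by simp
 finally have "card (UN i<e. ?bad i) < card \<Q>" unfolding cardQ by simp
 hence "(UN i<e. ?bad i) ~= \<Q>" by auto
 then obtain Q where Q: "Q:\<Q>" "Q~:(UN i<e. ?bad i)" by auto
 have "EX T. T <= {p:L' i. set p Int Q = {}} & card T = seqsize r M e" if i: "i < e" for i
 proof -
  have c1: "card {p:L' i. set p Int Q ~= {}} < rows r" using Q(2) i Q(1) by fastforce
  have "L' i = {p:L' i. set p Int Q ~= {}} Un {p:L' i. set p Int Q = {}}" by auto
  hence c2: "card (L' i) <= card {p:L' i. set p Int Q ~= {}} + card {p:L' i. set p Int Q = {}}" by (metis (no_types, lifting) card_Un_le)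
  have c3: "card (L' i) = ?k" using L' i by simp
  have arith: "x <= b" if "x + y <= a + b" "a < y" for x y a b :: nat using that by simp
  have "seqsize r M e <= card {p:L' i. set p Int Q = {}}" by (rule arith[OF c2[unfolded c3] c1])
  then obtain T where "T <= {p:L' i. set p Int Q = {}}" "card T = seqsize r M e" "finite T" by (rule obtain_subset_with_card_n)
  thus ?thesis by blast
 qed
 hence "ALL i. EX T. i < e --> T <= {p:L' i. set p Int Q = {}} & card T = seqsize r M e" by simp
 from choice[OF this] obtain T where T: "ALL i. i < e --> T i <= {p:L' i. set p Int Q = {}} & card (T i) = seqsize r M e" by blast
 have "linkage E (A' i) (B' i) (T i) & card (T i) = seqsize r M e & \<Union> (set ` T i) <= V" if i: "i < e" for i
 proof (intro conjI)
  have Tl: "T i <= L' i" using T i by auto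
  show "linkage E (A' i) (B' i) (T i)" using linkage_subset[OF _ Tl] L' i by simp
  show "card (T i) = seqsize r M e" using T i by simp
  have "\<Union> (set ` L i) <= V" using Suc.prems[of i] i by simp
  moreover have "\<Union> \<Q> <= V" using cQ by auto
  ultimately have "\<Union> (set ` L' i) <= V" using L' i by (meson Un_least order_trans)
  thus "\<Union> (set ` T i) <= V" using Tl by auto
 qed
 hence "EX R. (ALL i<e. conn E (R i) & R i Int A' i ~= {} & R i Int B' i ~= {} & R i <= (UN i<e. \<Union> (set ` T i))) & (ALL i<e. ALL j<i. R i Int R j = {})"
   by (rule Suc.IH)
 then obtain R where R: "ALL i<e. conn E (R i) & R i Int A' i ~= {} & R i Int B' i ~= {} & R i <= (UN i<e. \<Union> (set ` T i))" "ALL i<e. ALL j<i. R i Int R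
   j = {}" by blast
 define R' where "R' i = (if i < e then R i else Q)" for i
 obtain p where p: "p:L e" "Q = set p" using Q(1) unfolding \<Q>_def by auto
 have Uin: "(UN i<e. \<Union> (set ` T i)) <= (UN i<Suc e. \<Union> (set ` L i))"
 proof -
  have "\<Union> (set ` T i) <= (UN i<Suc e. \<Union> (set ` L i))" if i: "i < e" for i
  proof -
   have "\<Union> (set ` T i) <= \<Union> (set ` L' i)" using T i by auto
   also have "... <= \<Union> (set ` L i) Un \<Union> \<Q>" using L' i by simp
   also have "... <= (UN i<Suc e. \<Union> (set ` L i))" unfolding \<Q>_def using i by (auto simp: less_Suc_eq)
   finally show ?thesis .
  qed
  thus ?thesis by blast
 qed
 show ?case
 proof (intro exI[of _ R'] conjI allI impI)
  fix i
  assume i: "i < Suc e"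
  show "conn E (R' i)" using R(1) cQ[OF Q(1)] unfolding R'_def by simp
  show "R' i Int A i ~= {}"
  proof (cases "i < e")
   case True
   thus ?thesis using R(1) L' unfolding R'_def using True by fastforce
  next
   case False
   hence "i = e" using i by simp
   thus ?thesis unfolding R'_def using p linkageD(4,5)[OF Le(1) p(1)] by auto
  qed
  show "R' i Int B i ~= {}"
  proof (cases "i < e")
   case True
   hence "R i Int B' i ~= {}" "B' i <= B i" using R(1) L' by auto
   thus ?thesis unfolding R'_def using True by auto
  next
   case False
   hence "i = e" using i by simp
   thus ?thesis unfolding R'_def using p linkageD(4,6)[OF Le(1) p(1)] by auto
  qed
  show "R' i <= (UN i<Suc e. \<Union> (set ` L i))" using R(1) Uin p unfolding R'_def by (cases "i < e"; fastforce)
 next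
  fix i j
  assume i: "i < Suc e" "j < i"
  show "R' i Int R' j = {}"
  proof (cases "i < e")
   case True
   thus ?thesis unfolding R'_def using R(2) i by simp
  next
   case False
   hence "R j <= (UN i<e. \<Union> (set ` T i))" using R(1) i by simp
   thus ?thesis unfolding R'_def using False i T by auto
  qed
 qed
qed

theorem grid_theorem:
  assumes "r >= 1" "M >= 1"
  shows "EX theta. ALL (V :: 'a set) E \<B>. finite V --> E <= V \<times> V --> sym E --> irrefl E --> bramble E V theta \<B> --> hostminor E V r M"
proof -
 define m where "m = r * M"
 define e where "e = card (hE r M)"
 define n where "n = max 1 (seqsize r M e)"
 have m1: "m >= 1" unfolding m_def using assms by simp
 have fhE: "finite (hE r M)" by (rule finite_subset[of _ "hV r M \<times> hV r M"]) (use hE_hV in \<open>auto simp: hV_def\<close>)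
 have "hostminor E V r M" if g: "finite V" "E <= V \<times> V" "sym E" "irrefl E" "bramble E V (4 * m * n) \<B>" for V :: "'a set" and E \<B>
 proof (rule ccontr)
  assume no: "~hostminor E V r M"
  have n1: "n >= 1" unfolding n_def by simp
  obtain A X D where A0: "ALL i<m. conn E (A i) & A i <= V & A i Int D = {}" and Ad0: "ALL i<m. ALL j<m. i ~= j --> A i Int A j = {}" and X0: "ALL i<m. X i <=
    D & (ALL x:X i. EX a:A i. (a, x):E)" and DV: "D <= V" and lk0: "ALL i<m. ALL j<m. EX L. linkage (E Int D \<times> D) (X i) (X j) L & card L = n"
    by (rule mesh[OF g m1 n1])
  have A: "conn E (A i) & A i <= V & A i Int D = {}" if "i < m" for i using A0 that by simp
  note Ad = Ad0[rule_format]
  have X: "X i <= D & (ALL x:X i. EX a:A i. (a, x):E)" if "i < m" for i using X0 that by simp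
  note lk = lk0[rule_format]
  let ?F = "E Int D \<times> D"
  have F: "finite ?F" "sym ?F" "irrefl ?F" "?F <= D \<times> D" using g by (auto simp: sym_def irrefl_def intro: finite_subset[OF _ finite_SigmaI[of V "%_.
    V"]])
  have noD: "~hostminor ?F D r M" using no hostminor_mono[of ?F D r M E V] DV by auto
  obtain h where h: "bij_betw h {..<e} (hE r M)" unfolding e_def using fhE by (metis ex_bij_betw_nat_finite lessThan_atLeast0)
  define c where "c = (%(s, j). s * M + j)"
  have c: "c x < m" if xh: "x:hV r M" for x
  proof -
   obtain s j where x: "x = (s, j)" "s < r" "j < M" using xh unfolding hV_def by auto
   have "s * M + j < s * M + M" using x by simp
   also have "... = Suc s * M" by simp
   also have "... <= r * M" using x by (intro mult_le_mono1) simp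
   finally show ?thesis unfolding c_def m_def x by simp
  qed
  have cinj: "x = y" if xy: "x:hV r M" "y:hV r M" "c x = c y" for x y
  proof -
   obtain s j s' j' where x: "x = (s, j)" "j < M" "y = (s', j')" "j' < M" using xy unfolding hV_def by auto
   hence e: "s * M + j = s' * M + j'" using xy unfolding c_def by simp
   have "(s * M + j) mod M = j" "(s' * M + j') mod M = j'" using x by auto
   thus ?thesis using e x by simp
  qed
  have hin: "h i:hE r M" if "i < e" for i using h that unfolding bij_betw_def by auto
  have hfs: "fst (h i):hV r M" "snd (h i):hV r M" if "i < e" for i using hE_hV[of "fst (h i)" "snd (h i)"] hin[OF that] by auto
  have "EX L. linkage ?F (X (c (fst (h i)))) (X (c (snd (h i)))) L & card L = seqsize r M e & \<Union> (set ` L) <= D" if i: "i < e" for i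
  proof -
   obtain L where L: "linkage ?F (X (c (fst (h i)))) (X (c (snd (h i)))) L" "card L = n" using lk[OF c[OF hfs(1)[OF i]] c[OF hfs(2)[OF i]]] by blast
   have "seqsize r M e <= card L" using L(2) unfolding n_def by simp
   then obtain T where T: "T <= L" "card T = seqsize r M e" using obtain_subset_with_card_n by metis
   have "set p <= D" if "p:L" for p using path_in_field[OF linkageD(1)[OF L(1) that] F(4)] linkageD(5)[OF L(1) that] X[OF c[OF hfs(1)[OF i]]] by auto
   thus ?thesis using T(1) linkage_subset[OF L(1) T(1)] T(2) by auto
  qed
  hence "ALL i. EX L. i < e --> linkage ?F (X (c (fst (h i)))) (X (c (snd (h i)))) L & card L = seqsize r M e & \<Union> (set ` L) <= D" by simp
  from choice[OF this] obtain L where L: "ALL i. i < e --> linkage ?F (X (c (fst (h i)))) (X (c (snd (h i)))) (L i) & card (L i) = seqsize r M e & \<Union>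
    (set ` L i) <= D" by blast
  have "EX R. (ALL i<e. conn ?F (R i) & R i Int X (c (fst (h i))) ~= {} & R i Int X (c (snd (h i))) ~= {} & R i <= (UN i<e. \<Union> (set ` L i))) & (ALL i<e.
    ALL j<i. R i Int R j = {})" by (rule sequential[OF F noD assms(1)]) (use L in simp)
  then obtain R where R1: "ALL i<e. conn ?F (R i) & R i Int X (c (fst (h i))) ~= {} & R i Int X (c (snd (h i))) ~= {} & R i <= (UN i<e. \<Union> (set ` L i))"
    and R2: "ALL i<e. ALL j<i. R i Int R j = {}" by blast
  have RD: "R i <= D" if "i < e" for i
  proof -
   have "(UN i<e. \<Union> (set ` L i)) <= D" using L by auto
   thus ?thesis using R1 that by (meson order_trans)
  qed
  have Rd: "R i Int R j = {}" if "i < e" "j < e" "i ~= j" for i j using R2 that by (metis Int_commute linorder_neqE_nat)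
  have Rc: "conn E (R i)" if "i < e" for i using R1 that by (meson conn_edge_mono inf_le1)
  define mu where "mu x = A (c x) Un (UN i:{i. i < e & fst (h i) = x}. R i)" for x
  have RX: "EX a:A (c x). EX b:R i. (a, b):E" if x: "i < e" "x:hV r M" "x = fst (h i) | x = snd (h i)" for x i using R1 x X[OF c[OF x(2)]] by fastforce
  have "minor_model E V (hV r M) (hE r M) mu" unfolding minor_model_def
  proof (intro conjI ballI impI)
   fix x
   assume x: "x:hV r M"
   show "conn E (mu x)" unfolding mu_def
   proof (rule conn_UN[OF g(3)])
    show "conn E (A (c x))" using A[OF c[OF x]] by simp
    fix i
    assume i: "i : {i. i < e & fst (h i) = x}"
    thus "conn E (R i)" using Rc by simp
    show "touch E (A (c x)) (R i)" using RX[of i x] i x unfolding touch_def by auto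
   qed
   show "mu x <= V" unfolding mu_def using A[OF c[OF x]] RD DV by auto
  next
   fix x y
   assume xy: "x:hV r M" "y:hV r M" "x ~= y"
   have "c x ~= c y" using cinj[OF xy(1,2)] xy(3) by auto
   hence 1: "A (c x) Int A (c y) = {}" by (rule Ad[OF c[OF xy(1)] c[OF xy(2)]])
   have 2: "A (c x) Int R i = {}" "A (c y) Int R i = {}" if "i < e" for i using A[OF c[OF xy(1)]] A[OF c[OF xy(2)]] RD[OF that] by auto
   show "mu x Int mu y = {}"
   proof (rule ccontr)
    assume "mu x Int mu y ~= {}"
    then obtain v where v: "v:mu x" "v:mu y" by auto
    have nx: "v~:A (c x)" "v~:A (c y)" using v 1 2 unfolding mu_def by blast+
    obtain i where i: "i < e" "fst (h i) = x" "v:R i" using v(1) nx(1) unfolding mu_def by auto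
    obtain j where j: "j < e" "fst (h j) = y" "v:R j" using v(2) nx(2) unfolding mu_def by auto
    show False using Rd[of i j] i j xy(3) by blast
   qed
  next
   fix z
   assume z: "z:hE r M"
   obtain x y where xy: "z = (x, y)" by (cases z)
   obtain i where i: "i < e" "h i = z" using h z unfolding bij_betw_def by (metis imageE lessThan_iff)
   obtain a b where ab: "a:A (c y)" "b:R i" "(a, b):E" using RX[of i y] i hE_hV z xy by auto
   have "b:mu x" unfolding mu_def using ab i xy by auto
   moreover have "(b, a):E" using g(3) ab(3) by (rule symD)
   ultimately show "case z of (x, y) => EX a:mu x. EX b:mu y. (a, b):E" unfolding mu_def using ab xy by auto
  qed
  thus False using no unfolding hostminor_def by auto
 qed
 thus ?thesis by blast
qed

subsection \<open>Sparse induced subgraphs of bounded degree\<close>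

lemma conn_remove_edge: assumes "sym F" "conn F S" "v:S" "w:S" "(w, v):((F - {(v, w), (w, v)}) Int S \<times> S)^*" shows "conn (F - {(v, w), (w, v)}) S"
proof -
 let ?G = "(F - {(v, w), (w, v)})"
 have sG: "sym ?G" using assms(1) by (auto simp: sym_def)
 have vw: "(v, w):(?G Int S \<times> S)^*" by (rule sym_rtrancl_restr[OF sG assms(5)])
 have "(F Int S \<times> S) <= (?G Int S \<times> S)^*" using vw assms(5) by auto
 hence "(F Int S \<times> S)^* <= (?G Int S \<times> S)^*" by (rule rtrancl_subset_rtrancl)
 thus ?thesis using assms(2) unfolding conn_def by auto
qed

lemma bridge_side:
  assumes F: "sym F" "conn F S" "v:S" "w:S" and G: "G = F - {(v, w), (w, v)}" "~conn G S"
  shows "v~:compo G S w" "conn G (S - compo G S w)" "v:S - compo G S w"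
proof -
 have sG: "sym G" using F(1) unfolding G(1) by (auto simp: sym_def)
 show nv: "v~:compo G S w" using conn_remove_edge[OF F] G unfolding compo_def by auto
 thus "v:S - compo G S w" using F by simp
 have sub: "S - compo G S w = compo G S v"
 proof
  show "compo G S v <= S - compo G S w"
  proof
   fix u
   assume u: "u:compo G S v"
   hence uS: "u:S" using compo_in[OF F(3)] by auto
   have "(u, v):(G Int S \<times> S)^*" using sym_rtrancl_restr[OF sG] u unfolding compo_def by simp
   moreover have "(w, u):(G Int S \<times> S)^*" if "u:compo G S w" using that unfolding compo_def by simp
   ultimately have "u~:compo G S w" using nv unfolding compo_def by (metis mem_Collect_eq rtrancl_trans)
   thus "u:S - compo G S w" using uS by simp
  qed
  show "S - compo G S w <= compo G S v"
  proof (rule ccontr)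
   assume "~S - compo G S w <= compo G S v"
   then obtain u where u: "u:S" "u~:compo G S w Un compo G S v" by auto
   obtain a b where ab: "a:S" "a:compo G S w Un compo G S v" "b:S" "b~:compo G S w Un compo G S v" "(a, b):F" by (rule conn_cut[OF F(2,4) _ u]) simp
   have "(a, b):G" using ab(4) unfolding G(1) using ab(5) by auto
   thus False using ab compo_closed[of a G S w b] compo_closed[of a G S v b] F by auto
  qed
 qed
 show "conn G (S - compo G S w)" unfolding sub by (rule compo_conn[OF sG F(3)])
qed

lemma card_le_inj:
  assumes "finite B" "!!x. x:A ==> f x:B" "!!x y. x:A ==> y:A ==> f x = f y ==> x = y"
  shows "card A <= card B"
  by (rule card_inj_on_le[OF _ _ assms(1), of f]) (use assms in \<open>auto simp: inj_on_def\<close>)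

lemma minor_modelD:
  assumes "minor_model E V W H mu"
  shows "x:W ==> conn E (mu x)" "x:W ==> mu x <= V" "x:W ==> y:W ==> x ~= y ==> mu x Int mu y = {}" "(x, y):H ==> EX a:mu x. EX b:mu y. (a, b):E"
  using assms unfolding minor_model_def by auto

lemma minor_model_uniq: "minor_model E V W H mu ==> x:W ==> y:W ==> a:mu x ==> a:mu y ==> x = y" using minor_modelD(3) by fastforce

lemma minimal_model:
  assumes "finite E" "sym E" "irrefl E" and H: "finite H" "sym H" "irrefl H" "H <= W \<times> W" and "minor_model E V W H mu0"
  obtains F mu where "F <= E" "sym F" "minor_model F V W H mu" "!!a b. (a, b):F ==> EX x:W. EX y:W. a:mu x & b:mu y & (x = y | (x, y):H)" "!!x v. x:W ==> v:mu
    x ==> card {w. (v, w):F} <= card {y. (x, y):H}" "!!x v. x:W ==> v:mu x ==> 2 <= card {y. (x, y):H} ==> 2 <= card {w. (v, w):F}"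
proof -
 define P where "P F \<longleftrightarrow> F <= E & sym F & (EX mu. minor_model F V W H mu)" for F
 have "P E" unfolding P_def using assms by auto
 then obtain F where F: "P F" and mn: "ALL F'. P F' --> card F <= card F'" using ex_has_least_nat[of P E card] by auto
 then obtain mu where FE: "F <= E" and sF: "sym F" and m: "minor_model F V W H mu" unfolding P_def by auto
 have fF: "finite F" using FE assms(1) by (rule finite_subset)
 have min: "F' = F" if F': "F' <= F" "sym F'" "minor_model F' V W H mu'" for F' mu'
 proof -
  have "P F'" unfolding P_def using F' FE by auto
  thus ?thesis using mn F'(1) fF by (simp add: card_seteq)
 qed
 note mD = minor_modelD[OF m] and mu = minor_model_uniq[OF m]
 define Fr where "Fr = {(a, b). (a, b):F & (EX x:W. EX y:W. a:mu x & b:mu y & (x = y | (x, y):H))}"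
 have "Fr = F"
 proof (rule min)
  show "Fr <= F" unfolding Fr_def by auto
  show "sym Fr"
  proof (rule symI)
   fix a b
   assume "(a, b):Fr"
   then obtain x y where "(a, b):F" "x:W" "y:W" "a:mu x" "b:mu y" "x = y | (x, y):H" unfolding Fr_def by auto
   moreover from this have "(b, a):F" "y = x | (y, x):H" using sF H(2) by (auto dest: symD)
   ultimately show "(b, a):Fr" unfolding Fr_def by auto
  qed
  show "minor_model Fr V W H mu" unfolding minor_model_def
  proof (intro conjI ballI impI)
   fix x
   assume x: "x:W"
   have "F Int mu x \<times> mu x <= Fr" unfolding Fr_def using x by auto
   thus "conn Fr (mu x)" using conn_restrict[OF mD(1)[OF x] order_refl] conn_edge_mono by auto
   show "mu x <= V" by (rule mD(2)[OF x])
  next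
   fix x y
   assume "x:W" "y:W" "x ~= y"
   thus "mu x Int mu y = {}" by (rule mD(3))
  next
   fix z
   assume z: "z:H"
   obtain x y where xy: "z = (x, y)" by (cases z)
   then obtain a b where "a:mu x" "b:mu y" "(a, b):F" using mD(4) z by blast
   thus "case z of (x, y) => EX a:mu x. EX b:mu y. (a, b):Fr" unfolding Fr_def using z xy H(4) by blast
  qed
 qed
 hence Fin: "EX x:W. EX y:W. a:mu x & b:mu y & (x = y | (x, y):H)" if ab: "(a, b):F" for a b using ab unfolding Fr_def by blast
 have no_model: False if e: "(v, w):F" "minor_model (F - {(v, w), (w, v)}) V W H mu'" for v w mu' using sF min[of "F - {(v, w), (w, v)}"] e
   unfolding sym_def by auto

 text \<open>Deleting an edge inside \<open>mu x\<close> and one of its sides keeps a model unless that side carries all contacts to some neighbour.\<close>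
 have side: "v~:compo (F - {(v, w), (w, v)}) (mu x) w & (EX y. (x, y):H & (ALL a b. (a, b):F --> a:mu x --> b:mu y --> a:compo (F - {(v, w), (w, v)}) (mu x)
   w))" if x: "x:W" "v:mu x" "w:mu x" "(v, w):F" for x v w
 proof -
  define G where "G = F - {(v, w), (w, v)}"
  define K where "K = compo G (mu x) w"
  have keep: "(a, b):G" if "(a, b):F" "a~:mu x | b~:mu x" for a b using that x unfolding G_def by auto
  have conno: "conn G (mu z)" if z: "z:W" "z ~= x" for z using keep mD(3)[OF z(1) x(1) z(2)] conn_restrict[OF mD(1)[OF z(1)] order_refl] conn_edge_mono by blast
  have mk: "minor_model G V W H (mu(x := S))" if S: "conn G S" "S <= mu x" "!!y. (x, y):H ==> EX a:S. EX b:mu y. (a, b):F" for S unfolding minor_model_def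
  proof (intro conjI ballI impI)
   fix z
   assume z: "z:W"
   show "conn G ((mu(x := S)) z)" using conno[OF z] S(1) by auto
   show "(mu(x := S)) z <= V" using mD(2)[OF z] S(2) by auto
  next
   fix z y
   assume "z:W" "y:W" "z ~= y"
   thus "(mu(x := S)) z Int (mu(x := S)) y = {}" using mD(3)[of z y] S(2) by auto
  next
   fix e
   assume e: "e:H"
   obtain z y where zy: "e = (z, y)" by (cases e)
   have W: "z:W" "y:W" "z ~= y" using e zy H(3,4) by (auto simp: irrefl_def)
   show "case e of (z, y) => EX a:(mu(x := S)) z. EX b:(mu(x := S)) y. (a, b):G"
   proof (cases "z = x")
    case True
    then obtain a b where ab: "a:S" "b:mu y" "(a, b):F" using S(3)[of y] e zy by auto
    show ?thesis using mD(3)[OF W] ab True keep[OF ab(3)] zy by auto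
   next
    case zx: False
    show ?thesis
    proof (cases "y = x")
     case True
     obtain a b where ab: "a:S" "b:mu z" "(a, b):F" using e zy True H(2) S(3)[of z] by (auto dest: symD)
     show ?thesis using mD(3)[OF W] ab True keep[OF ab(3)] sF unfolding G_def using zx zy by (auto dest: symD)
    next
     case False
     obtain a b where ab: "a:mu z" "b:mu y" "(a, b):F" using mD(4)[of z y] e zy by auto
     show ?thesis using mD(3)[OF W(1) x(1) zx] ab keep[OF ab(3)] False zy by auto
    qed
   qed
  qed
  have nc: "~conn G (mu x)" using mk mD(4) no_model[OF x(4)] unfolding G_def by blast
  note bs = bridge_side[OF sF mD(1)[OF x(1)] x(2,3) G_def nc]
  have "EX y. (x, y):H & (ALL a b. (a, b):F --> a:mu x --> b:mu y --> a:K)" using mk bs(2) no_model[OF x(4)] unfolding K_def G_def by blast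
  thus ?thesis using bs(1) unfolding K_def G_def by simp
 qed
 have sidedisj: "compo (F - {(v, w), (w, v)}) (mu x) w Int compo (F - {(v, u), (u, v)}) (mu x) u = {}" if x: "x:W" "v:mu x" "w:mu x" "(v, w):F" "u:mu x" "(v,
   u):F" "u ~= w" for x v w u
 proof (rule ccontr)
  let ?Gw = "F - {(v, w), (w, v)}" and ?Gu = "F - {(v, u), (u, v)}"
  let ?Kw = "compo ?Gw (mu x) w" and ?Ku = "compo ?Gu (mu x) u"
  assume "?Kw Int ?Ku ~= {}"
  then obtain z where z: "z : ?Kw" "z : ?Ku" by auto
  have vK: "v ~: ?Kw" "v ~: ?Ku" using side[OF x(1,2,3,4)] side[OF x(1,2,5,6)] by auto
  have sGu: "sym ?Gu" using sF by (auto simp: sym_def)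
  have "conn ?Gu ?Ku" by (rule compo_conn[OF sGu x(5)])
  hence "conn (?Gu Int ?Ku \<times> ?Ku) ?Ku" by (rule conn_restrict) simp
  moreover have "?Gu Int ?Ku \<times> ?Ku <= ?Gw" using vK by auto
  ultimately have "conn ?Gw ?Ku" by (rule conn_edge_mono)
  hence "?Ku <= ?Kw" by (rule conn_sub_compo) (use z compo_in[OF x(5)] in auto)
  hence "u : ?Kw" by auto
  thus False using x sF compo_closed[OF _ x(3)] vK by (auto dest: symD)
 qed
 have uniqc: "w = w'" if h: "x:W" "v:mu x" "(x, y):H" "w:mu y" "w':mu y" "(v, w):F" "(v, w'):F" for x v y w w'
 proof (rule ccontr)
  assume ne: "w ~= w'"
  let ?G = "F - {(v, w), (w, v)}"
  have yW: "y:W" "x ~= y" using h(3) H(3,4) by (auto simp: irrefl_def)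
  have nx: "w~:mu x" "v~:mu y" "w'~:mu x" using mD(3)[OF h(1) yW] h by auto
  have "minor_model ?G V W H mu" unfolding minor_model_def
  proof (intro conjI ballI impI)
   fix z
   assume z: "z:W"
   have "z = x" if "v:mu z" using mu[OF z h(1) that h(2)] .
   hence "F Int mu z \<times> mu z <= ?G" using nx(1) by auto
   thus "conn ?G (mu z)" by (rule conn_edge_mono[OF conn_restrict[OF mD(1)[OF z] order_refl]])
   show "mu z <= V" by (rule mD(2)[OF z])
  next
   fix z z'
   assume "z:W" "z':W" "z ~= z'"
   thus "mu z Int mu z' = {}" by (rule mD(3))
  next
   fix e
   assume e: "e:H"
   obtain z z' where zz: "e = (z, z')" by (cases e)
   have zW: "z:W" "z':W" using e zz H(4) by auto
   obtain a b where ab: "a:mu z" "b:mu z'" "(a, b):F" using mD(4) e zz by blast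
   show "case e of (x, y) => EX a:mu x. EX b:mu y. (a, b) : ?G"
   proof (cases "(a, b) : ?G")
    case True
    thus ?thesis using ab zz by auto
   next
    case False
    then consider "a = v" "b = w" | "a = w" "b = v" using ab by auto
    thus ?thesis
    proof cases
     case 1
     thus ?thesis using mu[OF zW(2) yW(1)] ab h ne zz by auto
    next
     case 2
     hence "z = y" using mu[OF zW(1) yW(1)] ab h by simp
     thus ?thesis using sF ne h ab 2 zz by (auto dest: symD)
    qed
   qed
  qed
  thus False using no_model[OF h(6)] by auto
 qed
 show ?thesis
 proof (rule that[OF FE sF m Fin])
  fix x v
  assume x: "x:W" "v:mu x"
  have fN: "finite {y. (x, y):H}" by (rule finite_subset[OF _ finite_imageI[OF H(1), of snd]]) force
  have Nc: "w:mu x | (EX y. (x, y):H & w:mu y)" if vw: "(v, w):F" for w using Fin[OF vw] mu[OF _ x(1)] x(2) by auto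
  have "EX y. (x, y):H & (if w:mu x then (ALL a b. (a, b):F --> a:mu x --> b:mu y --> a:compo (F - {(v, w), (w, v)}) (mu x) w) else w:mu y)" if "(v, w):F" for
    w using side[OF x(1,2) _ that] Nc[OF that] by (cases "w:mu x") auto
  hence "ALL w. EX y. (v, w):F --> (x, y):H & (if w:mu x then (ALL a b. (a, b):F --> a:mu x --> b:mu y --> a:compo (F - {(v, w), (w, v)}) (mu x) w) else w:mu
    y)" by simp
  from choice[OF this] obtain f where f: "ALL w. (v, w):F --> (x, f w):H & (if w:mu x then (ALL a b. (a, b):F --> a:mu x --> b:mu (f w) --> a:compo (F - {(v,
    w), (w, v)}) (mu x) w) else w:mu (f w))" by auto
  have f1: "(x, f w):H" if "(v, w):F" for w using f that by simp
  have f2: "a:compo (F - {(v, w), (w, v)}) (mu x) w" if "(v, w):F" "w:mu x" "(a, b):F" "a:mu x" "b:mu (f w)" for a b w using f[rule_format, OF that(1)] that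
    by simp
  have f3: "w:mu (f w)" if "(v, w):F" "w~:mu x" for w using f that by simp
  show "card {w. (v, w):F} <= card {y. (x, y):H}"
  proof (rule card_le_inj[OF fN])
   show "f w : {y. (x, y):H}" if "w : {w. (v, w):F}" for w using f1 that by simp
  next
   have key: False if k: "(v, w):F" "(v, w'):F" "w:mu x" "w'~:mu x" "f w = f w'" for w w' using f2[OF k(1,3,2) x(2)] f3[OF k(2,4)] k(5) side[OF x k(3,1)]
     by auto
   fix w w'
   assume w: "w : {w. (v, w):F}" "w' : {w. (v, w):F}" "f w = f w'"
   have wF: "(v, w):F" "(v, w'):F" using w by auto
   show "w = w'"
   proof (cases "w:mu x"; cases "w':mu x")
    assume i: "w:mu x" "w':mu x"
    obtain a b where ab: "a:mu x" "b:mu (f w)" "(a, b):F" using mD(4)[OF f1[OF wF(1)]] by auto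
    have "a:compo (F - {(v, w), (w, v)}) (mu x) w" using f2[OF wF(1) i(1) ab(3,1,2)] .
    thus ?thesis using f2[OF wF(2) i(2) ab(3,1)] ab(2) w(3) sidedisj[OF x i(1) wF(1) i(2) wF(2)] by auto
   next
    assume "w:mu x" "w'~:mu x"
    thus ?thesis using key[of w w'] wF w(3) by simp
   next
    assume "w~:mu x" "w':mu x"
    thus ?thesis using key[of w' w] wF w(3) by simp
   next
    assume i: "w~:mu x" "w'~:mu x"
    thus ?thesis using uniqc[OF x f1[OF wF(1)] f3[OF wF(1) i(1)] _ wF] f3[OF wF(2) i(2)] w(3) by simp
   qed
  qed
  assume d2: "2 <= card {y. (x, y):H}"
  have fv: "finite {w. (v, w):F}" by (rule finite_subset[OF _ finite_imageI[OF fF, of snd]]) force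
  show "2 <= card {w. (v, w):F}"
  proof (rule ccontr)
   assume "~?thesis"
   hence c1: "card {w. (v, w):F} <= 1" by simp
   have one: "w = w'" if "(v, w):F" "(v, w'):F" for w w' using c1 fv that by (metis (mono_tags, lifting) One_nat_def card_le_Suc0_iff_eq mem_Collect_eq)
   obtain y1 y2 where y: "(x, y1):H" "(x, y2):H" "y1 ~= y2" using d2 card_le_Suc0_iff_eq[OF fN] by auto
   have yW: "y1:W" "y2:W" "y1 ~= x" "y2 ~= x" using y H(3,4) by (auto simp: irrefl_def)
   show False
   proof (cases "mu x = {v}")
    case True
    obtain b1 where b1: "b1:mu y1" "(v, b1):F" using mD(4)[OF y(1)] True by auto
    obtain b2 where b2: "b2:mu y2" "(v, b2):F" using mD(4)[OF y(2)] True by auto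
    show False using one b1 b2 mu[OF yW(1,2)] y(3) by auto
   next
    case False
    then obtain u where u: "u:mu x" "u ~= v" using x(2) by auto
    obtain a w where aw: "a:mu x" "a : {v}" "w:mu x" "w ~: {v}" "(a, w):F" by (rule conn_cut[OF mD(1)[OF x(1)] x(2) _ u(1), of "{v}"]) (use u in auto)
    hence vw: "(v, w):F" "w:mu x" by auto
    let ?G = "F - {(v, w), (w, v)}"
    define U where "U = mu x - {v}"
    have "(x, f w):H" using f1[OF vw(1)] .

    text \<open>\<open>v\<close> is a leaf without contacts, so the side of \<open>vw\<close> at \<open>v\<close> is useless.\<close>
    obtain y where yy: "(x, y):H" "ALL a b. (a, b):F --> a:mu x --> b:mu y --> a:compo (F - {(w, v), (v, w)}) (mu x) v"
      using side[OF x(1) vw(2) x(2)] vw(1) sF by (auto dest: symD)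
    obtain a b where ab: "a:mu x" "b:mu y" "(a, b):F" using mD(4)[OF yy(1)] by auto
    have "(v, a):((F - {(w, v), (v, w)}) Int mu x \<times> mu x)^*" using yy(2) ab unfolding compo_def by simp
    hence "a = v"
    proof (cases rule: converse_rtranclE)
     case (step z)
     thus ?thesis using one[OF vw(1), of z] by auto
    qed simp
    thus False using one[OF vw(1)] ab(3) mu[OF x(1), of y b] ab(2) yy(1) H(3,4) vw(2) by (auto simp: irrefl_def)
   qed
  qed
 qed
qed

lemma conn_lift:
  assumes "sym E" "conn H S" "!!x. x:S ==> conn E (mu x)" "!!x y. x:S ==> y:S ==> (x, y):H ==> touch E (mu x) (mu y)"
  shows "conn E (UN x:S. mu x)"
proof -
 let ?U = "UN x:S. mu x"
 obtain x0 where x0: "x0:S" using assms(2) conn_nonempty by auto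
 obtain a where a: "a:mu x0" using conn_nonempty[OF assms(3)[OF x0]] by auto
 have inside: "(u, v):(E Int ?U \<times> ?U)^*" if uv: "x:S" "u:mu x" "v:mu x" for x u v
 proof -
  have "(u, v):(E Int mu x \<times> mu x)^*" using assms(3)[OF uv(1)] uv(2,3) unfolding conn_def by simp
  thus ?thesis by (rule rtrancl_restr_mono) (use uv(1) in auto)
 qed
 have reach: "ALL v:mu x. (a, v):(E Int ?U \<times> ?U)^*" if "(x0, x):(H Int S \<times> S)^*" for x using that
 proof (induction rule: rtrancl_induct)
  case base
  thus ?case using inside[OF x0 a] by simp
 next
  case (step y z)
  hence yz: "y:S" "z:S" "(y, z):H" by auto
  obtain p q where pq: "p:mu y" "q:mu z" "p = q | (p, q):E" using assms(4)[OF yz] unfolding touch_def by auto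
  have "(a, p):(E Int ?U \<times> ?U)^*" using step.IH pq(1) by simp
  moreover have "(p, q):(E Int ?U \<times> ?U)^*" using pq yz by auto
  ultimately show ?case using inside[OF yz(2) pq(2)] by (meson rtrancl_trans)
 qed
 show ?thesis
 proof (rule connI[OF assms(1), of a])
  show "a : ?U" using x0 a by auto
  fix v
  assume "v : ?U"
  then obtain x where x: "x:S" "v:mu x" by auto
  show "(a, v):(E Int ?U \<times> ?U)^*" using assms(2) x0 x(1) unfolding conn_def using reach x(2) by auto
 qed
qed

lemma hE_sym': "sym (hE r M)" by (rule symI) (rule hE_sym)

lemma hE_irrefl: "irrefl (hE r M)" unfolding hE_def irrefl_def by auto

lemma finite_hV: "finite (hV r M)" unfolding hV_def by simp

lemma hE_sub: "hE r M <= hV r M \<times> hV r M" using hE_hV by auto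

lemma finite_hE: "finite (hE r M)" by (rule finite_subset[OF hE_sub]) (simp add: finite_hV)

lemma hE_deg: "card {y. (x, y):hE r M} <= 3"
proof -
 obtain s j where x: "x = (s, j)" by (cases x)
 let ?v = "if j mod r = s then (Suc s, j) else (s - 1, j)"
 have "{y. (x, y):hE r M} <= {(s, Suc j), (s, j - 1), ?v}" unfolding hE_def x by auto
 hence "card {y. (x, y):hE r M} <= card {(s, Suc j), (s, j - 1), ?v}" by (rule card_mono[rotated]) simp
 also have "... <= 3" by (simp add: card_insert_if)
 finally show ?thesis .
qed

lemma avoid_disjoint: assumes "finite T" "card T < card I" "finite I" "!!i j. i:I ==> j:I ==> i ~= j ==> A i Int A j = {}" shows "EX i:I. A i Int T = {}"
proof (rule ccontr)
 assume "~?thesis"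
 hence "ALL i:I. EX v. v:A i Int T" by auto
 from bchoice[OF this] obtain f where f: "ALL i:I. f i:A i Int T" by auto
 have "card I <= card T"
 proof (rule card_le_inj[OF assms(1), of I f])
  show "f i:T" if "i:I" for i using f that by simp
  show "i = j" if "i:I" "j:I" "f i = f j" for i j using f that assms(4)[OF that(1,2)] by (metis IntE disjoint_iff)
 qed
 thus False using assms(2) by simp
qed

definition hrow :: "nat => nat => (nat * nat) set" where
  "hrow M s = {(s, j) | j. j < M}"

definition hstair :: "nat => nat => (nat * nat) set" where
  "hstair r l = {(s, l * r + s) | s. s < r} Un {(Suc s, l * r + s) | s. Suc s < r}"

lemma hrow_conn: "s < r ==> 0 < M ==> conn (hE r M) (hrow M s)"
proof (rule connI[OF hE_sym', of "(s, 0)"])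
 assume s: "s < r" "0 < M"
 show "(s, 0):hrow M s" using s unfolding hrow_def by simp
 fix y
 assume "y:hrow M s"
 then obtain j where j: "y = (s, j)" "j < M" unfolding hrow_def by auto
 have "j < M ==> ((s, 0), (s, j)):(hE r M Int hrow M s \<times> hrow M s)^*" for j
 proof (induction j)
  case (Suc j)
  have "((s, j), (s, Suc j)):hE r M Int hrow M s \<times> hrow M s" using Suc(2) s unfolding hE_def hrow_def by simp
  thus ?case using Suc by (meson Suc_lessD rtrancl.rtrancl_into_rtrancl)
 qed simp
 thus "((s, 0), y):(hE r M Int hrow M s \<times> hrow M s)^*" using j by simp
qed

lemma stair_lt: "l < M ==> s < r ==> l * r + s < r * (M :: nat)"
proof -
 assume a: "l < M" "s < r"
 hence "l * r + s < Suc l * r" by simp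
 also have "... <= M * r" using a(1) by (intro mult_le_mono1) simp
 finally show ?thesis by (simp add: mult.commute)
qed

lemma hstair_conn: "0 < r ==> l < M ==> conn (hE r (r * M)) (hstair r l)"
proof (rule connI[OF hE_sym', of "(0, l * r)"])
 assume a: "0 < r" "l < M"
 let ?R = "hE r (r * M) Int hstair r l \<times> hstair r l"
 show "(0, l * r):hstair r l" using a unfolding hstair_def by auto
 have lt: "l * r + s < r * M" if "s < r" for s using stair_lt[OF a(2) that] .
 have step: "((s, l * r + s), (Suc s, l * r + s)) : ?R" "((Suc s, l * r + s), (Suc s, l * r + Suc s)) : ?R" if "Suc s < r" for s
 proof -
  show "((s, l * r + s), (Suc s, l * r + s)) : ?R" using that lt[of s] unfolding hE_def hstair_def by auto
  show "((Suc s, l * r + s), (Suc s, l * r + Suc s)) : ?R" using that lt[of "Suc s"] unfolding hE_def hstair_def by auto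
 qed
 have main: "s < r ==> ((0, l * r), (s, l * r + s)) : ?R\<^sup>*" for s
 proof (induction s)
  case (Suc s)
  hence "((0, l * r), (s, l * r + s)) : ?R\<^sup>*" by simp
  thus ?case using step[OF Suc(2)] by (meson rtrancl.rtrancl_into_rtrancl)
 qed simp
 fix y
 assume "y:hstair r l"
 then consider s where "y = (s, l * r + s)" "s < r" | s where "y = (Suc s, l * r + s)" "Suc s < r" unfolding hstair_def by auto
 thus "((0, l * r), y) : ?R\<^sup>*"
 proof cases
  case 1
  thus ?thesis using main by simp
 next
  case 2
  hence "((0, l * r), (s, l * r + s)) : ?R\<^sup>*" using main by simp
  thus ?thesis using step(1)[OF 2(2)] 2(1) by (meson rtrancl.rtrancl_into_rtrancl)
 qed
qed

lemma hstair_sub: "l < M ==> hstair r l <= hV r (r * M)" using stair_lt[of l M] unfolding hstair_def hV_def by auto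

lemma hstair_disj: "l ~= l' ==> hstair r l Int hstair r l' = {}"
proof -
 assume "l ~= l'"
 have "snd x div r = k" if "x:hstair r k" for x k using that unfolding hstair_def by auto
 thus ?thesis using \<open>l ~= l'\<close> by blast
qed

lemma host_bramble: assumes "sym E" "hostminor E V r (r * M)" "r >= 1" "M >= 1" shows "EX \<B>. bramble E V (min r M) \<B>"
proof -
 let ?W = "hV r (r * M)" and ?H = "hE r (r * M)"
 obtain mu where m: "minor_model E V ?W ?H mu" using assms(2) unfolding hostminor_def by auto
 note mD = minor_modelD[OF m]
 have cl: "conn E (UN x:S. mu x)" if S: "conn ?H S" "S <= ?W" for S
 proof (rule conn_lift[OF assms(1) S(1)])
  show "conn E (mu x)" if "x:S" for x using mD(1)[OF subsetD[OF S(2) that]] .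
  show "touch E (mu x) (mu y)" if "(x, y) : ?H" for x y using mD(4)[OF that] unfolding touch_def by auto
 qed
 have rW: "hrow (r * M) s <= ?W" if "s < r" for s using that unfolding hrow_def hV_def by auto
 have rM: "0 < r * M" using assms by simp
 define R where "R s = (UN x:hrow (r * M) s. mu x)" for s
 define T where "T l = (UN x:hstair r l. mu x)" for l
 have R: "conn E (R s)" "R s <= V" if "s < r" for s
 proof -
  show "conn E (R s)" unfolding R_def by (rule cl[OF hrow_conn[OF that rM] rW[OF that]])
  show "R s <= V" unfolding R_def using mD(2) rW[OF that] by auto
 qed
 have T: "conn E (T l)" "T l <= V" if "l < M" for l
 proof -
  show "conn E (T l)" unfolding T_def by (rule cl[OF hstair_conn[OF _ that] hstair_sub[OF that]]) (use assms in simp)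
  show "T l <= V" unfolding T_def using mD(2) hstair_sub[OF that] by auto
 qed
 have cross: "R s Int T l ~= {}" if sl: "s < r" "l < M" for s l
 proof -
  have "(s, l * r + s):hrow (r * M) s Int hstair r l" using sl stair_lt[OF sl(2,1)] unfolding hrow_def hstair_def by auto
  moreover have "mu (s, l * r + s) ~= {}" using conn_nonempty[OF mD(1)] calculation rW[OF sl(1)] by auto
  ultimately show ?thesis unfolding R_def T_def by auto
 qed
 have disj: "(UN x:S. mu x) Int (UN x:S'. mu x) = {}" if "S <= ?W" "S' <= ?W" "S Int S' = {}" for S S' using minor_model_uniq[OF m] that by blast
 have Rd: "R s Int R s' = {}" if "s < r" "s' < r" "s ~= s'" for s s' unfolding R_def
   by (rule disj[OF rW[OF that(1)] rW[OF that(2)]]) (use that in \<open>auto simp: hrow_def\<close>)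
 have Td: "T l Int T l' = {}" if "l < M" "l' < M" "l ~= l'" for l l' unfolding T_def
   by (rule disj[OF hstair_sub[OF that(1)] hstair_sub[OF that(2)] hstair_disj[OF that(3)]])
 have "bramble E V (min r M) {R s Un T l | s l. s < r & l < M}" unfolding bramble_def
 proof (intro conjI ballI allI impI)
  fix B
  assume "B : {R s Un T l | s l. s < r & l < M}"
  then obtain s l where B: "B = R s Un T l" "s < r" "l < M" by auto
  show "conn E B" unfolding B(1) using conn_Un[OF assms(1) R(1)[OF B(2)] T(1)[OF B(3)]] cross[OF B(2,3)] unfolding touch_def by simp
  show "B <= V" using B R T by auto
 next
  fix A B
  assume "A : {R s Un T l | s l. s < r & l < M}" "B : {R s Un T l | s l. s < r & l < M}"
  then obtain s l s' l' where "A = R s Un T l" "s < r" "l < M" "B = R s' Un T l'" "s' < r" "l' < M" by auto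
  thus "touch E A B" using cross[of s l'] unfolding touch_def by auto
 next
  fix Z :: "'a set"
  assume Z: "finite Z & card Z < min r M"
  obtain s where s: "s < r" "R s Int Z = {}" using avoid_disjoint[of Z "{..<r}" R] Z Rd by auto
  obtain l where l: "l < M" "T l Int Z = {}" using avoid_disjoint[of Z "{..<M}" T] Z Td by auto
  show "EX B:{R s Un T l | s l. s < r & l < M}. B Int Z = {}" using s l by auto
 qed
 thus ?thesis by auto
qed

abbreviation legs :: "'a rel => (nat => 'a list) => bool => nat => nat => bool" where
  "legs E g tri d e \<equiv> if tri then set (g d) Int set (g e) = {} & (hd (g d), hd (g e)):E & (ALL u:set (g d). ALL v:set (g e). (u, v):E --> u = hd (g d) &
    v = hd (g e)) else hd (g d) = hd (g e) & set (g d) Int set (g e) = {hd (g d)} & (ALL u:set (g d). ALL v:set (g e). (u, v):E --> u = hd (g d) | v = hd (g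
    d))"

definition tripod :: "'a rel => 'a set => (nat => 'a) => (nat => 'a list) => bool => bool" where
  "tripod E S t g tri = ((ALL d<3. ipath E (g d) & last (g d) = t d) & S = (UN d<3. set (g d)) & (ALL d<3. ALL e<3. d ~= e --> (legs E g tri d e)))"

lemma ipath_path: "ipath E p ==> path E p" unfolding ipath_def by simp

lemma ipath_rev: "sym E ==> ipath E p ==> ipath E (rev p)" unfolding ipath_def
proof (intro conjI allI impI)
 assume s: "sym E" and p: "path E p & (ALL i<length p. ALL j<length p. (p ! i, p ! j):E --> j = Suc i | i = Suc j)"
 show "path E (rev p)" using path_rev s p by auto
 fix i j
 assume ij: "i < length (rev p)" "j < length (rev p)" "(rev p ! i, rev p ! j):E"
 let ?i = "length p - Suc i" and ?j = "length p - Suc j"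
 have "?j = Suc ?i | ?i = Suc ?j" using ij p by (simp add: rev_nth)
 thus "j = Suc i | i = Suc j" using ij by auto
qed

lemma ipath_take: "ipath E p ==> n > 0 ==> ipath E (take n p)" unfolding ipath_def using path_take[of E p n] by simp

lemma ipath_drop: "ipath E p ==> n < length p ==> ipath E (drop n p)"
  unfolding ipath_def using path_drop[of E p n] by (fastforce simp: less_diff_conv add.commute)

lemma ipath_Cons: assumes "irrefl E" "sym E" "ipath E p" "z~:set p" "(z, hd p):E" "!!v. v:set p ==> (z, v):E ==> v = hd p" shows "ipath E (z # p)"
proof -
 have p: "path E p" "p ~= []" using assms(3) unfolding ipath_def path_def by auto
 have "path E (z # p)" using path_append[OF path_sing p(1), of z] assms(4,5) by simp
 moreover have "j = Suc i | i = Suc j" if ij: "i < length (z # p)" "j < length (z # p)" "((z # p) ! i, (z # p) ! j):E" for i j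
 proof -
  have h: "k = 0" if "k < length p" "(z, p ! k):E" for k using that assms(6)[of "p ! k"] hd_conv_nth p nth_eq_iff_index_eq unfolding path_def by fastforce
  show ?thesis
  proof (cases i; cases j)
   assume "i = 0" "j = 0"
   thus ?thesis using ij assms(1) by (auto simp: irrefl_def)
  next
   fix k
   assume "i = 0" "j = Suc k"
   thus ?thesis using ij h[of k] by simp
  next
   fix k
   assume "i = Suc k" "j = 0"
   thus ?thesis using ij h[of k] assms(2) by (auto dest: symD)
  next
   fix k l
   assume "i = Suc k" "j = Suc l"
   thus ?thesis using ij assms(3) unfolding ipath_def by auto
  qed
 qed
 ultimately show ?thesis unfolding ipath_def by simp
qed

lemma less3: "(d :: nat) < 3 \<longleftrightarrow> d = 0 | d = 1 | d = 2" by auto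

text \<open>A minimal connected set containing three terminals: the shortest path between two of them and a path from the third one that touches it in one
  vertex or in two consecutive ones.\<close>

lemma three_terminals:
  assumes E: "sym E" "irrefl E" and S: "conn E S" "finite S" "!!d. d < 3 ==> t d:S" and mn: "!!S'. S' <= S ==> conn E S' ==> (!!d. d < 3 ==> t d:S') ==> S' = S"
  shows "EX g tri. tripod E S t g tri"
proof -
 have t: "t 0:S" "t 1:S" "t 2:S" using S(3) by auto
 have mn': "S' = S" if "S' <= S" "conn E S'" "t 0:S'" "t 1:S'" "t 2:S'" for S' by (rule mn[OF that(1,2)]) (use that in \<open>auto simp: less3\<close>)
 obtain p where p: "ipath E p" "hd p = t 0" "last p = t 1" "set p <= S" using conn_ipath[OF S(1) t(1,2) E(2,1)] by auto
 have pp: "path E p" "p ~= []" "distinct p" using p(1) unfolding ipath_def path_def by auto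
 have cp: "conn E (set p)" using path_conn[OF E(1) pp(1)] .
 have tp: "t 0:set p" "t 1:set p" using p pp by (metis hd_in_set, metis last_in_set)
 have pe: "j = Suc i | i = Suc j" if "i < length p" "j < length p" "(p ! i, p ! j):E" for i j using p(1) that unfolding ipath_def by simp
 have setT: "set (rev (take (Suc a) p)) = {p ! i | i. i <= a}" if "a < length p" for a
 proof (rule set_eqI)
  fix v
  show "v:set (rev (take (Suc a) p)) \<longleftrightarrow> v : {p ! i | i. i <= a}"
  proof
   assume "v:set (rev (take (Suc a) p))"
   hence "v:set (take (Suc a) p)" by simp
   then obtain i where "i < length (take (Suc a) p)" "v = take (Suc a) p ! i" by (metis in_set_conv_nth)
   thus "v : {p ! i | i. i <= a}" by auto
  next
   assume "v : {p ! i | i. i <= a}"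
   then obtain i where "i <= a" "v = p ! i" by auto
   hence "take (Suc a) p ! i = v" "i < length (take (Suc a) p)" using that by auto
   hence "v:set (take (Suc a) p)" by (metis nth_mem)
   thus "v:set (rev (take (Suc a) p))" by simp
  qed
 qed
 have setD: "set (drop a p) = {p ! i | i. a <= i & i < length p}" for a
 proof (rule set_eqI)
  fix v
  show "v:set (drop a p) \<longleftrightarrow> v : {p ! i | i. a <= i & i < length p}"
  proof
   assume "v:set (drop a p)"
   then obtain i where "i < length (drop a p)" "v = drop a p ! i" by (metis in_set_conv_nth)
   thus "v : {p ! i | i. a <= i & i < length p}" by auto
  next
   assume "v : {p ! i | i. a <= i & i < length p}"
   then obtain i where "a <= i" "i < length p" "v = p ! i" by auto
   hence "drop a p ! (i - a) = v" "i - a < length (drop a p)" by auto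
   thus "v:set (drop a p)" by (metis nth_mem)
  qed
 qed
 have hT: "hd (rev (take (Suc a) p)) = p ! a" if "a < length p" for a using that by (simp add: take_Suc_conv_app_nth)
 have lT: "last (rev (take (Suc a) p)) = t 0" for a using p(2) by (simp add: last_rev)
 have pun: "set (rev (take (Suc a) p)) Un set (drop a p) = set p" "set (rev (take (Suc a) p)) Un set (drop (Suc a) p) = set p" for a
 proof -
  have "set (rev (take (Suc a) p)) Un set (drop (Suc a) p) = set (take (Suc a) p @ drop (Suc a) p)" by (simp only: set_append set_rev)
  thus 2: "set (rev (take (Suc a) p)) Un set (drop (Suc a) p) = set p" by simp
  have "set (drop (Suc a) p) <= set (drop a p)" by (rule set_drop_subset_set_drop) simp
  moreover have "set (drop a p) <= set p" by (rule set_drop_subset)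
  ultimately show "set (rev (take (Suc a) p)) Un set (drop a p) = set p" using 2 by auto
 qed
 have iT: "ipath E (rev (take (Suc a) p))" for a using ipath_rev[OF E(1) ipath_take[OF p(1)]] by simp
 have iD: "ipath E (drop a p)" "hd (drop a p) = p ! a" "last (drop a p) = t 1" if "a < length p" for a using ipath_drop[OF p(1) that] that p(3)
   by (auto simp: hd_drop_conv_nth)
 have eqn: "i = j" if "p ! i = p ! j" "i < length p" "j < length p" for i j using that pp(3) by (simp add: nth_eq_iff_index_eq)
 have claw2: "set (rev (take (Suc a) p)) Int set (drop a p) = {p ! a}" if "a < length p" for a unfolding setT[OF that] setD using that eqn by fastforce
 have claw3: "u = p ! a | v = p ! a" if h: "a < length p" "u:set (rev (take (Suc a) p))" "v:set (drop a p)" "(u, v):E" for a u v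
 proof -
  obtain i j where ij: "u = p ! i" "i <= a" "v = p ! j" "a <= j" "j < length p" using h(2,3) unfolding setT[OF h(1)] setD by auto
  hence "i = a | j = a" using pe[of i j] h by auto
  thus ?thesis using ij by auto
 qed
 show ?thesis
 proof (cases "t 2:set p")
  case True
  obtain a where a: "a < length p" "p ! a = t 2" using True by (metis in_set_conv_nth)
  define g where "g = (%d::nat. if d = 0 then rev (take (Suc a) p) else if d = 1 then drop a p else [p ! a])"
  have g: "g 0 = rev (take (Suc a) p)" "g 1 = drop a p" "g 2 = [p ! a]" by (simp_all add: g_def)
  have i2: "ipath E [p ! a]" using E(2) unfolding ipath_def by (simp add: irrefl_def)
  have "tripod E S t g False" unfolding tripod_def
  proof (intro conjI allI impI)
   fix d :: nat
   assume "d < 3"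
   hence d: "d = 0 | d = 1 | d = 2" unfolding less3 .
   show "ipath E (g d)" using d by (elim disjE; simp only: g iT iD(1)[OF a(1)] i2)
   show "last (g d) = t d" using d by (elim disjE; simp only: g lT iD(3)[OF a(1)] a(2) last.simps if_True simp_thms)
  next
   have "(UN d<3. set (g d)) = set (g 0) Un set (g 1) Un set (g 2)" by (auto simp: less3)
   also have "... = set p" unfolding g pun(1) using nth_mem[OF a(1)] by auto
   finally show "S = (UN d<3. set (g d))" using mn'[OF p(4) cp tp True] by simp
  next
   fix d e :: nat
   assume de: "d < 3" "e < 3" "d ~= e"
   have m2: "p ! a:set (rev (take (Suc a) p))" "p ! a:set (drop a p)" using claw2[OF a(1)] by auto
   have hds: "hd (g k) = p ! a" if "k < 3" for k using that g hT[OF a(1)] iD(2)[OF a(1)] unfolding less3 by auto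
   have "set (g d) Int set (g e) = {p ! a}" using de g claw2[OF a(1)] m2 unfolding less3 by (elim disjE) (simp_all add: Int_commute)
   moreover have "u = p ! a | v = p ! a" if "u:set (g d)" "v:set (g e)" "(u, v):E" for u v
     using de that g claw3[OF a(1), of u v] claw3[OF a(1), of v u] symD[OF E(1)] unfolding less3 by (elim disjE) auto
   ultimately show "legs E g False d e" using hds de by simp
  qed
  thus ?thesis by auto
 next
  case False
  define C where "C = compo E (S - set p) (t 2)"
  have t2: "t 2:S - set p" using False t by simp
  have CS: "C <= S - set p" unfolding C_def by (rule compo_in[OF t2])
  have cC: "conn E C" unfolding C_def by (rule compo_conn[OF E(1) t2])
  have tC: "t 2:C" unfolding C_def by simp
  obtain y b where y: "y:S" "y:C" "b:S" "b~:C" "(y, b):E" by (rule conn_cut[OF S(1) t(3) tC t(1)]) (use CS tp in auto)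
  have bp: "b:set p" using compo_closed[OF y(2)[unfolded C_def] t2 y(5)] y(3) y(4) unfolding C_def by auto
  obtain r0 where r0: "ipath E r0" "hd r0 = t 2" "last r0 = y" "set r0 <= C" using conn_ipath[OF cC tC y(2) E(2,1)] by auto
  obtain u w v where r: "r0 = u @ w # v" "EX b:set p. (w, b):E" "ALL x:set u. ~(EX b:set p. (x, b):E)" using r0(3) r0(1) unfolding ipath_def path_def
    using y(5) bp split_list_first_prop[of r0 "%x. EX b:set p. (x, b):E"] by (metis last_in_set)
  define q where "q = u @ [w]"
  have "q = take (Suc (length u)) r0" unfolding q_def r(1) by simp
  hence iq: "ipath E q" using ipath_take[OF r0(1)] by simp
  have hq: "hd q = t 2" using r0(2) unfolding q_def r(1) by (cases u) auto
  have qC: "set q <= C" using r0(4) unfolding q_def r(1) by auto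
  have qp: "set q Int set p = {}" using qC CS by auto
  have qonly: "x = w" if "x:set q" "b:set p" "(x, b):E" for x b using that r(3) unfolding q_def by auto
  have wq: "w:set q" unfolding q_def by simp
  have cq: "conn E (set q)" using path_conn[OF E(1) ipath_path[OF iq]] .
  have t2q: "t 2:set q" using hq unfolding q_def by (metis append_is_Nil_conv hd_in_set not_Cons_self2)
  have "conn E (set p Un set q)" by (rule conn_Un[OF E(1) cp cq]) (use r(2) wq symD[OF E(1)] in \<open>unfold touch_def, blast\<close>)
  hence Spq: "set p Un set q = S" by (intro mn') (use p(4) qC CS tp t2q in auto)
  define N where "N = {i. i < length p & (w, p ! i):E}"
  have Nne: "N ~= {}" using r(2) unfolding N_def by (auto simp: in_set_conv_nth)
  have fN: "finite N" unfolding N_def by simp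
  define a where "a = Min N"
  define m where "m = Max N"
  have aN: "a:N" "m:N" "a <= m" unfolding a_def m_def using fN Nne by auto
  have Nb: "a <= i & i <= m" if "i:N" for i unfolding a_def m_def using fN that by simp
  have al: "a < length p" "m < length p" "(w, p ! a):E" "(w, p ! m):E" using aN unfolding N_def by auto
  have am: "m <= Suc a"
  proof (rule ccontr)
   assume am: "~m <= Suc a"
   let ?S = "(set (rev (take (Suc a) p)) Un set q) Un set (drop m p)"
   have c1: "conn E (set (rev (take (Suc a) p)) Un set q)"
   proof (rule conn_Un[OF E(1) path_conn[OF E(1) ipath_path[OF iT]] cq])
    show "touch E (set (rev (take (Suc a) p))) (set q)" unfolding setT[OF al(1)] touch_def using al(3) wq symD[OF E(1)] by auto
   qed
   have "conn E ?S"
   proof (rule conn_Un[OF E(1) c1 path_conn[OF E(1) ipath_path[OF iD(1)[OF al(2)]]]])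
    show "touch E (set (rev (take (Suc a) p)) Un set q) (set (drop m p))" unfolding setD using al(2) unfolding touch_def using al(4) wq by auto
   qed
   moreover have "?S <= S" using Spq by (auto dest: in_set_takeD in_set_dropD)
   moreover have "t 0 : ?S" using lT[of a] iT[of a] unfolding ipath_def path_def by (metis UnI1 last_in_set)
   moreover have "t 1 : ?S" using iD[OF al(2)] unfolding ipath_def path_def by (metis UnI2 last_in_set)
   moreover have "t 2 : ?S" using t2q by simp
   ultimately have "?S = S" by (intro mn')
   moreover have "p ! Suc a:S" using Spq am al by auto
   ultimately show False using qp am al unfolding setD using eqn[of "Suc a"] unfolding setT[OF al(1)] by fastforce
  qed
  have wN: "i = a | i = m" if "i < length p" "(w, p ! i):E" for i using Nb[of i] that am unfolding N_def by auto
  have hr: "hd (rev q) = w" unfolding q_def by simp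
  have "q ~= []" unfolding q_def by simp
  hence lr: "last (rev q) = t 2" using hq by (simp add: last_rev)
  have ir: "ipath E (rev q)" using ipath_rev[OF E(1) iq] .
  have inp: "EX i. v = p ! i & i < length p" if "v:set p" for v using that by (metis in_set_conv_nth)
  show ?thesis
  proof (cases "m = a")
   case True
   have only: "u = w & v = p ! a" if h: "u:set q" "v:set p" "(u, v):E" for u v using qonly[OF h] inp[OF h(2)] wN True h(3) by auto
   have iz: "ipath E (p ! a # rev q)"
   proof (rule ipath_Cons[OF E(2,1) ir])
    show "p ! a~:set (rev q)" using qp al(1) by auto
    show "(p ! a, hd (rev q)):E" using hr al(3) symD[OF E(1)] by simp
    show "v = hd (rev q)" if "v:set (rev q)" "(p ! a, v):E" for v using only[of v "p ! a"] that symD[OF E(1)] al(1) hr by auto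
   qed
   define g where "g = (%d::nat. if d = 0 then rev (take (Suc a) p) else if d = 1 then drop a p else p ! a # rev q)"
   have g: "g 0 = rev (take (Suc a) p)" "g 1 = drop a p" "g 2 = p ! a # rev q" unfolding g_def by auto
   have m2: "p ! a:set (rev (take (Suc a) p))" "p ! a:set (drop a p)" using claw2[OF al(1)] by auto
   have sub: "set (rev (take (Suc a) p)) <= set p" "set (drop a p) <= set p" by (auto dest: in_set_takeD in_set_dropD)
   have "tripod E S t g False" unfolding tripod_def
   proof (intro conjI allI impI)
    fix d :: nat
    assume "d < 3"
    thus "ipath E (g d)" "last (g d) = t d" using g iT iD[OF al(1)] lT iz lr q_def unfolding less3 by auto
   next
    have "(UN d<3. set (g d)) = set (g 0) Un set (g 1) Un set (g 2)" by (auto simp: less3)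
    also have "... = set p Un set q" unfolding g pun(1) using nth_mem[OF al(1)] by auto
    finally show "S = (UN d<3. set (g d))" using Spq by simp
   next
    fix d e :: nat
    assume de: "d < 3" "e < 3" "d ~= e"
    have hds: "hd (g k) = p ! a" if "k < 3" for k using that g hT[OF al(1)] iD(2)[OF al(1)] unfolding less3 by auto
    have i2: "set (rev (take (Suc a) p)) Int set (p ! a # rev q) = {p ! a}" "set (drop a p) Int set (p ! a # rev q) = {p ! a}" using m2 sub qp by auto
    have "set (g d) Int set (g e) = {p ! a}" using de g claw2[OF al(1)] i2 unfolding less3 by (elim disjE) (simp_all add: Int_commute)
    moreover have pq: "u = p ! a | v = p ! a" if "u:set p" "v:set (p ! a # rev q)" "(u, v):E" for u v using only[of v u] that symD[OF E(1)] by auto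
    have "u = p ! a | v = p ! a" if "u:set (g d)" "v:set (g e)" "(u, v):E" for u v using de that g claw3[OF al(1), of u v] claw3[OF al(1), of v u] pq[of u v]
      pq[of v u] sub symD[OF E(1)] unfolding less3 by (elim disjE) auto
    ultimately show "legs E g False d e" using hds de by simp
   qed
   thus ?thesis by auto
  next
   case False
   hence m: "m = Suc a" using am aN(3) by simp
   define g where "g = (%d::nat. if d = 0 then rev (take (Suc a) p) else if d = 1 then drop m p else rev q)"
   have g: "g 0 = rev (take (Suc a) p)" "g 1 = drop m p" "g 2 = rev q" unfolding g_def by auto
   have hds: "hd (g 0) = p ! a" "hd (g 1) = p ! m" "hd (g 2) = w" using g hT[OF al(1)] iD(2)[OF al(2)] hr by auto
   have sub: "set (g 0) <= set p" "set (g 1) <= set p" unfolding g by (auto dest: in_set_takeD in_set_dropD)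
   have d01: "set (g 0) Int set (g 1) = {}" unfolding g setT[OF al(1)] setD using m eqn al by fastforce
   have d2: "set (g 0) Int set (g 2) = {}" "set (g 1) Int set (g 2) = {}" using sub qp unfolding g by auto
   have eh: "(hd (g 0), hd (g 1)):E" "(hd (g 2), hd (g 0)):E" "(hd (g 2), hd (g 1)):E" unfolding hds using path_nth[OF pp(1), of a] al m by auto
   have x01: "u = hd (g 0) & v = hd (g 1)" if h: "u:set (g 0)" "v:set (g 1)" "(u, v):E" for u v
   proof -
    obtain i j where ij: "u = p ! i" "i <= a" "v = p ! j" "m <= j" "j < length p" using h(1,2) unfolding g setT[OF al(1)] setD by auto
    thus ?thesis using pe[of i j] h m unfolding hds by auto
   qed
   have x2: "u = hd (g 2) & (v = p ! a | v = p ! m)" if h: "u:set (g 2)" "v:set p" "(u, v):E" for u v using qonly[of u v] h g inp[OF h(2)] wN hds by auto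
   have x20: "u = hd (g 2) & v = hd (g 0)" if h: "u:set (g 2)" "v:set (g 0)" "(u, v):E" for u v using al d01 x2[of u v] h sub hds unfolding g setD by auto
   have x21: "u = hd (g 2) & v = hd (g 1)" if h: "u:set (g 2)" "v:set (g 1)" "(u, v):E" for u v using d01 x2[of u v] h sub hds unfolding g setT[OF al(1)]
     by auto
   have "tripod E S t g True" unfolding tripod_def
   proof (intro conjI allI impI)
    fix d :: nat
    assume "d < 3"
    thus "ipath E (g d)" "last (g d) = t d" using g iT iD[OF al(2)] lT ir lr unfolding less3 by auto
   next
    have "(UN d<3. set (g d)) = set (g 0) Un set (g 1) Un set (g 2)" by (auto simp: less3)
    also have "... = set p Un set q" unfolding g m using pun(2)[of a] by auto
    finally show "S = (UN d<3. set (g d))" using Spq by simp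
   next
    fix d e :: nat
    assume de: "d < 3" "e < 3" "d ~= e"
    have "set (g d) Int set (g e) = {}" using de d01 d2 unfolding less3 by auto
    thus "legs E g True d e" using E(1) x01 x20 x21 de unfolding sym_def less3 using eh symD[OF E(1)] by (smt (verit))
   qed
   thus ?thesis by auto
  qed
 qed
qed

definition nb :: "'a rel => 'a set => 'a => 'a set" where
  "nb E U v = {w:U. (v, w):E}"

definition sparse :: "'a rel => 'a set => 'a => bool" where
  "sparse E U v = (card (nb E U v) <= 2 | (card (nb E U v) <= 3 & (ALL w:nb E U v. card (nb E U w) <= 2)) | (EX a b c. nb E U v = {a, b, c} & (a, b):E & card
    (nb E U a) <= 3 & card (nb E U b) <= 3 & card (nb E U c) <= 2))"

lemma nb_mono: "U' <= U ==> nb E U' v <= nb E U v" unfolding nb_def by auto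

lemma finite_nb [simp]: "finite U ==> finite (nb E U v)" unfolding nb_def by simp

lemma card_nb_mono: "finite U ==> U' <= U ==> card (nb E U' v) <= card (nb E U v)" by (intro card_mono finite_nb nb_mono)

lemma sparse_mono: assumes "finite U" "U' <= U" "sparse E U v" shows "sparse E U' v"
proof -
 have le: "card (nb E U' w) <= card (nb E U w)" for w by (rule card_nb_mono[OF assms(1,2)])
 have sub: "nb E U' v <= nb E U v" by (rule nb_mono[OF assms(2)])
 consider (1) "card (nb E U v) <= 2" | (2) "card (nb E U v) <= 3" "ALL w:nb E U v. card (nb E U w) <= 2" | (3) a b c where "nb E U v = {a, b, c}" "(a, b):E"
   "card (nb E U a) <= 3" "card (nb E U b) <= 3" "card (nb E U c) <= 2" using assms(3) unfolding sparse_def by auto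
 thus ?thesis
 proof cases
  case 1
  thus ?thesis using le[of v] unfolding sparse_def by simp
 next
  case 2
  have "card (nb E U' v) <= 3" using le[of v] 2(1) by simp
  moreover have "card (nb E U' w) <= 2" if "w:nb E U' v" for w using 2(2) le[of w] sub that by (meson le_trans subsetD)
  ultimately show ?thesis unfolding sparse_def by simp
 next
  case 3
  show ?thesis
  proof (cases "nb E U' v = {a, b, c}")
   case True
   thus ?thesis using 3 le le_trans unfolding sparse_def by blast
  next
   case False
   hence "nb E U' v \<subset> {a, b, c}" using sub 3(1) by auto
   hence "card (nb E U' v) < card {a, b, c}" by (intro psubset_card_mono) auto
   moreover have "card {a, b, c} <= 3" by (simp add: card_insert_if)
   ultimately show ?thesis unfolding sparse_def by simp
  qed
 qed
qed

lemma ipath_nb: assumes "ipath E p" "i < length p" shows "nb E (set p) (p ! i) <= (%j. p ! j) ` {j. j < length p & (j = Suc i | i = Suc j)}"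
proof
 fix w
 assume "w:nb E (set p) (p ! i)"
 then obtain j where "w = p ! j" "j < length p" "(p ! i, p ! j):E" unfolding nb_def by (auto simp: in_set_conv_nth)
 thus "w:(%j. p ! j) ` {j. j < length p & (j = Suc i | i = Suc j)}" using assms unfolding ipath_def by simp
qed

lemma ipath_nb_card: "ipath E p ==> v:set p ==> card (nb E (set p) v) <= 2"
proof -
 assume p: "ipath E p" "v:set p"
 then obtain i where i: "i < length p" "v = p ! i" by (auto simp: in_set_conv_nth)
 have "nb E (set p) v <= {p ! Suc i, p ! (i - 1)}" using ipath_nb[OF p(1) i(1)] i(2) by auto
 hence "card (nb E (set p) v) <= card {p ! Suc i, p ! (i - 1)}" by (intro card_mono) auto
 thus ?thesis by (simp add: card_insert_if split: if_splits)
qed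

lemma ipath_nb_hd: "ipath E p ==> nb E (set p) (hd p) <= {p ! 1}"
proof -
 assume p: "ipath E p"
 thus ?thesis unfolding ipath_def path_def using ipath_nb[OF p, of 0] by (auto simp: hd_conv_nth)
qed

lemma tripod_sparse: assumes "sym E" "irrefl E" "tripod E S t g tri" "v:S" shows "sparse E S v"
proof -
 have ip: "ipath E (g d)" if "d < 3" for d using assms(3) that unfolding tripod_def by simp
 have ne: "g d ~= []" if "d < 3" for d using ip[OF that] unfolding ipath_def path_def by simp
 have S: "S = (UN d<3. set (g d))" using assms(3) unfolding tripod_def by simp
 show ?thesis
 proof (cases tri)
  case False
  hence cl: "hd (g d) = hd (g e)" "set (g d) Int set (g e) = {hd (g d)}" "ALL u:set (g d). ALL v:set (g e). (u, v):E --> u = hd (g d) | v = hd (g d)" if "d <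
    3" "e < 3" "d ~= e" for d e using assms(3) that unfolding tripod_def by metis+
  define z where "z = hd (g 0)"
  have z: "hd (g d) = z" if "d < 3" for d using cl(1)[OF that, of 0] unfolding z_def by auto
  have non: "card (nb E S w) <= 2" if w: "w:S" "w ~= z" for w
  proof -
   obtain d where d: "d < 3" "w:set (g d)" using w S by auto
   have "nb E S w <= nb E (set (g d)) w"
   proof
    fix u
    assume "u:nb E S w"
    then obtain e where e: "e < 3" "u:set (g e)" "(w, u):E" unfolding nb_def S by auto
    show "u:nb E (set (g d)) w" using cl(3)[OF d(1) e(1)] d(2) e w(2) z[OF d(1)] ne[OF d(1)] hd_in_set unfolding nb_def by auto
   qed
   hence "card (nb E S w) <= card (nb E (set (g d)) w)" by (intro card_mono) auto
   thus ?thesis using ipath_nb_card[OF ip[OF d(1)] d(2)] by simp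
  qed
  show ?thesis
  proof (cases "v = z")
   case True
   have "nb E S z <= (%d. g d ! 1) ` {..<3}"
   proof
    fix u
    assume "u:nb E S z"
    then obtain d where d: "d < 3" "u:set (g d)" "(z, u):E" unfolding nb_def S by auto
    have "u:nb E (set (g d)) (hd (g d))" using d z[OF d(1)] unfolding nb_def by simp
    thus "u:(%d. g d ! 1) ` {..<3}" using ipath_nb_hd[OF ip[OF d(1)]] d(1) by auto
   qed
   hence "card (nb E S z) <= card ((%d. g d ! 1) ` {..<3::nat})" by (intro card_mono) auto
   also have "... <= 3" using card_image_le[of "{..<3::nat}" "%d. g d ! 1"] by simp
   finally have "card (nb E S z) <= 3" .
   moreover have "card (nb E S w) <= 2" if "w:nb E S z" for w using that assms(2) by (intro non) (auto simp: nb_def irrefl_def)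
   ultimately show ?thesis using True unfolding sparse_def by simp
  next
   case False
   thus ?thesis using non[OF assms(4)] unfolding sparse_def by simp
  qed
 next
  case True
  hence cl: "set (g d) Int set (g e) = {}" "(hd (g d), hd (g e)):E" "ALL u:set (g d). ALL v:set (g e). (u, v):E --> u = hd (g d) & v = hd (g e)" if "d < 3" "e
    < 3" "d ~= e" for d e using assms(3) that unfolding tripod_def by auto
  have non: "card (nb E S w) <= 2" if w: "d < 3" "w:set (g d)" "w ~= hd (g d)" for w d
  proof -
   have "nb E S w <= nb E (set (g d)) w" using cl(3) w unfolding nb_def S by auto
   hence "card (nb E S w) <= card (nb E (set (g d)) w)" by (intro card_mono) auto
   thus ?thesis using ipath_nb_card[OF ip[OF w(1)] w(2)] by simp
  qed
  have hdn: "nb E S (hd (g d)) = nb E (set (g d)) (hd (g d)) Un (%e. hd (g e)) ` ({..<3} - {d})" if d: "d < 3" for d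
  proof -
   have "u:nb E (set (g d)) (hd (g d)) Un (%e. hd (g e)) ` ({..<3} - {d})" if "u:nb E S (hd (g d))" for u using ne[OF d] that cl(3)[OF d] unfolding nb_def S
     by fastforce
   moreover have "u:nb E S (hd (g d))" if hu: "u:(%e. hd (g e)) ` ({..<3} - {d})" for u
   proof -
    obtain e where e: "e < 3" "e ~= d" "u = hd (g e)" using hu by auto
    show ?thesis unfolding S e(3) using e(1) ne[OF e(1)] cl(2)[OF d e(1)] e(2) unfolding nb_def by (auto intro!: bexI[of _ e])
   qed
   ultimately show ?thesis using d unfolding nb_def S by auto
  qed
  have hd3: "card (nb E S (hd (g d))) <= 3" if d: "d < 3" for d
  proof -
   have 1: "card (nb E (set (g d)) (hd (g d))) <= 1" using card_mono[OF _ ipath_nb_hd[OF ip[OF d]]] by simp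
   have "card ((%e. hd (g e)) ` ({..<3} - {d})) <= card ({..<3} - {d})" by (rule card_image_le) simp
   thus ?thesis using d unfolding hdn[OF d] using card_Un_le[of "nb E (set (g d)) (hd (g d))" "(%e. hd (g e)) ` ({..<3} - {d})"] 1 by simp
  qed
  obtain d where d: "d < 3" "v:set (g d)" using assms(4) S by auto
  show ?thesis
  proof (cases "v = hd (g d)")
   case False
   thus ?thesis using non[OF d] unfolding sparse_def by simp
  next
   case True
   obtain e f where ef: "{..<3} - {d} = {e, f}" "e < 3" "f < 3" "e ~= f"
   proof -
    have "card ({..<3} - {d}) = 2" using d(1) by simp
    then obtain e f where "{..<3} - {d} = {e, f}" "e ~= f" by (auto simp: card_2_iff)
    moreover from this have "e < 3" "f < 3" by auto
    ultimately show ?thesis using that by simp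
   qed
   show ?thesis
   proof (cases "nb E (set (g d)) v = {}")
    case True
    thus ?thesis using hdn[OF d(1)] ef \<open>v = hd (g d)\<close> unfolding sparse_def by (simp add: card_insert_if)
   next
    case False
    hence c: "nb E S v = {hd (g e), hd (g f), g d ! 1}" "g d ! 1:nb E (set (g d)) v"
      using ipath_nb_hd[OF ip[OF d(1)]] hdn[OF d(1)] ef \<open>v = hd (g d)\<close> by auto
    have "g d ! 1 ~= hd (g d)" using c(2) True assms(2) unfolding nb_def irrefl_def by auto
    hence "card (nb E S (g d ! 1)) <= 2" using c(2) by (intro non[OF d(1)]) (auto simp: nb_def)
    thus ?thesis using cl(2) ef c(1) hd3 unfolding sparse_def by metis
   qed
  qed
 qed
qed

definition qE :: "'a rel => ('a => 'b) => 'b rel" where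
  "qE E q = {(q a, q b) | a b. (a, b):E & q a ~= q b}"

lemma qE_sym: "sym E ==> sym (qE E q)" unfolding qE_def sym_def by (simp, metis)

lemma qE_irrefl: "irrefl (qE E q)" unfolding qE_def irrefl_def by simp

lemma qE_conn: assumes "sym E" "conn E B" shows "conn (qE E q) (q ` B)"
proof -
 obtain x where x: "x:B" using assms(2) unfolding conn_def by auto
 show ?thesis
 proof (rule connI[OF qE_sym[OF assms(1)]])
  show "q x:q ` B" using x by simp
  fix y
  assume "y:q ` B"
  then obtain b where b: "b:B" "y = q b" by auto
  have "(x, b):(E Int B \<times> B)^*" using assms(2) x b(1) unfolding conn_def by simp
  hence "(q x, q b):(qE E q Int q ` B \<times> q ` B)^*"
  proof (induction rule: rtrancl_induct)
   case (step y z)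
   show ?case
   proof (cases "q y = q z")
    case False
    hence "(q y, q z):qE E q Int q ` B \<times> q ` B" using step(2) unfolding qE_def by auto
    thus ?thesis using step.IH by (meson rtrancl.rtrancl_into_rtrancl)
   qed (use step.IH in simp)
  qed simp
  thus "(q x, y):(qE E q Int q ` B \<times> q ` B)^*" using b by simp
 qed
qed

lemma bramble_quotient:
  assumes "sym E" "bramble E U (k * theta) \<B>" "k >= 1" and "!!x. EX C. finite C & card C <= k & (ALL B:\<B>. x:q ` B --> B Int C ~= {})"
  shows "bramble (qE E q) (q ` U) theta ((`) q ` \<B>)"
  unfolding bramble_def
proof (intro conjI ballI allI impI)
 fix B
 assume "B:(`) q ` \<B>"
 then obtain A where A: "A:\<B>" "B = q ` A" by auto
 hence "conn E A" "A <= U" using assms(2) unfolding bramble_def by auto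
 thus "conn (qE E q) B" "B <= q ` U" using qE_conn[OF assms(1)] A(2) by auto
next
 fix A B
 assume "A:(`) q ` \<B>" "B:(`) q ` \<B>"
 then obtain A' B' where AB: "A':\<B>" "A = q ` A'" "B':\<B>" "B = q ` B'" by auto
 hence "touch E A' B'" using assms(2) unfolding bramble_def by simp
 thus "touch (qE E q) A B" unfolding touch_def AB qE_def by blast
next
 fix T :: "'b set"
 assume T: "finite T & card T < theta"
 obtain C where C: "ALL x. finite (C x) & card (C x) <= k & (ALL B:\<B>. x:q ` B --> B Int C x ~= {})"
   using choice[of "%x C. finite C & card C <= k & (ALL B:\<B>. x:q ` B --> B Int C ~= {})"] assms(4) by auto
 let ?T = "UN x:T. C x"
 show "EX B:(`) q ` \<B>. B Int T = {}"
 proof -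
  have "card ?T <= (SUM x:T. card (C x))" using T by (intro card_UN_le) simp
  also have "... <= card T * k" using sum_bounded_above[of T "%x. card (C x)" k] C by simp
  also have "... < k * theta" using T assms(3) by simp
  finally have "card ?T < k * theta" .
  moreover have "finite ?T" using T C by simp
  ultimately obtain B where B: "B:\<B>" "B Int ?T = {}" using assms(2) unfolding bramble_def by auto
  have "q ` B Int T = {}" using C B(1) B(2) by auto
  thus ?thesis using B(1) by auto
 qed
qed

lemma sparse_cong: assumes "!!w. w = v | w:nb E U' v ==> nb E U' w = nb E S w" "sparse E S v" shows "sparse E U' v"
proof -
 have v: "nb E U' v = nb E S v" using assms(1) by simp
 have n: "nb E U' w = nb E S w" if "w:nb E S v" for w using assms(1) that by simp
 consider (1) "card (nb E S v) <= 2" | (2) "card (nb E S v) <= 3" "ALL w:nb E S v. card (nb E S w) <= 2" | (3) a b c where "nb E S v = {a, b, c}" "(a, b):E"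
   "card (nb E S a) <= 3" "card (nb E S b) <= 3" "card (nb E S c) <= 2" using assms(2) unfolding sparse_def by auto
 thus ?thesis
 proof cases
  case 3
  hence "nb E U' a = nb E S a" "nb E U' b = nb E S b" "nb E U' c = nb E S c" using n by auto
  thus ?thesis using 3 v unfolding sparse_def by metis
 next
  case 2
  thus ?thesis using n v unfolding sparse_def by simp
 next
  case 1
  thus ?thesis using v unfolding sparse_def by simp
 qed
qed

definition cn :: "'a rel => 'a set => 'a set => 'a set" where
  "cn E U S = S Un (UN v:S. nb E U v)"

lemma cn_sub: "S <= U ==> cn E U S <= U" unfolding cn_def nb_def by auto

lemma cn_mono: "S <= T ==> U <= V ==> cn E U S <= cn E V T" unfolding cn_def nb_def by auto

lemma cn_conn: assumes "sym E" "conn E S" shows "conn E (cn E U S)"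
proof -
 have "cn E U S = S Un (UN w:cn E U S. {w})" unfolding cn_def by simp
 moreover have "conn E (S Un (UN w:cn E U S. {w}))" by (rule conn_UN[OF assms]) (auto simp: touch_def cn_def nb_def)
 ultimately show ?thesis by simp
qed

lemma cn_card: assumes "!!v. v:U ==> card (nb E U v) <= D" "finite U" "S <= U" shows "card (cn E U S) <= card S * (D + 1)"
proof -
 have fS: "finite S" using assms finite_subset by auto
 have "card (UN v:S. nb E U v) <= (SUM v:S. card (nb E U v))" by (rule card_UN_le[OF fS])
 also have "... <= card S * D" using sum_bounded_above[of S "%v. card (nb E U v)" D] assms by auto
 finally have "card (UN v:S. nb E U v) <= card S * D" .
 thus ?thesis unfolding cn_def using card_Un_le[of S "UN v:S. nb E U v"] by simp
qed

abbreviation ball2 :: "'a rel => 'a set => 'a => 'a set" where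
  "ball2 E U v \<equiv> cn E U (cn E U {v})"

lemma ball2_nb: "w = v | w:nb E U v ==> nb E U w <= ball2 E U v" unfolding cn_def by auto

lemma surj_upto3: assumes "finite N" "card N <= 3" "N ~= {}" shows "EX t. t ` {..<3::nat} = N"
proof -
 obtain h where h: "bij_betw h {0..<card N} N" using ex_bij_betw_nat_finite[OF assms(1)] by auto
 have im: "h ` {0..<card N} = N" using h unfolding bij_betw_def by simp
 have c: "0 < card N" using assms by auto
 define t where "t i = (if i < card N then h i else h 0)" for i
 have hN: "h i:N" if "i < card N" for i using im that by auto
 have "t i:N" for i unfolding t_def using hN c by simp
 moreover have "y:t ` {..<3::nat}" if y: "y:N" for y using im y assms(2) unfolding t_def by fastforce
 ultimately show ?thesis by auto
qed

lemma connector_tripod: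
  assumes E: "sym E" "irrefl E" and B: "finite B" "conn E B" and t: "ALL d<3. t d:B"
  shows "EX S g tri. S <= B & conn E S & (ALL d<3. t d:S) & tripod E S t g tri"
proof -
 define P where "P = (%S. S <= B & conn E S & (ALL d<3. t d:S))"
 define S where "S = arg_min card P"
 have "P B" unfolding P_def using B t by auto
 hence S: "P S" "!!S'. P S' ==> card S <= card S'" unfolding S_def by (auto intro: arg_min_natI arg_min_nat_le)
 have fS: "finite S" using S(1) B(1) finite_subset unfolding P_def by auto
 have "EX g tri. tripod E S t g tri"
 proof (rule three_terminals[OF E])
  show "conn E S" "finite S" using S(1) fS unfolding P_def by auto
  show "t d:S" if "d < 3" for d using S(1) that unfolding P_def by simp
  fix S'
  assume h: "S' <= S" "conn E S'" "!!d. d < 3 ==> t d:S'"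
  hence "P S'" using S(1) unfolding P_def by auto
  thus "S' = S" using S(2) h(1) fS by (metis card_seteq)
 qed
 thus ?thesis using S(1) unfolding P_def by auto
qed

lemma small_connector:
  assumes E: "sym E" "irrefl E" and B: "finite B" "conn E B" and T: "T <= B" "card T <= 3"
  shows "EX S<=B. conn E S & T <= S & (ALL v:S. sparse E S v)"
proof -
 have "finite T" using T(1) B(1) finite_subset by auto
 obtain b where b: "b:B" using B(2) unfolding conn_def by auto
 obtain t where t: "ALL d<3. t d:B" "T <= t ` {..<3::nat}"
 proof (cases "T = {}")
  case True
  thus ?thesis using that[of "%d. b"] b by simp
 next
  case False
  then obtain t where "t ` {..<3::nat} = T" using surj_upto3[OF \<open>finite T\<close> T(2)] by auto
  thus ?thesis using that[of t] T(1) by auto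
 qed
 obtain S g tri where S: "S <= B" "conn E S" "ALL d<3. t d:S" "tripod E S t g tri" using connector_tripod[OF E B t(1)] by auto
 show ?thesis using t(2) S(3) S(1,2) tripod_sparse[OF E S(4)] by blast
qed

lemma contract_balls:
  assumes E: "sym E" "irrefl E" and U: "finite U" "I <= U" and sc: "!!v w. v:I ==> w:I ==> v ~= w ==> ~touch E (ball2 E U v) (ball2 E U w)" and q: "!!u v. v:I
    ==> u:ball2 E U v ==> q u = v" "!!u. u~:(UN v:I. ball2 E U v) ==> q u = u" and F: "F <= qE (E Int U \<times> U) q" "sym F" "minor_model F (q ` U) W H mu"
    "!!x v. x:W ==> v:mu x ==> card {w. (v, w):F} <= 3" "H <= W \<times> W"
  shows "EX U'<=U. EX mu'. minor_model E U' W H mu' & (ALL v:I Int U'. sparse E U' v)"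
proof -
 have vb: "v:ball2 E U v" for v unfolding cn_def by simp
 have bU: "ball2 E U v <= U" if "v:I" for v using that U by (intro cn_sub) auto
 have qI: "u:ball2 E U v" if "q u = v" "v:I" for u v using that q(1) q(2) vb by (cases "u:(UN v:I. ball2 E U v)"; auto)
 have qn: "u = v" if "q u = v" "v~:I" for u v using q(1)[of _ u] q(2)[of u] that by (cases "u:(UN v:I. ball2 E U v)") auto
 have qid: "q v = v" if "v:q ` U" for v
 proof (cases "v:I")
  case True
  thus ?thesis using q(1) vb by simp
 next
  case False
  obtain u where "v = q u" using \<open>v:q ` U\<close> by auto
  thus ?thesis using qn[of u v] False by simp
 qed
 have FE: "(v:I --> (EX a:ball2 E U v. (a, w):E)) & (v~:I --> w~:I --> (v, w):E)" if h: "(v, w):F" for v w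
 proof -
  obtain a b where ab: "v = q a" "w = q b" "(a, b):E" "v ~= w" using h F(1) unfolding qE_def by auto
  have 1: "EX a:ball2 E U v. (a, w):E" if vI: "v:I"
  proof -
   have a: "a:ball2 E U v" using qI ab(1) vI by simp
   have "w~:I"
   proof
    assume w: "w:I"
    thus False using qI ab(2) sc[OF vI w ab(4)] a ab(3) unfolding touch_def by simp
   qed
   thus ?thesis using qn ab(2) a ab(3) by metis
  qed
  have 2: "(v, w):E" if "v~:I" "w~:I" using qn[of a v] qn[of b w] ab that by simp
  show ?thesis using 1 2 by simp
 qed
 have "EX S. (v:I --> card {w. (v, w):F} <= 3 --> S <= ball2 E U v & conn E S & (ALL w. (v, w):F --> (EX a:S. (a, w):E)) & (ALL u:S. sparse E S u))" for v
 proof (cases "v:I & card {w. (v, w):F} <= 3")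
  case True
  hence "EX a. (v, w):F --> a:ball2 E U v & (a, w):E" for w using FE[of v w] by auto
  then obtain a where a: "!!w. (v, w):F ==> a w:ball2 E U v & (a w, w):E" by metis
  have fF: "finite {w. (v, w):F}"
  proof (rule finite_subset)
   show "{w. (v, w):F} <= q ` U" using F(1) unfolding qE_def by auto
  qed (use U in simp)
  have "EX S<=ball2 E U v. conn E S & a ` {w. (v, w):F} <= S & (ALL v:S. sparse E S v)"
  proof (rule small_connector[OF E])
   show "finite (ball2 E U v)" using bU True U(1) finite_subset by blast
   show "conn E (ball2 E U v)" by (intro cn_conn E(1) conn_sing)
   show "a ` {w. (v, w):F} <= ball2 E U v" using a by auto
   show "card (a ` {w. (v, w):F}) <= 3" using card_image_le[OF fF, of a] True by simp
  qed
  then obtain S where S: "S <= ball2 E U v" "conn E S" "a ` {w. (v, w):F} <= S" "ALL v:S. sparse E S v" by auto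
  have "EX c:S. (c, w):E" if "(v, w):F" for w using a[OF that] S(3) that by auto
  thus ?thesis using S by auto
 qed blast
 then obtain S where S: "!!v. v:I ==> card {w. (v, w):F} <= 3 ==> S v <= ball2 E U v & conn E (S v) & (ALL w. (v, w):F --> (EX a:S v. (a, w):E)) & (ALL u:S v.
   sparse E (S v) u)" by metis
 define phi where "phi v = (if v:I then S v else {v})" for v
 define N where "N = (UN x:W. mu x)"
 have NU: "N <= q ` U" unfolding N_def using minor_modelD(2)[OF F(3)] by auto
 have N3: "card {w. (v, w):F} <= 3" if "v:N" for v using that F(4) unfolding N_def by auto
 have phiq: "q u = v" if h: "v:N" "u:phi v" for u v
 proof (cases "v:I")
  case True
  hence "u:ball2 E U v" using S[OF True N3[OF h(1)]] h(2) unfolding phi_def by auto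
  thus ?thesis by (rule q(1)[OF True])
 next
  case False
  hence uv: "u = v" using h(2) by (simp add: phi_def)
  have "q v = v" using qid h(1) NU by blast
  thus ?thesis unfolding uv .
 qed
 have phiU: "phi v <= U" if h: "v:N" for v
 proof (cases "v:I")
  case True
  thus ?thesis using S[OF True N3[OF h]] bU[OF True] unfolding phi_def by auto
 next
  case False
  obtain u where "u:U" "v = q u" using NU h by auto
  thus ?thesis using qn[of u v] False unfolding phi_def by auto
 qed
 have phic: "conn E (phi v)" if "v:N" for v using S[of v] N3[OF that] unfolding phi_def by simp
 have phit: "EX a:phi v. EX b:phi w. (a, b):E" if h: "v:N" "w:N" "(v, w):F" for v w
 proof -
  consider "v:I" "w~:I" | "v~:I" "w:I" | "v~:I" "w~:I" using FE[OF h(3)] h(3) F(1) sc vb[of w] unfolding qE_def touch_def by blast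
  thus ?thesis
  proof cases
   case 1
   thus ?thesis using S[OF 1(1) N3[OF h(1)]] h(3) unfolding phi_def by simp
  next
   case 2
   then obtain a where "a:S w" "(a, v):E" using S[OF 2(2) N3[OF h(2)]] h(3) F(2) by (meson symD)
   thus ?thesis using 2 E(1) unfolding phi_def by (auto dest: symD)
  next
   case 3
   thus ?thesis using FE[OF h(3)] unfolding phi_def by simp
  qed
 qed
 define U' where "U' = (UN v:N. phi v)"
 define mu' where "mu' x = (UN v:mu x. phi v)" for x
 have muN: "mu x <= N" if "x:W" for x using that unfolding N_def by auto
 have "minor_model E U' W H mu'" unfolding minor_model_def
 proof (intro conjI ballI impI)
  fix x
  assume x: "x:W"
  show "conn E (mu' x)" unfolding mu'_def
  proof (rule conn_lift[OF E(1) minor_modelD(1)[OF F(3) x]])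
   show "conn E (phi v)" if "v:mu x" for v using phic muN[OF x] that by auto
   show "touch E (phi v) (phi w)" if "v:mu x" "w:mu x" "(v, w):F" for v w using phit[of v w] muN[OF x] that unfolding touch_def by auto
  qed
  show "mu' x <= U'" using muN[OF x] unfolding mu'_def U'_def by auto
 next
  fix x y
  assume xy: "x:W" "y:W" "x ~= y"
  show "mu' x Int mu' y = {}" using phiq muN xy minor_modelD(3)[OF F(3) xy] unfolding mu'_def by blast
 next
  fix e
  assume e: "e:H"
  obtain x y where xy: "e = (x, y)" by (cases e)
  hence W: "x:W" "y:W" using F(5) e by auto
  obtain v w where vw: "v:mu x" "w:mu y" "(v, w):F" using minor_modelD(4)[OF F(3)] e xy by blast
  then obtain a b where "a:phi v" "b:phi w" "(a, b):E" using phit[of v w] muN W by auto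
  thus "case e of (x, y) => EX a:mu' x. EX b:mu' y. (a, b):E" using vw xy unfolding mu'_def by auto
 qed
 moreover have "U' <= U" unfolding U'_def using phiU by auto
 moreover have "sparse E U' v" if v: "v:I" "v:U'" for v
 proof -
  have UN: "u:phi (q u) & q u:N" if "u:U'" for u using that phiq unfolding U'_def by auto
  have qv: "q v = v" using q(1)[OF v(1) vb] .
  have vN: "v:N" "v:S v" using UN[OF v(2)] qv v(1) unfolding phi_def by auto
  have SU: "S v <= U'" unfolding U'_def using vN(1) v(1) by (auto simp: phi_def)
  show ?thesis
  proof (rule sparse_cong)
   show "sparse E (S v) v" using S[OF v(1) N3[OF vN(1)]] vN(2) by simp
   fix w
   assume "w = v | w:nb E U' v"
   hence w: "w = v | w:nb E U v" using \<open>U' <= U\<close> unfolding nb_def by auto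
   have "z:S v" if z: "z:U'" "(w, z):E" for z
   proof -
    show ?thesis using ball2_nb[OF w] z \<open>U' <= U\<close> unfolding nb_def using q(1)[OF v(1)] UN[OF z(1)] v(1) unfolding phi_def by auto
   qed
   thus "nb E U' w = nb E (S v) w" using SU unfolding nb_def by auto
  qed
 qed
 ultimately show ?thesis by auto
qed

lemma bramble_restrict: assumes "bramble E U k \<B>" shows "bramble (E Int U \<times> U) U k \<B>" unfolding bramble_def
proof (intro conjI ballI)
 have b: "!!B. B:\<B> ==> conn E B & B <= U" "!!A B. A:\<B> ==> B:\<B> ==> touch E A B" "ALL T. finite T & card T < k --> (EX B:\<B>. B Int T = {})"
   using assms unfolding bramble_def by auto
 show "conn (E Int U \<times> U) B" "B <= U" if "B:\<B>" for B using b(1)[OF that] conn_restrict by auto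
 show "touch (E Int U \<times> U) A B" if h: "A:\<B>" "B:\<B>" for A B using b(2)[OF h] b(1)[OF h(1)] b(1)[OF h(2)] unfolding touch_def by auto
 show "ALL T. finite T & card T < k --> (EX B:\<B>. B Int T = {})" by (rule b(3))
qed

lemma qE_sub: "qE (E Int U \<times> U) q <= q ` U \<times> q ` U" unfolding qE_def by auto

abbreviation spread :: "'a rel => 'a set => 'a set => bool" where
  "spread E U I \<equiv> ALL v:I. ALL w:I. v ~= w --> ~touch E (ball2 E U v) (ball2 E U w)"

lemma sparsify_round:
  assumes "r >= 1" "M >= 1"
  shows "EX R0 M0. R0 >= 1 & M0 >= 1 & (ALL (E :: 'a rel) U I. finite U --> sym E --> irrefl E --> (ALL v:U. card (nb E U v) <= D) --> I <= U --> (spread E U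
    I) --> hostminor E U R0 M0 --> (EX U'<=U. hostminor E U' r M & (ALL v:I Int U'. sparse E U' v)))"
proof -
 obtain theta where theta: "ALL (V :: 'a set) E \<B>. finite V --> E <= V \<times> V --> sym E --> irrefl E --> bramble E V theta \<B> --> hostminor E V r M"
   using grid_theorem[OF assms] by auto
 define k where "k = (D + 1) * (D + 1)"
 define n where "n = k * theta + 1"
 have k1: "k >= 1" unfolding k_def by simp
 have main: "EX U'<=U. hostminor E U' r M & (ALL v:I Int U'. sparse E U' v)" if U: "finite U" and E: "sym E" "irrefl E" and D: "ALL v:U. card (nb E U v) <= D"
   and IU: "I <= U" and sc: "spread E U I" and h: "hostminor E U n (n * n)" for E :: "'a rel" and U I
 proof -
  have n1: "n >= 1" unfolding n_def by simp
  obtain \<B> where "bramble E U (min n n) \<B>" using host_bramble[OF E(1) h n1 n1] by auto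
  hence "bramble E U (k * theta) \<B>" by (rule bramble_mono) (simp add: n_def)
  hence b: "bramble (E Int U \<times> U) U (k * theta) \<B>" by (rule bramble_restrict)
  have bU: "ball2 E U v <= U" if "v:I" for v using that IU by (intro cn_sub) auto
  have vb: "v:ball2 E U v" for v unfolding cn_def by simp
  define q where "q u = (if EX v:I. u:ball2 E U v then SOME v. v:I & u:ball2 E U v else u)" for u
  have q1: "q u = v" if h: "v:I" "u:ball2 E U v" for u v
  proof -
   have ex: "EX v. v:I & u:ball2 E U v" using h by auto
   have qe: "q u = (SOME v. v:I & u:ball2 E U v)" unfolding q_def using h by auto
   have "q u:I & u:ball2 E U (q u)" using someI_ex[OF ex] unfolding qe .
   thus ?thesis using sc h unfolding touch_def by auto
  qed
  have q2: "q u = u" if h: "u~:(UN v:I. ball2 E U v)" for u using h unfolding q_def by auto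
  have qc: "(q u:I & u:ball2 E U (q u)) | q u = u" for u using q1 q2 by blast
  have qI: "u:ball2 E U x" if "q u = x" "x:I" for u x using qc[of u] vb[of x] that by auto
  have qn: "u = x" if "q u = x" "x~:I" for u x using qc[of u] that by simp
  have card_ball: "card (ball2 E U v) <= k" if "v:I" for v
  proof -
   have "card (ball2 E U v) <= card (cn E U {v}) * (D + 1)" using D U IU that by (intro cn_card cn_sub) auto
   moreover have "card (cn E U {v}) <= card {v} * (D + 1)" using D U IU that by (intro cn_card) auto
   hence "card (cn E U {v}) * (D + 1) <= (D + 1) * (D + 1)" by (intro mult_le_mono1) simp
   ultimately show ?thesis unfolding k_def by simp
  qed
  have C: "EX C. finite C & card C <= k & (ALL B:\<B>. x:q ` B --> B Int C ~= {})" for x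
  proof (cases "x:I")
   case True
   have "finite (ball2 E U x)" using bU[OF True] U finite_subset by auto
   thus ?thesis using qI True card_ball[OF True] by blast
  next
   case False
   have "ALL B:\<B>. x:q ` B --> B Int {x} ~= {}" using qn False by blast
   moreover have "finite {x}" "card {x} <= k" using k1 by auto
   ultimately show ?thesis by blast
  qed
  let ?E = "qE (E Int U \<times> U) q"
  have sE: "sym (E Int U \<times> U)" using E(1) by (rule sym_restr)
  have "bramble ?E (q ` U) theta ((`) q ` \<B>)" by (rule bramble_quotient[OF sE b k1 C])
  then obtain mu0 where mu0: "minor_model ?E (q ` U) (hV r M) (hE r M) mu0" using theta U qE_sub qE_sym[OF sE] qE_irrefl finite_imageI
    unfolding hostminor_def by metis
  have fE: "finite ?E" by (rule finite_subset[OF qE_sub]) (use U in simp)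
  obtain F mu where F: "F <= ?E" "sym F" "minor_model F (q ` U) (hV r M) (hE r M) mu" "!!x v. x:hV r M ==> v:mu x ==> card {w. (v, w):F} <= card {y. (x, y):hE
    r M}" by (rule minimal_model[OF fE qE_sym[OF sE] qE_irrefl finite_hE hE_sym' hE_irrefl hE_sub mu0]) (rule that)
  have "EX U'<=U. EX mu'. minor_model E U' (hV r M) (hE r M) mu' & (ALL v:I Int U'. sparse E U' v)"
  proof (rule contract_balls[OF E U IU _ q1 q2 F(1-3) _ hE_sub])
   show "~touch E (ball2 E U v) (ball2 E U w)" if "v:I" "w:I" "v ~= w" for v w using sc that by simp
   show "card {w. (v, w):F} <= 3" if "x:hV r M" "v:mu x" for x v using F(4)[OF that] hE_deg le_trans by blast
  qed
  thus ?thesis unfolding hostminor_def by simp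
 qed
 have "n >= 1" "n * n >= 1" unfolding n_def by auto
 thus ?thesis using main by (intro exI[of _ n] exI[of _ "n * n"] conjI allI impI)
qed

lemma greedy_colouring:
  assumes "finite U" "!!v w. R v w ==> R w v" "!!v. v:U ==> card {w:U. R v w} < k"
  shows "EX c. (ALL v:U. c v < k) & (ALL v:U. ALL w:U. v ~= w --> R v w --> c v ~= (c w :: nat))"
  using assms(1,3)
proof (induction U rule: finite_induct)
 case (insert x U)
 have "card {w:U. R v w} < k" if "v:insert x U" for v
 proof -
  have "card {w:U. R v w} <= card {w:insert x U. R v w}" using insert(1) by (intro card_mono) auto
  thus ?thesis using insert(4)[OF that] by simp
 qed
 hence x: "card {w:U. R x w} < k" and u: "!!v. v:U ==> card {w:U. R v w} < k" by auto
 obtain c where c: "ALL v:U. c v < k" "ALL v:U. ALL w:U. v ~= w --> R v w --> c v ~= c w" using insert.IH[OF u] by auto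
 have f: "finite {w:U. R x w}" by (rule finite_subset[OF _ insert(1)]) blast
 obtain i where i: "i < k" "i~:c ` {w:U. R x w}" using card_image_le[OF f, of c] x card_mono[OF finite_imageI[OF f], of "{..<k}" c] by auto
 show ?case
 proof (intro exI[of _ "c(x := i)"] conjI ballI impI)
  show "(c(x := i)) v < k" if "v:insert x U" for v using that i c(1) by auto
  fix v w
  assume h: "v:insert x U" "w:insert x U" "v ~= w" "R v w"
  consider "v = x" "w:U" "w ~= x" | "w = x" "v:U" "v ~= x" | "v:U" "w:U" "v ~= x" "w ~= x" using h by auto
  thus "(c(x := i)) v ~= (c(x := i)) w" using i(2) assms(2) c(2) h by auto
 qed
qed auto

lemma cn_flip: "sym E ==> a:U ==> b:U ==> a:ball2 E U b ==> b:ball2 E U a" unfolding cn_def nb_def sym_def by blast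

lemma conflict_card: assumes "finite U" "sym E" "ALL v:U. card (nb E U v) <= D" "v:U" shows "card {w:U. touch E (ball2 E U v) (ball2 E U w)} <= (D + 1) ^ 5"
proof -
 let ?c = "cn E U"
 let ?S = "?c (?c (?c (?c (?c {v}))))"
 have s: "{v} <= U" using assms(4) by simp
 have card: "card (?c S) <= card S * (D + 1)" if "S <= U" for S using assms that by (intro cn_card) auto
 have 1: "card (?c {v}) <= (D + 1)" using card[OF s] by simp
 have 2: "card (?c (?c {v})) <= (D + 1) * (D + 1)" using card[of "?c {v}"] 1 cn_sub[OF s] by (meson le_trans mult_le_mono1)
 have 3: "card (?c (?c (?c {v}))) <= (D + 1) * (D + 1) * (D + 1)" using card[of "?c (?c {v})"] 2 cn_sub cn_sub[OF s] by (meson le_trans mult_le_mono1)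
 have 4: "card (?c (?c (?c (?c {v})))) <= (D + 1) * (D + 1) * (D + 1) * (D + 1)" using card[of "?c (?c (?c {v}))"] 3 cn_sub cn_sub[OF s]
   by (meson le_trans mult_le_mono1)
 have 5: "card ?S <= (D + 1) * (D + 1) * (D + 1) * (D + 1) * (D + 1)" using card[of "?c (?c (?c (?c {v})))"] 4 cn_sub cn_sub[OF s]
   by (meson le_trans mult_le_mono1)
 have "{w:U. touch E (ball2 E U v) (ball2 E U w)} <= ?S"
 proof
  fix w
  assume "w : {w:U. touch E (ball2 E U v) (ball2 E U w)}"
  then obtain a b where w: "w:U" and ab: "a:ball2 E U v" "b:ball2 E U w" "a = b | (a, b):E" unfolding touch_def by auto
  have "ball2 E U w <= U" using w by (intro cn_sub) simp
  hence bU: "b:U" using ab(2) by auto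
  have "b : ?c (ball2 E U v)" unfolding cn_def[of E U "ball2 E U v"] using ab(1,3) bU by (auto simp: nb_def)
  moreover have "w:ball2 E U b" using cn_flip[OF assms(2) bU w ab(2)] .
  moreover have "ball2 E U b <= ?c (?c (?c (ball2 E U v)))" if "b : ?c (ball2 E U v)" using that by (intro cn_mono) auto
  ultimately show "w : ?S" by auto
 qed
 moreover have "finite ?S" using cn_sub cn_sub[OF s] assms(1) by (meson finite_subset)
 ultimately have 6: "card {w:U. touch E (ball2 E U v) (ball2 E U w)} <= card ?S" by (rule card_mono[rotated])
 have p5: "x ^ 5 = x * x * x * x * x" for x :: nat by (simp add: eval_nat_numeral)
 show ?thesis unfolding p5 by (rule le_trans[OF 6 5])
qed

lemma sparsify_rounds: "ALL r M. r >= 1 --> M >= 1 --> (EX R0 M0. R0 >= 1 & M0 >= 1 & (ALL (E :: 'a rel) U I. finite U --> sym E --> irrefl E --> (ALL v:U.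
  card (nb E U v) <= D) --> (ALL i<k. spread E U (I i)) --> hostminor E U R0 M0 --> (EX U'<=U. hostminor E U' r M & (ALL i<k. ALL v:I i Int U'. sparse E U'
  v))))" for k :: nat
proof (induction k)
 case 0
 show ?case by auto
next
 case (Suc k)
 show ?case
 proof (intro allI impI)
  fix r M :: nat
  assume rM: "r >= 1" "M >= 1"
  obtain R1 M1 where R1: "R1 >= 1" "M1 >= 1" and R: "ALL (E :: 'a rel) U I. finite U --> sym E --> irrefl E --> (ALL v:U. card (nb E U v) <= D) --> I <= U -->
    (spread E U I) --> hostminor E U R1 M1 --> (EX U'<=U. hostminor E U' r M & (ALL v:I Int U'. sparse E U' v))"
    using sparsify_round[OF rM, where 'a = 'a and D = D] by auto
  obtain R0 M0 where R0: "R0 >= 1" "M0 >= 1" and S: "ALL (E :: 'a rel) U I. finite U --> sym E --> irrefl E --> (ALL v:U. card (nb E U v) <= D) --> (ALL i<k.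
    spread E U (I i)) --> hostminor E U R0 M0 --> (EX U'<=U. hostminor E U' R1 M1 & (ALL i<k. ALL v:I i Int U'. sparse E U' v))"
    using Suc.IH[rule_format, OF R1] by auto
  have "EX U'<=U. hostminor E U' r M & (ALL i<Suc k. ALL v:I i Int U'. sparse E U' v)" if U: "finite U" "sym E" "irrefl E" and D: "ALL v:U. card (nb E U v) <=
    D" and I: "ALL i<Suc k. spread E U (I i)" and h: "hostminor E U R0 M0" for E :: "'a rel" and U I
  proof -
   have "EX U'<=U. hostminor E U' R1 M1 & (ALL i<k. ALL v:I i Int U'. sparse E U' v)"
   proof (rule S[rule_format, OF U _ _ h])
    show "card (nb E U v) <= D" if "v:U" for v using D that by simp
    show "~touch E (ball2 E U v) (ball2 E U w)" if "i < k" "v:I i" "w:I i" "v ~= w" for i v w using I less_SucI[OF that(1)] that(2-4) by simp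
   qed
   then obtain U1 where U1: "U1 <= U" "hostminor E U1 R1 M1" "ALL i<k. ALL v:I i Int U1. sparse E U1 v" by auto
   have f1: "finite U1" using U1(1) U(1) finite_subset by auto
   have D1: "ALL v:U1. card (nb E U1 v) <= D" using D U1(1) card_nb_mono[OF U(1) U1(1)] le_trans by blast
   have "ALL v:I k Int U1. ALL w:I k Int U1. v ~= w --> ~touch E (ball2 E U1 v) (ball2 E U1 w)"
   proof (intro ballI impI notI)
    fix v w
    assume vw: "v:I k Int U1" "w:I k Int U1" "v ~= w" "touch E (ball2 E U1 v) (ball2 E U1 w)"
    have "ball2 E U1 u <= ball2 E U u" for u using U1(1) by (intro cn_mono) auto
    hence "touch E (ball2 E U v) (ball2 E U w)" using touch_mono[OF vw(4)] by simp
    thus False using I vw by auto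
   qed
   then obtain U2 where U2: "U2 <= U1" "hostminor E U2 r M" "ALL v:I k Int U1 Int U2. sparse E U2 v"
     using R[rule_format, of U1 E "I k Int U1", OF f1 U(2,3) _ _ _ U1(2)] D1 by auto
   have "sparse E U2 v" if i: "i < Suc k" "v:I i Int U2" for i v
   proof (cases "i = k")
    case True
    thus ?thesis using U2 i by auto
   next
    case False
    hence "i < k" "v:I i Int U1" using i U2(1) by auto
    hence "sparse E U1 v" using U1(3) by simp
    thus ?thesis by (rule sparse_mono[OF f1 U2(1)])
   qed
   thus ?thesis using U2 U1(1) by blast
  qed
  thus "EX R0 M0. R0 >= 1 & M0 >= 1 & (ALL (E :: 'a rel) U I. finite U --> sym E --> irrefl E --> (ALL v:U. card (nb E U v) <= D) --> (ALL i<Suc k. spread E U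
    (I i)) --> hostminor E U R0 M0 --> (EX U'<=U. hostminor E U' r M & (ALL i<Suc k. ALL v:I i Int U'. sparse E U' v)))" using R0
    by (intro exI[of _ R0] exI[of _ M0] conjI allI impI)
 qed
qed

theorem sparse_host:
  assumes "r >= 1" "M >= 1"
  shows "EX theta. ALL (E :: 'a rel) U \<B>. finite U --> E <= U \<times> U --> sym E --> irrefl E --> (ALL v:U. card (nb E U v) <= D) --> bramble E U theta
    \<B> --> (EX U'<=U. hostminor E U' r M & (ALL v:U'. sparse E U' v))"
proof -
 define k where "k = (D + 1) ^ 5 + 1"
 obtain R0 M0 where R0: "R0 >= 1" "M0 >= 1" and S: "ALL (E :: 'a rel) U I. finite U --> sym E --> irrefl E --> (ALL v:U. card (nb E U v) <= D) --> (ALL i<k.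
   spread E U (I i)) --> hostminor E U R0 M0 --> (EX U'<=U. hostminor E U' r M & (ALL i<k. ALL v:I i Int U'. sparse E U' v))"
   using sparsify_rounds[rule_format, OF assms, where 'a = 'a and D = D and k = k] by auto
 obtain theta where theta: "ALL (V :: 'a set) E \<B>. finite V --> E <= V \<times> V --> sym E --> irrefl E --> bramble E V theta \<B> --> hostminor E V R0 M0"
   using grid_theorem[OF R0] by auto
 have "EX U'<=U. hostminor E U' r M & (ALL v:U'. sparse E U' v)" if U: "finite U" and EU: "E <= U \<times> U" and E: "sym E" "irrefl E" and D: "ALL v:U. card
   (nb E U v) <= D" and b: "bramble E U theta \<B>" for E :: "'a rel" and U \<B>
 proof -
  have "card {w:U. touch E (ball2 E U v) (ball2 E U w)} < k" if "v:U" for v using conflict_card[OF U E(1) D that] unfolding k_def by simp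
  then obtain c where c: "ALL v:U. c v < k" "ALL v:U. ALL w:U. v ~= w --> touch E (ball2 E U v) (ball2 E U w) --> c v ~= (c w :: nat)"
    using greedy_colouring[OF U, of "%v w. touch E (ball2 E U v) (ball2 E U w)" k] touch_sym[OF E(1)] by auto
  have "hostminor E U R0 M0" using theta U EU E b by auto
  hence "EX U'<=U. hostminor E U' r M & (ALL i<k. ALL v:{v:U. c v = i} Int U'. sparse E U' v)" using D c(2) by (intro S[rule_format, OF U E]; fastforce)
  then obtain U' where "U' <= U" "hostminor E U' r M" "ALL i<k. ALL v:{v:U. c v = i} Int U'. sparse E U' v" by auto
  thus ?thesis using c(1) by auto
 qed
 thus ?thesis by blast
qed

subsection \<open>Induced grid models\<close>

definition imodel :: "'a rel => 'a set => 'b set => 'b rel => ('b => 'a set) => bool" where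
  "imodel E V N J Z = ((ALL n:N. conn E (Z n) & Z n <= V) & (ALL n:N. ALL m:N. n ~= m --> Z n Int Z m = {} & ((EX a:Z n. EX b:Z m. (a, b):E)
    \<longleftrightarrow> (n, m):J)))"

lemma imodelD:
  assumes "imodel E V N J Z"
  shows "n:N ==> conn E (Z n)" "n:N ==> Z n <= V" "n:N ==> m:N ==> n ~= m ==> Z n Int Z m = {}" "n:N ==> m:N ==> n ~= m ==> (n, m):J ==> EX a:Z n. EX b:Z m.
    (a, b):E" "n:N ==> m:N ==> n ~= m ==> a:Z n ==> b:Z m ==> (a, b):E ==> (n, m):J"
  using assms unfolding imodel_def by blast+

lemma imodel_compose: assumes "sym E" "imodel E V N J Z" "imodel J N N' J' X" shows "imodel E V N' J' (%n. UN x:X n. Z x)"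
proof -
 have X: "X n <= N" if "n:N'" for n using imodelD(2)[OF assms(3)] that .
 have ne: "x ~= y" if "n:N'" "m:N'" "n ~= m" "x:X n" "y:X m" for n m x y using imodelD(3)[OF assms(3) that(1-3)] that(4,5) by auto
 show ?thesis unfolding imodel_def
 proof (intro conjI ballI impI)
  fix n
  assume n: "n:N'"
  show "conn E (UN x:X n. Z x)"
  proof (rule conn_lift[OF assms(1) imodelD(1)[OF assms(3) n]])
   show "conn E (Z x)" if "x:X n" for x using imodelD(1)[OF assms(2)] X[OF n] that by auto
   show "touch E (Z x) (Z y)" if h: "x:X n" "y:X n" "(x, y):J" for x y
   proof (cases "x = y")
    case True
    thus ?thesis using imodelD(1)[OF assms(2), of x] X[OF n] h(1) unfolding conn_def touch_def by auto
   next
    case False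
    thus ?thesis using imodelD(4)[OF assms(2) _ _ False h(3)] X[OF n] h unfolding touch_def by auto
   qed
  qed
  show "(UN x:X n. Z x) <= V" using imodelD(2)[OF assms(2)] X[OF n] by auto
 next
  fix n m
  assume nm: "n:N'" "m:N'" "n ~= m"
  show "(UN x:X n. Z x) Int (UN x:X m. Z x) = {}" using imodelD(3)[OF assms(2)] X ne[OF nm] nm by blast
  show "(EX a:UN x:X n. Z x. EX b:UN x:X m. Z x. (a, b):E) \<longleftrightarrow> (n, m):J'"
  proof
   assume "EX a:UN x:X n. Z x. EX b:UN x:X m. Z x. (a, b):E"
   then obtain x y a b where h: "x:X n" "y:X m" "a:Z x" "b:Z y" "(a, b):E" by auto
   thus "(n, m):J'" using imodelD(5)[OF assms(2)] X nm ne[OF nm] imodelD(5)[OF assms(3) nm] h by blast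
  next
   assume "(n, m):J'"
   then obtain x y where h: "x:X n" "y:X m" "(x, y):J" using imodelD(4)[OF assms(3) nm] by auto
   then obtain a b where "a:Z x" "b:Z y" "(a, b):E" using imodelD(4)[OF assms(2)] X nm ne[OF nm] by blast
   thus "EX a:UN x:X n. Z x. EX b:UN x:X m. Z x. (a, b):E" using h by auto
  qed
 qed
qed

lemma card_ge2: "finite A ==> 2 <= card A ==> EX x:A. x ~= u" using card_mono[of "{u}" A] by auto

lemma qEI: "(a, b):E ==> q a ~= q b ==> (q a, q b):qE E q" unfolding qE_def by auto

text \<open>An edge of the sparse graph that the minimal model does not use closes a triangle with two edges that it does use.\<close>

lemma sparse_chord:
  assumes E: "sym E" "irrefl E" "finite U" and s: "sparse E U v" and vw: "v:U" "w:U" "(v, w):E" and F: "F <= E Int U \<times> U" "sym F" "(v, w)~:F" "2 <= card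
    {x. (v, x):F}" "2 <= card {x. (w, x):F}"
  shows "EX b. (v, b):F & (b, w):F"
proof -
 have nbF: "insert z {x. (u, x):F} <= nb E U u" if "z:nb E U u" for z u using that F(1) unfolding nb_def by auto
 have wv: "w:nb E U v" "v:nb E U w" using vw E(1) unfolding nb_def by (auto dest: symD)
 have Fs: "(w, v)~:F" using F(2,3) by (meson symD)
 have fF: "finite {x. (u, x):F}" for u using F(1) E(3) by (auto intro: finite_subset[of _ U])
 have c3: "3 <= card (nb E U v)" "3 <= card (nb E U w)" using card_mono[OF finite_nb[OF E(3)] nbF[OF wv(1)]] card_mono[OF finite_nb[OF E(3)] nbF[OF wv(2)]]
   F(3-5) Fs fF by auto
 then obtain a b c where abc: "nb E U v = {a, b, c}" "(a, b):E" "card (nb E U a) <= 3" "card (nb E U b) <= 3" "card (nb E U c) <= 2" using s wv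
   unfolding sparse_def by auto
 have main: "EX b. (v, b):F & (b, w):F" if h: "nb E U v = {w, b, c}" "(w, b):E" "card (nb E U w) <= 3" for b c
 proof -
  have bw: "b:U" "(v, b):E" "b:nb E U w" using h unfolding nb_def by auto
  obtain x where x: "(v, x):F" "x ~= c" using card_ge2[OF fF F(4), of c] by auto
  hence vb: "(v, b):F" using F(1,3) h(1) unfolding nb_def by auto
  have "(w, b):F"
  proof (rule ccontr)
   assume wb: "(w, b)~:F"
   have "b ~= v" using bw(2) E(2) unfolding irrefl_def by auto
   hence "4 <= card (insert v (insert b {x. (w, x):F}))" using F(5) wb Fs fF by simp
   have "insert v (insert b {x. (w, x):F}) <= nb E U w" using nbF[OF wv(2)] bw(3) by auto
   hence "card (insert v (insert b {x. (w, x):F})) <= card (nb E U w)" by (rule card_mono[OF finite_nb[OF E(3)]])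
   moreover note \<open>4 <= card (insert v (insert b {x. (w, x):F}))\<close>
   ultimately show False using h(3) by simp
  qed
  thus ?thesis using vb F(2) by (meson symD)
 qed
 have ba: "(b, a):E" using abc(2) E(1) by (meson symD)
 show ?thesis using abc(1,5) wv(1) c3(2) main[of b c] abc main[of a c] ba by fastforce
qed

lemma sparse_imodel:
  assumes E: "sym E" "irrefl E" "finite U" and sp: "ALL v:U. sparse E U v" and H: "finite H" "sym H" "irrefl H" "H <= W \<times> W" and mu0: "minor_model E U W
    H mu0" and deg: "ALL x:W. beta x:N --> 2 <= card {y. (x, y):H}" and far: "ALL x y z. (x, y):H --> (y, z):H --> beta x = beta y | beta y = beta z | x = z"
    and cl: "ALL n:N. conn H {x:W. beta x = n}"
  shows "EX Z. imodel E U N (qE H beta) Z"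
proof -
 let ?E = "E Int U \<times> U"
 have sE: "sym ?E" "irrefl ?E" "finite ?E" using sym_restr[OF E(1)] E(2,3) by (auto simp: irrefl_def)
 have muE: "minor_model ?E U W H mu0" unfolding minor_model_def
 proof (intro conjI ballI impI)
  show "conn ?E (mu0 x)" "mu0 x <= U" if "x:W" for x using minor_modelD(1,2)[OF mu0 that] conn_restrict by auto
  show "mu0 x Int mu0 y = {}" if "x:W" "y:W" "x ~= y" for x y using minor_modelD(3)[OF mu0 that] .
  fix e
  assume e: "e:H"
  obtain x y where xy: "e = (x, y)" by (cases e)
  thus "case e of (x, y) => EX a:mu0 x. EX b:mu0 y. (a, b) : ?E" using e H(4) minor_modelD(4)[OF mu0, of x y] minor_modelD(2)[OF mu0] by blast
 qed
 obtain F mu where F: "F <= ?E" "sym F" and mu: "minor_model F U W H mu" and FH: "!!a b. (a, b):F ==> EX x:W. EX y:W. a:mu x & b:mu y & (x = y | (x, y):H)" and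
   F2: "!!x v. x:W ==> v:mu x ==> 2 <= card {y. (x, y):H} ==> 2 <= card {w. (v, w):F}" by (rule minimal_model[OF sE(3,1,2) H muE]) (rule that)
 have FH': "x = y | (x, y):H" if h: "(a, b):F" "a:mu x" "b:mu y" "x:W" "y:W" for a b x y using FH[OF h(1)] minor_model_uniq[OF mu] h by blast
 define Z where "Z n = (UN x:{x:W. beta x = n}. mu x)" for n
 have FE: "F <= E" using F(1) by simp
 have "imodel E U N (qE H beta) Z" unfolding imodel_def
 proof (intro conjI ballI impI)
  fix n
  assume n: "n:N"
  have "conn F (Z n)" unfolding Z_def
  proof (rule conn_lift[OF F(2)])
   show "conn H {x:W. beta x = n}" using cl n by simp
   show "conn F (mu x)" if "x : {x:W. beta x = n}" for x using minor_modelD(1)[OF mu] that by simp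
   show "touch F (mu x) (mu y)" if "(x, y):H" for x y using minor_modelD(4)[OF mu that] unfolding touch_def by simp
  qed
  thus "conn E (Z n)" by (rule conn_edge_mono[OF _ FE])
  show "Z n <= U" using minor_modelD(2)[OF mu] unfolding Z_def by auto
 next
  fix n m
  assume nm: "n:N" "m:N" "n ~= m"
  show "Z n Int Z m = {}" using minor_model_uniq[OF mu] nm(3) unfolding Z_def by auto
  show "(EX a:Z n. EX b:Z m. (a, b):E) \<longleftrightarrow> (n, m):qE H beta"
  proof
   assume "(n, m):qE H beta"
   then obtain x y where xy: "(x, y):H" "n = beta x" "m = beta y" unfolding qE_def by auto
   thus "EX a:Z n. EX b:Z m. (a, b):E" using H(4) minor_modelD(4)[OF mu xy(1)] FE unfolding Z_def by blast
  next
   assume "EX a:Z n. EX b:Z m. (a, b):E"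
   then obtain v w x z where h: "v:mu x" "w:mu z" "x:W" "z:W" "beta x = n" "beta z = m" "(v, w):E" unfolding Z_def by auto
   have xz: "beta x ~= beta z" using h nm by simp
   have "(x, z):H | (EX y. (x, y):H & (y, z):H)"
   proof (cases "(v, w):F")
    case True
    thus ?thesis using FH' h xz by auto
   next
    case False
    have U: "v:U" "w:U" using minor_modelD(2)[OF mu] h by auto
    obtain b where b: "(v, b):F" "(b, w):F" using F2 deg h nm sparse_chord[OF E _ U h(7) F False] sp U by auto
    obtain y where y: "y:W" "b:mu y" using FH[OF b(1)] by auto
    show ?thesis using FH' b y h xz by blast
   qed
   thus "(n, m):qE H beta"
   proof
    assume "(x, z):H"
    thus ?thesis using xz h unfolding qE_def by auto
   next
    assume "EX y. (x, y):H & (y, z):H"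
    then obtain y where y: "(x, y):H" "(y, z):H" by auto
    thus ?thesis using far xz qEI[OF y(2), of beta] h(5,6) qEI[OF y(1), of beta] by metis
   qed
  qed
 qed
 thus ?thesis by auto
qed

text \<open>A label \<open>(k, s, rho)\<close> stands for a vertex of the grid if \<open>k = 0\<close>; the edge to its right is divided into the parts
  \<open>k = 1, 2, 3\<close> and the edge below it into \<open>k = 4, 5, 6\<close>.\<close>

definition fN :: "nat => nat => (nat * nat * nat) set" where
  "fN r M = {(k, s, rho). k < 7 & s < r & 1 <= rho & rho <= M & (4 <= k --> Suc s < r)}"

definition fnext :: "nat * nat * nat => nat * nat * nat => bool" where
  "fnext n m = ((EX s rho. (n, m) : {((0, s, rho), (1, s, rho)), ((1, s, rho), (2, s, rho)), ((2, s, rho), (3, s, rho)), ((3, s, rho), (0, s, Suc rho)), ((0,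
    s, rho), (4, s, rho)), ((4, s, rho), (5, s, rho)), ((5, s, rho), (6, s, rho)), ((6, s, rho), (0, Suc s, rho))}))"

definition fE :: "((nat * nat * nat) \<times> (nat * nat * nat)) set" where
  "fE = {(n, m). fnext n m | fnext m n}" context fixes r M R :: nat defines "R \<equiv> 4 * r + 8" begin

definition fW :: "(nat * nat) set" where
  "fW = {(a, j). 4 <= a & a <= 4 * r & j < R * (M + 2) & (a mod 4 = 0 | j mod R = a - 1 | j mod R = a)}"

definition fH :: "((nat * nat) \<times> (nat * nat)) set" where
  "fH = hE R (R * (M + 2)) Int fW \<times> fW"

definition flab :: "nat * nat => nat * nat * nat" where
  "flab = (%(a, j). (if a mod 4 = 0 then (if j mod R < R - 6 then 0 else 1 + (j mod R - (R - 6)) div 2) else 3 + a mod 4, a div 4 - 1, j div R))"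

definition fport :: "nat * nat => nat * nat" where
  "fport = (%(a, j). let p = j mod R in if a mod 4 = 0 then (if p = a then (Suc a, j) else if p = a - 1 then (a - 1, j) else if p = R - 7 | p = R - 5 | p = R -
    3 | p = R - 1 then (a, Suc j) else (a, j - 1)) else (if p = a - 1 then (a - 1, j) else (Suc a, j)))"

lemma fH_cases:
  assumes "(x, y):fH"
  obtains a j where "x = (a, j)" "y = (a, Suc j)" "x:fW" "y:fW" | a j where "y = (a, j)" "x = (a, Suc j)" "x:fW" "y:fW" | a j where "x = (a, j)" "y = (Suc a,
    j)" "j mod R = a" "x:fW" "y:fW" | a j where "y = (a, j)" "x = (Suc a, j)" "j mod R = a" "x:fW" "y:fW"
  using assms unfolding fH_def hE_def by auto

lemma fport_row:
  assumes "(a, j):fW" "(a, Suc j):fW" "flab (a, j) ~= flab (a, Suc j)"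
  shows "fport (a, j) = (a, Suc j)" "fport (a, Suc j) = (a, j)" "fnext (flab (a, j)) (flab (a, Suc j))"
proof -
 have a: "4 <= a" "a <= 4 * r" using assms(1) unfolding fW_def by auto
 have R: "R = 4 * r + 8" unfolding R_def ..
 define p where "p = j mod R"
 have p: "p < R" unfolding p_def R by simp
 have S: "Suc j mod R = (if Suc p = R then 0 else Suc p)" "Suc j div R = (if Suc p = R then Suc (j div R) else j div R)" unfolding p_def
   by (simp_all add: mod_Suc div_Suc)
 have a4: "a mod 4 = 0"
 proof (rule ccontr)
  assume "a mod 4 ~= 0"
  hence "p = a - 1 | p = a" "Suc j mod R = a - 1 | Suc j mod R = a" using assms(1,2) unfolding fW_def p_def by auto
  hence "Suc j div R = j div R" using S R by auto
  thus False using assms(3) \<open>a mod 4 ~= 0\<close> unfolding flab_def by simp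
 qed
 have "p = R - 7 | p = R - 5 | p = R - 3 | p = R - 1"
 proof (rule ccontr)
  assume c: "~?thesis"
  hence "p < 4 * r + 1 | p = 4 * r + 2 | p = 4 * r + 4 | p = 4 * r + 6" using p R by auto
  hence 1: "Suc p ~= R" and 2: "(p < R - 6 \<longleftrightarrow> Suc p < R - 6) & (~p < R - 6 --> (p - (R - 6)) div 2 = (Suc p - (R - 6)) div 2)" using R
    by auto
  have "flab (a, Suc j) = flab (a, j)" unfolding flab_def using 1 2 S by (auto simp: p_def[symmetric])
  thus False using assms(3) by simp
 qed
 hence p4: "p = 4 * r + 1 | p = 4 * r + 3 | p = 4 * r + 5 | p = 4 * r + 7" unfolding R by auto
 have R7: "7 < R" using R by simp
 have "flab (a, j) = (if p < R - 6 then 0 else 1 + (p - (R - 6)) div 2, a div 4 - 1, j div R)" "flab (a, Suc j) = (if Suc p = R then 0 else if Suc p < R - 6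
   then 0 else 1 + (Suc p - (R - 6)) div 2, a div 4 - 1, if Suc p = R then Suc (j div R) else j div R)" unfolding flab_def using a4 S R7
   by (auto simp: p_def[symmetric])
 thus "fnext (flab (a, j)) (flab (a, Suc j))" using p4 R unfolding fnext_def by (elim disjE) simp_all
 note p4
 moreover define q where "q = Suc j mod R"
 moreover have "q = (if Suc p = 4 * r + 8 then 0 else Suc p)" unfolding q_def S(1) using R by simp
 ultimately have "p ~= a & p ~= a - 1 & (p = R - 7 | p = R - 5 | p = R - 3 | p = R - 1) & Suc j mod R ~= a & Suc j mod R ~= a - 1 & ~(Suc j mod R = R - 7 | Suc
   j mod R = R - 5 | Suc j mod R = R - 3 | Suc j mod R = R - 1)" unfolding q_def[symmetric] R using a by (elim disjE; simp; linarith)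
 thus "fport (a, j) = (a, Suc j)" "fport (a, Suc j) = (a, j)" unfolding fport_def using a4 by (simp_all add: p_def[symmetric])
qed

lemma fport_col: assumes "j mod R = a" shows "fport (a, j) = (Suc a, j)" "fport (Suc a, j) = (a, j)" using assms unfolding fport_def by auto

lemma fport: assumes "(x, y):fH" "flab x ~= flab y" shows "fport x = y" using assms(1)
proof (cases rule: fH_cases)
 case (1 a j)
 thus ?thesis using fport_row[of a j] assms(2) by simp
next
 case (2 a j)
 thus ?thesis using fport_row[of a j] assms(2) by simp
next
 case (3 a j)
 thus ?thesis using fport_col[of j a] by simp
next
 case (4 a j)
 thus ?thesis using fport_col[of j a] by simp
qed

lemma fH_sym: "sym fH" unfolding fH_def by (rule sym_restr) (rule hE_sym')

lemma fport_col_lab: assumes "(a, j):fW" "(Suc a, j):fW" "j mod R = a" shows "fnext (flab (a, j)) (flab (Suc a, j))"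
proof -
 have i: "Suc (a div 4 - Suc 0) = a div 4" using assms(1) unfolding fW_def by auto
 have p: "j mod R < R - 6" using assms(3) assms(2) R_def unfolding fW_def by simp
 have "a mod 4 = 0 | a mod 4 = 1 | a mod 4 = 2 | a mod 4 = 3" by auto
 thus ?thesis using p i by (elim disjE) (simp_all add: flab_def fnext_def mod_Suc div_Suc)
qed

lemma fH_far: "(x, y):fH ==> (y, z):fH ==> flab x = flab y | flab y = flab z | x = z" using fport[of y x] fport[of y z] fH_sym by (metis symD)

lemma row_edge: "a mod 4 = 0 ==> 4 <= a ==> a <= 4 * r ==> Suc j < R * (M + 2) ==> ((a, j), (a, Suc j)):fH" unfolding fH_def hE_def fW_def by (auto simp: R_def)

lemma step_edge: "4 <= a ==> a <= 4 * r ==> j < R * (M + 2) ==> j mod R = a - 1 ==> ((a, j), (a, Suc j)):fH"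
proof -
 assume h: "4 <= a" "a <= 4 * r" "j < R * (M + 2)" "j mod R = a - 1"
 have "Suc j mod R = a" using h by (simp add: mod_Suc R_def)
 moreover have "Suc j < R * (M + 2)"
 proof (rule ccontr)
  assume "~Suc j < R * (M + 2)"
  hence "Suc j = R * (M + 2)" using h(3) by simp
  thus False using \<open>Suc j mod R = a\<close> h(1) by simp
 qed
 ultimately show ?thesis using h unfolding fH_def hE_def fW_def by (auto simp: R_def)
qed

lemma col_edge: "4 <= a ==> Suc a <= 4 * r ==> j < R * (M + 2) ==> j mod R = a ==> ((a, j), (Suc a, j)):fH" unfolding fH_def hE_def fW_def by (auto simp: R_def)

lemma fH_deg: assumes "x:fW" "flab x:fN r M" shows "2 <= card {y. (x, y):fH}"
proof -
 obtain a j where x: "x = (a, j)" by (cases x)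
 have a: "4 <= a" "a <= 4 * r" "j < R * (M + 2)" "a mod 4 = 0 | j mod R = a - 1 | j mod R = a" using assms(1) unfolding x fW_def by auto
 have rho: "1 <= j div R" "j div R <= M" using assms(2) unfolding x flab_def fN_def by auto
 have R0: "0 < R" unfolding R_def by simp
 have j: "1 <= j" "Suc j < R * (M + 2)"
 proof -
  show "1 <= j" using rho(1) by (cases "j = 0") auto
  have "j < R * (M + 1)" using rho(2) R0 by (metis Suc_eq_plus1 div_less_iff_less_mult le_imp_less_Suc mult.commute)
  thus "Suc j < R * (M + 2)" using R0 by simp
 qed
 have "EX y z. (x, y):fH & (x, z):fH & y ~= z"
 proof (cases "a mod 4 = 0")
  case True
  have "(x, (a, j - 1)):fH" "(x, (a, Suc j)):fH" using row_edge[OF True a(1,2), of "j - 1"] j row_edge[OF True a(1,2) j(2)] fH_sym unfolding x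
    by (auto dest: symD)
  thus ?thesis by (intro exI[of _ "(a, j - 1)"] exI[of _ "(a, Suc j)"]) auto
 next
  case False
  hence a4: "5 <= a" "Suc a <= 4 * r" using a(1,2) by presburger+
  show ?thesis
  proof (cases "j mod R = a")
   case True
   have "(j - 1) mod R = a - 1" using True j(1) a by (metis diff_Suc_1 mod_Suc Suc_pred' le_simps(3) not_numeral_le_zero zero_neq_numeral le_zero_eq
     One_nat_def)
   hence "((a, j - 1), (a, j)):fH" using step_edge[OF a(1,2), of "j - 1"] j by simp
   hence "(x, (a, j - 1)):fH" "(x, (Suc a, j)):fH" using col_edge[OF a(1) a4(2) a(3) True] fH_sym unfolding x by (auto dest: symD)
   thus ?thesis by (intro exI[of _ "(a, j - 1)"] exI[of _ "(Suc a, j)"]) auto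
  next
   case False
   hence p: "j mod R = a - 1" using a(4) \<open>a mod 4 ~= 0\<close> by simp
   have "((a - 1, j), (a, j)):fH" using col_edge[of "a - 1" j] a4 a p by simp
   hence "(x, (a - 1, j)):fH" "(x, (a, Suc j)):fH" using step_edge[OF a(1-3) p] fH_sym unfolding x by (auto dest: symD)
   thus ?thesis by (intro exI[of _ "(a - 1, j)"] exI[of _ "(a, Suc j)"]) auto
  qed
 qed
 then obtain y z where yz: "(x, y):fH" "(x, z):fH" "y ~= z" by auto
 have "finite (snd ` fH)" unfolding fH_def using finite_hE by simp
 hence "finite {y. (x, y):fH}" by (rule finite_subset[rotated]) force
 hence "card {y, z} <= card {y. (x, y):fH}" using yz by (intro card_mono) auto
 thus ?thesis using yz(3) by simp
qed

lemma line_conn: assumes "sym H" "l <= u" "!!j. l <= j ==> j < u ==> ((a, j), (a, Suc j)):H" shows "conn H ({a} \<times> {l..u :: nat})"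
proof (rule connI[OF assms(1)])
 show "(a, l) : {a} \<times> {l..u}" using assms(2) by simp
 have "((a, l), (a, j)):(H Int ({a} \<times> {l..u}) \<times> ({a} \<times> {l..u}))^*" if "l <= j" "j <= u" for j using that
 proof (induction j rule: dec_induct)
  case (step j)
  hence "((a, j), (a, Suc j)):H Int ({a} \<times> {l..u}) \<times> ({a} \<times> {l..u})" using assms(3) by auto
  thus ?case using step by (meson Suc_leD rtrancl.rtrancl_into_rtrancl)
 qed simp
 thus "((a, l), y):(H Int ({a} \<times> {l..u}) \<times> ({a} \<times> {l..u}))^*" if "y : {a} \<times> {l..u}" for y using that by auto
qed

lemma flab_mult: "p < R ==> flab (a, rho * R + p) = (if a mod 4 = 0 then (if p < R - 6 then 0 else 1 + (p - (R - 6)) div 2) else 3 + a mod 4, a div 4 - 1, rho)"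
  unfolding flab_def by simp

lemma mult_lt: "p < R ==> rho <= M ==> Suc (rho * R + p) < R * (M + 2)"
proof -
 assume h: "p < R" "rho <= M"
 hence "rho * R <= M * R" by simp
 thus ?thesis using h unfolding R_def by (simp add: algebra_simps)
qed

lemma fH_class: assumes "n:fN r M" shows "conn fH {x:fW. flab x = n}"
proof -
 obtain k s rho where n: "n = (k, s, rho)" by (cases n)
 have b: "k < 7" "s < r" "1 <= rho" "rho <= M" "4 <= k ==> Suc s < r" using assms unfolding n fN_def by auto
 define a where "a = 4 * (s + 1) + (k - 3)"
 define l where "l = (if k = 0 then 0 else if k < 4 then R - 8 + 2 * k else a - 1)"
 define u where "u = (if k = 0 then R - 7 else if k < 4 then R - 7 + 2 * k else a)"
 have R: "R = 4 * r + 8" unfolding R_def ..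
 have "k - 3 < 4" using b(1) by simp
 moreover have "(4 * (s + 1) + q) mod 4 = q" "(4 * (s + 1) + q) div 4 = s + 1" if "q < 4" for q using that by presburger+
 ultimately have a: "4 <= a" "a mod 4 = k - 3" "a div 4 = s + 1" unfolding a_def by auto
 have a2: "a <= 4 * r" using b unfolding a_def by (cases "4 <= k") auto
 have a3: "a mod 4 = (if k < 4 then 0 else k - 3)" using a(2) by simp
 note a = a(1) a2 a3 a(3)
 have lu: "l <= u" "u < R" unfolding l_def u_def using R a by auto
 have "{x:fW. flab x = n} = {a} \<times> {rho * R + l..rho * R + u}"
 proof (intro set_eqI iffI)
  fix x
  assume "x : {x:fW. flab x = n}"
  then obtain a' j where x: "x = (a', j)" "(a', j):fW" "flab (a', j) = (k, s, rho)" unfolding n by (cases x) auto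
  define p where "p = j mod R"
  have j: "j = rho * R + p" using x(3) unfolding p_def flab_def by auto
  have a': "4 <= a'" "a' div 4 - 1 = s" "a' mod 4 = 0 | p = a' - 1 | p = a'" "k = (if a' mod 4 = 0 then (if p < R - 6 then 0 else 1 + (p - (R - 6)) div 2) else
    3 + a' mod 4)" using x unfolding fW_def p_def flab_def by auto
  have p: "p < R" unfolding p_def R by simp
  have "a' = a & l <= p & p <= u"
  proof (cases "a' mod 4 = 0")
   case True
   hence k: "k = (if p < R - 6 then 0 else 1 + (p - (R - 6)) div 2)" using a'(4) by simp
   hence "k < 4" using p by auto
   hence "a' = a" using True a'(1,2) unfolding a_def by auto
   moreover have "l <= p & p <= u"
   proof (cases "k = 0")
    case True
    thus ?thesis using k unfolding l_def u_def by (auto split: if_splits)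
   next
    case False
    have np: "~p < R - 6" using k False by auto
    hence "k = 1 + (p - (R - 6)) div 2" using k by simp
    moreover define w where "w = p - (R - 6)"
    moreover have "l = 4 * r + 2 * k" "u = 4 * r + 1 + 2 * k" using False \<open>k < 4\<close> R unfolding l_def u_def by auto
    ultimately show ?thesis using np R by auto
   qed
   ultimately show ?thesis by simp
  next
   case False
   hence k: "k = 3 + a' mod 4" "4 <= k" using a'(4) by auto
   hence "a' = a" using a'(1,2) unfolding a_def by presburger
   thus ?thesis using a'(3) k unfolding l_def u_def by auto
  qed
  thus "x : {a} \<times> {rho * R + l..rho * R + u}" using x(1) j by auto
 next
  fix x
  assume "x : {a} \<times> {rho * R + l..rho * R + u}"
  then obtain j where x: "x = (a, j)" "rho * R + l <= j" "j <= rho * R + u" by auto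
  define p where "p = j - rho * R"
  have p: "j = rho * R + p" "l <= p" "p <= u" using x unfolding p_def by auto
  have pR: "p < R" using p(3) lu(2) by simp
  have "flab (a, j) = (k, s, rho)" unfolding p(1) flab_mult[OF pR] a(3,4) using p(2,3) b(1) R unfolding l_def u_def by (auto split: if_splits)
  thus "x : {x:fW. flab x = n}" unfolding fW_def using a mult_lt[OF pR b(4)] p pR b(1) unfolding l_def u_def n x(1) by auto
 qed
 moreover have "conn fH ({a} \<times> {rho * R + l..rho * R + u})"
 proof (rule line_conn[OF fH_sym])
  show "rho * R + l <= rho * R + u" using lu by simp
  fix j
  assume h: "rho * R + l <= j" "j < rho * R + u"
  define p where "p = j - rho * R"
  have p: "j = rho * R + p" "l <= p" "p < u" using h unfolding p_def by auto
  have pR: "p < R" using p(3) lu(2) by simp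
  show "((a, j), (a, Suc j)):fH"
  proof (cases "k < 4")
   case True
   thus ?thesis using row_edge a mult_lt[OF pR b(4)] p(1) by simp
  next
   case False
   thus ?thesis using p(2,3) unfolding l_def u_def using step_edge[OF a(1,2), of j] mult_lt[OF pR b(4)] p(1) pR by fastforce
  qed
 qed
 ultimately show ?thesis by simp
qed

lemma fH_label_edges: assumes "n:fN r M" "m:fN r M" shows "(n, m):qE fH flab \<longleftrightarrow> (n, m):fE"
proof
 assume "(n, m):qE fH flab"
 then obtain x y where xy: "(x, y):fH" "n = flab x" "m = flab y" "flab x ~= flab y" unfolding qE_def by auto
 from xy(1) have "fnext (flab x) (flab y) | fnext (flab y) (flab x)" using fport_row(3) xy(4) fport_col_lab by (cases rule: fH_cases; auto)
 thus "(n, m):fE" unfolding fE_def xy(2,3) by simp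
next
 have R: "R = 4 * r + 8" unfolding R_def ..
 have main: "(n, m):qE fH flab" if h: "fnext n m" "n:fN r M" "m:fN r M" for n m
 proof -
  have ex: "EX x y. (x, y):fH & flab x = n & flab y = m"
  proof -
   obtain k s rho where n: "n = (k, s, rho)" by (cases n)
   have b: "k < 7" "s < r" "1 <= rho" "rho <= M" "4 <= k ==> Suc s < r" using h(2) unfolding n fN_def by auto
   define a where "a = 4 * (s + 1) + (k - 3)"
   define p where "p = (if k < 4 then R - 7 + 2 * k else a)"
   have "k - 3 < 4" using b(1) by simp
   moreover have "(4 * (s + 1) + q) mod 4 = q" "(4 * (s + 1) + q) div 4 = s + 1" if "q < 4" for q using that by presburger+
   ultimately have a: "4 <= a" "a mod 4 = k - 3" "a div 4 = s + 1" unfolding a_def by auto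
   have a2: "a <= 4 * r" using b unfolding a_def by (cases "4 <= k") auto
   have a3: "a mod 4 = (if k < 4 then 0 else k - 3)" using a(2) by simp
   note a = a(1) a2 a3 a(3)
   have pR: "p < R" unfolding p_def using R a by auto
   show ?thesis
   proof (cases "k = 0 & m = (4, s, rho)")
    case True
    hence s: "Suc s < r" using h(3) unfolding fN_def by auto
    have aR: "a < R" using a R by simp
    have "Suc a <= 4 * r" unfolding a_def using s True by simp
    hence "((a, rho * R + a), (Suc a, rho * R + a)):fH" using col_edge[OF a(1)] mult_lt[OF aR b(4)] aR by simp
    moreover have "flab (a, rho * R + a) = n" "flab (Suc a, rho * R + a) = m" unfolding flab_mult[OF aR] n using True a R by auto
    ultimately show ?thesis by auto
   next
    case False
    show ?thesis
    proof (cases "k < 4")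
     case True
     hence am: "a mod 4 = 0" using a by simp
     have m: "m = (if k = 3 then (0, s, Suc rho) else (Suc k, s, rho))" using h(1) False True unfolding n fnext_def by auto
     have e: "((a, rho * R + p), (a, Suc (rho * R + p))):fH" by (rule row_edge[OF am a(1,2) mult_lt[OF pR b(4)]])
     have "flab (a, rho * R + p) = n" using True unfolding flab_mult[OF pR] n a(4) am using R unfolding p_def by auto
     moreover have "flab (a, Suc (rho * R + p)) = m"
     proof (cases "k = 3")
      case True
      hence "Suc (rho * R + p) = Suc rho * R + 0" unfolding p_def using R by simp
      moreover have "flab (a, Suc rho * R + 0) = m" using flab_mult[of 0 a "Suc rho"] m True am a(4) R by simp
      ultimately show ?thesis by (simp only:)
     next
      case False
      hence "Suc p < R" "k = 0 | k = 1 | k = 2" unfolding p_def using True R by auto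
      thus ?thesis using flab_mult[of "Suc p" a rho] m am a(4) R unfolding p_def by auto
     qed
     ultimately show ?thesis using e by auto
    next
     case F: False
     hence m: "m = (if k = 6 then (0, Suc s, rho) else (Suc k, s, rho))" using h(1) unfolding n fnext_def by auto
     have pa: "p = a" "Suc a <= 4 * r" unfolding p_def a_def using F b by auto
     have e: "((a, rho * R + p), (Suc a, rho * R + p)):fH" using col_edge[OF a(1) pa(2)] mult_lt[OF pR b(4)] pR pa(1) by simp
     have k: "k = 4 | k = 5 | k = 6" using F b(1) by auto
     hence "flab (a, rho * R + p) = n" unfolding flab_mult[OF pR] n a(3,4) by auto
     moreover have "flab (Suc a, rho * R + p) = m" unfolding flab_mult[OF pR] m using k a pa R by (elim disjE) (auto simp: mod_Suc div_Suc)
     ultimately show ?thesis using e by auto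
    qed
   qed
  qed
  moreover have "n ~= m" using h(1) unfolding fnext_def by auto
  ultimately show ?thesis using qEI by metis
 qed
 assume "(n, m):fE"
 hence "fnext n m | fnext m n" unfolding fE_def by simp
 thus "(n, m):qE fH flab"
 proof
  assume "fnext n m"
  thus ?thesis by (rule main[OF _ assms])
 next
  assume "fnext m n"
  hence "(m, n):qE fH flab" by (rule main[OF _ assms(2,1)])
  thus ?thesis by (rule symD[OF qE_sym[OF fH_sym]])
 qed
qed
end

lemma minor_model_sub: "minor_model E V W H mu ==> W' <= W ==> H' <= H ==> minor_model E V W' H' mu" unfolding minor_model_def by (meson subsetD)

lemma sparse_fine_grid:
  assumes E: "sym E" "irrefl E" "finite U" "ALL v:U. sparse E U v" and h: "hostminor E U (4 * r + 8) ((4 * r + 8) * (M + 2))"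
  shows "EX Z. imodel E U (fN r M) fE Z"
proof -
 obtain mu where "minor_model E U (hV (4 * r + 8) ((4 * r + 8) * (M + 2))) (hE (4 * r + 8) ((4 * r + 8) * (M + 2))) mu" using h unfolding hostminor_def by auto
 moreover have "fW r M <= hV (4 * r + 8) ((4 * r + 8) * (M + 2))" unfolding fW_def hV_def by auto
 moreover have "fH r M <= hE (4 * r + 8) ((4 * r + 8) * (M + 2))" unfolding fH_def by simp
 ultimately have mu: "minor_model E U (fW r M) (fH r M) mu" by (rule minor_model_sub)
 have "EX Z. imodel E U (fN r M) (qE (fH r M) (flab r)) Z"
 proof (rule sparse_imodel[OF E])
  show "finite (fH r M)" "irrefl (fH r M)" "fH r M <= fW r M \<times> fW r M" unfolding fH_def using finite_hE hE_irrefl by (auto simp: irrefl_def)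
  show "sym (fH r M)" by (rule fH_sym)
  show "minor_model E U (fW r M) (fH r M) mu" by fact
  show "ALL x:fW r M. flab r x:fN r M --> 2 <= card {y. (x, y):fH r M}" using fH_deg by simp
  show "ALL n:fN r M. conn (fH r M) {x:fW r M. flab r x = n}" using fH_class by simp
  show "ALL x y z. (x, y):fH r M --> (y, z):fH r M --> flab r x = flab r y | flab r y = flab r z | x = z" using fH_far by simp
 qed
 then obtain Z where "imodel E U (fN r M) (qE (fH r M) (flab r)) Z" by auto
 thus ?thesis unfolding imodel_def using fH_label_edges by auto
qed

lemma ipath_ends:
  assumes "ipath E (a # q @ [z])" "q ~= []" "sym E"
  shows "a~:set q" "z~:set q" "a ~= z" "(a, hd q):E" "(last q, z):E" "(a, z)~:E" "conn E (set q)" "y:set q ==> (a, y):E ==> y = hd q" "y:set q ==> (z, y):E ==>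
    y = last q"
proof -
 let ?p = "a # q @ [z]"
 have p: "path E ?p" using assms(1) by (rule ipath_path)
 thus "a~:set q" "z~:set q" "a ~= z" unfolding path_def by auto
 have nq: "?p ! Suc i = q ! i" if "i < length q" for i using that by (simp add: nth_append)
 have adj: "j = Suc i | i = Suc j" if "i < length ?p" "j < length ?p" "(?p ! i, ?p ! j):E" for i j using assms(1) that unfolding ipath_def by simp
 have l0: "0 < length q" using assms(2) by simp
 have "(?p ! 0, ?p ! Suc 0):E" by (rule path_nth[OF p]) simp
 thus "(a, hd q):E" using nq[OF l0] assms(2) by (simp add: hd_conv_nth)
 have "(?p ! length q, ?p ! Suc (length q)):E" by (rule path_nth[OF p]) simp
 thus "(last q, z):E" using nq[of "length q - 1"] assms(2) by (simp add: last_conv_nth)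
 show "(a, z)~:E" using adj[of 0 "Suc (length q)"] l0 by auto
 have "path E ([a] @ q @ [z])" using p by simp
 hence "path E (q @ [z])" by (rule path_appendD2) simp
 thus "conn E (set q)" by (intro path_conn[OF assms(3)]) (rule path_appendD1[OF _ assms(2)])
 show "y = hd q" if h: "y:set q" "(a, y):E"
 proof -
  obtain i where i: "i < length q" "y = q ! i" using h(1) by (metis in_set_conv_nth)
  thus ?thesis using adj[of 0 "Suc i"] nq[OF i(1)] h(2) by (simp add: hd_conv_nth)
 qed
 show "y = last q" if h: "y:set q" "(z, y):E"
 proof -
  obtain i where i: "i < length q" "y = q ! i" using h(1) by (metis in_set_conv_nth)
  hence "Suc i = length q" using adj[of "Suc (length q)" "Suc i"] nq[OF i(1)] h(2) by auto
  thus ?thesis using i assms(2) by (metis diff_Suc_1 last_conv_nth)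
 qed
qed

lemma shortest_link:
  assumes E: "sym E" "irrefl E" and Z: "conn E Z" and ne: "EX x:Z. P x" "EX y:Z. Q y" and far: "!!x y. x:Z ==> y:Z ==> P x ==> Q y ==> x ~= y & (x, y)~:E"
  shows "EX a q z. ipath E (a # q @ [z]) & q ~= [] & set (a # q @ [z]) <= Z & P a & Q z & (ALL x:set (a # q @ [z]). (P x --> x = a) & (Q x --> x = z))"
proof -
 define L where "L p \<longleftrightarrow> ipath E p & set p <= Z & P (hd p) & Q (last p)" for p
 obtain x y where xy: "x:Z" "P x" "y:Z" "Q y" using ne by auto
 obtain p0 where "ipath E p0" "hd p0 = x" "last p0 = y" "set p0 <= Z" using conn_ipath[OF Z xy(1,3) E(2,1)] by auto
 hence "L p0" using xy unfolding L_def by simp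
 define p where "p = arg_min length L"
 have p: "L p" "!!p'. L p' ==> length p <= length p'" unfolding p_def using \<open>L p0\<close> by (auto intro: arg_min_natI arg_min_nat_le)
 have ip: "ipath E p" "set p <= Z" "P (hd p)" "Q (last p)" using p(1) unfolding L_def by auto
 have pn: "p ~= []" using ip(1) unfolding ipath_def path_def by simp
 have uP: "p ! i = hd p" if i: "i < length p" "P (p ! i)" for i
 proof -
  have "L (drop i p)" unfolding L_def using ipath_drop[OF ip(1) i(1)] set_drop_subset[of i p] ip i by (auto simp: hd_drop_conv_nth)
  hence "i = 0" using p(2)[of "drop i p"] i(1) by simp
  thus ?thesis using pn by (simp add: hd_conv_nth)
 qed
 have uQ: "p ! i = last p" if i: "i < length p" "Q (p ! i)" for i
 proof -
  have "hd (take (Suc i) p) = hd p" "last (take (Suc i) p) = p ! i" using i(1) pn by (simp_all add: take_Suc_conv_app_nth hd_conv_nth nth_append)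
  hence "L (take (Suc i) p)" using set_take_subset ip(2) unfolding L_def using ipath_take[OF ip(1), of "Suc i"] ip(3) i(2) by fastforce
  hence "Suc i = length p" using p(2)[of "take (Suc i) p"] i(1) by simp
  thus ?thesis using pn by (metis diff_Suc_1 last_conv_nth)
 qed
 have hl: "hd p ~= last p" "(hd p, last p)~:E" using ip(2) pn far[of "hd p" "last p"] ip(3,4) by (meson hd_in_set last_in_set subsetD)+
 obtain a p1 where a: "p = a # p1" using pn by (cases p) auto
 hence "p1 ~= []" using hl by auto
 then obtain q z where q: "p1 = q @ [z]" using append_butlast_last_id by metis
 have pq: "p = a # q @ [z]" using a q by simp
 have "q ~= []" using path_nth[OF ipath_path[OF ip(1)], of 0] pq hl(2) by auto
 moreover have "(P x --> x = a) & (Q x --> x = z)" if x: "x:set p" for x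
 proof -
  obtain i where "i < length p" "x = p ! i" using x by (metis in_set_conv_nth)
  moreover have "hd p = a" "last p = z" unfolding pq by auto
  ultimately show ?thesis using uP[of i] uQ[of i] by auto
 qed
 moreover have "P a" "Q z" using ip(3,4) unfolding pq by auto
 ultimately show ?thesis using ip(1,2) unfolding pq by auto
qed

definition junction :: "'a rel => 'a set => (nat => 'a) => bool => bool" where
  "junction E Y t tri = ((EX L h. (ALL d<3. conn E (L d) & h d:L d & t d:L d & L d <= insert (t d) Y) & (ALL d<3. ALL e<3. d ~= e --> (if tri then L d Int L e
    = {} & (h d, h e):E & (ALL u:L d. ALL v:L e. (u, v):E --> u = h d & v = h e) else h d = h e & L d Int L e = {h d} & (ALL u:L d. ALL v:L e. (u, v):E --> u =
    h d | v = h d)))))"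

text \<open>A terminal is a leaf, hence it lies on no other leg, not even as the common end of all legs.\<close>

lemma junction_exists:
  assumes E: "sym E" "irrefl E" and Y: "conn E Y" "finite Y" and t: "!!d. d < 3 ==> t d~:Y" "!!d e. d < 3 ==> e < 3 ==> d ~= e ==> t d ~= t e & (t d, t e)~:E"
    "!!d. d < 3 ==> EX y:Y. ALL y':Y. (t d, y'):E \<longleftrightarrow> y' = y"
  shows "EX tri. junction E Y t tri"
proof -
 let ?B = "Y Un (UN d:{..<3::nat}. {t d})"
 have cB: "conn E ?B"
 proof (rule conn_UN[OF E(1) Y(1)])
  show "touch E Y {t d}" if d: "d : {..<3}" for d using t(3)[of d] d E(1) unfolding touch_def by (auto dest: symD)
 qed simp
 obtain S g tri where S: "S <= ?B" "tripod E S t g tri"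
 proof -
  have "finite ?B" "ALL d<3. t d : ?B" using Y(2) by auto
  from connector_tripod[OF E this(1) cB this(2)] show ?thesis by (elim exE conjE) (rule that)
 qed
 have ip: "ipath E (g d)" "last (g d) = t d" if "d < 3" for d using S(2) that unfolding tripod_def by auto
 have ne: "g d ~= []" if "d < 3" for d using ip(1)[OF that] unfolding ipath_def path_def by simp
 have mem: "hd (g d):set (g d)" "t d:set (g d)" if "d < 3" for d using ne[OF that] by (auto simp flip: ip(2)[OF that])
 have Sg: "S = (UN d<3. set (g d))" using S(2) unfolding tripod_def by simp
 have pr: "legs E g tri d e" if "d < 3" "e < 3" "d ~= e" for d e using S(2) that unfolding tripod_def by blast
 have leaf: "t e~:set (g d)" if de: "d < 3" "e < 3" "d ~= e" for d e
 proof
  assume te: "t e:set (g d)"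
  have ntri: "~tri" using pr[OF de] te mem(2)[OF de(2)] by auto
  have c: "hd (g k) = t e" if "k < 3" for k
  proof -
   have "t e = hd (g d)" using pr[OF de] ntri te mem(2)[OF de(2)] by auto
   thus ?thesis using pr[of d k] that de(1) ntri by (cases "k = d") auto
  qed
  have second: "EX u. u:set (g k) & u ~= t e & u:Y & (t e, u):E" if k: "k < 3" "k ~= e" for k
  proof -
   have "hd (g k) ~= last (g k)" using c[OF k(1)] ip(2)[OF k(1)] t(2)[of k e] k de by auto
   then obtain u r where g: "g k = t e # u # r" using c[OF k(1)] ne[OF k(1)] by (cases "g k"; cases "tl (g k)") auto
   have e: "(t e, u):E" using path_nth[OF ipath_path[OF ip(1)[OF k(1)]], of 0] g by simp
   have "u ~= t e" using e E(2) unfolding irrefl_def by auto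
   moreover have "u:S" using g k(1) unfolding Sg by (auto intro!: bexI[of _ k])
   hence "u:Y" using S(1) t(2)[OF de(2)] e \<open>u ~= t e\<close> by auto
   ultimately show ?thesis using g e by auto
  qed
  obtain f where f: "f < 3" "f ~= d" "f ~= e" using de card_mono[of "{d, e}" "{..<3}"] by auto
  obtain u v where u: "u:set (g d)" "u ~= t e" "u:Y" "(t e, u):E" and v: "v:set (g f)" "v:Y" "(t e, v):E" using second[OF de(1,3)] second[OF f(1,3)] by auto
  show False using t(3)[OF de(2)] u v pr[OF de(1) f(1)] f(2) ntri c[OF de(1)] by auto
 qed
 have "junction E Y t tri" unfolding junction_def
 proof (intro exI[of _ "%d. set (g d)"] exI[of _ "%d. hd (g d)"] conjI allI impI)
  fix d :: nat
  assume d: "d < 3"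
  show "conn E (set (g d))" "hd (g d):set (g d)" "t d:set (g d)" using path_conn[OF E(1) ipath_path[OF ip(1)[OF d]]] mem[OF d] by auto
  show "set (g d) <= insert (t d) Y" using d S(1) leaf[OF d] unfolding Sg by auto
 next
  fix d e :: nat
  assume "d < 3" "e < 3" "d ~= e"
  from pr[OF this] show "legs E g tri d e" .
 qed
 thus ?thesis by auto
qed

text \<open>A label \<open>(k, s, rho)\<close> is a vertex of the grid, the edge to its right or the edge below it for \<open>k = 0, 1, 2\<close>.\<close>

definition gN :: "nat => nat => (nat * nat * nat) set" where
  "gN r M = {(k, s, rho). k < 3 & s < r & 1 <= rho & rho <= M & (k = 1 --> rho < M) & (k = 2 --> Suc s < r)}"

definition gnext :: "nat * nat * nat => nat * nat * nat => bool" where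
  "gnext n m = ((EX s rho. (n, m) : {((0, s, rho), (1, s, rho)), ((1, s, rho), (0, s, Suc rho)), ((0, s, rho), (2, s, rho)), ((2, s, rho), (0, Suc s, rho))}))"

definition gE :: "((nat * nat * nat) \<times> (nat * nat * nat)) set" where
  "gE = {(n, m). gnext n m | gnext m n}"

lemma gnext_iff: "gnext (k, s, rho) (k', s', rho') \<longleftrightarrow> k = 0 & s' = s & rho' = rho & (k' = 1 | k' = 2) | k' = 0 & (k = 1 & s' = s & rho' =
  Suc rho | k = 2 & s' = Suc s & rho' = rho)"
  unfolding gnext_def by auto

lemma fnext_iff: "fnext (k, s, rho) (k', s', rho') \<longleftrightarrow> s' = s & rho' = rho & (k = 0 & (k' = 1 | k' = 4) | k' = Suc k & k : {1, 2, 4, 5}) | k'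
  = 0 & (k = 3 & s' = s & rho' = Suc rho | k = 6 & s' = Suc s & rho' = rho)"
  unfolding fnext_def by auto

lemma gE_sym: "sym gE" unfolding gE_def sym_def by simp

lemma gE_node_edge: "(n, m):gE ==> fst n = 0 \<longleftrightarrow> fst m ~= 0" unfolding gE_def gnext_def by auto

definition gpart :: "nat => nat * nat * nat => nat * nat * nat" where
  "gpart i m = (3 * fst m - 3 + i, snd m)"

definition glo :: "nat * nat * nat => nat * nat * nat" where
  "glo m = (0, snd m)"

definition ghi :: "nat * nat * nat => nat * nat * nat" where
  "ghi m = (0, if fst m = 1 then (fst (snd m), Suc (snd (snd m))) else (Suc (fst (snd m)), snd (snd m)))"

lemma gE_lohi: "m:gN r M ==> fst b = 0 ==> (b, m):gE \<longleftrightarrow> fst m ~= 0 & (b = glo m | b = ghi m)"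
  by (cases b; cases m) (auto simp: gE_def gnext_iff gN_def glo_def ghi_def)

lemma gpart_facts:
  assumes "m:gN r M" "fst m ~= 0"
  shows "1 <= i ==> i <= 3 ==> gpart i m:fN r M" "glo m:fN r M" "ghi m:fN r M" "glo m ~= ghi m" "(gpart 1 m, gpart 2 m):fE" "(gpart 2 m, gpart 3 m):fE" "(gpart
    1 m, glo m):fE" "(gpart 3 m, ghi m):fE" "1 <= i ==> i <= 3 ==> fst b = 0 ==> (gpart i m, b):fE ==> i = 1 & b = glo m | i = 3 & b = ghi m" "(gpart 1 m,
    gpart 3 m)~:fE"
proof -
 obtain k s rho where m: "m = (k, s, rho)" by (cases m)
 have k: "k = 1 & rho < M | k = 2 & Suc s < r" and s: "s < r" "1 <= rho" "rho <= M" using assms unfolding m gN_def by auto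
 show "1 <= i ==> i <= 3 ==> gpart i m:fN r M" "glo m:fN r M" "ghi m:fN r M" "glo m ~= ghi m" "(gpart 1 m, gpart 2 m):fE" "(gpart 2 m, gpart 3 m):fE" "(gpart 1
   m, glo m):fE" "(gpart 3 m, ghi m):fE" "(gpart 1 m, gpart 3 m)~:fE" using k s unfolding m gpart_def glo_def ghi_def by (auto simp: fN_def fE_def fnext_iff)
 show "i = 1 & b = glo m | i = 3 & b = ghi m" if "1 <= i" "i <= 3" "fst b = 0" "(gpart i m, b):fE" using that k unfolding m gpart_def glo_def ghi_def
   by (cases b) (auto simp: fE_def fnext_iff)
qed

lemma gpart_sep:
  assumes "m:gN r M" "fst m ~= 0" "m':gN r M" "fst m' ~= 0" "m ~= m'" "1 <= i" "i <= 3" "1 <= j" "j <= 3"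
  shows "gpart i m ~= gpart j m'" "(gpart i m, gpart j m')~:fE"
proof -
 obtain k s rho where m: "m = (k, s, rho)" by (cases m)
 obtain k' s' rho' where m': "m' = (k', s', rho')" by (cases m')
 have k: "k = 1 | k = 2" using assms(1,2) unfolding m gN_def by auto
 have k': "k' = 1 | k' = 2" using assms(3,4) unfolding m' gN_def by auto
 have ne: "(s, rho) = (s', rho') ==> k ~= k'" using assms(5) unfolding m m' by simp
 have 1: "3 * k - 3 + i = 3 * k' - 3 + j ==> k = k'" using k k' assms(6-9) by auto
 have 2: "3 * k' - 3 + j = Suc (3 * k - 3 + i) ==> 3 * k - 3 + i : {1, 2, 4, 5} ==> k = k'" "3 * k - 3 + i = Suc (3 * k' - 3 + j) ==> 3 * k' - 3 + j : {1, 2,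
   4, 5} ==> k = k'" using k k' assms(6-9) by auto
 have 0: "3 * k - 3 + i ~= 0" "3 * k' - 3 + j ~= 0" using assms(6,8) by auto
 show "gpart i m ~= gpart j m'" using 1 ne unfolding m m' gpart_def by auto
 show "(gpart i m, gpart j m')~:fE"
 proof
  assume "(gpart i m, gpart j m'):fE"
  hence "s = s' & rho = rho' & k = k'" using 0 2 unfolding m m' gpart_def fE_def by (auto simp: fnext_iff)
  thus False using ne by simp
 qed
qed

lemma gN_nodes: "b:gN r M ==> fst b = 0 ==> b:fN r M" unfolding gN_def fN_def by auto

lemma fE_nodes: "fst b = 0 ==> fst b' = 0 ==> (b, b')~:fE" unfolding fE_def fnext_def by auto

definition ported :: "'a rel => 'a set => 'a set => 'a => bool" where
  "ported E Y X t = (t:X & (ALL x:X. ALL y:Y. (x, y):E --> x = t) & (EX y:Y. ALL y':Y. (t, y'):E \<longleftrightarrow> y' = y))"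

lemma thin_grid:
  assumes E: "sym E" "irrefl E" and Z: "imodel E V (fN r M) fE Z"
  shows "EX Y t. imodel E V (gN r M) gE Y & (ALL b:gN r M. ALL m:gN r M. (b, m):gE --> fst b = 0 --> ported E (Y b) (Y m) (t b m))"
proof -
 define P where "P m x \<longleftrightarrow> (EX y:Z (glo m). (x, y):E)" for m x
 define Q where "Q m x \<longleftrightarrow> (EX y:Z (ghi m). (x, y):E)" for m x
 let ?Z = "%m. Z (gpart 1 m) Un Z (gpart 2 m) Un Z (gpart 3 m)"
 let ?e = "%m. m:gN r M & fst m ~= 0"
 have fs: "(y, x):E" if "(x, y):E" for x y using E(1) that by (rule symD)
 have Zn: "x ~= y & ((x, y):E --> (n, n'):fE)" if "n:fN r M" "n':fN r M" "n ~= n'" "x:Z n" "y:Z n'" for n n' x y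
   using imodelD(3,5)[OF Z that(1-3)] that(4,5) by auto
 have part: "EX i. 1 <= i & i <= 3 & x:Z (gpart i m)" if "x : ?Z m" for m x
 proof -
  have "EX i:{1, 2, 3}. x:Z (gpart i m)" using that by simp
  then obtain i where "i : {1, 2, 3}" "x:Z (gpart i m)" by auto
  moreover from this(1) have "1 <= i" "i <= 3" by auto
  ultimately show ?thesis by auto
 qed
 have link: "EX a q z. ipath E (a # q @ [z]) & q ~= [] & set (a # q @ [z]) <= ?Z m & P m a & Q m z & (ALL x:set (a # q @ [z]). (P m x --> x = a) & (Q m x --> x
   = z))" if m: "?e m" for m
 proof (rule shortest_link[OF E])
  note f = gpart_facts[of m r M, OF conjunct1[OF m] conjunct2[OF m]]
  have f1: "gpart 1 m:fN r M" "gpart 2 m:fN r M" "gpart 3 m:fN r M" using f(1) by auto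
  have ne: "gpart 1 m ~= gpart 2 m" "gpart 2 m ~= gpart 3 m" "gpart 1 m ~= glo m" "gpart 3 m ~= ghi m" "gpart 1 m ~= gpart 3 m"
    unfolding gpart_def glo_def ghi_def by auto
  show "conn E (?Z m)" by (intro conn_Un E(1) imodelD(1)[OF Z] f1) (use imodelD(4)[OF Z f1(1,2) ne(1) f(5)] imodelD(4)[OF Z f1(2,3) ne(2) f(6)] in \<open>auto
    simp: touch_def\<close>)
  show "EX x:?Z m. P m x" "EX x:?Z m. Q m x" unfolding P_def Q_def using imodelD(4)[OF Z f1(1) f(2) ne(3) f(7)] imodelD(4)[OF Z f1(3) f(3) ne(4) f(8)] by auto
  fix x y
  assume h: "x : ?Z m" "y : ?Z m" "P m x" "Q m y"
  obtain i j where ij: "1 <= i" "i <= 3" "x:Z (gpart i m)" "1 <= j" "j <= 3" "y:Z (gpart j m)" using part h by meson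
  have nb: "gpart k m ~= glo m" "gpart k m ~= ghi m" if "1 <= k" for k using that unfolding gpart_def glo_def ghi_def by auto
  have i: "i = 1" using h(3) Zn[OF f(1)[OF ij(1,2)] f(2) nb(1)[OF ij(1)] ij(3)] unfolding P_def using f(9)[OF ij(1,2)] f(4) by (metis fst_conv glo_def)
  have j: "j = 3" using h(4) Zn[OF f(1)[OF ij(4,5)] f(3) nb(2)[OF ij(4)] ij(6)] unfolding Q_def using f(9)[OF ij(4,5)] f(4) by (metis fst_conv ghi_def)
  show "x ~= y & (x, y)~:E" using Zn[OF f1(1,3) ne(5)] f(10) ij(3,6) unfolding i j by simp
 qed
 define ok where "ok m p \<longleftrightarrow> (case p of (a, q, z) => ipath E (a # q @ [z]) & q ~= [] & set (a # q @ [z]) <= ?Z m & P m a & Q m z & (ALL x:set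
   (a # q @ [z]). (P m x --> x = a) & (Q m x --> x = z)))" for m p
 have "ALL m. EX p. ?e m --> ok m p" using link unfolding ok_def by simp
 from choice[OF this] obtain p where p: "ALL m. ?e m --> ok m (p m)" by auto
 define a q z where "a m = fst (p m)" and "q m = fst (snd (p m))" and "z m = snd (snd (p m))" for m
 have L0: "ipath E (a m # q m @ [z m]) & q m ~= [] & set (a m # q m @ [z m]) <= ?Z m & P m (a m) & Q m (z m) & (ALL x:set (a m # q m @ [z m]). (P m x --> x = a
   m) & (Q m x --> x = z m))" if m: "?e m" for m
 proof -
  have "ok m (a m, q m, z m)" using p m unfolding a_def q_def z_def prod.collapse by blast
  thus ?thesis unfolding ok_def prod.case .
 qed
 note L = L0[THEN conjunct1] L0[THEN conjunct2, THEN conjunct1] L0[THEN conjunct2, THEN conjunct2, THEN conjunct1] L0[THEN conjunct2, THEN conjunct2, THEN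
   conjunct2, THEN conjunct1] L0[THEN conjunct2, THEN conjunct2, THEN conjunct2, THEN conjunct2, THEN conjunct1] L0[THEN conjunct2, THEN conjunct2, THEN
   conjunct2, THEN conjunct2, THEN conjunct2]
 let ?p = "%m. set (a m # q m @ [z m])"
 have F1: "x ~= y & (x, y)~:E" if h: "?e m" "?e m'" "m ~= m'" "x : ?p m" "y : ?p m'" for m m' x y
 proof -
  obtain i j where ij: "1 <= i" "i <= 3" "x:Z (gpart i m)" "1 <= j" "j <= 3" "y:Z (gpart j m')"
    using part[of x m] part[of y m'] L(3)[OF h(1)] L(3)[OF h(2)] h(4,5) by blast
  show ?thesis using Zn[OF gpart_facts(1)[of m r M i] gpart_facts(1)[of m' r M j] _ ij(3,6)] h ij gpart_sep[of m r M m' i j] by simp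
 qed
 have F2: "x ~= y & ((x, y):E --> b = glo m & x = a m | b = ghi m & x = z m)" if h: "?e m" "b:gN r M" "fst b = 0" "x : ?p m" "y:Z b" for m b x y
 proof -
  obtain i where i: "1 <= i" "i <= 3" "x:Z (gpart i m)" using part[of x m] L(3)[OF h(1)] h(4) by auto
  have "gpart i m ~= b" using i(1) h(3) unfolding gpart_def by auto
  note n = Zn[OF gpart_facts(1)[of m r M i] gN_nodes[OF h(2,3)] this i(3) h(5)]
  have "b = glo m | b = ghi m" if "(x, y):E" using n gpart_facts(9)[of m r M i b] h i that by auto
  moreover have "x = a m" if "(x, y):E" "b = glo m" using L(6)[OF h(1)] h(4,5) that unfolding P_def by auto
  moreover have "x = z m" if "(x, y):E" "b = ghi m" using L(6)[OF h(1)] h(4,5) that unfolding Q_def by auto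
  ultimately show ?thesis using n h(1) i by auto
 qed
 have Y0: "x ~= y & (x, y)~:E" if "b:gN r M" "fst b = 0" "b':gN r M" "fst b' = 0" "b ~= b'" "x:Z b" "y:Z b'" for b b' x y
   using Zn[OF gN_nodes gN_nodes, of b b' x y] fE_nodes[of b b'] that by simp
 define u where "u b m = (if b = glo m then a m else z m)" for b m
 define t where "t b m = (if b = glo m then hd (q m) else last (q m))" for b m
 define Y where "Y n = (if fst n = 0 then Z n Un {u n m | m. m:gN r M & (n, m):gE} else set (q n))" for n
 have gem: "?e m" "b = glo m | b = ghi m" if "m:gN r M" "(b, m):gE" "fst b = 0" for m b using that gE_lohi[OF that(1,3)] by auto
 have up: "u b m : ?p m" for b m unfolding u_def by auto
 have ut: "t b m:set (q m)" "(t b m, u b m):E" "x:set (q m) ==> (x, u b m):E ==> x = t b m" "u b m~:set (q m)" if "?e m" for b m x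
 proof -
  note I = ipath_ends[OF L(1,2)[OF \<open>?e m\<close>] E(1)]
  show "t b m:set (q m)" "u b m~:set (q m)" using L(2)[OF \<open>?e m\<close>] I(1,2) unfolding t_def u_def by auto
  show "(t b m, u b m):E" using fs[OF I(4)] I(5) unfolding t_def u_def by simp
  show "x:set (q m) ==> (x, u b m):E ==> x = t b m" using I(8,9)[of x] fs[of x "u b m"] unfolding t_def u_def by auto
 qed
 have uu: "u b m ~= u b' m & (u b m, u b' m)~:E" if "?e m" "b = glo m | b = ghi m" "b' = glo m | b' = ghi m" "b ~= b'" for m b b'
   using ipath_ends(3,6)[OF L(1,2)[OF that(1)] E(1)] fs[of "z m" "a m"] that(2-4) unfolding u_def by auto
 have uZ: "EX y:Z b. (u b m, y):E" if "m:gN r M" "(b, m):gE" "fst b = 0" for b m using L(4,5)[OF gem(1)[OF that]] gem(2)[OF that]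
   unfolding u_def P_def Q_def by auto
 have uY: "b' = b" if h: "m:gN r M" "(b, m):gE" "fst b = 0" "b':gN r M" "fst b' = 0" "y:Z b'" "(u b m, y):E" for b b' m y
   using F2[OF gem(1)[OF h(1-3)] h(4,5) up[of b m] h(6)] h(7) gem(2)[OF h(1-3)] ipath_ends(3)[OF L(1,2)[OF gem(1)[OF h(1-3)]] E(1)] unfolding u_def
   by (simp split: if_splits)
 have NN: "x ~= y & (x, y)~:E" if h: "b:gN r M" "fst b = 0" "b':gN r M" "fst b' = 0" "b ~= b'" "x:Y b" "y:Y b'" for b b' x y
 proof -
  have zu: "x ~= y & (x, y)~:E" if "b:gN r M" "fst b = 0" "b':gN r M" "fst b' = 0" "b ~= b'" "x:Z b" "y = u b' m" "m:gN r M" "(b', m):gE" for b b' x y m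
    using uY[OF that(8,9,4,1,2,6)] F2[OF gem(1)[OF that(8,9,4)] that(1,2) up that(6)] that(5,7) fs by metis
  consider "x:Z b" "y:Z b'" | m where "x:Z b" "y = u b' m" "m:gN r M" "(b', m):gE" | m where "y:Z b'" "x = u b m" "m:gN r M" "(b, m):gE" | m m' where "x = u b
    m" "m:gN r M" "(b, m):gE" "y = u b' m'" "m':gN r M" "(b', m'):gE" using h(6,7) unfolding Y_def h(2,4) by auto
  thus ?thesis
  proof cases
   case 1
   thus ?thesis using Y0[OF h(1-5)] by simp
  next
   case 2
   thus ?thesis using zu[OF h(1-5)] by simp
  next
   case 3
   thus ?thesis using zu[OF h(3,4,1,2) h(5)[symmetric]] fs by metis
  next
   case 4
   show ?thesis
   proof (cases "m = m'")
    case True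
    have "b' = glo m | b' = ghi m" using gem(2)[OF 4(5,6) h(4)] True by simp
    from uu[OF gem[OF 4(2,3) h(2)] this h(5)] show ?thesis unfolding 4(1,4) True[symmetric] .
   next
    case False
    from F1[OF gem(1)[OF 4(2,3) h(2)] gem(1)[OF 4(5,6) h(4)] False up up] show ?thesis unfolding 4(1,4) .
   qed
  qed
 qed
 have NM: "x ~= y & ((x, y):E --> (b, m):gE & x = t b m & y = u b m)" if h: "b:gN r M" "fst b = 0" "?e m" "x:Y m" "y:Y b" for b m x y
 proof -
  have x: "x:set (q m)" "x : ?p m" "x ~= a m" "x ~= z m" using h(3,4) ipath_ends(1,2)[OF L(1,2)[OF h(3)] E(1)] unfolding Y_def by auto
  consider "y:Z b" | m' where "y = u b m'" "m':gN r M" "(b, m'):gE" using h(5) unfolding Y_def h(2) by auto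
  thus ?thesis
  proof cases
   case 1
   thus ?thesis using F2[OF h(3,1,2) x(2)] x by simp
  next
   case 2
   show ?thesis
   proof (cases "m = m'")
    case True
    show ?thesis using ut(4)[OF h(3), of b] x(1) ut(3)[OF h(3) x(1)] 2(3) unfolding 2(1) True[symmetric] by auto
   next
    case False
    from F1[OF h(3) gem(1)[OF 2(2,3) h(2)] False x(2) up] show ?thesis unfolding 2(1) by simp
   qed
  qed
 qed
 have MM: "x ~= y & (x, y)~:E" if "?e m" "?e m'" "m ~= m'" "x:Y m" "y:Y m'" for m m' x y using F1[OF that(1-3), of x y] that unfolding Y_def by auto
 have uYb: "u b m:Y b" if "m:gN r M" "(b, m):gE" "fst b = 0" for b m unfolding Y_def if_P[OF that(3)] using that by blast
 have qY: "Y m = set (q m)" if "?e m" for m unfolding Y_def by (rule if_not_P) (use that in blast)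
 have "imodel E V (gN r M) gE Y" unfolding imodel_def
 proof (intro conjI ballI impI)
  fix n
  assume n: "n:gN r M"
  have pV: "?p m <= V" if "?e m" for m
  proof
   fix x
   assume "x : ?p m"
   then obtain i where i: "1 <= i" "i <= 3" "x:Z (gpart i m)" using L(3)[OF \<open>?e m\<close>] part[of x m] by auto
   show "x:V" using gpart_facts(1)[of m r M i] \<open>?e m\<close> i imodelD(2)[OF Z] by blast
  qed
  show "conn E (Y n)"
  proof (cases "fst n = 0")
   case True
   have "Y n = Z n Un (UN m:{m:gN r M. (n, m):gE}. {u n m})" using True unfolding Y_def by auto
   moreover have "conn E (Z n Un (UN m:{m:gN r M. (n, m):gE}. {u n m}))" by (rule conn_UN[OF E(1) imodelD(1)[OF Z gN_nodes[OF n True]]]) (simp, use uZ[OF _ _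
     True] fs in \<open>unfold touch_def, blast\<close>)
   ultimately show ?thesis by simp
  next
   case False
   thus ?thesis using ipath_ends(7)[OF L(1,2) E(1), of n] n unfolding Y_def by simp
  qed
  show "Y n <= V"
  proof
   fix x
   assume x: "x:Y n"
   show "x:V"
   proof (cases "fst n = 0")
    case True
    then consider "x:Z n" | m where "x = u n m" "m:gN r M" "(n, m):gE" using x unfolding Y_def by auto
    thus ?thesis
    proof cases
     case 1
     thus ?thesis using imodelD(2)[OF Z gN_nodes[OF n True]] by auto
    next
     case 2
     thus ?thesis using pV[OF gem(1)[OF 2(2,3) True]] up[of n m] by auto
    qed
   next
    case False
    thus ?thesis using x pV[of n] n unfolding Y_def by auto
   qed
  qed
 next
  fix n m
  assume nm: "n:gN r M" "m:gN r M" "n ~= m"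
  have dist: "x ~= y" "(x, y):E ==> (n, m):gE" if xy: "x:Y n" "y:Y m" for x y
  proof -
   have "x ~= y & ((x, y):E --> (n, m):gE)" using NN[of n m x y] nm xy NM[of n m y x] fs NM[of m n x y] gE_sym symD MM[of n m x y] by metis
   thus "x ~= y" "(x, y):E ==> (n, m):gE" by auto
  qed
  show "Y n Int Y m = {}" using dist(1) by auto
  have conv: "EX x:Y n. EX y:Y m. (x, y):E" if h: "n:gN r M" "m:gN r M" "(n, m):gE" "fst n = 0" for n m
    using ut(1,2)[OF gem(1)[OF h(2-4)], of n] uYb[OF h(2-4)] qY[OF gem(1)[OF h(2-4)]] fs by blast
  show "(EX x:Y n. EX y:Y m. (x, y):E) \<longleftrightarrow> (n, m):gE"
  proof
   assume nme: "(n, m):gE"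
   hence mn: "(m, n):gE" using gE_sym by (meson symD)
   show "EX x:Y n. EX y:Y m. (x, y):E"
   proof (cases "fst n = 0")
    case True
    thus ?thesis by (rule conv[OF nm(1,2) nme])
   next
    case False
    hence "fst m = 0" using gE_node_edge[OF nme] by simp
    from conv[OF nm(2,1) mn this] obtain x y where "x:Y m" "y:Y n" "(x, y):E" by auto
    thus ?thesis using fs by auto
   qed
  qed (use dist in blast)
 qed
 moreover have "ported E (Y b) (Y m) (t b m)" if h: "b:gN r M" "m:gN r M" "(b, m):gE" "fst b = 0" for b m unfolding ported_def
   using ut(1,2)[OF gem(1)[OF h(2-4)], of b] qY[OF gem(1)[OF h(2-4)]] NM[OF h(1,4) gem(1)[OF h(2-4)]] uYb[OF h(2-4)] by blast
 ultimately show ?thesis by blast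
qed

definition zigzag :: "(nat => 'b) => (nat => 'b) => nat => nat => 'b set" where
  "zigzag f g l u = insert (g l) (UN i:{l<..<u}. {f i, g i})"

lemma zigzag_conn: assumes "sym J" "!!i. (f i, g i):J & (g i, f (Suc i)):J" shows "conn J (zigzag f g l (Suc (l + n)))"
proof (induction n)
 case (Suc n)
 let ?S = "zigzag f g l (Suc (l + n))"
 have "g (l + n) : ?S" unfolding zigzag_def by (cases n) auto
 hence "conn J (insert (f (Suc (l + n))) ?S)" using conn_insert[OF assms(1) Suc] assms(2) by simp
 hence "conn J (insert (g (Suc (l + n))) (insert (f (Suc (l + n))) ?S))" by (rule conn_insert[OF assms(1)]) (use assms(2) in auto)
 moreover have "{l<..<Suc (l + Suc n)} = insert (Suc (l + n)) {l<..<Suc (l + n)}" by auto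
 hence "zigzag f g l (Suc (l + Suc n)) = insert (g (Suc (l + n))) (insert (f (Suc (l + n))) ?S)" unfolding zigzag_def by auto
 ultimately show ?case by simp
next
 case 0
 have "{l<..<Suc l} = {}" by auto
 thus ?case by (simp add: zigzag_def)
qed

definition gsub :: "(nat => nat) => (nat => nat) => nat * nat * nat => (nat * nat * nat) set" where
  "gsub sigma c = (%(k, s, rho). if k = 0 then {(0, sigma s, c rho)} else if k = 1 then zigzag (%x. (0, sigma s, x)) (%x. (1, sigma s, x)) (c rho) (c (Suc
    rho)) else zigzag (%y. (0, y, c rho)) (%y. (2, y, c rho)) (sigma s) (sigma (Suc s)))"

lemma gsub_model:
  assumes m: "strict_mono sigma" "strict_mono c" and r: "!!s. s < r' ==> sigma s < r" "!!rho. 1 <= rho ==> rho <= M' ==> 1 <= c rho & c rho <= M"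
  shows "imodel gE (gN r M) (gN r' M') gE (gsub sigma c)"
proof -
 have lt: "sigma s < sigma (Suc s)" "c s < c (Suc s)" for s using m by (auto simp: strict_mono_Suc_iff)
 have mem: "(q, y, x):gsub sigma c (k, s, rho) \<longleftrightarrow> (if k = 0 then q = 0 & y = sigma s & x = c rho else if k = 1 then y = sigma s & (q = 1 & c
   rho <= x & x < c (Suc rho) | q = 0 & c rho < x & x < c (Suc rho)) else x = c rho & (q = 2 & sigma s <= y & y < sigma (Suc s) | q = 0 & sigma s < y & y <
   sigma (Suc s)))" for q y x k s rho using lt[of s] lt[of rho] unfolding gsub_def zigzag_def by auto
 have bt: "i = j" if "strict_mono f" "f i <= x" "x < f (Suc i)" "f j <= x" "x < f (Suc j)" for f :: "nat => nat" and i j x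
   using that(2-5) strict_mono_less[OF that(1), of i "Suc j"] strict_mono_less[OF that(1), of j "Suc i"] by simp
 have eq: "i = j" if "strict_mono f" "f i = f j" for f :: "nat => nat" and i j using strict_mono_eq[OF that(1)] that(2) by simp
 have nb: "~(f i < f j & f j < f (Suc i))" if "strict_mono f" for f :: "nat => nat" and i j
   using strict_mono_less[OF that, of i j] strict_mono_less[OF that, of j "Suc i"] by simp
 have uniq: "n = n'" if h: "n:gN r' M'" "n':gN r' M'" "a:gsub sigma c n" "a:gsub sigma c n'" for n n' a
 proof -
  obtain k s rho k' s' rho' q y x where n: "n = (k, s, rho)" "n' = (k', s', rho')" "a = (q, y, x)" by (metis prod_cases3)
  have k: "k = 0 | k = 1 | k = 2" "k' = 0 | k' = 1 | k' = 2" using h(1,2) unfolding n gN_def by auto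
  show ?thesis using h(3,4) k unfolding n mem by (elim disjE) (auto dest: bt[OF m(1)] bt[OF m(2)] eq[OF m(1)] eq[OF m(2)] simp: nb[OF m(1), simplified] nb[OF
    m(2), simplified] intro: bt[OF m(1)] bt[OF m(2)] bt[OF m(1) less_imp_le _ less_imp_le] bt[OF m(2) less_imp_le _ less_imp_le])
 qed
 have step: "n = n' | gnext n n'" if h: "n:gN r' M'" "n':gN r' M'" "a:gsub sigma c n" "b:gsub sigma c n'" "gnext a b" for n n' a b
 proof -
  obtain k s rho where n: "n = (k, s, rho)" by (cases n)
  obtain k' s' rho' where n': "n' = (k', s', rho')" by (cases n')
  have k: "k < 3" "k' < 3" and g: "(0, s, rho):gN r' M'" "(0, s', rho'):gN r' M'" "k = 1 ==> (0, s, Suc rho):gN r' M'" "k = 2 ==> (0, Suc s, rho):gN r' M'"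
    using h(1,2) unfolding n n' gN_def by auto
  from h(5) obtain y x where "a = (0, y, x) & b = (1, y, x) | a = (1, y, x) & b = (0, y, Suc x) | a = (0, y, x) & b = (2, y, x) | a = (2, y, x) & b = (0, Suc
    y, x)" unfolding gnext_def by auto
  then consider (1) "a = (0, y, x)" "b = (1, y, x)" | (2) "a = (1, y, x)" "b = (0, y, Suc x)" | (3) "a = (0, y, x)" "b = (2, y, x)" | (4) "a = (2, y, x)" "b =
    (0, Suc y, x)" by auto
  thus ?thesis
  proof cases
   case 1
   have b: "k' = 1" "y = sigma s'" "c rho' <= x" "x < c (Suc rho')" using h(4) unfolding 1 n' mem by (auto split: if_splits)
   show ?thesis
   proof (cases "x = c rho'")
    case True
    thus ?thesis using uniq[OF h(1) g(2) h(3)] b unfolding 1 mem using b(1) unfolding n' gnext_iff by (simp add: gnext_iff)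
   next
    case False
    thus ?thesis using uniq[OF h(1,2,3)] b unfolding 1 n' mem by simp
   qed
  next
   case 2
   have b: "k = 1" "y = sigma s" "c rho <= x" "x < c (Suc rho)" using h(3) unfolding 2 n mem by (auto split: if_splits)
   show ?thesis
   proof (cases "Suc x = c (Suc rho)")
    case True
    thus ?thesis using uniq[OF h(2) g(3)[OF b(1)] h(4)] b unfolding 2 mem using b(1) unfolding n by (simp add: gnext_iff)
   next
    case False
    thus ?thesis using uniq[OF h(2,1,4)] b unfolding 2 n mem by simp
   qed
  next
   case 3
   have b: "k' = 2" "x = c rho'" "sigma s' <= y" "y < sigma (Suc s')" using h(4) k(2) unfolding 3 n' mem by (auto split: if_splits)
   show ?thesis
   proof (cases "y = sigma s'")
    case True
    thus ?thesis using uniq[OF h(1) g(2) h(3)] b unfolding 3 mem using b(1) unfolding n' by (simp add: gnext_iff)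
   next
    case False
    thus ?thesis using uniq[OF h(1,2,3)] b unfolding 3 n' mem by simp
   qed
  next
   case 4
   have b: "k = 2" "x = c rho" "sigma s <= y" "y < sigma (Suc s)" using h(3) k(1) unfolding 4 n mem by (auto split: if_splits)
   show ?thesis
   proof (cases "Suc y = sigma (Suc s)")
    case True
    thus ?thesis using uniq[OF h(2) g(4)[OF b(1)] h(4)] b unfolding 4 mem using b(1) unfolding n by (simp add: gnext_iff)
   next
    case False
    thus ?thesis using uniq[OF h(2,1,4)] b unfolding 4 n mem by simp
   qed
  qed
 qed
 have conv: "EX a:gsub sigma c n. EX b:gsub sigma c n'. gnext a b" if h: "gnext n n'" for n n'
 proof -
  obtain s rho where "(n, n') : {((0, s, rho), (1, s, rho)), ((1, s, rho), (0, s, Suc rho)), ((0, s, rho), (2, s, rho)), ((2, s, rho), (0, Suc s, rho))}"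
    using h unfolding gnext_def by auto
  moreover have "(1, sigma s, c (Suc rho) - 1):gsub sigma c (1, s, rho)" "(2, sigma (Suc s) - 1, c rho):gsub sigma c (2, s, rho)" "(1, sigma s, c rho):gsub
    sigma c (1, s, rho)" "(2, sigma s, c rho):gsub sigma c (2, s, rho)" "(0, sigma s, c rho):gsub sigma c (0, s, rho)" "(0, sigma (Suc s), c rho):gsub sigma c
    (0, Suc s, rho)" "(0, sigma s, c (Suc rho)):gsub sigma c (0, s, Suc rho)" using lt[of s] lt[of rho] by (auto simp: mem)
  moreover have "gnext (1, sigma s, c (Suc rho) - 1) (0, sigma s, c (Suc rho))" "gnext (2, sigma (Suc s) - 1, c rho) (0, sigma (Suc s), c rho)" "gnext (0,
    sigma s, c rho) (1, sigma s, c rho)" "gnext (0, sigma s, c rho) (2, sigma s, c rho)" using lt[of s] lt[of rho] by (auto simp: gnext_iff)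
  ultimately show ?thesis by auto
 qed
 have EI: "(a, b):gE \<longleftrightarrow> gnext a b | gnext b a" for a b unfolding gE_def by simp
 show ?thesis unfolding imodel_def
 proof (intro conjI ballI impI)
  fix n
  assume n: "n:gN r' M'"
  obtain k s rho where ks: "n = (k, s, rho)" by (cases n)
  have b: "k < 3" "s < r'" "1 <= rho" "rho <= M'" "k = 1 ==> rho < M'" "k = 2 ==> Suc s < r'" using n unfolding ks gN_def by auto
  have sc: "conn gE (zigzag f g l u)" if "l < u" "!!i. gnext (f i) (g i) & gnext (g i) (f (Suc i))" for f g l u
    using zigzag_conn[OF gE_sym, of f g l "u - Suc l"] that by (simp add: EI)
  show "conn gE (gsub sigma c n)" unfolding ks gsub_def using lt by (auto intro!: sc simp: gnext_iff)
  show "gsub sigma c n <= gN r M"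
  proof
   fix a
   assume a: "a:gsub sigma c n"
   obtain q y x where qyx: "a = (q, y, x)" by (cases a)
   show "a:gN r M" using r(1)[of s] r(1)[of "Suc s"] r(2)[of rho] r(2)[of "Suc rho"] b a b(1) unfolding ks qyx mem gN_def by (auto split: if_splits)
  qed
 next
  fix n m
  assume nm: "n:gN r' M'" "m:gN r' M'" "n ~= m"
  show "gsub sigma c n Int gsub sigma c m = {}" using uniq[OF nm(1,2)] nm(3) by auto
  show "(EX a:gsub sigma c n. EX b:gsub sigma c m. (a, b):gE) \<longleftrightarrow> (n, m):gE"
    using step[OF nm(1,2)] step[OF nm(2,1)] nm(3) conv[of n m] conv[of m n] unfolding EI by blast
 qed
qed

definition gdir :: "nat => nat * nat * nat => nat * nat * nat" where
  "gdir d = (%(k, s, rho). if d = 0 then (1, s, rho - 1) else if d = 1 then (1, s, rho) else (2, s, rho))"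

definition inner_node :: "nat => nat => nat * nat * nat => bool" where
  "inner_node r M = (%(k, s, rho). k = 0 & Suc s < r & 2 <= rho & rho < M)"

lemma gdir_facts:
  assumes "inner_node r M b" "d < 3"
  shows "b:gN r M" "gdir d b:gN r M" "(b, gdir d b):gE" "fst b = 0" "fst (gdir d b) ~= 0" "e < 3 ==> d ~= e ==> gdir d b ~= gdir e b"
  using assms unfolding inner_node_def gdir_def gE_def less3 by (cases b; auto simp: gN_def gnext_iff)+

lemma ported_union:
  assumes "ported E Y (W x0) t" "x0:X" "!!x v y. x:X ==> v:W x ==> y:Y ==> (v, y):E ==> x = x0"
  shows "ported E Y (UN x:X. W x) t"
  using assms unfolding ported_def by blast

lemma ported_compose:
  assumes "sym E" "imodel E V (gN r M) gE Y" "ported E (Y b) (Y m) t" "X <= gN r M" "b:gN r M" "m:X" "b~:X" and "!!x. x:X ==> (b, x):gE ==> x = m"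
  shows "ported E (Y b) (UN x:X. Y x) t"
proof (rule ported_union[where W = Y, OF assms(3,6)])
 fix x v y
 assume h: "x:X" "v:Y x" "y:Y b" "(v, y):E"
 have "(y, v):E" using assms(1) h(4) by (rule symD)
 hence "(b, x):gE" using assms(7) imodelD(5)[OF assms(2,5), of x y v] h assms(4) by auto
 thus "x = m" by (rule assms(8)[OF h(1)])
qed

lemma extend_mono: assumes "finite S" "n <= card (S :: nat set)" shows "EX f. strict_mono f & (ALL i<n. f i:S)"
proof -
 obtain f where f: "ALL i<n. f i:S" "ALL i j. i < j & j < n --> f i < (f j :: nat)" using increasing_enum[OF assms] by auto
 define g where "g i = (if i < n then f i else Suc (Max S + i))" for i
 have "f i <= Max S" if "i < n" for i using f(1) assms(1) that by simp
 hence "strict_mono g" unfolding strict_mono_def g_def using f(2) by (auto simp: le_imp_less_Suc trans_le_add1)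
 thus ?thesis using f(1) unfolding g_def by auto
qed

lemma uniform_grid: "EX r M. ALL (E :: 'a rel) V Y t. sym E --> irrefl E --> finite V --> imodel E V (gN r M) gE Y --> (ALL b:gN r M. ALL m:gN r M. (b, m):gE
  --> fst b = 0 --> ported E (Y b) (Y m) (t b m)) --> (EX Y' t' tri. imodel E V (gN r' M') gE Y' & (ALL b. inner_node r' M' b --> (ALL d<3. ported E (Y' b) (Y'
  (gdir d b)) (t' b d)) & junction E (Y' b) (t' b) tri))"
proof -
 define r where "r = Suc (2 * r')"
 define M where "M = Suc M' * 2 ^ (2 * r') + 3"
 have main: "EX Y' t' tri. imodel E V (gN r' M') gE Y' & (ALL b. inner_node r' M' b --> (ALL d<3. ported E (Y' b) (Y' (gdir d b)) (t' b d)) & junction E (Y' b)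
   (t' b) tri)" if E: "sym E" "irrefl E" "finite V" and Y: "imodel E V (gN r M) gE Y" and t: "ALL b:gN r M. ALL m:gN r M. (b, m):gE --> fst b = 0 --> ported E
   (Y b) (Y m) (t b m)" for E :: "'a rel" and V Y t
 proof -
  define p where "p b d = t b (gdir d b)" for b d
  have pt: "ported E (Y b) (Y (gdir d b)) (p b d)" if "inner_node r M b" "d < 3" for b d using t gdir_facts[OF that] unfolding p_def by simp
  have jt: "EX tri. junction E (Y b) (p b) tri" if b: "inner_node r M b" for b
  proof (rule junction_exists[OF E(1,2)])
   have bN: "b:gN r M" using gdir_facts(1)[OF b, of 0] by simp
   show "conn E (Y b)" using imodelD(1)[OF Y bN] .
   show "finite (Y b)" by (rule finite_subset[OF imodelD(2)[OF Y bN] E(3)])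
   have pY: "p b d:Y (gdir d b)" "b ~= gdir d b" if "d < 3" for d using pt[OF b that] gdir_facts(4,5)[OF b that] unfolding ported_def by auto
   show "p b d~:Y b" if "d < 3" for d using pY[OF that] imodelD(3)[OF Y bN gdir_facts(2)[OF b that]] by auto
   show "p b d ~= p b e & (p b d, p b e)~:E" if "d < 3" "e < 3" "d ~= e" for d e
   proof -
    have ne: "gdir d b ~= gdir e b" by (rule gdir_facts(6)[OF b that])
    have "(gdir d b, gdir e b)~:gE" using gE_node_edge[of "gdir d b" "gdir e b"] gdir_facts(5)[OF b that(1)] gdir_facts(5)[OF b that(2)] by auto
    moreover note I = imodelD(3,5)[OF Y gdir_facts(2)[OF b that(1)] gdir_facts(2)[OF b that(2)] ne]
    have "p b d ~= p b e" using I(1) pY(1)[OF that(1)] pY(1)[OF that(2)] by auto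
    ultimately show ?thesis using I(2)[OF pY(1)[OF that(1)] pY(1)[OF that(2)]] by auto
   qed
   show "EX y:Y b. ALL y':Y b. ((p b d, y'):E) = (y' = y)" if "d < 3" for d using pt[OF b that] unfolding ported_def by simp
  qed
  define T where "T x = {s. s < 2 * r' & junction E (Y (0, s, x)) (p (0, s, x)) True}" for x
  have "M' * card (Pow {..<2 * r'}) < card {2..<M}" unfolding M_def by (simp add: card_Pow)
  then obtain C where C: "M' < card {x : {2..<M}. T x = C}" by (rule pigeonhole_fibre[rotated 2, of M' "Pow {..<2 * r'}" "{2..<M}" T]) (auto simp: T_def)
  have C2: "C <= {..<2 * r'}"
  proof -
   have "{x : {2..<M}. T x = C} ~= {}" using C by (metis card.empty not_less_zero)
   thus ?thesis unfolding T_def by auto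
  qed
  have "card C + card ({..<2 * r'} - C) = 2 * r'" using C2 by (simp add: card_Diff_subset finite_subset[OF C2] card_mono[OF _ C2, simplified])
  then obtain tri S where S: "S <= {..<2 * r'}" "r' <= card S" "S = (if tri then C else {..<2 * r'} - C)" using C2
    by (cases "r' <= card C") (metis, metis Diff_subset le_cases mult_2 nat_add_left_cancel_le trans_le_add1 not_le add_less_le_mono order_less_irrefl)
  obtain sigma where sigma: "strict_mono sigma" "ALL i<r'. sigma i:S" using extend_mono[OF finite_subset[OF S(1)] S(2)] by auto
  obtain c where c: "strict_mono c" "ALL i<Suc M'. c i : {x : {2..<M}. T x = C}" using extend_mono[of "{x : {2..<M}. T x = C}" "Suc M'"] C by auto
  have sigmar: "sigma s < 2 * r'" if "s < r'" for s using sigma(2) S(1) that by auto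
  have cM: "2 <= c x & c x < M & T (c x) = C" if "x <= M'" for x using c(2) that by auto
  have X: "imodel gE (gN r M) (gN r' M') gE (gsub sigma c)"
  proof (rule gsub_model[OF sigma(1) c(1)])
   show "sigma s < r" if "s < r'" for s using sigmar[OF that] unfolding r_def by simp
   show "1 <= c x & c x <= M" if "1 <= x" "x <= M'" for x using cM[OF that(2)] by simp
  qed
  define Y' where "Y' n = (UN x:gsub sigma c n. Y x)" for n
  define g where "g = (%(k :: nat, s, x). (0 :: nat, sigma s, c x))"
  have "(ALL d<3. ported E (Y' b) (Y' (gdir d b)) (p (g b) d)) & junction E (Y' b) (p (g b)) tri" if b: "inner_node r' M' b" for b
  proof -
   obtain s x where bs: "b = (0, s, x)" "Suc s < r'" "2 <= x" "x < M'" using b unfolding inner_node_def by auto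
   have gb: "g b = (0, sigma s, c x)" unfolding g_def bs(1) by simp
   note gb' = gb[unfolded bs(1)]
   have gi: "inner_node r M (g b)" unfolding inner_node_def gb using sigmar[of s] cM[of x] bs unfolding r_def by auto
   have sub: "gsub sigma c b = {g b}" unfolding gsub_def bs(1) gb' by simp
   have Yb: "Y' b = Y (g b)" unfolding Y'_def sub by simp
   have lt: "c (x - 1) < c x" "c x < c (Suc x)" "sigma s < sigma (Suc s)" using c(1) sigma(1) bs(3) by (auto simp: strict_mono_less)
   have "ported E (Y (g b)) (Y' (gdir d b)) (p (g b) d)" if d: "d < 3" for d unfolding Y'_def
   proof (rule ported_compose[OF E(1) Y pt[OF gi d] imodelD(2)[OF X gdir_facts(2)[OF b d]] gdir_facts(1)[OF gi d]])
    show "gdir d (g b):gsub sigma c (gdir d b)" using lt bs(3) unfolding bs(1) gb' gdir_def gsub_def zigzag_def by auto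
    show "g b~:gsub sigma c (gdir d b)" using gdir_facts(4,5)[OF b d] imodelD(3)[OF X gdir_facts(1,2)[OF b d]] sub by fastforce
    fix z
    assume z: "z:gsub sigma c (gdir d b)" "(g b, z):gE"
    thus "z = gdir d (g b)" using d lt bs(3) unfolding less3 bs(1) gb' gdir_def gsub_def zigzag_def gE_def by (elim disjE) (auto simp: gnext_iff)
   qed
   moreover have "junction E (Y (g b)) (p (g b)) tri"
   proof -
    have "junction E (Y (g b)) (p (g b)) True \<longleftrightarrow> tri" using sigma(2) cM[of x] bs unfolding S(3) gb T_def by auto
    thus ?thesis using jt[OF gi] by (metis (full_types))
   qed
   ultimately show ?thesis unfolding Yb by simp
  qed
  moreover have "imodel E V (gN r' M') gE Y'" unfolding Y'_def by (rule imodel_compose[OF E(1) Y X])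
  ultimately show ?thesis by (intro exI[of _ Y'] exI[of _ "%b. p (g b)"] exI[of _ tri]) blast
 qed
 thus ?thesis by blast
qed

subsection \<open>Walls and their line graphs\<close>

definition gr :: "'a set => 'a rel => 'a pair_pre_digraph" where
  "gr X A = \<lparr>pverts = X, parcs = A\<rparr>"

lemma gr_simps [simp]: "pverts (gr X A) = X" "parcs (gr X A) = A" unfolding gr_def by auto

lemma pair_graph_gr: "finite X ==> A <= X \<times> X ==> sym A ==> irrefl A ==> pair_graph (gr X A)"
  by unfold_locales (auto simp: irrefl_def symmetric_def dest: finite_subset)

lemma iso_gr:
  assumes "A <= X \<times> X" "C <= Y \<times> Y" "bij_betw f X Y" "!!x y. x:X ==> y:X ==> (x, y):A \<longleftrightarrow> (f x, f y):C"
  shows "digraph_iso (with_proj (gr X A)) (with_proj (gr Y C))"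
proof -
 define h where "h = \<lparr>iso_verts = f, iso_arcs = map_prod f f, iso_head = snd, iso_tail = fst\<rparr>"
 have inj: "inj_on f X" and im: "f ` X = Y" using assms(3) unfolding bij_betw_def by auto
 have "pre_digraph.digraph_isomorphism (with_proj (gr X A)) h" unfolding pre_digraph.digraph_isomorphism_def h_def using inj assms(1)
   by (auto simp: wf_digraph_def inj_on_def with_proj_def) (blast dest: subsetD)+
 moreover have "map_prod f f ` A = C" using assms(1,4) assms(2) im by blast
 hence "app_iso h (with_proj (gr X A)) = with_proj (gr Y C)" unfolding h_def using im by simp
 ultimately show ?thesis unfolding digraph_iso_def by auto
qed

lemma iso_gr_inv:
  assumes "A <= X \<times> X" "C <= Y \<times> Y" "bij_betw f X Y" "!!x y. x:X ==> y:X ==> (x, y):A \<longleftrightarrow> (f x, f y):C"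
  shows "digraph_iso (with_proj (gr Y C)) (with_proj (gr X A))"
proof (rule iso_gr[OF assms(2,1) bij_betw_inv_into[OF assms(3)]])
 fix x y
 assume "x:Y" "y:Y"
 thus "(x, y):C \<longleftrightarrow> (inv_into X f x, inv_into X f y):A" using assms(4)[of "inv_into X f x" "inv_into X f y"] assms(3)
   by (auto simp: bij_betw_def)
qed

lemma contains_induced: assumes "pair_graph G" "X <= pverts G" shows "contains G (gr X (parcs G Int X \<times> X))"
proof -
 interpret pair_graph G by fact
 have "induced_subgraph (with_proj (gr X (parcs G Int X \<times> X))) (with_proj G)" unfolding induced_subgraph_def subgraph_def compatible_def
   using assms(2) wf_digraph by (auto simp: wf_digraph_def with_proj_def)
 moreover have "digraph_iso (with_proj (gr X (parcs G Int X \<times> X))) (with_proj (gr X (parcs G Int X \<times> X)))" by (rule iso_gr[of _ _ _ _ id]) auto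
 ultimately show ?thesis unfolding contains_def by auto
qed

definition sdg :: "'k set => 'k rel => ('k * 'k => 'k list) => 'k pair_pre_digraph" where
  "sdg KV D p = gr (KV Un (UN e:D. set (p e))) (UN e:D. ed (fst e # p e @ [snd e]) Un (ed (fst e # p e @ [snd e]))^-1)"

lemma ed_Cons: "ed (x # y # xs) = insert (x, y) (ed (y # xs))"
proof (intro set_eqI iffI)
 fix e
 assume "e:ed (x # y # xs)"
 then obtain i where i: "e = ((x # y # xs) ! i, (x # y # xs) ! Suc i)" "Suc i < length (x # y # xs)" unfolding ed_def by auto
 thus "e:insert (x, y) (ed (y # xs))" unfolding ed_def by (cases i) auto
next
 fix e
 assume "e:insert (x, y) (ed (y # xs))"
 then consider "e = (x, y)" | i where "e = ((y # xs) ! i, (y # xs) ! Suc i)" "Suc i < length (y # xs)" unfolding ed_def by auto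
 thus "e:ed (x # y # xs)" unfolding ed_def by cases (rule CollectI, rule exI[of _ 0], simp, rule CollectI, rule exI[of _ "Suc i" for i], auto)
qed

lemma ed_single [simp]: "ed [x] = {}" unfolding ed_def by simp

lemma ed_snoc: "xs ~= [] ==> ed (xs @ [y]) = insert (last xs, y) (ed xs)"
proof (induction xs)
 case (Cons x xs)
 show ?case
 proof (cases xs)
  case (Cons z zs)
  thus ?thesis using Cons.IH by (simp add: ed_Cons insert_commute)
 qed (simp add: ed_Cons)
qed simp

lemma ed_set: "(x, y):ed xs ==> x:set xs & y:set xs" unfolding ed_def by auto

lemma subdivision_sdg:
  assumes K: "finite KV" "D <= KV \<times> KV" "irrefl D" "!!a b. (a, b):D ==> (b, a)~:D" and p: "!!e. e:D ==> distinct (p e) & set (p e) Int KV = {}" "!!e f.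
    e:D ==> f:D ==> e ~= f ==> set (p e) Int set (p f) = {}"
  shows "subdivision_pair (gr KV (D Un D^-1)) (sdg KV D p)"
  using p
proof (induction "SUM e:D. length (p e)" arbitrary: p)
 case 0
 have fO: "finite D" using K(1,2) by (meson finite_SigmaI finite_subset)
 hence p0: "p e = []" if "e:D" for e using 0(1) that by simp
 hence "sdg KV D p = gr KV (D Un D^-1)" unfolding sdg_def by (intro arg_cong2[of _ _ _ _ gr]) (auto simp: ed_def)
 moreover have "subdivision_pair (gr KV (D Un D^-1)) (gr KV (D Un D^-1))"
 proof (rule subdivision_pair_base)
  interpret pair_graph "gr KV (D Un D^-1)" using K by (intro pair_graph_gr) (auto simp: irrefl_def sym_def)
  show "pair_bidirected_digraph (gr KV (D Un D^-1))" by unfold_locales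
 qed
 ultimately show ?case by simp
next
 case (Suc n)
 have fO: "finite D" using K(1,2) by (meson finite_SigmaI finite_subset)
 obtain e0 where e0: "e0:D" "p e0 ~= []" using Suc(2) by (metis list.size(3) nat.simps(3) sum.neutral)
 obtain q x where q: "p e0 = q @ [x]" using e0(2) append_butlast_last_id by metis
 obtain a w where aw: "e0 = (a, w)" by (cases e0)
 define p' where "p' = p(e0 := q)"
 have p'o: "p' f = p f" if "f ~= e0" for f using that unfolding p'_def by simp
 have p'e: "p' e0 = q" unfolding p'_def by simp
 have len: "(SUM e:D. length (p e)) = Suc (SUM e:D. length (p' e))" using fO e0(1) by (simp add: sum.remove[of D e0] q cong: sum.cong) (simp add: p'_def)
 have p1: "distinct (p' e) & set (p' e) Int KV = {}" if "e:D" for e using Suc(3)[OF that] q p'e p'o[of e] by (cases "e = e0") auto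
 have IH: "subdivision_pair (gr KV (D Un D^-1)) (sdg KV D p')"
 proof (rule Suc(1))
  show "n = (SUM e:D. length (p' e))" using len Suc(2) by simp
  show "set (p' e) Int set (p' f) = {}" if "e:D" "f:D" "e ~= f" for e f using Suc(4)[OF that] unfolding p'_def by (auto simp: q)
 qed (rule p1)
 define u where "u = last (a # q)"
 let ?f = "%p e. fst e # p e @ [snd e]"
 have e1: "ed (?f p' e0) = insert (u, w) (ed (a # q))" using ed_snoc[of "a # q" w] p'e aw unfolding u_def by simp
 have e2: "ed (?f p e0) = insert (x, w) (insert (u, x) (ed (a # q)))" using ed_snoc[of "a # q" x] ed_snoc[of "a # q @ [x]" w] q aw unfolding u_def by simp
 have KVw: "a:KV" "w:KV" "a ~= w" using K(2,3) e0(1) aw unfolding irrefl_def by auto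
 have xn: "x~:KV" "x~:set q" using Suc(3)[OF e0(1)] q by auto
 have qn: "set q Int KV = {}" using Suc(3)[OF e0(1)] q by auto
 have other: "(u, w)~:ed (?f p f) & (w, u)~:ed (?f p f)" if f: "f:D" "f ~= e0" for f
 proof (cases "u:set q")
  case True
  thus ?thesis using Suc(4)[OF e0(1) f(1)] f(2) q qn K(2) f(1) ed_set[of u w "?f p f"] ed_set[of w u "?f p f"] by fastforce
 next
  case False
  hence ua: "u = a" "u:KV" using KVw unfolding u_def by auto
  show ?thesis
  proof (cases "p f = []")
   case True
   thus ?thesis using f e0(1) K(4) aw ua by (auto simp: ed_def less_Suc_eq)
  next
   case False
   obtain b r c where f': "f = (b, c)" by (cases f)
   obtain y ys where ys: "p f = ys @ [y]" using False append_butlast_last_id by metis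
   have "y~:KV" "set ys Int KV = {}" using Suc(3)[OF f(1)] ys by auto
   moreover have "v:set ys" if "(z, v):ed (b # ys)" for z v using that unfolding ed_def by auto
   ultimately show ?thesis using ed_snoc[of "b # ys" y] ed_snoc[of "b # ys @ [y]" c] ys f' ua KVw by auto
  qed
 qed
 have par: "parcs (sdg KV D p') - {(u, w), (w, u)} Un {(u, x), (x, u), (x, w), (w, x)} = parcs (sdg KV D p)"
 proof -
  have split: "parcs (sdg KV D g) = ed (?f g e0) Un (ed (?f g e0))^-1 Un (UN e:D - {e0}. ed (?f g e) Un (ed (?f g e))^-1)" for g unfolding sdg_def
    using e0(1) by auto
  have rest: "(UN e:D - {e0}. ed (?f p' e) Un (ed (?f p' e))^-1) = (UN e:D - {e0}. ed (?f p e) Un (ed (?f p e))^-1)" (is "_ = ?R") using p'o by auto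
  show ?thesis using other unfolding split rest e1 e2 using ed_set[of u w "a # q"] ed_set[of w u "a # q"] KVw qn by auto
 qed
 have ver: "pverts (sdg KV D p') Un {x} = pverts (sdg KV D p)"
 proof -
  have split: "pverts (sdg KV D g) = KV Un set (g e0) Un (UN e:D - {e0}. set (g e))" for g unfolding sdg_def using e0(1) by auto
  show ?thesis using p'o unfolding split p'e q by auto
 qed
 have "subdivision_pair (gr KV (D Un D^-1)) (subdivide (sdg KV D p') (u, w) x)"
 proof (rule subdivision_pair_divide[OF _ _ IH])
  show "(u, w):parcs (sdg KV D p')" unfolding sdg_def using e0(1) e1 by auto
  have "x~:set (p' f)" if "f:D" for f using Suc(4)[OF e0(1) that] q p'e xn(2) p'o[of f] by (cases "f = e0") auto
  thus "x~:pverts (sdg KV D p')" unfolding sdg_def using xn(1) by auto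
 qed
 moreover have "subdivide (sdg KV D p') (u, w) x = sdg KV D p" unfolding subdivide.simps par ver by simp
 ultimately show ?case by simp
qed

lemma ed_map: "ed (map u p) = map_prod u u ` ed p" by (induction p rule: induct_list012) (auto simp: ed_Cons ed_def[of "[]"])

lemma ed_index: "distinct p ==> i < length p ==> j < length p ==> (p ! i, p ! j):ed p \<longleftrightarrow> j = Suc i"
  unfolding ed_def by (auto simp: nth_eq_iff_index_eq)

lemma ipath_edges:
  assumes "sym E" "ipath E p" "x:set p" "y:set p"
  shows "(x, y):E \<longleftrightarrow> (x, y):ed p | (y, x):ed p"
  using assms(3,4) in_set_conv_nth assms(2) path_nth assms(1) symD ed_index unfolding ipath_def path_def by metis

definition kJ :: "'k rel => (('k * 'k) \<times> ('k * 'k)) set" where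
  "kJ D = {(n, m). EX a b. (n = (a, a) | n = (b, b)) & m = (a, b) & m:D | (m = (a, a) | m = (b, b)) & n = (a, b) & n:D}"

definition kN :: "'k set => 'k rel => 'k rel" where
  "kN KV D = {(v, v) | v. v:KV} Un D"

definition nbk :: "'k rel => 'k => 'k => bool" where
  "nbk D v w = ((v, w):D | (w, v):D)"

definition edk :: "'k rel => 'k => 'k => 'k * 'k" where
  "edk D v w = (if (v, w):D then (v, w) else (w, v))"

abbreviation obstructs :: "'b pair_pre_digraph => 'a rel => 'a set => bool" where
  "obstructs W E X \<equiv> EX S. subdivision_pair W S & (digraph_iso (with_proj S) (with_proj (gr X (E Int X \<times> X))) | digraph_iso (with_proj
    (line_graph S)) (with_proj (gr X (E Int X \<times> X))))"

lemma assembly: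
  fixes E :: "'a rel" and KV :: "(nat * nat) set"
  assumes E: "sym E" "irrefl E" "finite V" and K: "finite KV" "D <= KV \<times> KV" "irrefl D" "!!a b. (a, b):D ==> (b, a)~:D" "!!v. v:KV ==> EX w. nbk D v w"
    and W: "imodel E V (kN KV D) (kJ D) W" and dir: "!!v w. nbk D v w ==> dir v w < (3 :: nat)" "!!v w w'. nbk D v w ==> nbk D v w' ==> w ~= w' ==> dir v w ~=
    dir v w'" and port: "!!v w. nbk D v w ==> ported E (W (v, v)) (W (edk D v w)) (t v (dir v w))" and td: "!!v d e. v:KV ==> d < 3 ==> e < 3 ==> d ~= e ==> t
    v d ~= t v e" and jun: "!!v. v:KV ==> junction E (W (v, v)) (t v) tri"
  shows "EX X<=V. obstructs (gr KV (D Un D^-1)) E X"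
proof -
 have es: "(y, x):E" if "(x, y):E" for x y using E(1) that by (rule symD)
 have nKV: "v:KV & w:KV & v ~= w" if "nbk D v w" for v w using that K(2) irreflD[OF K(3), of v] unfolding nbk_def by auto
 have ek: "edk D v w:D" "edk D v w = (v, w) | edk D v w = (w, v)" if "nbk D v w" for v w using that unfolding nbk_def edk_def by auto
 have es2: "nbk D a b & nbk D b a & edk D a b = (a, b) & edk D b a = (a, b)" if "(a, b):D" for a b using that K(4) unfolding nbk_def edk_def by auto
 have vN: "(v, v):kN KV D" if "v:KV" for v using that unfolding kN_def by blast
 have eN: "e:kN KV D" if "e:D" for e using that unfolding kN_def by simp
 have eD: "fst e ~= snd e" if "e:D" for e using that K(3) unfolding irrefl_def by (cases e) auto
 have "ALL v. EX Lh. v:KV --> (ALL d<3. conn E (fst Lh d) & snd Lh d:fst Lh d & t v d:fst Lh d & fst Lh d <= insert (t v d) (W (v, v))) & (ALL d<3. ALL e<3. d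
   ~= e --> (if tri then fst Lh d Int fst Lh e = {} & (snd Lh d, snd Lh e):E & (ALL u:fst Lh d. ALL v:fst Lh e. (u, v):E --> u = snd Lh d & v = snd Lh e) else
   snd Lh d = snd Lh e & fst Lh d Int fst Lh e = {snd Lh d} & (ALL u:fst Lh d. ALL v:fst Lh e. (u, v):E --> u = snd Lh d | v = snd Lh d)))" (is "ALL v. EX Lh.
   v:KV --> ?J v Lh")
 proof
  fix v
  show "EX Lh. v:KV --> ?J v Lh"
  proof (cases "v:KV")
   case True
   obtain L h where "?J v (L, h)" using jun[OF True] unfolding junction_def fst_conv snd_conv by auto
   thus ?thesis by blast
  qed blast
 qed
 from choice[OF this] obtain Lh where Lh: "ALL v. v:KV --> ?J v (Lh v)" ..
 define l h where "l v w = fst (Lh v) (dir v w)" and "h v w = snd (Lh v) (dir v w)" for v w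
 have J1: "conn E (l v w)" "h v w:l v w" "t v (dir v w):l v w" "l v w <= insert (t v (dir v w)) (W (v, v))" if "nbk D v w" for v w
   using Lh nKV[OF that] dir(1)[OF that] unfolding l_def h_def by blast+
 have J2: "if tri then l v w Int l v w' = {} & (h v w, h v w'):E & (ALL x:l v w. ALL y:l v w'. (x, y):E --> x = h v w & y = h v w') else h v w = h v w' & l v w
   Int l v w' = {h v w} & (ALL x:l v w. ALL y:l v w'. (x, y):E --> x = h v w | y = h v w)" if "nbk D v w" "nbk D v w'" "w ~= w'" for v w w'
   using Lh nKV[OF that(1)] dir(1)[OF that(1)] dir(1)[OF that(2)] dir(2)[OF that] unfolding l_def h_def by blast
 have tW: "t v (dir v w):W (edk D v w)" if "nbk D v w" for v w using port[OF that] unfolding ported_def by simp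
 define T where "T e = l (fst e) (snd e) Un W e Un l (snd e) (fst e)" for e
 have cT: "conn E (T e)" if "e:D" for e
 proof -
  obtain a b where e: "e = (a, b)" by (cases e)
  note n = es2[OF that[unfolded e]]
  have t: "t a (dir a b):l a b Int W (a, b)" "t b (dir b a):l b a Int W (a, b)" using J1(3)[of a b] J1(3)[of b a] tW[of a b] tW[of b a] n by auto
  show ?thesis unfolding T_def by (intro conn_Un E(1) J1(1) imodelD(1)[OF W] eN) (use n that e t in \<open>auto simp: touch_def\<close>)
 qed
 have Tc: "x:W e | (EX v w. nbk D v w & e = edk D v w & x:l v w & x:W (v, v))" if "e:D" "x:T e" for e x
 proof -
  obtain a b where e: "e = (a, b)" by (cases e)
  note n = es2[OF that(1)[unfolded e]]
  have "x:l a b | x:W e | x:l b a" using that(2) unfolding T_def e by auto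
  moreover have "x:W e | x:W (a, a)" if "x:l a b" using J1(4)[of a b] tW[of a b] n that unfolding e by auto
  moreover have "x:W e | x:W (b, b)" if "x:l b a" using J1(4)[of b a] tW[of b a] n that unfolding e by auto
  ultimately show ?thesis using n unfolding e by metis
 qed
 have WW: "x ~= y & ((x, y):E --> (n, m):kJ D)" if "n:kN KV D" "m:kN KV D" "n ~= m" "x:W n" "y:W m" for n m x y using imodelD(3,5)[OF W that(1-3)] that(4,5)
   by auto
 have mixed: "EX w. nbk D v w & e = edk D v w & x:l v w" if h: "e:D" "x:W e" "v:KV" "y:W (v, v)" "x = y | (x, y):E" for e x v y
 proof -
  have ne: "e ~= (v, v)" using eD[OF h(1)] by auto
  note 1 = WW[OF eN[OF h(1)] vN[OF h(3)] ne h(2,4)]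
  hence xy: "(x, y):E" and "(e, (v, v)):kJ D" using h(5) by auto
  then obtain w where w: "e = (v, w) | e = (w, v)" unfolding kJ_def by auto
  have n: "nbk D v w" "e = edk D v w" using w h(1) K(4)[of v w] unfolding nbk_def edk_def by auto
  show ?thesis using port[OF n(1)] xy h(2,4) unfolding ported_def using n J1(3)[OF n(1)] by blast
 qed
 have key: "EX v w w'. nbk D v w & nbk D v w' & w ~= w' & e = edk D v w & f = edk D v w' & x:l v w & y:l v w'" if h: "e:D" "f:D" "e ~= f" "x:T e" "y:T f" "x =
   y | (x, y):E" for e f x y
 proof -
  consider "x:W e" "y:W f" | v w where "x:W e" "nbk D v w" "f = edk D v w" "y:l v w" "y:W (v, v)" | v w where "y:W f" "nbk D v w" "e = edk D v w" "x:l v w"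
    "x:W (v, v)" | v w u w' where "nbk D v w" "e = edk D v w" "x:l v w" "x:W (v, v)" "nbk D u w'" "f = edk D u w'" "y:l u w'" "y:W (u, u)"
    using Tc[OF h(1,4)] Tc[OF h(2,5)] by auto
  thus ?thesis
  proof cases
   case 1
   thus ?thesis using WW[OF eN[OF h(1)] eN[OF h(2)] h(3)] h(6) eD[OF h(1)] eD[OF h(2)] unfolding kJ_def by fastforce
  next
   case 2
   thus ?thesis using mixed[OF h(1) 2(1) _ 2(5) h(6)] nKV[OF 2(2)] h(3) by metis
  next
   case 3
   thus ?thesis using mixed[OF h(2) 3(1) _ 3(5)] nKV[OF 3(2)] h(3,6) es by metis
  next
   case 4
   have "(v, v) = (u, u)"
   proof (rule ccontr)
    assume ne: "(v, v) ~= (u, u)"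
    have "((v, v), (u, u))~:kJ D" using K(3) unfolding kJ_def irrefl_def by auto
    thus False using WW[OF vN vN ne 4(4,8)] nKV[OF 4(1)] nKV[OF 4(5)] h(6) by simp
   qed
   hence u: "u = v" by simp
   show ?thesis using h(3) 4(1,2,3,5,6,7) unfolding u by blast
  qed
 qed
 have hT: "h a b:T (a, b)" "h b a:T (a, b)" if "(a, b):D" for a b using es2[OF that] J1(2)[of a b] J1(2)[of b a] unfolding T_def by auto
 have "ALL e. EX p. e:D --> ipath E p & hd p = h (fst e) (snd e) & last p = h (snd e) (fst e) & set p <= T e" using conn_ipath[OF cT _ _ E(2,1)] hT
   by (metis prod.collapse)
 from choice[OF this] obtain P where P: "!!e. e:D ==> ipath E (P e)" "!!e. e:D ==> hd (P e) = h (fst e) (snd e)" "!!e. e:D ==> last (P e) = h (snd e) (fst e)"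
   "!!e. e:D ==> set (P e) <= T e" by blast
 have Pn: "P e ~= []" "distinct (P e)" if "e:D" for e using P(1)[OF that] unfolding ipath_def path_def by auto
 have hP: "h v w:set (P (edk D v w))" if "nbk D v w" for v w using P(2,3)[OF ek(1)[OF that]] ek(2)[OF that] Pn(1)[OF ek(1)[OF that]]
   by (metis fst_conv hd_in_set last_in_set snd_conv)
 have key': "EX v w w'. nbk D v w & nbk D v w' & w ~= w' & e = edk D v w & f = edk D v w' & x:l v w & y:l v w'" if "e:D" "f:D" "e ~= f" "x:set (P e)" "y:set (P
   f)" "x = y | (x, y):E" for e f x y using key[OF that(1-3) _ _ that(6)] P(4) that by blast
 define X where "X = (UN e:D. set (P e))"
 have XV: "X <= V" using P(4) Tc imodelD(2)[OF W] eN vN nKV unfolding X_def by blast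
 have iv: "EX iota :: 'a => nat * nat. inj_on iota X & iota ` X Int KV = {}"
 proof -
  have "infinite (UNIV - KV :: (nat * nat) set)" using K(1) by (simp add: finite_prod)
  then obtain B where B: "B <= UNIV - KV" "finite B" "card B = card X" using infinite_arbitrarily_large by metis
  then obtain iota where "bij_betw iota X B" using finite_same_card_bij XV E(3) finite_subset by metis
  thus ?thesis using B(1) unfolding bij_betw_def by auto
 qed
 then obtain iota :: "'a => nat * nat" where iota: "inj_on iota X" "iota ` X Int KV = {}" by auto
 have PX: "x:X" if "e:D" "x:set (P e)" for e x using that unfolding X_def by auto
 note nbE = K(5)
 show ?thesis
 proof (cases tri)
  case False
  define c where "c v = h v (SOME w. nbk D v w)" for v
  have cc: "h v w = c v" if "nbk D v w" for v w using J2[OF that someI[of "nbk D v", OF that]] False unfolding c_def by auto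
  have J3: "l v w Int l v w' = {c v}" "!!x y. x:l v w ==> y:l v w' ==> (x, y):E ==> x = c v | y = c v" if "nbk D v w" "nbk D v w'" "w ~= w'" for v w w'
    using J2[OF that] False cc[OF that(1)] by auto
  have cW: "c v:W (v, v)" if v: "v:KV" for v
  proof (rule ccontr)
   assume n: "c v~:W (v, v)"
   obtain w where w: "nbk D v w" using K(5)[OF v] by auto
   define d e where "d = dir v w" and "e = (if d = 0 then 1 else 0 :: nat)"
   have d: "d < 3" "e < 3" "d ~= e" unfolding e_def d_def using dir(1)[OF w] by auto
   have "snd (Lh v) d = c v" using cc[OF w] unfolding h_def d_def .
   hence "c v = t v d" "c v = t v e" using Lh v False n d(1,2) by (metis insertE subsetD)+
   thus False using td[OF v d] by simp
  qed
  have ci: "v = w" if "v:KV" "w:KV" "c v = c w" for v w using WW[OF vN[OF that(1)] vN[OF that(2)] _ cW[OF that(1)] cW[OF that(2)]] that(3) by auto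
  define I where "I e = butlast (tl (P e))" for e
  have PI: "P e = c (fst e) # I e @ [c (snd e)]" if e: "e:D" for e
  proof -
   have n: "nbk D (fst e) (snd e)" "nbk D (snd e) (fst e)" using es2[of "fst e" "snd e"] e by auto
   have hl: "hd (P e) = c (fst e)" "last (P e) = c (snd e)" using P(2,3)[OF e] cc[OF n(1)] cc[OF n(2)] by auto
   have ne: "hd (P e) ~= last (P e)" unfolding hl using ci nKV[OF n(1)] by blast
   hence "tl (P e) ~= []" using Pn(1)[OF e] by (cases "P e") auto
   hence "tl (P e) = butlast (tl (P e)) @ [last (P e)]" by (metis append_butlast_last_id last_tl)
   thus ?thesis using Pn(1)[OF e] hl unfolding I_def by (metis list.collapse)
  qed
  have cX: "c v:X" if "v:KV" for v using nbE[OF that] hP cc PX ek(1) by metis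
  have In: "x~:c ` KV" if e: "e:D" "x:set (I e)" for e x
  proof
   assume "x:c ` KV"
   then obtain v where v: "v:KV" "x = c v" by auto
   have xP: "x:set (P e)" using PI[OF e(1)] e(2) by simp
   have ends: "x ~= c (fst e)" "x ~= c (snd e)" using Pn(2)[OF e(1)] e(2) unfolding PI[OF e(1)] by auto
   obtain w where w: "nbk D v w" using nbE[OF v(1)] by auto
   have ne: "e ~= edk D v w" using ek(2)[OF w] ends v(2) by auto
   obtain v' w1 w2 where h': "nbk D v' w1" "nbk D v' w2" "w1 ~= w2" "e = edk D v' w1" "x:l v' w1" "x:l v' w2"
     using hP[OF w] cc[OF w] v(2) key'[OF e(1) ek(1)[OF w] ne xP] by metis
   show False using J3(1)[OF h'(1-3)] h'(5,6) ek(2)[OF h'(1)] ends unfolding h'(4) by auto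
  qed
  define u where "u x = (if x:c ` KV then inv_into KV c x else iota x)" for x
  have uc: "u (c v) = v" if "v:KV" for v unfolding u_def using that ci by (auto simp: inj_on_def)
  have uI: "u x = iota x" if "e:D" "x:set (I e)" for e x unfolding u_def using In[OF that] by simp
  have IX: "x:X" if "e:D" "x:set (I e)" for e x using PX[OF that(1)] PI[OF that(1)] that(2) by simp
  have ui: "inj_on u X"
  proof (rule inj_onI)
   have dj: "u x:KV \<longleftrightarrow> x:c ` KV" if "x:X" for x using uc iota(2) that unfolding u_def by auto
   fix x y
   assume xy: "x:X" "y:X" "u x = u y"
   show "x = y" using dj[OF xy(1)] dj[OF xy(2)] uc xy iota(1) inj_onD unfolding u_def by fastforce
  qed
  define p where "p e = map iota (I e)" for e
  have full: "fst e # p e @ [snd e] = map u (P e)" if e: "e:D" for e using K(2) e uI[OF e] uc unfolding p_def PI[OF e] by auto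
  have "subdivision_pair (gr KV (D Un D^-1)) (sdg KV D p)"
  proof (rule subdivision_sdg[OF K(1-4)])
   fix e
   assume e: "e:D"
   show "distinct (p e) & set (p e) Int KV = {}" using Pn(2)[OF e] unfolding PI[OF e] using IX[OF e] unfolding p_def using iota
     by (auto simp: distinct_map intro: inj_on_subset)
  next
   fix e f
   assume ef: "e:D" "f:D" "e ~= f"
   show "set (p e) Int set (p f) = {}"
   proof (rule ccontr)
    assume "set (p e) Int set (p f) ~= {}"
    then obtain x y where xy: "x:set (I e)" "y:set (I f)" "iota x = iota y" unfolding p_def set_map by blast
    hence "x = y" using inj_onD[OF iota(1) xy(3)] IX ef by simp
    moreover have "x:set (P e)" "y:set (P f)" using PI ef xy by auto
    ultimately obtain v w1 w2 where h': "nbk D v w1" "nbk D v w2" "w1 ~= w2" "x:l v w1" "x:l v w2" using key'[OF ef] by metis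
    thus False using J3(1)[OF h'(1-3)] In[OF ef(1) xy(1)] nKV[OF h'(1)] by auto
   qed
  qed
  moreover have "sdg KV D p = gr (u ` X) (UN e:D. map_prod u u ` ed (P e) Un (map_prod u u ` ed (P e))^-1)"
  proof -
   have "KV Un (UN e:D. set (p e)) = u ` X"
   proof
    have "v:u ` X" if "v:KV" for v using uc[OF that] cX[OF that] by (metis imageI)
    moreover have "y:u ` X" if ye: "e:D" "y:set (p e)" for e y
    proof -
     obtain x where "x:set (I e)" "y = iota x" using ye(2) unfolding p_def by auto
     thus ?thesis using uI[OF ye(1)] IX[OF ye(1)] by (metis imageI)
    qed
    ultimately show "KV Un (UN e:D. set (p e)) <= u ` X" by auto
    show "u ` X <= KV Un (UN e:D. set (p e))"
    proof
     fix y
     assume "y:u ` X"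
     then obtain e x where e: "e:D" "x:set (P e)" "y = u x" unfolding X_def by auto
     hence "y:set (fst e # p e @ [snd e])" unfolding full[OF e(1)] by simp
     thus "y:KV Un (UN e:D. set (p e))" using K(2) e(1) by auto
    qed
   qed
   moreover have "ed (fst e # p e @ [snd e]) = map_prod u u ` ed (P e)" if "e:D" for e unfolding full[OF that] by (rule ed_map)
   ultimately show ?thesis unfolding sdg_def by simp
  qed
  moreover have "digraph_iso (with_proj (gr (u ` X) (UN e:D. map_prod u u ` ed (P e) Un (map_prod u u ` ed (P e))^-1))) (with_proj (gr X (E Int X \<times> X)))"
  proof (rule iso_gr_inv)
   show "bij_betw u X (u ` X)" using ui by (rule inj_on_imp_bij_betw)
   show "E Int X \<times> X <= X \<times> X" by simp
   have edX: "ed (P e) <= X \<times> X" if "e:D" for e using PX[OF that] ed_set by fastforce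
   thus "(UN e:D. map_prod u u ` ed (P e) Un (map_prod u u ` ed (P e))^-1) <= u ` X \<times> u ` X" by blast
   fix x y
   assume xy: "x:X" "y:X"
   have um: "(u x, u y):map_prod u u ` ed (P e) \<longleftrightarrow> (x, y):ed (P e)" if "e:D" "x:X" "y:X" for e x y using that edX inj_onD[OF ui] by blast
   have one: "EX e:D. x:set (P e) & y:set (P e)" if h': "(x, y):E"
   proof -
    obtain e f where e: "e:D" "x:set (P e)" "f:D" "y:set (P f)" using xy unfolding X_def by auto
    show ?thesis using key'[OF e(1,3) _ e(2,4)] h' hP cc J3(2) e by metis
   qed
   have "(x, y):E \<longleftrightarrow> (EX e:D. (x, y):ed (P e) | (y, x):ed (P e))" using one ipath_edges[OF E(1) P(1)] ed_set by meson
   thus "(x, y):E Int X \<times> X \<longleftrightarrow> (u x, u y):(UN e:D. map_prod u u ` ed (P e) Un (map_prod u u ` ed (P e))^-1)" using xy um by auto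
  qed
  ultimately show ?thesis using XV by (intro exI[of _ X] conjI exI[of _ "sdg KV D p"]) (assumption | simp)+
 next
  case True
  have J3: "l v w Int l v w' = {}" "(h v w, h v w'):E" "!!x y. x:l v w ==> y:l v w' ==> (x, y):E ==> x = h v w & y = h v w'" if "nbk D v w" "nbk D v w'" "w ~=
    w'" for v w w' using J2[OF that] True by auto
  have disj: "set (P e) Int set (P f) = {}" if "e:D" "f:D" "e ~= f" for e f using key'[OF that] J3(1) by blast
  define p where "p e = map iota (butlast (P e))" for e
  define F where "F e = fst e # p e @ [snd e]" for e
  have bX: "set (butlast (P e)) <= X" if "e:D" for e using PX[OF that] by (meson in_set_butlastD subsetI)
  have p1: "distinct (p e) & set (p e) Int KV = {}" if e: "e:D" for e unfolding p_def using iota bX[OF e] Pn(2)[OF e]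
    by (auto simp: distinct_map distinct_butlast intro: inj_on_subset)
  have p2: "set (p e) Int set (p f) = {}" if ef: "e:D" "f:D" "e ~= f" for e f
  proof -
   have "set (butlast (P e)) Int set (butlast (P f)) = {}" using disj[OF ef] by (meson disjoint_iff in_set_butlastD)
   thus ?thesis unfolding p_def using inj_on_image_Int[OF iota(1) bX[OF ef(1)] bX[OF ef(2)]] by simp
  qed
  have sub: "subdivision_pair (gr KV (D Un D^-1)) (sdg KV D p)" by (rule subdivision_sdg[OF K(1-4) p1 p2])
  have len: "length (F e) = Suc (length (P e))" if "e:D" for e unfolding F_def p_def using Pn(1)[OF that] by simp
  have sF: "set (F e) = {fst e, snd e} Un set (p e)" for e unfolding F_def by auto
  have ends: "fst e:KV" "snd e:KV" "fst e ~= snd e" if "e:D" for e using K(2) eD[OF that] that by auto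
  have dF: "distinct (F e)" if "e:D" for e unfolding F_def using p1[OF that] ends[OF that] by auto
  have F0: "F e ! 0 = fst e" "F e ! length (P e) = snd e" if "e:D" for e
  proof -
   show "F e ! 0 = fst e" unfolding F_def by simp
   have "last (F e) = snd e" "F e ~= []" unfolding F_def by auto
   thus "F e ! length (P e) = snd e" using len[OF that] by (metis diff_Suc_1 last_conv_nth)
  qed
  have Fi: "F e ! a = F e ! b \<longleftrightarrow> a = b" if "e:D" "a <= length (P e)" "b <= length (P e)" for e a b
    using nth_eq_iff_index_eq[OF dF[OF that(1)], of a b] len[OF that(1)] that(2,3) by simp
  have Fs: "F e ! a:set (F e)" if "e:D" "a <= length (P e)" for e a using len[OF that(1)] that(2) by simp
  have FK: "i = 0 | i = length (P e)" if h': "e:D" "i < length (F e)" "F e ! i:KV" for e i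
    using p1[OF h'(1)] nth_mem[OF h'(2)] h'(3) F0[OF h'(1)] Fi[OF h'(1), of i 0] Fi[OF h'(1), of i "length (P e)"] h'(2) len[OF h'(1)] unfolding sF by auto
  have FF: "F e ! i:KV" if h': "e:D" "f:D" "e ~= f" "i < length (F e)" "F e ! i:set (F f)" for e f i
    using p2[OF h'(1-3)] nth_mem[OF h'(4)] h'(5) ends[OF h'(1)] ends[OF h'(2)] unfolding sF by auto
  define sg where "sg e i = {F e ! i, F e ! Suc i}" for e i
  have sgm: "F e ! i:sg e i" "F e ! Suc i:sg e i" for e i unfolding sg_def by auto
  have vA: "EX w. nbk D v w & e = edk D v w & P e ! i = h v w" if h': "e:D" "i < length (P e)" "v:KV" "v:sg e i" for e i v
  proof -
   note n = es2[of "fst e" "snd e", unfolded prod.collapse, OF h'(1)]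
   have "v = F e ! i | v = F e ! Suc i" using h'(4) unfolding sg_def by simp
   thus ?thesis
   proof
    assume v: "v = F e ! i"
    hence "i = 0" using FK[OF h'(1), of i] h'(2,3) len[OF h'(1)] by auto
    thus ?thesis using v n F0[OF h'(1)] P(2)[OF h'(1)] Pn(1)[OF h'(1)] by (intro exI[of _ "snd e"]) (simp add: hd_conv_nth)
   next
    assume v: "v = F e ! Suc i"
    hence i: "Suc i = length (P e)" using FK[OF h'(1), of "Suc i"] h'(2,3) len[OF h'(1)] by auto
    thus ?thesis using Pn(1)[OF h'(1)] v F0(2)[OF h'(1)] n P(3)[OF h'(1)] by (metis diff_Suc_1 last_conv_nth)
   qed
  qed
  have vB: "EX i<length (P (edk D v w)). P (edk D v w) ! i = h v w & v:sg (edk D v w) i" if k: "nbk D v w" for v w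
  proof -
   define e where "e = edk D v w"
   have e: "e:D" "e = (v, w) | e = (w, v)" using ek[OF k] unfolding e_def by auto
   have n: "0 < length (P e)" using Pn(1)[OF e(1)] by simp
   from e(2) have "EX i<length (P e). P e ! i = h v w & v:sg e i"
   proof
    assume "e = (v, w)"
    thus ?thesis using P(2)[OF e(1)] F0(1)[OF e(1)] n sgm(1)[of e 0] by (intro exI[of _ 0]) (simp add: hd_conv_nth)
   next
    assume "e = (w, v)"
    moreover obtain k where "length (P e) = Suc k" using n by (cases "length (P e)") auto
    moreover from this have "P e ! k = last (P e)" using Pn(1)[OF e(1)] by (simp add: last_conv_nth)
    ultimately show ?thesis using P(3)[OF e(1)] F0(2)[OF e(1)] sgm(2)[of e k] by auto
   qed
   thus ?thesis unfolding e_def .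
  qed
  have sgi: "e = f & i = j" if h': "e:D" "f:D" "i < length (P e)" "j < length (P f)" "sg e i = sg f j" for e f i j
  proof (cases "e = f")
   case True
   show ?thesis using h'(5) True unfolding sg_def doubleton_eq_iff using Fi[OF h'(1), of i j] Fi[OF h'(1), of i "Suc j"] Fi[OF h'(1), of "Suc i" j] h'(3,4)
     by auto
  next
   case False
   have all: "sg e i = {fst e, snd e}" if h': "e:D" "f:D" "e ~= f" "i < length (P e)" "j < length (P f)" "sg e i = sg f j" for e f i j
   proof -
    have "sg f j <= set (F f)" unfolding sg_def using h'(5) Fs[OF h'(2)] by auto
    hence "F e ! i:set (F f)" "F e ! Suc i:set (F f)" using h'(6) sgm by blast+
    thus ?thesis using FF[OF h'(1-3)] h'(4) len[OF h'(1)] FK[OF h'(1), of i] FK[OF h'(1), of "Suc i"] F0[OF h'(1)] unfolding sg_def by simp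
   qed
   show ?thesis using all[OF h'(1,2) False h'(3-5)] all[OF h'(2,1) _ h'(4,3) h'(5)[symmetric]] False h'(5) h'(1,2) K(4)[of "fst e" "snd e"]
     by (metis doubleton_eq_iff prod.collapse)
  qed
  have ix: "EX e:D. EX i<length (P e). x = P e ! i" if "x:X" for x using that unfolding X_def by (auto simp: in_set_conv_nth)
  have ux: "e = f & i = j" if h': "e:D" "f:D" "i < length (P e)" "j < length (P f)" "P e ! i = P f ! j" for e f i j
    using disj[OF h'(1,2)] nth_mem[OF h'(3)] nth_mem[OF h'(4)] disjoint_iff nth_eq_iff_index_eq[OF Pn(2)[OF h'(1)] h'(3)] h'(4,5) by metis
  define g where "g x = (THE s. EX e:D. EX i<length (P e). x = P e ! i & s = sg e i)" for x
  have gP: "g (P e ! i) = sg e i" if h': "e:D" "i < length (P e)" for e i unfolding g_def by (rule the_equality) (use ux h' in blast)+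
  have gi: "inj_on g X"
  proof (rule inj_onI)
   fix x y
   assume "x:X" "y:X" "g x = g y"
   then obtain e i f j where "e:D" "i < length (P e)" "x = P e ! i" "f:D" "j < length (P f)" "y = P f ! j" "sg e i = sg f j" using ix gP by metis
   thus "x = y" using sgi by metis
  qed
  let ?S = "sdg KV D p"
  have LV: "{{a, b} | a b. (a, b):parcs ?S} = g ` X"
  proof (intro set_eqI iffI)
   fix s
   assume "s : {{a, b} | a b. (a, b):parcs ?S}"
   then obtain a b e where "s = {a, b}" "e:D" "(a, b):ed (F e) | (b, a):ed (F e)" unfolding sdg_def F_def by auto
   then obtain i where i: "e:D" "s = sg e i" "Suc i < length (F e)" unfolding ed_def sg_def by auto
   thus "s:g ` X" using gP[of e i] len[OF i(1)] PX[OF i(1)] by auto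
  next
   fix s
   assume "s:g ` X"
   then obtain e i where i: "e:D" "i < length (P e)" "s = sg e i" using ix gP by blast
   hence "(F e ! i, F e ! Suc i):ed (F e)" using len[OF i(1)] unfolding ed_def by auto
   hence "(F e ! i, F e ! Suc i):parcs ?S" using i(1) unfolding sdg_def F_def by auto
   thus "s : {{a, b} | a b. (a, b):parcs ?S}" using i(3) unfolding sg_def by blast
  qed
  define LE where "LE = {(a, b). a:g ` X & b:g ` X & a ~= b & a Int b ~= {}}"
  have LG: "line_graph ?S = gr (g ` X) LE" unfolding line_graph_def Let_def LV LE_def gr_def ..
  have "digraph_iso (with_proj (gr (g ` X) LE)) (with_proj (gr X (E Int X \<times> X)))"
  proof (rule iso_gr_inv)
   show "bij_betw g X (g ` X)" using gi by (rule inj_on_imp_bij_betw)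
   show "LE <= g ` X \<times> g ` X" unfolding LE_def by auto
   fix x y
   assume xy: "x:X" "y:X"
   obtain e i f j where e: "e:D" "i < length (P e)" "x = P e ! i" and f: "f:D" "j < length (P f)" "y = P f ! j" using ix xy by metis
   have "(x, y):E \<longleftrightarrow> sg e i ~= sg f j & sg e i Int sg f j ~= {}"
   proof (cases "e = f")
    case True
    have "(x, y):E \<longleftrightarrow> j = Suc i | i = Suc j" using ipath_edges[OF E(1) P(1)[OF e(1)]] ed_index[OF Pn(2)[OF e(1)]] e f True by simp
    moreover have "sg e i Int sg f j ~= {} \<longleftrightarrow> i = j | i = Suc j | j = Suc i" unfolding sg_def
      using Fi[OF e(1), of i j] Fi[OF e(1), of i "Suc j"] Fi[OF e(1), of "Suc i" j] Fi[OF e(1), of "Suc i" "Suc j"] e(2) f(2) True by auto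
    moreover have "sg e i = sg f j \<longleftrightarrow> i = j" using sgi[OF e(1) f(1) e(2) f(2)] True by auto
    ultimately show ?thesis by auto
   next
    case False
    have ne: "sg e i ~= sg f j" using sgi[OF e(1) f(1) e(2) f(2)] False by auto
    have "sg e i Int sg f j ~= {}" if xyE: "(x, y):E"
    proof -
     obtain v w w' where k: "nbk D v w" "nbk D v w'" "w ~= w'" "e = edk D v w" "f = edk D v w'" "x:l v w" "y:l v w'"
       using key'[OF e(1) f(1) False _ _ disjI2[OF xyE]] e f by auto
     show ?thesis using vB[OF k(1)] ux[OF e(1) e(1) e(2)] e(3) k(4) vB[OF k(2)] ux[OF f(1) f(1) f(2)] f(3) k(5) J3(3)[OF k(1-3,6,7) xyE] by fastforce
    qed
    moreover have "(x, y):E" if "sg e i Int sg f j ~= {}"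
    proof -
     obtain v where v: "v:sg e i" "v:sg f j" using \<open>sg e i Int sg f j ~= {}\<close> by auto
     have "sg f j <= set (F f)" unfolding sg_def using f(2) Fs[OF f(1)] by auto
     hence "v:KV" using v FF[OF e(1) f(1) False, of i] FF[OF e(1) f(1) False, of "Suc i"] e(2) len[OF e(1)] unfolding sg_def by auto
     then obtain w w' where "nbk D v w" "e = edk D v w" "x = h v w" "nbk D v w'" "f = edk D v w'" "y = h v w'"
       using vA[OF e(1,2) _ v(1)] vA[OF f(1,2) _ v(2)] e(3) f(3) by auto
     thus ?thesis using J3(2) False by metis
    qed
    ultimately show ?thesis using ne by auto
   qed
   thus "(x, y):E Int X \<times> X \<longleftrightarrow> (g x, g y):LE" using gP[OF e(1,2)] gP[OF f(1,2)] imageI[OF xy(1), of g] imageI[OF xy(2), of g] xy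
     unfolding e(3) f(3) LE_def by simp
  qed blast
  thus ?thesis using XV sub unfolding LG[symmetric] by auto
 qed
qed

text \<open>The wall is drawn on rows \<open>2i\<close>, \<open>2i + 1\<close> and columns \<open>3j + 2, 3j + 3, 3j + 4\<close> of the grid, such that every
  vertex of the wall leaves its grid vertex to the left, to the right and downwards only. \<open>wlab k i b j q\<close> is the vertex \<open>(v, v)\<close> or
  the edge of the wall that uses the label \<open>(k, 2i + b, 3j + q + 2)\<close>.\<close>

definition wlab :: "nat => nat => nat => nat => nat => ((nat * nat) \<times> (nat * nat)) option" where
  "wlab k i b j q = (let ev = even (i + j); hor = Some ((i, j), (i, Suc j)); hor' = (if j = 0 then None else Some ((i, j - 1), (i, j))); up = (if i = 0 then
    None else Some ((i - 1, j), (i, j))) in if b = 0 then (if k = 0 then (if q = 0 then (if ev then None else Some ((i, j), (i, j))) else if q = 1 then (if ev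
    then None else up) else if ev then hor else None) else if k = 1 then (if q = 0 then (if ev then None else up) else if q = 1 then None else if ev then hor
    else None) else if q = 0 then (if ev then None else hor) else if q = 1 then None else if ev then hor else None) else if k = 0 then (if q = 0 then (if ev
    then hor' else hor) else if q = 1 then (if ev then Some ((i, j), (i, j)) else hor) else hor) else if k = 1 then (if q = 0 then (if ev then hor' else hor)
    else if q = 1 then hor else if ev then None else hor) else if q = 1 & ev then Some ((i, j), (Suc i, j)) else None)"

definition compat :: "('k * 'k) option => ('k * 'k) option => bool" where
  "compat x y = ((ALL a b c d. x = Some (a, b) --> y = Some (c, d) --> (a, b) = (c, d) | a = b & (a = c | a = d) | c = d & (c = a | c = b)))"

lemma wlab_compat:
  assumes "q < 3" "b < 2"
  shows "compat (wlab 0 i b j q) (wlab 1 i b j q)" "compat (wlab 0 i b j q) (wlab 2 i b j q)" "q < 2 ==> compat (wlab 1 i b j q) (wlab 0 i b j (Suc q))"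
    "compat (wlab 1 i b j 2) (wlab 0 i b (Suc j) 0)" "compat (wlab 2 i 0 j q) (wlab 0 i 1 j q)" "compat (wlab 2 i 1 j q) (wlab 0 (Suc i) 0 j q)"
proof -
 have q: "q = 0 | q = 1 | q = 2" and b: "b = 0 | b = 1" using assms by auto
 show "compat (wlab 0 i b j q) (wlab 1 i b j q)" "compat (wlab 0 i b j q) (wlab 2 i b j q)" "q < 2 ==> compat (wlab 1 i b j q) (wlab 0 i b j (Suc q))" "compat
   (wlab 1 i b j 2) (wlab 0 i b (Suc j) 0)" "compat (wlab 2 i 0 j q) (wlab 0 i 1 j q)" "compat (wlab 2 i 1 j q) (wlab 0 (Suc i) 0 j q)" using q b
   by (elim disjE; simp add: wlab_def compat_def Let_def)+
qed

definition wl :: "nat * nat * nat => ((nat * nat) \<times> (nat * nat)) option" where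
  "wl = (%(k, s, rho). if rho < 2 then None else wlab k (s div 2) (s mod 2) ((rho - 2) div 3) ((rho - 2) mod 3))"

lemma wl_compat: assumes "gnext n m" shows "compat (wl n) (wl m)"
proof -
 obtain s rho where g: "(n, m) : {((0, s, rho), (1, s, rho)), ((1, s, rho), (0, s, Suc rho)), ((0, s, rho), (2, s, rho)), ((2, s, rho), (0, Suc s, rho))}"
   using assms unfolding gnext_def by auto
 show ?thesis
 proof (cases "rho < 2")
  case True
  hence "wl n = None" using g unfolding wl_def by auto
  thus ?thesis unfolding compat_def by simp
 next
  case False
  define i b j q where "i = s div 2" and "b = s mod 2" and "j = (rho - 2) div 3" and "q = (rho - 2) mod 3"
  have qb: "q < 3" "b < 2" unfolding q_def b_def by auto
  have S: "(Suc rho - 2) div 3 = (if q = 2 then Suc j else j)" "(Suc rho - 2) mod 3 = (if q = 2 then 0 else Suc q)"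
  proof -
   obtain x where "rho = x + 2" using False by (metis add.commute le_Suc_ex not_less)
   thus "(Suc rho - 2) div 3 = (if q = 2 then Suc j else j)" "(Suc rho - 2) mod 3 = (if q = 2 then 0 else Suc q)" by (auto simp: j_def q_def div_Suc mod_Suc)
  qed
  have T: "Suc s div 2 = (if b = 1 then Suc i else i)" "Suc s mod 2 = (if b = 1 then 0 else 1)" by (auto simp: i_def b_def div_Suc mod_Suc)
  note C = wlab_compat[OF qb, of i j]
  have 3: "compat (wl (1, s, rho)) (wl (0, s, Suc rho))" using C(3,4) S by (cases "q = 2") (auto simp: wl_def i_def[symmetric] b_def[symmetric]
    j_def[symmetric] q_def[symmetric])
  have 4: "compat (wl (2, s, rho)) (wl (0, Suc s, rho))" using C(5,6) qb False T by (cases "b = 1") (auto simp: wl_def i_def[symmetric] b_def[symmetric]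
    j_def[symmetric] q_def[symmetric] less_2_cases_iff)
  have "compat (wl (0, s, rho)) (wl (1, s, rho))" "compat (wl (0, s, rho)) (wl (2, s, rho))" using C(1,2) False
    by (simp_all add: wl_def i_def[symmetric] b_def[symmetric] j_def[symmetric] q_def[symmetric])
  thus ?thesis using g 3 4 by auto
 qed
qed

definition wpath :: "(nat * nat) \<times> (nat * nat) => (nat * nat * nat) list" where
  "wpath = (%((i, j), (i', j')). let c = 3 * j + 2 in if (i, j) = (i', j') then (if even (i + j) then [(0, 2 * i + 1, Suc c)] else [(0, 2 * i, c)]) else if i'
    ~= i then [(2, 2 * i + 1, c + 1), (0, 2 * i + 2, c + 1), (1, 2 * i + 2, c)] else if even (i + j) then [(1, 2 * i + 1, c + 1), (0, 2 * i + 1, c + 2), (2, 2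
    * i, c + 2), (0, 2 * i, c + 2), (1, 2 * i, c + 2)] else [(2, 2 * i, c), (0, 2 * i + 1, c), (1, 2 * i + 1, c), (0, 2 * i + 1, c + 1), (1, 2 * i + 1, c + 1),
    (0, 2 * i + 1, c + 2), (1, 2 * i + 1, c + 2), (0, 2 * i + 1, c + 3), (1, 2 * i + 1, c + 3)])"

definition worient :: "((nat * nat) \<times> (nat * nat)) set" where
  "worient = {((i, j), (i, Suc j)) | i j. True} Un {((i, j), (Suc i, j)) | i j. even (i + j)}"

definition wdir :: "nat * nat => nat * nat => nat" where
  "wdir = (%(i, j) (i', j'). if i' ~= i then (if even (i + j) then 2 else 1) else if j' < j then 0 else if even (i + j) then 1 else 2)"

lemma wl_eval: "q < 3 ==> b < 2 ==> rho = 3 * j + q + 2 ==> s = 2 * i + b ==> wl (k, s, rho) = wlab k i b j q" unfolding wl_def by simp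

lemma wl_wpath: assumes "l:worient | fst l = snd l" "n:set (wpath l)" shows "wl n = Some l"
proof -
 consider i j where "l = ((i, j), (i, j))" | i j where "l = ((i, j), (i, Suc j))" | i j where "l = ((i, j), (Suc i, j))" "even (i + j)"
   using assms(1) unfolding worient_def by (cases l) auto
 thus ?thesis
 proof cases
  case (1 i j)
  have "wl (0, 2 * i + 1, Suc (3 * j + 2)) = wlab 0 i 1 j 1" "wl (0, 2 * i, 3 * j + 2) = wlab 0 i 0 j 0" by (rule wl_eval; simp)+
  thus ?thesis using assms(2) unfolding 1 wpath_def by (auto simp: wlab_def split: if_splits)
 next
  case (2 i j)
  define c where "c = 3 * j + 2"
  have "wl (k, 2 * i + 1, c) = wlab k i 1 j 0" "wl (k, 2 * i + 1, c + 1) = wlab k i 1 j 1" "wl (k, 2 * i + 1, c + 2) = wlab k i 1 j 2" "wl (k, 2 * i + 1, c +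
    3) = wlab k i 1 (Suc j) 0" "wl (k, 2 * i, c) = wlab k i 0 j 0" "wl (k, 2 * i, c + 2) = wlab k i 0 j 2" for k unfolding c_def by (rule wl_eval; simp)+
  thus ?thesis using assms(2) unfolding 2 wpath_def prod.case c_def[symmetric] by (auto simp: wlab_def Let_def split: if_splits)
 next
  case (3 i j)
  define c where "c = 3 * j + 2"
  have "wl (k, 2 * i + 1, c + 1) = wlab k i 1 j 1" "wl (k, 2 * i + 2, c + 1) = wlab k (Suc i) 0 j 1" "wl (k, 2 * i + 2, c) = wlab k (Suc i) 0 j 0" for k
    unfolding c_def by (rule wl_eval; simp)+
  thus ?thesis using assms(2) 3(2) unfolding 3 wpath_def prod.case c_def[symmetric] by (auto simp: wlab_def Let_def split: if_splits)
 qed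
qed

definition wpos :: "nat * nat => nat * nat * nat" where
  "wpos v = hd (wpath (v, v))"

lemma wpos: "wpath (v, v) = [wpos v]" "wpos (i, j) = (if even (i + j) then (0, 2 * i + 1, 3 * j + 3) else (0, 2 * i, 3 * j + 2))"
  unfolding wpos_def wpath_def by (cases v; simp)+

lemma wport:
  assumes "(v, w):worient"
  shows "gdir (wdir v w) (wpos v):set (wpath (v, w))" "gdir (wdir w v) (wpos w):set (wpath (v, w))" "x:set (wpath (v, w)) ==> (wpos v, x):gE ==> x = gdir (wdir
    v w) (wpos v)" "x:set (wpath (v, w)) ==> (wpos w, x):gE ==> x = gdir (wdir w v) (wpos w)"
proof -
 consider i j where "v = (i, j)" "w = (i, Suc j)" "even (i + j)" | i j where "v = (i, j)" "w = (i, Suc j)" "odd (i + j)" | i j where "v = (i, j)" "w = (Suc i,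
   j)" "even (i + j)" using assms unfolding worient_def by auto
 hence "gdir (wdir v w) (wpos v):set (wpath (v, w)) & gdir (wdir w v) (wpos w):set (wpath (v, w)) & (ALL x:set (wpath (v, w)). (wpos v, x):gE --> x = gdir
   (wdir v w) (wpos v)) & (ALL x:set (wpath (v, w)). (wpos w, x):gE --> x = gdir (wdir w v) (wpos w))"
   by cases (simp_all add: wpos wdir_def gdir_def wpath_def Let_def gE_def gnext_iff)
 thus "gdir (wdir v w) (wpos v):set (wpath (v, w))" "gdir (wdir w v) (wpos w):set (wpath (v, w))" "x:set (wpath (v, w)) ==> (wpos v, x):gE ==> x = gdir (wdir v
   w) (wpos v)" "x:set (wpath (v, w)) ==> (wpos w, x):gE ==> x = gdir (wdir w v) (wpos w)" by auto
qed

lemma wall_model: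
  assumes D: "D <= worient" "D <= KV \<times> KV" and KV: "KV <= {..<t} \<times> {..<2 * t}"
  shows "imodel gE (gN (2 * t + 1) (6 * t + 3)) (kN KV D) (kJ D) (%l. set (wpath l))"
  unfolding imodel_def
proof (intro conjI ballI impI)
 have lab: "l:worient | fst l = snd l" if "l:kN KV D" for l using that D unfolding kN_def by auto
 fix l
 assume l: "l:kN KV D"
 obtain i j i' j' where lij: "l = ((i, j), (i', j'))" by (metis prod.exhaust)
 have b: "i < t" "j < 2 * t" "i' < t" "j' < 2 * t" using l D(2) KV unfolding lij kN_def by auto
 have c: "i' = i & j' = j | i' = i & j' = Suc j | i' = Suc i & j' = j" using lab[OF l] unfolding lij worient_def by auto
 have "wpath l ~= []" "successively (%x y. (x, y):gE) (wpath l)" unfolding lij wpath_def by (auto simp: gE_def gnext_iff)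
 thus "conn gE (set (wpath l))" by (rule successively_conn[OF gE_sym])
 show "set (wpath l) <= gN (2 * t + 1) (6 * t + 3)" using b unfolding lij wpath_def by (auto simp: gN_def)
next
 have lab: "l:worient | fst l = snd l" if "l:kN KV D" for l using that D unfolding kN_def by auto
 fix l m
 assume lm: "l:kN KV D" "m:kN KV D" "l ~= m"
 note wl = wl_wpath[OF lab[OF lm(1)]] wl_wpath[OF lab[OF lm(2)]]
 show "set (wpath l) Int set (wpath m) = {}" using wl lm(3) by fastforce
 show "(EX a:set (wpath l). EX b:set (wpath m). (a, b):gE) \<longleftrightarrow> (l, m):kJ D"
 proof
  assume "EX a:set (wpath l). EX b:set (wpath m). (a, b):gE"
  hence "compat (Some l) (Some m) | compat (Some m) (Some l)" using wl wl_compat unfolding gE_def by fastforce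
  moreover obtain a b c d where ab: "l = (a, b)" "m = (c, d)" by (metis prod.exhaust)
  ultimately show "(l, m):kJ D" using lm unfolding kN_def unfolding compat_def kJ_def by blast
 next
  assume "(l, m):kJ D"
  then obtain a b where "(l = (a, a) | l = (b, b)) & m = (a, b) & m:D | (m = (a, a) | m = (b, b)) & l = (a, b) & l:D" unfolding kJ_def by auto
  moreover have "EX x:set (wpath (a, b)). (wpos a, x):gE" "EX x:set (wpath (a, b)). (wpos b, x):gE" if "(a, b):D"
  proof -
   have "wdir v w < 3" for v w unfolding wdir_def by (simp add: case_prod_beta)
   moreover have "(wpos v, gdir d (wpos v)):gE" if "d < 3" for v d by (cases v) (auto simp: wpos gdir_def gE_def gnext_iff)
   ultimately show "EX x:set (wpath (a, b)). (wpos a, x):gE" "EX x:set (wpath (a, b)). (wpos b, x):gE" using wport(1,2)[of a b] D(1) that by blast+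
  qed
  ultimately obtain v x where "v = wpos a | v = wpos b" "(v, x):gE" "v:set (wpath l) & x:set (wpath m) | v:set (wpath m) & x:set (wpath l)" using wpos(1)
    by (metis list.set_intros(1))
  thus "EX a:set (wpath l). EX b:set (wpath m). (a, b):gE" using symD[OF gE_sym] by blast
 qed
qed

lemma wall_gr:
  fixes t defines "KV \<equiv> wall_verts t" defines "D \<equiv> brick_arcs t Int KV \<times> KV Int worient"
  shows "wall t = gr KV (D Un D^-1)"
  unfolding D_def brick_arcs_def worient_def wall_def gr_def KV_def[symmetric] by auto

lemma wall_neighbour: assumes "t >= 2" "v:wall_verts t" shows "EX w:wall_verts t. (v, w):brick_arcs t"
proof -
 obtain i j where v: "v = (i, j)" "i < t" "j < 2 * t" using assms(2) unfolding wall_verts_def by auto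
 have inner: "(i, k):wall_verts t" if "0 < k" "Suc k < 2 * t" for k
 proof -
  let ?N = "{u. ((i, k), u):brick_arcs t}"
  have "?N <= {..<t} \<times> {..<2 * t}" unfolding brick_arcs_def by auto
  hence "finite ?N" by (rule finite_subset) simp
  moreover have "{(i, k - 1), (i, Suc k)} <= ?N" using that v(2) unfolding brick_arcs_def by auto
  ultimately have "card {(i, k - 1), (i, Suc k)} <= card ?N" by (rule card_mono)
  thus ?thesis using that v(2) unfolding wall_verts_def by auto
 qed
 show ?thesis
 proof (cases "Suc (Suc j) < 2 * t")
  case True
  thus ?thesis using inner[of "Suc j"] v by (intro bexI[of _ "(i, Suc j)"]) (auto simp: brick_arcs_def)
 next
  case False
  thus ?thesis using inner[of "j - 1"] v assms(1) by (intro bexI[of _ "(i, j - 1)"]) (auto simp: brick_arcs_def)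
 qed
qed

theorem grid_obstruction:
  assumes "t >= 2"
  shows "EX r M. ALL (E :: 'a rel) V Z. sym E --> irrefl E --> finite V --> imodel E V (fN r M) fE Z --> (EX X<=V. obstructs (wall t) E X)"
proof -
 let ?r = "2 * t + 1" and ?M = "6 * t + 3"
 obtain r M where U: "ALL (E :: 'a rel) V Y t. sym E --> irrefl E --> finite V --> imodel E V (gN r M) gE Y --> (ALL b:gN r M. ALL m:gN r M. (b, m):gE --> fst
   b = 0 --> ported E (Y b) (Y m) (t b m)) --> (EX Y' t' tri. imodel E V (gN ?r ?M) gE Y' & (ALL b. inner_node ?r ?M b --> (ALL d<3. ported E (Y' b) (Y' (gdir
   d b)) (t' b d)) & junction E (Y' b) (t' b) tri))" using uniform_grid[where r' = ?r and M' = ?M and 'a = 'a] by auto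
 have "EX X<=V. obstructs (wall t) E X" if E: "sym E" "irrefl E" "finite V" and Z: "imodel E V (fN r M) fE Z" for E :: "'a rel" and V Z
 proof -
  obtain Y0 t0 where "imodel E V (gN r M) gE Y0" "ALL b:gN r M. ALL m:gN r M. (b, m):gE --> fst b = 0 --> ported E (Y0 b) (Y0 m) (t0 b m)"
    using thin_grid[OF E(1,2) Z] by auto
  then obtain Y t' tri where Y: "imodel E V (gN ?r ?M) gE Y" and J: "ALL b. inner_node ?r ?M b --> (ALL d<3. ported E (Y b) (Y (gdir d b)) (t' b d)) & junction
    E (Y b) (t' b) tri" using U[rule_format, OF E, of Y0 t0] by auto
  define KV D where "KV = wall_verts t" and "D = brick_arcs t Int KV \<times> KV Int worient"
  have KV: "KV <= {..<t} \<times> {..<2 * t}" unfolding KV_def wall_verts_def by auto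
  have D: "D <= worient" "D <= KV \<times> KV" unfolding D_def by auto
  note X = wall_model[OF D KV]
  define W where "W l = (UN x:set (wpath l). Y x)" for l
  have W: "imodel E V (kN KV D) (kJ D) W" unfolding W_def by (rule imodel_compose[OF E(1) Y X])
  have Wv: "W (v, v) = Y (wpos v)" for v unfolding W_def wpos(1) by simp
  have inner: "inner_node ?r ?M (wpos v)" if "v:KV" for v using KV that by (cases v) (auto simp: wpos inner_node_def)
  have wd: "wdir v w < 3" for v w unfolding wdir_def by (simp add: case_prod_beta)
  have nk: "v:KV & w:KV & v ~= w & ((v, w):worient | (w, v):worient) & edk D v w:D" if "nbk D v w" for v w using that D
    unfolding nbk_def edk_def worient_def by auto
  have wD: "(a, b):worient ==> (b, a)~:worient" for a b unfolding worient_def by auto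
  have "EX X<=V. obstructs (gr KV (D Un D^-1)) E X"
  proof (rule assembly[OF E _ D(2) _ _ _ W, where dir = wdir and t = "%v. t' (wpos v)" and tri = tri])
   show "finite KV" using KV by (rule finite_subset) simp
   show "irrefl D" using D(1) wD unfolding irrefl_def by blast
   show "(b, a)~:D" if "(a, b):D" for a b using that wD D(1) by blast
   show "EX w. nbk D v w" if v: "v:KV" for v
   proof -
    obtain w where w: "w:KV" "(v, w):brick_arcs t" using wall_neighbour[OF assms] v unfolding KV_def by blast
    hence "(w, v):brick_arcs t" "(v, w):worient | (w, v):worient" unfolding brick_arcs_def worient_def by auto
    thus ?thesis using v w unfolding nbk_def D_def by blast
   qed
   show "wdir v w < 3" for v w by (rule wd)
   show "wdir v w ~= wdir v w'" if "nbk D v w" "nbk D v w'" "w ~= w'" for v w w' using nk[OF that(1)] nk[OF that(2)] that(3) unfolding worient_def wdir_def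
     by (auto split: if_splits)
   show "junction E (W (v, v)) (t' (wpos v)) tri" if "v:KV" for v using J inner[OF that] unfolding Wv by blast
   show "t' (wpos v) d ~= t' (wpos v) e" if h: "v:KV" "d < 3" "e < 3" "d ~= e" for v d e
     using J inner[OF h(1)] h(2,3) imodelD(3)[OF Y gdir_facts(2)[OF inner[OF h(1)] h(2)] gdir_facts(2)[OF inner[OF h(1)] h(3)] gdir_facts(6)[OF inner[OF h(1)]
     h(2-4)]] IntI empty_iff unfolding ported_def by metis
   show "ported E (W (v, v)) (W (edk D v w)) (t' (wpos v) (wdir v w))" if n: "nbk D v w" for v w
   proof -
    note i = inner[OF conjunct1[OF nk[OF n]]]
    have e: "edk D v w:kN KV D" "(v, v):kN KV D" "(v, v) ~= edk D v w" using nk[OF n] unfolding kN_def edk_def by (blast, blast, metis prod.inject)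
    have p: "gdir (wdir v w) (wpos v):set (wpath (edk D v w))" "ALL x:set (wpath (edk D v w)). (wpos v, x):gE --> x = gdir (wdir v w) (wpos v)"
    proof -
     have "edk D v w = (v, w) & (v, w):worient | edk D v w = (w, v) & (w, v):worient" using nk[OF n] D(1) unfolding edk_def by auto
     thus "gdir (wdir v w) (wpos v):set (wpath (edk D v w))" "ALL x:set (wpath (edk D v w)). (wpos v, x):gE --> x = gdir (wdir v w) (wpos v)"
       using wport(1,3)[of v w] wport(2,4)[of w v] by auto
    qed
    have pt: "ported E (Y (wpos v)) (Y (gdir (wdir v w) (wpos v))) (t' (wpos v) (wdir v w))" using J i wd by blast
    show ?thesis unfolding Wv unfolding W_def
    proof (rule ported_compose[OF E(1) Y pt imodelD(2)[OF X e(1)] gdir_facts(1)[OF i wd] p(1)])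
     show "wpos v~:set (wpath (edk D v w))" using imodelD(3)[OF X e(2,1,3)] wpos(1)[of v] by auto
    qed (use p(2) in blast)
   qed
  qed
  thus ?thesis using wall_gr[of t] unfolding KV_def D_def by simp
 qed
 thus ?thesis by blast
qed

subsection \<open>Quotients of bounded degree\<close>

definition nbs :: "'a rel => 'a set => 'a set" where
  "nbs E X = {w. w~:X & (EX x:X. (x, w):E)}"

definition tame :: "'a rel => 'a set => nat => 'a set set => 'a set => bool" where
  "tame E V K \<B> X = (conn E X & X <= V & card (nbs E X) < K & (ALL B:\<B>. ~B <= X))"

definition tame_parts :: "'a rel => 'a set => nat => 'a set set => 'a set set => bool" where
  "tame_parts E V K \<B> Q = (\<Union>Q = V & (ALL P:Q. conn E P & (EX X. tame E V K \<B> X & P <= X)) & (ALL P:Q. ALL P':Q. P ~= P' --> P Int P' = {}))"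

lemma compo_eq: assumes "sym E" "y:compo E S x" shows "compo E S y = compo E S x"
proof -
 have "(x, y):(E Int S \<times> S)^*" using assms(2) unfolding compo_def by simp
 moreover from this have "(y, x):(E Int S \<times> S)^*" by (rule sym_rtrancl_restr[OF assms(1)])
 ultimately show ?thesis unfolding compo_def by auto
qed

text \<open>If a part had too many neighbours, then replacing all parts meeting the tame set around it
  by this set and the components that remain would give fewer parts.\<close>

lemma minimal_parts_degree:
  assumes E: "sym E" "finite V" "E <= V \<times> V" and Q: "tame_parts E V K \<B> Q" "!!Q'. tame_parts E V K \<B> Q' ==> card Q <= card Q'" and P: "P:Q"
  shows "card {P':Q. P' ~= P & touch E P P'} < K"
proof -
 have fQ: "finite Q" using Q(1) E(2) unfolding tame_parts_def by (metis finite_UnionD)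
 have QV: "\<Union>Q = V" and cQ: "!!P. P:Q ==> conn E P & (EX X. tame E V K \<B> X & P <= X)" and dQ: "!!P P' x. P:Q ==> P':Q ==> x:P ==> x:P' ==> P = P'"
   using Q(1) unfolding tame_parts_def by blast+
 obtain X where X: "tame E V K \<B> X" "P <= X" using cQ[OF P] by auto
 have cX: "conn E X" "X <= V" "card (nbs E X) < K" using X(1) unfolding tame_def by auto
 have nV: "nbs E X <= V" using E(3) unfolding nbs_def by auto
 hence fN: "finite (nbs E X)" using E(2) finite_subset by auto
 define M where "M = {P:Q. P Int X ~= {}}"
 define f where "f n = compo E ((THE P. P:Q & n:P) - X) n" for n
 have fP: "f n = compo E (P - X) n" if "P:Q" "n:P" for n P
 proof -
  have "(THE P. P:Q & n:P) = P" by (rule the_equality) (use that dQ in auto)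
  thus ?thesis unfolding f_def by simp
 qed
 define Q' where "Q' = insert X ((Q - M) Un f ` (nbs E X Int \<Union>M))"
 have piece: "EX n:nbs E X Int P. x:f n" if h: "P:M" "x:P" "x~:X" for P x
 proof -
  have PQ: "P:Q" "P Int X ~= {}" using h(1) unfolding M_def by auto
  obtain y where y: "y:P" "y:X" using PQ(2) by auto
  have xS: "x:P - X" using h by simp
  have sub: "compo E (P - X) x <= P - X" by (rule compo_in[OF xS])
  obtain a b where ab: "a:compo E (P - X) x" "b:P" "b~:compo E (P - X) x" "(a, b):E"
    by (rule conn_cut[OF conjunct1[OF cQ[OF PQ(1)]] h(2) compo_self[of x E "P - X"] y(1)]) (use sub y in auto)
  show ?thesis using compo_closed[OF ab(1) xS ab(4)] ab(2,3) sub ab(1) symD[OF E(1) ab(4)] unfolding nbs_def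
    using fP[OF PQ(1), of a] compo_eq[OF E(1) ab(1)] by fastforce
 qed
 have "tame_parts E V K \<B> Q'"
 proof -
  have fsub: "EX P:M. n:P - X & f n = compo E (P - X) n & f n <= P - X" if hn: "n:nbs E X Int \<Union>M" for n
  proof -
   obtain P where P: "P:M" "n:P" using hn by auto
   have n: "n:P - X" using P(2) hn unfolding nbs_def by simp
   show ?thesis using P(1) unfolding M_def using n fP[OF _ P(2)] compo_in[OF n] by blast
  qed
  have U: "\<Union>Q' = V"
  proof
   have MV: "P <= V" if "P:M" for P using that QV unfolding M_def by auto
   show "\<Union>Q' <= V" using cX(2) QV fsub MV unfolding Q'_def by blast
   show "V <= \<Union>Q'" using QV piece unfolding Q'_def by fastforce
  qed
  have C: "conn E A & (EX X. tame E V K \<B> X & A <= X)" if hA: "A:Q'" for A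
  proof -
   consider "A = X" | "A:Q" | n where "n:nbs E X Int \<Union>M" "A = f n" using hA unfolding Q'_def by auto
   thus ?thesis
   proof cases
    case 1
    thus ?thesis using X(1) cX(1) by auto
   next
    case 2
    thus ?thesis by (rule cQ)
   next
    case 3
    then obtain P where P: "P:M" "n:P - X" "f n = compo E (P - X) n" "f n <= P - X" using fsub by blast
    moreover have "conn E (f n)" unfolding P(3) by (rule compo_conn[OF E(1) P(2)])
    ultimately show ?thesis unfolding M_def using cQ[of P] unfolding 3(2) by blast
   qed
  qed
  have Dj: "A = A'" if h: "A:Q'" "A':Q'" "x:A" "x:A'" for A A' x
  proof -
   have part: "A = X & x:X | x~:X & A:Q - M | x~:X & (EX P:M. x:P & A = compo E (P - X) x)" if h: "A:Q'" "x:A" for A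
   proof -
    consider "A = X" | "A:Q - M" | n where "n:nbs E X Int \<Union>M" "A = f n" using h(1) unfolding Q'_def by auto
    thus ?thesis
    proof cases
     case 2
     thus ?thesis using h(2) unfolding M_def by auto
    next
     case 3
     then obtain P where P: "P:M" "f n = compo E (P - X) n" "f n <= P - X" using fsub by blast
     thus ?thesis using compo_eq[OF E(1), of x "P - X" n] h(2) 3(2) by blast
    qed (use h in blast)
   qed
   have MQ: "P = P'" if "P:M | P:Q - M" "P':M | P':Q - M" "x:P" "x:P'" for P P' using that dQ unfolding M_def by auto
   show ?thesis using part[OF h(1,3)] part[OF h(2,4)] MQ h(3) h(4) by auto
  qed
  show ?thesis unfolding tame_parts_def using U C Dj by blast
 qed
 hence "card Q <= card Q'" by (rule Q(2))
 also have "card Q' <= Suc (card ((Q - M) Un f ` (nbs E X Int \<Union>M)))" unfolding Q'_def using fQ fN by (simp add: card_insert_if)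
 also have "... <= Suc (card (Q - M) + card (nbs E X Int \<Union>M))" using card_Un_le[of "Q - M" "f ` (nbs E X Int \<Union>M)"] card_image_le[of "nbs E X Int
   \<Union>M" f] fN by simp
 finally have 1: "card Q <= Suc (card (Q - M) + card (nbs E X Int \<Union>M))" .
 have MQ: "M <= Q" unfolding M_def by simp
 have 2: "card Q = card M + card (Q - M)" using card_Diff_subset[OF finite_subset[OF MQ fQ] MQ] card_mono[OF fQ MQ] by simp
 let ?N = "{P':Q. P' ~= P & touch E P P'}"
 have "EX n. n:nbs E X - \<Union>M & n:P'" if h: "P' : ?N - M" for P' using h X(2) dQ unfolding M_def touch_def nbs_def by blast
 hence "ALL P':?N - M. EX n. n:nbs E X - \<Union>M & n:P'" by simp
 from bchoice[OF this] obtain g where g: "ALL P':?N - M. g P':nbs E X - \<Union>M & g P':P'" by auto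
 have 3: "card (?N - M) <= card (nbs E X - \<Union>M)"
 proof (rule card_inj_on_le[of g])
  show "inj_on g (?N - M)"
  proof (rule inj_onI)
   fix x y
   assume h: "x : ?N - M" "y : ?N - M" "g x = g y"
   show "x = y" using bspec[OF g h(1)] bspec[OF g h(2)] h dQ by auto
  qed
  show "g ` (?N - M) <= nbs E X - \<Union>M" using g by auto
 qed (use fN in simp)
 have 4: "card (nbs E X) = card (nbs E X Int \<Union>M) + card (nbs E X - \<Union>M)" by (rule card_Int_Diff[OF fN])
 have "insert P (?N Int M) <= M" using P X(2) cQ[OF P] unfolding M_def conn_def by auto
 hence "card (insert P (?N Int M)) <= card M" using finite_subset[OF MQ fQ] by (rule card_mono[rotated])
 moreover have "card ?N = card (?N Int M) + card (?N - M)" by (rule card_Int_Diff) (use fQ in simp)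
 ultimately show ?thesis using fQ 1 2 3 4 cX(3) by auto
qed

theorem tame_obstruction:
  assumes "t >= 2" "K >= 1"
  shows "EX theta. ALL (E :: 'a rel) V \<B>. finite V --> E <= V \<times> V --> sym E --> irrefl E --> bramble E V theta \<B> --> (ALL v:V. EX X. v:X & tame E
    V K \<B> X) --> (EX X<=V. obstructs (wall t) E X)"
proof -
 obtain r M where G: "ALL (E :: 'a rel) V Z. sym E --> irrefl E --> finite V --> imodel E V (fN r M) fE Z --> (EX X<=V. obstructs (wall t) E X)"
   using grid_obstruction[OF assms(1), where 'a = 'a] by auto
 let ?R = "4 * r + 8" and ?M = "(4 * r + 8) * (M + 2)"
 obtain theta where H: "ALL (E :: ('a set \<times> 'a set) set) U \<B>. finite U --> E <= U \<times> U --> sym E --> irrefl E --> (ALL v:U. card (nb E U v) <=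
   K) --> bramble E U theta \<B> --> (EX U'<=U. hostminor E U' ?R ?M & (ALL v:U'. sparse E U' v))"
   using sparse_host[of ?R ?M, where 'a = "'a set" and D = K] by auto
 have "EX X<=V. obstructs (wall t) E X" if E: "finite V" "E <= V \<times> V" "sym E" "irrefl E" and b: "bramble E V (K * theta) \<B>" and tm: "ALL v:V. EX X.
   v:X & tame E V K \<B> X" for E :: "'a rel" and V \<B>
 proof -
  have "tame_parts E V K \<B> ((%v. {v}) ` V)" using tm unfolding tame_parts_def by auto
  then obtain Q where Q: "tame_parts E V K \<B> Q" "!!Q'. tame_parts E V K \<B> Q' ==> card Q <= card Q'"
    using arg_min_natI[of "tame_parts E V K \<B>"] arg_min_nat_le[of "tame_parts E V K \<B>" _ card] by auto
  have QV: "\<Union>Q = V" and cQ: "!!P. P:Q ==> conn E P & (EX X. tame E V K \<B> X & P <= X)" and dQ: "!!P P' x. P:Q ==> P':Q ==> x:P ==> x:P' ==> P = P'"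
    using Q(1) unfolding tame_parts_def by blast+
  have fQ: "finite Q" using QV E(1) by (metis finite_UnionD)
  define q where "q v = (THE P. P:Q & v:P)" for v
  have qP: "q v = P" if "P:Q" "v:P" for v P unfolding q_def by (rule the_equality) (use that dQ in auto)
  have qv: "q v:Q & v:q v" if v: "v:V" for v using v QV qP by auto
  have qV: "q ` V = Q" using cQ qP QV unfolding conn_def by blast
  let ?E = "qE E q"
  have qEi: "(P, P') : ?E \<longleftrightarrow> P:Q & P':Q & P ~= P' & (EX a:P. EX b:P'. (a, b):E)" for P P'
  proof
   assume "(P, P') : ?E"
   then obtain a b where "(a, b):E" "P = q a" "P' = q b" "q a ~= q b" unfolding qE_def by auto
   thus "P:Q & P':Q & P ~= P' & (EX a:P. EX b:P'. (a, b):E)" using qv[of a] qv[of b] E(2) by auto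
  next
   assume "P:Q & P':Q & P ~= P' & (EX a:P. EX b:P'. (a, b):E)"
   then obtain a b where "P:Q" "P':Q" "P ~= P'" "a:P" "b:P'" "(a, b):E" by auto
   thus "(P, P') : ?E" using qEI[of a b E q] qP[of P a] qP[of P' b] by simp
  qed
  have im: "imodel E V Q ?E id" unfolding imodel_def using cQ QV dQ qEi by (simp add: disjoint_iff) blast
  have Eq: "?E <= Q \<times> Q" "sym ?E" "irrefl ?E" using qEi qE_sym[OF E(3)] qE_irrefl by auto
  have deg: "ALL P:Q. card (nb ?E Q P) <= K"
  proof
   fix P
   assume P: "P:Q"
   have "nb ?E Q P <= {P':Q. P' ~= P & touch E P P'}" unfolding nb_def touch_def using qEi by auto
   hence "card (nb ?E Q P) <= card {P':Q. P' ~= P & touch E P P'}" using fQ by (intro card_mono) auto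
   thus "card (nb ?E Q P) <= K" using minimal_parts_degree[OF E(3,1,2) Q P] by simp
  qed
  have "EX C. finite C & card C <= K & (ALL B:\<B>. P:q ` B --> B Int C ~= {})" for P
  proof (cases "P:Q")
   case True
   obtain X where X: "tame E V K \<B> X" "P <= X" using cQ[OF True] by auto
   have "finite (nbs E X)" by (rule finite_subset[of _ V]) (use E in \<open>auto simp: nbs_def\<close>)
   moreover have "B Int nbs E X ~= {}" if B: "B:\<B>" "P:q ` B" for B
   proof -
    have B': "conn E B" "B <= V" using b B(1) unfolding bramble_def by auto
    obtain v where v: "v:B" "P = q v" using B(2) by auto
    hence "v:X" using qv[of v] B'(2) X(2) by auto
    moreover obtain y where "y:B" "y~:X" using B(1) X(1) unfolding tame_def by auto
    ultimately obtain x z where "x:B" "x:X" "z:B" "z~:X" "(x, z):E" using conn_cut[OF B'(1) v(1)] by metis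
    thus ?thesis unfolding nbs_def by auto
   qed
   ultimately show ?thesis using X(1) unfolding tame_def by auto
  next
   case False
   hence "P~:q ` B" if "B:\<B>" for B using qV b that unfolding bramble_def by auto
   thus ?thesis by auto
  qed
  from bramble_quotient[OF E(3) b assms(2) this] have "bramble ?E Q theta ((`) q ` \<B>)" unfolding qV .
  then obtain U' where U': "U' <= Q" "hostminor ?E U' ?R ?M" "ALL v:U'. sparse ?E U' v" using H fQ Eq deg by meson
  obtain Z where "imodel ?E U' (fN r M) fE Z" using sparse_fine_grid[OF Eq(2,3) finite_subset[OF U'(1) fQ] U'(3,2)] by auto
  hence "imodel ?E Q (fN r M) fE Z" using U'(1) unfolding imodel_def by auto
  hence "imodel E V (fN r M) fE (%n. UN x:Z n. id x)" by (rule imodel_compose[OF E(3) im])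
  thus ?thesis using G E by blast
 qed
 thus ?thesis by (intro exI[of _ "K * theta"] allI impI)
qed

subsection \<open>Hubs\<close>

lemma ramsey_lists:
  assumes "finite C"
  shows "EX N :: nat. ALL F :: nat list => 'c. (ALL xs. F xs:C) --> (EX e :: nat => nat. EX c. strict_mono e & (ALL i<n. e i < N) & (ALL xs. length xs = r &
    sorted_wrt (<) xs & set xs <= {..<n} --> F (map e xs) = c))"
proof -
 have "EX h. bij_betw h C {..<card C}" using ex_bij_betw_finite_nat[OF assms] by (simp only: atLeast0LessThan)
 then obtain h where h: "bij_betw h C {..<card C}" by auto
 obtain N :: nat where N: "partn_lst {..<N} (replicate (card C) n) r" using ramsey_full by auto
 have "EX e :: nat => nat. EX c. strict_mono e & (ALL i<n. e i < N) & (ALL xs. length xs = r & sorted_wrt (<) xs & set xs <= {..<n} --> F (map e xs) = c)" if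
   F: "ALL xs. F xs:C" for F :: "nat list => 'c"
 proof -
  let ?f = "%S. h (F (sorted_list_of_set S))"
  have "?f:nsets {..<N} r \<rightarrow> {..<card C}" using F h unfolding bij_betw_def by auto
  then obtain i H where i: "i < card C" "H:nsets {..<N} n" "?f ` nsets H r <= {i}" using N unfolding partn_lst_def monochromatic_def by auto
  have H: "finite H" "n <= card H" "H <= {..<N}" using i(2) unfolding nsets_def by auto
  obtain e where e: "strict_mono e" "ALL i<n. e i:H" using extend_mono[OF H(1,2)] by auto
  have "F (map e xs) = inv_into C h i" if xs: "length xs = r" "sorted_wrt (<) xs" "set xs <= {..<n}" for xs
  proof -
   have s: "sorted_wrt (<) (map e xs)" using xs(2) e(1) by (simp add: sorted_wrt_map strict_mono_less)
   hence d: "distinct (map e xs)" "sorted (map e xs)" by (auto simp: strict_sorted_iff)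
   have "set (map e xs):nsets H r" unfolding nsets_def using xs e(2) distinct_card[OF d(1)] by auto
   moreover have "sorted_list_of_set (set (map e xs)) = map e xs" by (rule sorted_list_of_set.idem_if_sorted_distinct[OF d(2,1)])
   ultimately show ?thesis using i(3) h F unfolding bij_betw_def by auto
  qed
  thus ?thesis using e H(3) by auto
 qed
 thus ?thesis by auto
qed

definition clique :: "'a rel => 'a set => nat => bool" where
  "clique E V n = ((EX C<=V. card C = n & (ALL u:C. ALL v:C. u ~= v --> (u, v):E)))"

definition stable :: "'a rel => 'a set => bool" where
  "stable E A = ((ALL u:A. ALL v:A. (u, v)~:E))"

definition biclique :: "'a rel => 'a set => nat => bool" where
  "biclique E V n = ((EX A B. A <= V & B <= V & A Int B = {} & card A = n & card B = n & stable E A & stable E B & (ALL a:A. ALL b:B. (a, b):E)))"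

definition spider :: "'a rel => 'a set => nat => nat => 'a => bool" where
  "spider E V c n x = ((EX L. (ALL i<n. ipath E (x # L i) & length (L i) = Suc c & set (L i) <= V) & (ALL i<n. ALL j<n. i ~= j --> set (L i) Int set (L j) =
    {})))"

lemma no_biclique: "EX R :: nat. ALL (E :: 'a rel) V f g. sym E --> irrefl E --> ~clique E V (Suc t) --> ~biclique E V t --> inj_on f {..<R} --> inj_on g
  {..<R} --> f ` {..<R} <= V --> g ` {..<R} <= V --> ~(ALL i<R. ALL j<R. (f i, g j):E)"
proof -
 obtain R where R: "ALL F :: nat list => bool. (ALL xs. F xs:UNIV) --> (EX e :: nat => nat. EX c. strict_mono e & (ALL i<Suc t. e i < R) & (ALL xs. length xs =
   2 & sorted_wrt (<) xs & set xs <= {..<Suc t} --> F (map e xs) = c))" using ramsey_lists[of "UNIV :: bool set" "Suc t" 2] by auto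
 have st: "EX A<=f ` {..<R}. card A = t & stable E A" if E: "sym E" "irrefl E" and c: "~clique E V (Suc t)" and f: "inj_on f {..<R}" "f ` {..<R} <= V" for E ::
   "'a rel" and V f
 proof -
  obtain e b where e: "strict_mono e" "ALL i<Suc t. e i < R" and b: "ALL xs. length xs = 2 & sorted_wrt (<) xs & set xs <= {..<Suc t} --> ((f (map e xs ! 0), f
    (map e xs ! 1)):E) = b" using R[rule_format, of "%xs. (f (xs ! 0), f (xs ! 1)):E"] by auto
  have b': "((f (e i), f (e j)):E) = b" if "i < Suc t" "j < Suc t" "i ~= j" for i j
  proof -
   have "((f (e i), f (e j)):E) = b" if "i < j" "j < Suc t" for i j using b[rule_format, of "[i, j]"] that by simp
   from this[of i j] this[of j i] show ?thesis using that E(1) by (metis linorder_neqE_nat symD)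
  qed
  have inj: "inj_on (%i. f (e i)) {..<Suc t}" by (rule inj_onI) (use e f(1) in \<open>auto dest!: inj_onD simp: strict_mono_eq\<close>)
  have sub: "(%i. f (e i)) ` {..<Suc t} <= f ` {..<R}" using e(2) by auto
  have "~b"
  proof
   assume b
   hence "ALL u:(%i. f (e i)) ` {..<Suc t}. ALL v:(%i. f (e i)) ` {..<Suc t}. u ~= v --> (u, v):E" using b' by auto
   thus False using c sub f(2) card_image[OF inj] unfolding clique_def by (metis card_lessThan subset_trans)
  qed
  hence "stable E ((%i. f (e i)) ` {..<t})" unfolding stable_def using b' E(2) unfolding irrefl_def by (auto simp: less_Suc_eq)
  moreover have "card ((%i. f (e i)) ` {..<t}) = t" using inj_on_subset[OF inj, of "{..<t}"] by (simp add: card_image)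
  moreover have "(%i. f (e i)) ` {..<t} <= f ` {..<R}" using sub by auto
  ultimately show ?thesis by auto
 qed
 have "~(ALL i<R. ALL j<R. (f i, g j):E)" if h: "sym E" "irrefl E" "~clique E V (Suc t)" "~biclique E V t" "inj_on f {..<R}" "inj_on g {..<R}" "f ` {..<R} <=
   V" "g ` {..<R} <= V" for E :: "'a rel" and V f g
 proof
  assume c: "ALL i<R. ALL j<R. (f i, g j):E"
  obtain A B where AB: "A <= f ` {..<R}" "card A = t" "stable E A" "B <= g ` {..<R}" "card B = t" "stable E B" using st[OF h(1-3,5,7)] st[OF h(1-3,6,8)] by auto
  have ab: "ALL a:A. ALL b:B. (a, b):E" using AB(1,4) c by auto
  hence "A Int B = {}" using irreflD[OF h(2)] by auto
  moreover have "A <= V" "B <= V" using AB(1,4) h(7,8) by auto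
  ultimately have "biclique E V t" unfolding biclique_def using AB(2,3,5,6) ab by auto
  thus False using h(4) by simp
 qed
 thus ?thesis by blast
qed

lemma spider_free_cover:
  assumes "irrefl E" "finite V" "E <= V \<times> V" "x:V" "~spider E V c c x"
  shows "EX Z<=V. x~:Z & card Z <= c * Suc c & (ALL p. ipath E p --> hd p = x --> set p Int Z = {} --> length p <= Suc c)"
proof -
 have "~~spider E V c 0 x" unfolding spider_def by simp
 from ex_least_nat_less[of "%n. ~spider E V c n x", OF assms(5) this] obtain n where n: "n < c" "spider E V c n x" "~spider E V c (Suc n) x" by auto
 obtain L where L: "ALL i<n. ipath E (x # L i) & length (L i) = Suc c & set (L i) <= V" "ALL i<n. ALL j<n. i ~= j --> set (L i) Int set (L j) = {}"
   using n(2) unfolding spider_def by auto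
 define Z where "Z = (UN i<n. set (L i))"
 have "card Z <= (SUM i<n. card (set (L i)))" unfolding Z_def by (rule card_UN_le) simp
 also have "... <= n * Suc c" using sum_bounded_above[of "{..<n}" "%i. card (set (L i))" "Suc c"] L(1) by (simp add: card_length[THEN order_trans])
 also have "... <= c * Suc c" using n(1) by (simp only: mult_le_mono1)
 finally have cZ: "card Z <= c * Suc c" .
 have "length p <= Suc c" if p: "ipath E p" "hd p = x" "set p Int Z = {}" for p
 proof (rule ccontr)
  assume len: "~length p <= Suc c"
  define q where "q = take (Suc c) (tl p)"
  have tp: "take (Suc (Suc c)) p = x # q" using p(1,2) unfolding q_def ipath_def path_def by (cases p) auto
  have ip: "ipath E (x # q)" using ipath_take[OF p(1), of "Suc (Suc c)"] tp by simp
  have "set (take (Suc (Suc c)) p) <= set p" by (rule set_take_subset)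
  hence qp: "set q <= set p" unfolding tp by simp
  have "set (x # q) <= V" using path_in_field[OF ipath_path[OF ip] assms(3)] assms(4) by simp
  moreover have "length q = Suc c" unfolding q_def using len by simp
  ultimately have "spider E V c (Suc n) x" unfolding spider_def using L ip qp p(3) unfolding Z_def by (intro exI[of _ "L(n := q)"]) (auto simp: less_Suc_eq)
  thus False using n(3) by simp
 qed
 moreover have "Z <= V" "x~:Z" unfolding Z_def using L(1) unfolding ipath_def path_def by auto
 ultimately show ?thesis using cZ by auto
qed

definition hub :: "'a rel => 'a set => nat => 'a set set => 'a => bool" where
  "hub E V K \<B> v = (v:V & ~(EX X. v:X & tame E V K \<B> X))"

lemma hubs_linked:
  assumes E: "sym E" "irrefl E" "finite V" "E <= V \<times> V" and B: "ALL B:\<B>. conn E B & B <= V" "ALL A:\<B>. ALL B:\<B>. touch E A B" and h: "hub E V K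
    \<B> x" "hub E V K \<B> y" and T: "finite T" "card T < K" "x~:T" "y~:T"
  shows "EX p. ipath E p & hd p = x & last p = y & set p <= V - T"
proof -
 have ex: "EX B:\<B>. B <= compo E (V - T) z" if z: "hub E V K \<B> z" "z~:T" for z
 proof (rule ccontr)
  assume n: "~(EX B:\<B>. B <= compo E (V - T) z)"
  have zV: "z:V - T" using z unfolding hub_def by simp
  have "nbs E (compo E (V - T) z) <= T" unfolding nbs_def using compo_closed[OF _ zV] E(4) by auto
  hence "card (nbs E (compo E (V - T) z)) < K" using card_mono[OF T(1)] T(2) le_less_trans by blast
  hence "tame E V K \<B> (compo E (V - T) z)" unfolding tame_def using compo_conn[OF E(1) zV] compo_in[OF zV] n by auto
  thus False using z(1) unfolding hub_def by simp
 qed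
 obtain A B where AB: "A:\<B>" "A <= compo E (V - T) x" "B:\<B>" "B <= compo E (V - T) y" using ex[OF h(1) T(3)] ex[OF h(2) T(4)] by auto
 have xV: "x:V - T" and yV: "y:V - T" using h T(3,4) unfolding hub_def by auto
 have "touch E A B" using B(2) AB by simp
 then obtain b where "b:B" "b:compo E (V - T) x" using AB compo_closed[OF _ xV] compo_in[OF yV] unfolding touch_def by blast
 hence "compo E (V - T) y = compo E (V - T) x" using compo_eq[OF E(1)] AB(4) by blast
 thus ?thesis using compo_self conn_ipath[OF compo_conn[OF E(1) xV] compo_self _ E(2,1)] compo_in[OF xV] by (metis subset_trans)
qed

lemma disjoint_choice:
  assumes "finite I" "!!i T. i:I ==> finite T ==> card T <= card I * c ==> EX q. R i q & set q Int T = {} & length q <= c"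
  shows "EX q. (ALL i:I. R i (q i) & length (q i) <= c) & (ALL i:I. ALL j:I. i ~= j --> set (q i) Int set (q j) = {})"
  using assms
proof (induction I rule: finite_induct)
 case (insert a I)
 have "EX q. (ALL i:I. R i (q i) & length (q i) <= c) & (ALL i:I. ALL j:I. i ~= j --> set (q i) Int set (q j) = {})"
   by (rule insert.IH) (use insert(1,2) in \<open>auto intro!: insert.prems\<close>)
 then obtain q where q: "ALL i:I. R i (q i) & length (q i) <= c" "ALL i:I. ALL j:I. i ~= j --> set (q i) Int set (q j) = {}" by auto
 let ?T = "UN i:I. set (q i)"
 have "card ?T <= (SUM i:I. card (set (q i)))" by (rule card_UN_le[OF insert(1)])
 also have "... <= card I * c" using sum_bounded_above[of I "%i. card (set (q i))" c] q(1) card_length le_trans by fastforce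
 finally have "card ?T <= card (insert a I) * c" using insert(1,2) by simp
 then obtain p where p: "R a p" "set p Int ?T = {}" "length p <= c" using insert.prems[of a ?T] insert(1) by auto
 show ?case using q p by (intro exI[of _ "q(a := p)"]) auto
qed simp

theorem few_hubs: "EX m K. K >= 1 & (ALL (E :: 'a rel) V \<B>. sym E --> irrefl E --> finite V --> E <= V \<times> V --> (ALL B:\<B>. conn E B & B <= V) -->
  (ALL A:\<B>. ALL B:\<B>. touch E A B) --> ~clique E V (Suc t) --> ~biclique E V t --> (ALL x:V. ~spider E V c c x) --> card {v. hub E V K \<B> v} < m)"
proof -
 obtain R :: nat where R: "ALL (E :: 'a rel) V f g. sym E --> irrefl E --> ~clique E V (Suc t) --> ~biclique E V t --> inj_on f {..<R} --> inj_on g {..<R} -->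
   f ` {..<R} <= V --> g ` {..<R} <= V --> ~(ALL i<R. ALL j<R. (f i, g j):E)" using no_biclique[where t = t and 'a = 'a] by auto
 define n2 d where "n2 = 4 * R + c + 4" and "d = c * Suc c"
 define C where "C = Pow ({..<3::nat} \<times> {..<Suc c} \<times> {..<Suc c})"
 obtain N2 where N2: "ALL F :: nat list => (nat * nat * nat) set. (ALL xs. F xs:C) --> (EX e :: nat => nat. EX P. strict_mono e & (ALL i<n2. e i < N2) & (ALL
   xs. length xs = 4 & sorted_wrt (<) xs & set xs <= {..<n2} --> F (map e xs) = P))" using ramsey_lists[of C n2 4] unfolding C_def by auto
 define n1 where "n1 = N2 + t + d + 2"
 obtain m where m: "ALL F :: nat list => bool \<times> bool \<times> bool. (ALL xs. F xs:UNIV) --> (EX e :: nat => nat. EX P. strict_mono e & (ALL i<n1. e i <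
   m) & (ALL xs. length xs = 2 & sorted_wrt (<) xs & set xs <= {..<n1} --> F (map e xs) = P))"
   using ramsey_lists[of "UNIV :: (bool \<times> bool \<times> bool) set" n1 2] by auto
 define K where "K = N2 * d + N2 + N2 * N2 * c + 1"
 have "card {v. hub E V K \<B> v} < m" if E: "sym E" "irrefl E" "finite V" "E <= V \<times> V" and B: "ALL B:\<B>. conn E B & B <= V" "ALL A:\<B>. ALL B:\<B>.
   touch E A B" and cl: "~clique E V (Suc t)" and bc: "~biclique E V t" and sp: "ALL x:V. ~spider E V c c x" for E :: "'a rel" and V \<B>
 proof (rule ccontr)
  assume "~card {v. hub E V K \<B> v} < m"
  then obtain Hs where Hs: "Hs <= {v. hub E V K \<B> v}" "card Hs = m" "finite Hs" by (meson not_less obtain_subset_with_card_n)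
  have "EX eta. bij_betw eta {..<m} Hs" using ex_bij_betw_nat_finite[OF Hs(3)] Hs(2) by (simp only: atLeast0LessThan)
  then obtain eta where eta: "bij_betw eta {..<m} Hs" by auto
  have "ALL x:V. EX Z. Z <= V & x~:Z & card Z <= d & (ALL p. ipath E p --> hd p = x --> set p Int Z = {} --> length p <= Suc c)"
  proof
   fix x
   assume x: "x:V"
   thus "EX Z. Z <= V & x~:Z & card Z <= d & (ALL p. ipath E p --> hd p = x --> set p Int Z = {} --> length p <= Suc c)" unfolding d_def
     using spider_free_cover[OF E(2-4) x sp[rule_format, OF x]] by simp
  qed
  from bchoice[OF this] obtain Z where Z: "ALL x:V. Z x <= V & x~:Z x & card (Z x) <= d & (ALL p. ipath E p --> hd p = x --> set p Int Z x = {} --> length p <=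
    Suc c)" by auto
  obtain e1 :: "nat => nat" and P1 where e1: "strict_mono e1" "ALL i<n1. e1 i < m" and P1: "ALL xs. length xs = 2 & sorted_wrt (<) xs & set xs <= {..<n1} -->
    (let x = eta (map e1 xs ! 0); y = eta (map e1 xs ! 1) in ((x, y):E, y:Z x, x:Z y)) = P1"
    using m[rule_format, of "%xs. let x = eta (xs ! 0); y = eta (xs ! 1) in ((x, y):E, y:Z x, x:Z y)"] by auto
  define h where "h i = eta (e1 i)" for i
  have hP: "((h i, h j):E, h j:Z (h i), h i:Z (h j)) = P1" if "i < j" "j < n1" for i j using P1[rule_format, of "[i, j]"] that unfolding h_def
    by (simp add: Let_def)
  have hh: "hub E V K \<B> (h i)" if "i < n1" for i using that eta e1(2) Hs(1) unfolding h_def bij_betw_def by auto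
  have hV: "h i:V" if "i < n1" for i using hh[OF that] unfolding hub_def by simp
  have hi: "h i = h j \<longleftrightarrow> i = j" if "i < n1" "j < n1" for i j using that inj_onD[OF bij_betw_imp_inj_on[OF eta]] e1(2) strict_mono_eq[OF
    e1(1)] unfolding h_def by blast
  have hc: "card (h ` I) = card I" if "I <= {..<n1}" for I
  proof (rule card_image, rule inj_onI)
   fix i j
   assume ij: "i:I" "j:I" "h i = h j"
   thus "i = j" using that hi by auto
  qed
  have fZ: "finite (Z x) & card (Z x) <= d" if "x:V" for x using Z that finite_subset[OF _ E(3)] by simp
  have chz: "~h ` I <= Z x" if "I <= {..<n1}" "card I = Suc d" "x:V" for I x using that fZ card_mono[of "Z x" "h ` I"] hc by fastforce
  obtain p1 p2 p3 where p: "P1 = (p1, p2, p3)" by (cases P1)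
  have "~p1"
  proof
   assume p1
   hence a: "(h i, h j):E" if "i < n1" "j < n1" "i ~= j" for i j using hP[of i j] hP[of j i] that E(1) unfolding p by (metis linorder_neqE_nat prod.inject symD)
   have s: "{..<Suc t} <= {..<n1}" unfolding n1_def by simp
   hence "h ` {..<Suc t} <= V" using hV by auto
   moreover have "card (h ` {..<Suc t}) = Suc t" using hc[OF s] by simp
   moreover have "(u, v):E" if uv: "u:h ` {..<Suc t}" "v:h ` {..<Suc t}" "u ~= v" for u v
   proof -
    obtain i j where ij: "u = h i" "v = h j" "i < Suc t" "j < Suc t" using uv(1,2) by auto
    hence "i ~= j" "i < n1" "j < n1" using uv(3) unfolding n1_def by auto
    thus ?thesis using a ij(1,2) by simp
   qed
   ultimately have "clique E V (Suc t)" unfolding clique_def by blast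
   thus False using cl by simp
  qed
  moreover have "~p2" using hP[of 0] chz[of "{1..Suc d}" "h 0"] hV[of 0] unfolding p n1_def by fastforce
  moreover have "~p3" using hP[of _ "Suc d"] chz[of "{..<Suc d}" "h (Suc d)"] hV[of "Suc d"] unfolding p n1_def by auto
  ultimately have hn: "(h i, h j)~:E & h j~:Z (h i)" if "i < n1" "j < n1" for i j using hP[of i j] hP[of j i] that E(1,2) Z hV unfolding p
    by (metis irreflD linorder_neqE_nat prod.inject symD)
  have N12: "i < n1" if "i < N2" for i using that unfolding n1_def by simp
  define T0 where "T0 = (UN i<N2. Z (h i)) Un h ` {..<N2}"
  have cT0: "card T0 <= N2 * d + N2"
  proof -
   have "card (UN i<N2. Z (h i)) <= (SUM i<N2. card (Z (h i)))" by (rule card_UN_le) simp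
   also have "... <= N2 * d" using sum_bounded_above[of "{..<N2}" "%i. card (Z (h i))" d] fZ hV N12 by simp
   finally show ?thesis unfolding T0_def using card_Un_le[of "UN i<N2. Z (h i)" "h ` {..<N2}"] card_image_le[of "{..<N2}" h] by simp
  qed
  define I where "I = {(i, j). i < j & j < N2}"
  have "I <= {..<N2} \<times> {..<N2}" unfolding I_def by auto
  hence I: "finite I" "card I <= N2 * N2" using card_mono[of "{..<N2} \<times> {..<N2}" I] finite_subset by auto
  define good where "good ij q \<longleftrightarrow> ipath E (h (fst ij) # q @ [h (snd ij)]) & q ~= [] & set q Int T0 = {} & set q <= V" for ij q
  have "EX q. good ij q & set q Int T = {} & length q <= c" if ij: "ij:I" and T: "finite T" "card T <= card I * c" for ij T
  proof -
   obtain i j where ijd: "ij = (i, j)" "i < j" "j < N2" using ij unfolding I_def by auto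
   have b: "i < n1" "j < n1" "i ~= j" using ijd N12 by auto
   let ?T = "(T0 Un T) - {h i, h j}"
   have "card (T0 Un T) < K" using T(2) mult_le_mono1[OF I(2), of c] card_Un_le[of T0 T] cT0 unfolding K_def by linarith
   then obtain p where pp: "ipath E p" "hd p = h i" "last p = h j" "set p <= V - ?T"
     using card_mono[of "T0 Un T" ?T] T(1) hubs_linked[OF E B hh[OF b(1)] hh[OF b(2)], of ?T] fZ hV N12 unfolding T0_def by auto
   have pn: "p ~= []" using pp(1) unfolding ipath_def path_def by simp
   obtain p' where p': "p = h i # p'" using pn pp(2) by (cases p) auto
   hence "p' ~= []" using pp(3) hi b by auto
   then obtain q where q: "p' = q @ [h j]" using pp(3) p' append_butlast_last_id by (metis last_ConsR)
   have pq: "p = h i # q @ [h j]" using p' q by simp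
   have "q ~= []" using path_nth[OF ipath_path[OF pp(1)], of 0] pq hn b by auto
   moreover have "set q Int (T0 Un T) = {}" using pp(1) unfolding ipath_def path_def using pp(4) unfolding pq by auto
   ultimately have "set p Int Z (h i) = {}" unfolding T0_def using ijd hn b unfolding pq by fastforce
   hence "length p <= Suc c" using Z hV[OF b(1)] pp(1,2) by simp
   thus ?thesis using pp(1,4) \<open>q ~= []\<close> \<open>set q Int (T0 Un T) = {}\<close> unfolding good_def ijd(1) pq by auto
  qed
  then obtain q where q: "ALL ij:I. good ij (q ij) & length (q ij) <= c" "ALL ij:I. ALL kl:I. ij ~= kl --> set (q ij) Int set (q kl) = {}"
    using disjoint_choice[OF I(1), of c good] by auto
  define qa where "qa i j a = q (i, j) ! min a (length (q (i, j)) - 1)" for i j a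
  have qg: "good (i, j) (q (i, j)) & length (q (i, j)) <= c" if "i < j" "j < N2" for i j using q(1) that unfolding I_def by simp
  have qin: "qa i j a:set (q (i, j))" if "i < j" "j < N2" for i j a
  proof -
   have "q (i, j) ~= []" using qg[OF that] unfolding good_def by simp
   thus ?thesis unfolding qa_def by (intro nth_mem) (simp add: min.strict_coboundedI2)
  qed
  have qex: "EX a<c. x = qa i j a" if "x:set (q (i, j))" "i < j" "j < N2" for x i j
  proof -
   note xx = that
   obtain a where a: "a < length (q (i, j))" "x = q (i, j) ! a" using xx(1) unfolding in_set_conv_nth by auto
   hence "x = qa i j a" "a < c" using qg[OF xx(2,3)] unfolding qa_def by auto
   thus ?thesis by auto
  qed
  define F where "F xs = (let i = xs ! 0; j = xs ! 1; k = xs ! 2; l = xs ! 3 in {(0 :: nat, a, b) | a b. a < c & b < c & (qa i j a, qa k l b):E} Un {(1, a, 0)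
    | a. a < c & (qa i j a, h k):E} Un {(2, a, 0) | a. a < c & (h i, qa j k a):E})" for xs
  have "ALL xs. F xs:C" unfolding F_def C_def Let_def by auto
  from N2[rule_format, of F, OF this[rule_format]] obtain e :: "nat => nat" and P where e: "strict_mono e" "ALL i<n2. e i < N2" and P: "ALL xs. length xs = 4 &
    sorted_wrt (<) xs & set xs <= {..<n2} --> F (map e xs) = P" by auto
  have eN: "e i < N2" if "i < n2" for i using e(2) that by simp
  have em: "e i < e j \<longleftrightarrow> i < j" "e i = e j \<longleftrightarrow> i = j" for i j using e(1) by (auto simp: strict_mono_less strict_mono_eq)
  have FP: "F [e i, e j, e k, e l] = P" if "i < j" "j < k" "k < l" "l < n2" for i j k l using P[rule_format, of "[i, j, k, l]"] that by simp
  have F0: "(0, a, b):F [i, j, k, l] \<longleftrightarrow> a < c & b < c & (qa i j a, qa k l b):E" for a b i j k l unfolding F_def by simp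
  have F1: "(1, a, 0):F [i, j, k, l] \<longleftrightarrow> a < c & (qa i j a, h k):E" for a i j k l unfolding F_def by simp
  have F2: "(2, a, 0):F [i, j, k, l] \<longleftrightarrow> a < c & (h i, qa j k a):E" for a i j k l unfolding F_def by simp
  have b0: "(qa (e i) (e j) a, qa (e k) (e l) b):E \<longleftrightarrow> (0, a, b):P" if "i < j" "j < k" "k < l" "l < n2" "a < c" "b < c" for i j k l a b
    using F0[of a b "e i" "e j" "e k" "e l"] FP[OF that(1-4)] that(5,6) by simp
  have b1: "(qa (e i) (e j) a, h (e k)):E \<longleftrightarrow> (1, a, 0):P" if "i < j" "j < k" "Suc k < n2" "a < c" for i j k a
    using F1[of a "e i" "e j" "e k" "e (Suc k)"] FP[OF that(1,2) lessI that(3)] that(4) by simp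
  have b2: "(h (e i), qa (e j) (e k) a):E \<longleftrightarrow> (2, a, 0):P" if "i < j" "j < k" "Suc k < n2" "a < c" for i j k a
    using F2[of a "e i" "e j" "e k" "e (Suc k)"] FP[OF that(1,2) lessI that(3)] that(4) by simp
  have qd: "qa (e i) (e j) a ~= qa (e k) (e l) b" if "i < j" "j < n2" "k < l" "l < n2" "i ~= k" for i j k l a b
  proof -
   have "(e i, e j):I" "(e k, e l):I" "(e i, e j) ~= (e k, e l)" using that em eN unfolding I_def by auto
   thus ?thesis using q(2) qin[of "e i" "e j" a] qin[of "e k" "e l" b] unfolding I_def by fastforce
  qed
  have qV: "qa (e i) (e j) a:V" if "i < j" "j < n2" for i j a
  proof -
   have "e i < e j" "e j < N2" using em eN that by auto
   thus ?thesis using qin qg unfolding good_def by blast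
  qed
  have hd: "h (e i):V" "h (e i) = h (e j) \<longleftrightarrow> i = j" if "i < n2" "j < n2" for i j using hV hi N12 eN em that by auto
  have RR: False if "!!x y. x < R ==> y < R ==> (f x, k y):E" "inj_on f {..<R}" "inj_on k {..<R}" "f ` {..<R} <= V" "k ` {..<R} <= V" for f k
    using R[rule_format, OF E(1,2) cl bc that(2-5)] that(1) by simp
  have n0: "(0, a, b)~:P" if ab: "a < c" "b < c" for a b
  proof
   assume "(0, a, b):P"
   hence "(qa (e (2 * x)) (e (2 * x + 1)) a, qa (e (2 * (R + y))) (e (2 * (R + y) + 1)) b):E" if "x < R" "y < R" for x y
     using b0[of "2 * x" "2 * x + 1" "2 * (R + y)" "2 * (R + y) + 1"] ab that unfolding n2_def by auto
   moreover have "inj_on (%x. qa (e (2 * x)) (e (2 * x + 1)) a) {..<R}" "inj_on (%y. qa (e (2 * (R + y))) (e (2 * (R + y) + 1)) b) {..<R}"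
     by (rule inj_onI, rule ccontr, use qd in \<open>simp add: n2_def\<close>)+
   moreover have "(%x. qa (e (2 * x)) (e (2 * x + 1)) a) ` {..<R} <= V" "(%y. qa (e (2 * (R + y))) (e (2 * (R + y) + 1)) b) ` {..<R} <= V"
     by (intro image_subsetI, use qV in \<open>simp add: n2_def\<close>)+
   ultimately show False by (rule RR)
  qed
  have n1: "(1, a, 0)~:P" if ab: "a < c" for a
  proof
   assume "(1, a, 0):P"
   hence "(qa (e (2 * x)) (e (2 * x + 1)) a, h (e (2 * R + y))):E" if "x < R" "y < R" for x y using b1[of "2 * x" "2 * x + 1" "2 * R + y" a] ab that
     unfolding n2_def by simp
   moreover have "inj_on (%x. qa (e (2 * x)) (e (2 * x + 1)) a) {..<R}" by (rule inj_onI, rule ccontr, use qd in \<open>simp add: n2_def\<close>)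
   moreover have "inj_on (%y. h (e (2 * R + y))) {..<R}" by (rule inj_onI) (use hd(2) in \<open>simp add: n2_def\<close>)
   moreover have "(%x. qa (e (2 * x)) (e (2 * x + 1)) a) ` {..<R} <= V" "(%y. h (e (2 * R + y))) ` {..<R} <= V"
     by (intro image_subsetI, use qV hV N12 eN in \<open>simp add: n2_def\<close>)+
   ultimately show False by (rule RR)
  qed
  have n2': "(2, a, 0)~:P" if ab: "a < c" for a
  proof
   assume "(2, a, 0):P"
   hence "(h (e x), qa (e (R + 2 * y)) (e (R + 2 * y + 1)) a):E" if "x < R" "y < R" for x y using b2[of x "R + 2 * y" "R + 2 * y + 1" a] ab that
     unfolding n2_def by simp
   moreover have "inj_on (%x. h (e x)) {..<R}" by (rule inj_onI) (use hd(2) in \<open>simp add: n2_def\<close>)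
   moreover have "inj_on (%y. qa (e (R + 2 * y)) (e (R + 2 * y + 1)) a) {..<R}" by (rule inj_onI, rule ccontr, use qd in \<open>simp add: n2_def\<close>)
   moreover have "(%x. h (e x)) ` {..<R} <= V" "(%y. qa (e (R + 2 * y)) (e (R + 2 * y + 1)) a) ` {..<R} <= V"
     by (intro image_subsetI, use qV hV N12 eN in \<open>simp add: n2_def\<close>)+
   ultimately show False by (rule RR)
  qed
  define Q where "Q i = (if i <= c then set (q (e i, e (Suc i))) else {})" for i
  define A where "A i = insert (h (e i)) (Q i)" for i
  have g: "good (e i, e (Suc i)) (q (e i, e (Suc i)))" if "i <= c" for i using qg[of "e i" "e (Suc i)"] eN[of "Suc i"] em(1)[of i "Suc i"] that
    unfolding n2_def by simp
  have Qa: "EX a<c. x = qa (e i) (e (Suc i)) a" if "x:Q i" "i <= c" for x i using qex[of x "e i" "e (Suc i)"] eN[of "Suc i"] em(1)[of i "Suc i"] that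
    unfolding n2_def Q_def by simp
  have far: "(u, v)~:E" if u: "u:A i" and v: "v:A j" and ij: "Suc (Suc i) <= j" "j <= Suc c" for u v i j
  proof
   assume uv: "(u, v):E"
   have i: "i <= c" "i < n2" "j < n2" "Suc j < n2" "Suc (Suc j) < n2" "Suc i < j" "i < j" "i < Suc i" "j < Suc j" using ij unfolding n2_def by auto
   have Qj: "j <= c" if "v:Q j" using that unfolding Q_def by (cases "j <= c") simp_all
   from u v consider (hh) "u = h (e i)" "v = h (e j)" | (hq) "u = h (e i)" "v:Q j" | (qh) "u:Q i" "v = h (e j)" | (qq) "u:Q i" "v:Q j" unfolding A_def by auto
   thus False using uv hn[of "e i" "e j"] N12 eN Qa Qj b2 n2' i i(1) b1 n1 b0 n0 by metis
  qed
  have c1: "conn E (insert (h (e (Suc i))) (A i))" if "i <= c" for i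
  proof -
   have "conn E (set (h (e i) # q (e i, e (Suc i)) @ [h (e (Suc i))]))" using g[OF that] unfolding good_def by (intro path_conn[OF E(1) ipath_path]) simp
   moreover have "set (h (e i) # q (e i, e (Suc i)) @ [h (e (Suc i))]) = insert (h (e (Suc i))) (A i)" unfolding A_def Q_def using that by auto
   ultimately show ?thesis by simp
  qed
  have AW: "conn E (UN i<=k. insert (h (e (Suc i))) (A i))" if "k <= c" for k using that
  proof (induction k)
   case (Suc k)
   have "touch E (insert (h (e (Suc (Suc k)))) (A (Suc k))) (UN i<=k. insert (h (e (Suc i))) (A i))" unfolding A_def touch_def by auto
   thus ?case unfolding atMost_Suc using conn_Un[OF E(1) c1[OF Suc.prems]] Suc by simp
  qed (use c1[of 0] in simp)
  define W where "W = (UN i<=c. insert (h (e (Suc i))) (A i))"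
  have "h (e 0):W" "h (e (Suc c)):W" unfolding W_def A_def by auto
  then obtain p where p: "ipath E p" "hd p = h (e 0)" "last p = h (e (Suc c))" "set p <= W" by (rule conn_ipath[OF AW[OF order_refl] _ _ E(2,1), folded W_def])
  have l: "k < n2" "e k < n1" "h (e k):T0" if "k <= Suc c" for k using N12 eN[of k] that unfolding n2_def T0_def by auto
  have QT: "Q i Int T0 = {}" for i unfolding Q_def using g[of i] unfolding good_def by simp
  have "Z (h (e 0)) <= T0" unfolding T0_def using eN[of 0] l(1)[of 0] by auto
  moreover have "h (e k)~:Z (h (e 0))" if "k <= Suc c" for k using hn[OF l(2)[OF le0] l(2)[OF that]] by simp
  moreover have WA: "EX i<=Suc c. x:A i" if x: "x:W" for x
  proof -
   obtain i where i: "i <= c" "x = h (e (Suc i)) | x:A i" using x unfolding W_def by auto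
   thus ?thesis unfolding A_def by (cases "x = h (e (Suc i))") (auto intro: exI[of _ i])
  qed
  ultimately have "set p Int Z (h (e 0)) = {}" using QT unfolding A_def using p(4) by blast
  hence lp: "length p <= Suc c" using Z hV[OF l(2)[OF le0]] p(1,2) by simp
  have pn: "path E p" "p ~= []" using p(1) unfolding ipath_def path_def by auto
  have "EX i<=k. p ! k:A i" if "k < length p" for k using that
  proof (induction k)
   case 0
   thus ?case using p(2) unfolding A_def by (simp add: hd_conv_nth)
  next
   case (Suc k)
   then obtain i where i: "i <= k" "p ! k:A i" by auto
   obtain j where j: "j <= Suc c" "p ! Suc k:A j" using WA p(4) nth_mem[OF Suc.prems] by auto
   have "~Suc (Suc i) <= j" using far[OF i(2) j(2) _ j(1)] path_nth[OF pn(1) Suc.prems] by auto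
   thus ?case using i(1) j(2) by (intro exI[of _ j]) simp
  qed
  from this[of "length p - 1"] obtain i where i: "i <= length p - 1" "h (e (Suc c)):A i" using pn(2) p(3) by (auto simp: last_conv_nth)
  show False using i(1) lp hd(2)[OF l(1)[of i] l(1)[OF order_refl]] QT[of i] l(3)[OF order_refl] i(2) unfolding A_def by fastforce
 qed
 moreover have "K >= 1" unfolding K_def by simp
 ultimately show ?thesis by blast
qed

subsection \<open>Treewidth\<close>

inductive dec :: "'a rel => nat => 'a set => 'a set => bool" for E w where
  bag: "finite X ==> card X <= w ==> Y <= X ==> dec E w X Y"
  | glue: "dec E w U X ==> dec E w U' X' ==> U Int U' <= X Int X' ==> E Int (U - U') \<times> (U' - U) = {} ==> Y <= X ==> dec E w (U Un U') Y"

lemma bramble_or_dec: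
  assumes E: "sym E" "E <= V \<times> V" "finite V" and k: "k >= 1" and nb: "\<nexists>\<B>. bramble E V (Suc k) \<B>" and "U <= V" "X <= U" "card X <= 3 * k"
  shows "dec E (4 * k) U X"
  using assms(6-8)
proof (induction "card U" arbitrary: U X rule: less_induct)
 case less
 have fU: "finite U" using less.prems(1) E(3) finite_subset by auto
 show ?case
 proof (cases "card U <= 4 * k")
  case True
  thus ?thesis using bag[OF fU] less.prems(2) by simp
 next
  case False
  obtain Y where Y: "X <= Y" "Y <= U" "card Y = 3 * k" using exists_subset_between[of X "3 * k" U] less.prems(2,3) False fU by auto
  have fY: "finite Y" using Y(2) fU finite_subset by auto
  define big where "big S x \<longleftrightarrow> card Y < 2 * card (compo E (U - S) x Int Y)" for S x
  have "EX S<=U. card S <= k & (ALL x:U - S. ~big S x)"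
  proof (rule ccontr)
   assume n: "~?thesis"
   define \<B> where "\<B> = {compo E (U - S) x | S x. S <= U & card S <= k & x:U - S & big S x}"
   have "ALL B:\<B>. conn E B & B <= V"
   proof
    fix B
    assume "B:\<B>"
    then obtain S x where "B = compo E (U - S) x" "x:U - S" unfolding \<B>_def by auto
    thus "conn E B & B <= V" using compo_conn[OF E(1)] compo_in[of x "U - S" E] less.prems(1) by auto
   qed
   moreover have "ALL A:\<B>. ALL B:\<B>. touch E A B"
   proof (intro ballI)
    fix A B
    assume "A:\<B>" "B:\<B>"
    hence b: "card Y < 2 * card (A Int Y)" "card Y < 2 * card (B Int Y)" unfolding \<B>_def big_def by auto
    have "card (A Int Y Un B Int Y) <= card Y" by (rule card_mono[OF fY]) blast
    thus "touch E A B" using b card_Un_disjoint[of "A Int Y" "B Int Y"] fY unfolding touch_def by auto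
   qed
   moreover have "EX B:\<B>. B Int T = {}" if T: "finite T" "card T < Suc k" for T
   proof -
    have c: "T Int U <= U" "card (T Int U) <= k" using T card_mono[OF T(1), of "T Int U"] by auto
    then obtain x where x: "x:U - T Int U" "big (T Int U) x" using n by auto
    thus ?thesis unfolding \<B>_def using c compo_in[OF x(1), of E] by blast
   qed
   ultimately have "bramble E V (Suc k) \<B>" unfolding bramble_def by simp
   thus False using nb by simp
  qed
  then obtain S where S: "S <= U" "card S <= k" and big: "ALL x:U - S. ~big S x" by auto
  have fS: "finite S" using S(1) fU finite_subset by auto
  have small: "2 * card (compo E (U - S) x Int Y) <= card Y" if "x:U - S" for x using big[rule_format, OF that] unfolding big_def by simp
  have sub: "dec E (4 * k) (compo E (U - S) x Un S) (S Un Y Int compo E (U - S) x)" if x: "x:U - S" for x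
  proof -
   let ?C = "compo E (U - S) x"
   have C: "?C <= U" using compo_in[OF x, of E] by auto
   have "Y <= (?C Int Y) Un S" if "?C Un S = U" using that Y(2) by auto
   hence "card Y <= card (?C Int Y) + card S" if "?C Un S = U" using that card_mono[of "(?C Int Y) Un S" Y] card_Un_le[of "?C Int Y" S] fY fS by simp
   hence "?C Un S ~= U" using small[OF x] S(2) Y(3) k by auto
   hence "card (?C Un S) < card U" using C S(1) by (intro psubset_card_mono[OF fU]) blast
   moreover have "card (S Un Y Int ?C) <= 3 * k" using card_Un_le[of S "Y Int ?C"] small[OF x] S(2) Y(3) by (simp add: Int_commute)
   ultimately show ?thesis using less.hyps[of "?C Un S" "S Un Y Int ?C"] C S(1) less.prems(1) by auto
  qed
  define \<C> where "\<C> = compo E (U - S) ` (U - S)"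
  have cc: "EX x:U - S. C = compo E (U - S) x" if "C:\<C>" for C using that unfolding \<C>_def by auto
  have gl: "dec E (4 * k) (Y Un S Un \<Union>\<D>) (Y Un S)" if "finite \<D>" "\<D> <= \<C>" for \<D> using that
  proof (induction \<D> rule: finite_induct)
   case empty
   show ?case using card_Un_le[of Y S] S(2) Y(3) bag[of "Y Un S" "4 * k" "Y Un S" E] fY fS by simp
  next
   case (insert C \<D>)
   obtain x where x: "x:U - S" "C = compo E (U - S) x" using insert.prems cc by blast
   have dis: "C Int D = {}" if D: "D:\<D>" for D
   proof (rule ccontr)
    assume ne: "C Int D ~= {}"
    obtain y where y: "D = compo E (U - S) y" using D insert.prems cc by auto
    obtain z where "z:C" "z:D" using ne by auto
    thus False using compo_eq[OF E(1)] x(2) y D insert.hyps by metis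
   qed
   have "D <= U" if D: "D:\<D>" for D
   proof -
    obtain y where "y:U - S" "D = compo E (U - S) y" using D insert.prems cc by auto
    thus ?thesis using compo_in[of y "U - S" E] by auto
   qed
   hence DU: "\<Union>\<D> <= U" by auto
   have "E Int ((Y Un S Un \<Union>\<D>) - (C Un S)) \<times> ((C Un S) - (Y Un S Un \<Union>\<D>)) = {}"
   proof (rule ccontr)
    assume "~?thesis"
    then obtain a b where "(a, b):E" "a:U - S" "a~:C" "b:C" using Y(2) DU by blast
    thus False using compo_closed[OF _ x(1), of b E a] x(2) symD[OF E(1)] by simp
   qed
   moreover have "(Y Un S Un \<Union>\<D>) Int (C Un S) <= (Y Un S) Int (S Un Y Int C)" using dis by auto
   ultimately have "dec E (4 * k) ((Y Un S Un \<Union>\<D>) Un (C Un S)) (Y Un S)" using glue[OF _ sub[OF x(1), folded x(2)]] insert.IH insert.prems by simp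
   moreover have "(Y Un S Un \<Union>\<D>) Un (C Un S) = Y Un S Un \<Union>(insert C \<D>)" by auto
   ultimately show ?case by simp
  qed
  have "Y Un S Un \<Union>\<C> = U" using compo_in[of _ "U - S" E] unfolding \<C>_def using Y(2) S(1) by auto
  moreover have "finite \<C>" unfolding \<C>_def using fU by simp
  ultimately have "dec E (4 * k) U (Y Un S)" using gl[of \<C>] by simp
  from glue[OF this bag[of "{}" "4 * k" "{}" E]] show ?thesis using Y(1) by auto
 qed
qed

definition nat_tree :: "nat => (nat => nat) => nat pair_pre_digraph" where
  "nat_tree n p = \<lparr> pverts = {..<n}, parcs = {(i, p i) | i. 0 < i & i < n} Un {(p i, i) | i. 0 < i & i < n} \<rparr>"

definition par :: "nat => (nat => nat) => bool" where
  "par n p = (0 < n & (ALL i. 0 < i & i < n --> p i < i))"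

definition bags :: "'a rel => nat => 'a set => 'a set => nat => (nat => nat) => (nat => 'a set) => bool" where
  "bags E w U X n p beta = (par n p & X <= beta 0 & (UN i<n. beta i) = U & (ALL i<n. finite (beta i) & card (beta i) <= w) & (ALL u:U. ALL v:U. (u, v):E -->
    (EX i<n. u:beta i & v:beta i)) & (ALL v:U. EX r<n. v:beta r & (ALL i<n. v:beta i --> i = r | (0 < i & v:beta (p i)))))"

lemma dec_bags: "dec E w U X ==> sym E ==> EX n p beta. bags E w U X n p beta"
proof (induction rule: dec.induct)
 case (bag X Y)
 have "bags E w X Y 1 id (%i. X)" unfolding bags_def par_def using bag by auto
 thus ?case by auto
next
 case (glue U X U' X' Y)
 obtain n p beta n' p' beta' where b: "bags E w U X n p beta" "bags E w U' X' n' p' beta'" using glue by auto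
 define q where "q i = (if i < n then p i else if i = n then 0 else n + p' (i - n))" for i
 define gamma where "gamma i = (if i < n then beta i else beta' (i - n))" for i
 have B: "par n p" "X <= beta 0" "(UN i<n. beta i) = U" "ALL i<n. finite (beta i) & card (beta i) <= w" "ALL u:U. ALL v:U. (u, v):E --> (EX i<n. u:beta i &
   v:beta i)" "ALL v:U. EX r<n. v:beta r & (ALL i<n. v:beta i --> i = r | (0 < i & v:beta (p i)))" by (insert b(1)[unfolded bags_def], elim conjE, assumption)+
 have B': "par n' p'" "X' <= beta' 0" "(UN i<n'. beta' i) = U'" "ALL i<n'. finite (beta' i) & card (beta' i) <= w" "ALL u:U'. ALL v:U'. (u, v):E --> (EX i<n'.
   u:beta' i & v:beta' i)" "ALL v:U'. EX r<n'. v:beta' r & (ALL i<n'. v:beta' i --> i = r | (0 < i & v:beta' (p' i)))"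
   by (insert b(2)[unfolded bags_def], elim conjE, assumption)+
 have n: "0 < n" "0 < n'" and pp: "!!i. 0 < i ==> i < n ==> p i < i" "!!i. 0 < i ==> i < n' ==> p' i < i" using B(1) B'(1) unfolding par_def by auto
 have gamma: "gamma i = beta i" if "i < n" for i using that unfolding gamma_def by simp
 have gamma': "gamma (n + i) = beta' i" for i unfolding gamma_def by simp
 have ex: "i < n | (EX j<n'. i = n + j)" if "i < n + n'" for i
 proof (cases "i < n")
  case False
  hence "i - n < n'" "i = n + (i - n)" using that by auto
  thus ?thesis by auto
 qed simp
 have all: "(ALL i<n + n'. P i) \<longleftrightarrow> (ALL i<n. P i) & (ALL i<n'. P (n + i))" for P using ex by auto
 have root: "v:beta 0 & v:beta' 0" if "v:U" "v:U'" for v using that glue(3) B(2) B'(2) by auto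
 have sU: "beta i <= U" if "i < n" for i using that B(3) by auto
 have sU': "beta' i <= U'" if "i < n'" for i using that B'(3) by auto
 have "par (n + n') q"
 proof -
  have "q i < i" if i: "0 < i" "i < n + n'" for i
  proof (cases "i <= n")
   case False
   hence "p' (i - n) < i - n" using i by (intro pp(2)) simp_all
   thus ?thesis using False unfolding q_def by simp
  qed (use i pp(1)[of i] in \<open>simp add: q_def\<close>)
  thus ?thesis unfolding par_def using n by simp
 qed
 moreover have "(UN i<n + n'. gamma i) = U Un U'" using ex gamma gamma' unfolding B(3)[symmetric] B'(3)[symmetric] by fastforce
 moreover have "ALL i<n + n'. finite (gamma i) & card (gamma i) <= w" unfolding all using B(4) B'(4) gamma gamma' by simp
 moreover have "EX i<n + n'. u:gamma i & v:gamma i" if uv: "u:U Un U'" "v:U Un U'" "(u, v):E" for u v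
 proof -
  have "u:U & v:U | u:U' & v:U'" using uv glue(4) symD[OF glue(8) uv(3)] by auto
  thus ?thesis
  proof
   assume "u:U & v:U"
   then obtain i where "i < n" "u:beta i" "v:beta i" using B(5) uv(3) by auto
   thus ?thesis using gamma by (intro exI[of _ i]) simp
  next
   assume "u:U' & v:U'"
   then obtain i where "i < n'" "u:beta' i" "v:beta' i" using B'(5) uv(3) by auto
   thus ?thesis using gamma' by (intro exI[of _ "n + i"]) simp
  qed
 qed
 moreover have "EX r<n + n'. v:gamma r & (ALL i<n + n'. v:gamma i --> i = r | (0 < i & v:gamma (q i)))" if v: "v:U Un U'" for v
 proof -
  have q1: "gamma (q i) = beta (p i)" if "i < n" "0 < i" for i using that gamma[of "p i"] pp(1)[of i] unfolding q_def by simp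
  have q2: "gamma (q (n + i)) = (if i = 0 then beta 0 else beta' (p' i))" for i using n unfolding q_def gamma_def by simp
  show ?thesis
  proof (cases "v:U")
   case True
   then obtain r where r: "r < n" "v:beta r" "ALL i<n. v:beta i --> i = r | (0 < i & v:beta (p i))" using B(6) by auto
   have "v:gamma (q (n + i))" if i: "i < n'" "v:beta' i" for i using B'(6) sU'[OF i(1)] i root True unfolding q2 by auto
   hence "ALL i<n + n'. v:gamma i --> i = r | (0 < i & v:gamma (q i))" unfolding all using r(3) q1 gamma gamma' n by auto
   thus ?thesis using r(1,2) gamma by (intro exI[of _ r]) simp
  next
   case False
   then obtain r where r: "r < n'" "v:beta' r" "ALL i<n'. v:beta' i --> i = r | (0 < i & v:beta' (p' i))" using B'(6) v by auto
   have "ALL i<n + n'. v:gamma i --> i = n + r | (0 < i & v:gamma (q i))" unfolding all using gamma sU False r(3) unfolding q2 gamma' by auto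
   thus ?thesis using r(1,2) gamma' by (intro exI[of _ "n + r"]) simp
  qed
 qed
 ultimately have "bags E w (U Un U') Y (n + n') q gamma" using B(2) glue(5) gamma[OF n(1)] unfolding bags_def by simp
 thus ?case by auto
qed

lemma cas_pairs: "pre_digraph.cas (with_proj T) u es v ==> tl (pre_digraph.awalk_verts (with_proj T) u es) = map snd es & (ALL j. Suc j < length es --> fst (es
  ! Suc j) = snd (es ! j)) & (es ~= [] --> fst (es ! 0) = u & snd (last es) = v)"
proof (induction es arbitrary: u)
 case Nil
 thus ?case by (simp add: pre_digraph.awalk_verts.simps)
next
 case (Cons e es)
 thus ?case by (cases es) (auto simp: pre_digraph.awalk_verts.simps pre_digraph.cas.simps nth_Cons split: nat.splits)
qed

lemma undirected_tree_nat_tree: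
  assumes "par n p"
  shows "undirected_tree (nat_tree n p)" and "!!J r. J <= {..<n} ==> r:J ==> ALL i:J. i = r | (0 < i & p i:J) ==> Digraph_Component.connected (with_proj
    (nat_tree n p) \<restriction> J)"
proof -
 let ?T = "nat_tree n p"
 have p: "p i < i" if "0 < i" "i < n" for i using assms that unfolding par_def by simp
 have pn: "p i < n" if "0 < i" "i < n" for i using p[OF that] that(2) by simp
 have V: "pverts ?T = {..<n}" unfolding nat_tree_def by simp
 have A: "(i, j):parcs ?T \<longleftrightarrow> (0 < i & i < n & j = p i) | (0 < j & j < n & i = p j)" for i j unfolding nat_tree_def by auto
 have pg: "pair_graph ?T"
 proof
  show "finite (pverts ?T)" using V by simp
  fix e
  assume e: "e:parcs ?T"
  obtain i j where ij: "e = (i, j)" by (cases e)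
  show "fst e:pverts ?T" "snd e:pverts ?T" "fst e ~= snd e" using e p[of j] pn unfolding ij V A by auto
 next
  have "parcs ?T <= {..<n} \<times> {..<n}" using A pn by auto
  thus "finite (parcs ?T)" by (rule finite_subset) simp
  show "symmetric (with_proj ?T)" unfolding symmetric_def with_proj_simps by (rule symI) (use A in blast)
 qed
 show C: "Digraph_Component.connected (with_proj ?T \<restriction> J)" if J: "J <= {..<n}" "r:J" "ALL i:J. i = r | (0 < i & p i:J)" for J r
 proof -
  define M where "M = with_proj (mk_symmetric (with_proj ?T \<restriction> J))"
  have M: "verts M = J" "sym (arcs_ends M)" "!!i. 0 < i ==> i:J ==> p i:J ==> (i, p i):arcs_ends M" unfolding M_def with_proj_simps parcs_mk_symmetric
    using A J(1) by (simp, blast intro!: symI, fastforce)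
  have "(i, r):rtrancl_on J (arcs_ends M)" if "i:J" for i using that
  proof (induction i rule: less_induct)
   case (less i)
   show ?case
   proof (cases "i = r")
    case False
    hence i: "0 < i" "p i:J" "i < n" using J less.prems by auto
    show ?thesis using converse_rtrancl_on_into_rtrancl_on[OF M(3)[OF i(1) less.prems i(2)]] less p[OF i(1,3)] i(2) by simp
   qed (use J(2) in simp)
  qed
  moreover have "(r, i):rtrancl_on J (arcs_ends M)" if "(i, r):rtrancl_on J (arcs_ends M)" for i using rtrancl_on_sym[OF M(2)] that by (rule symD)
  ultimately show ?thesis unfolding Digraph_Component.connected_def strongly_connected_def M_def[symmetric] reachable_def M(1) using J(2)
    by (blast intro: rtrancl_on_trans)
 qed
 have "with_proj ?T \<restriction> {..<n} = with_proj ?T" using A pn V unfolding induce_subgraph_def with_proj_def by fastforce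
 hence "Digraph_Component.connected (with_proj ?T)" using C[of "{..<n}" 0] assms unfolding par_def by (metis order_refl lessThan_iff gr0I less_trans)
 moreover have "~(pre_digraph.cycle (with_proj ?T) es & 3 <= length es)" for es
 proof
  assume es: "pre_digraph.cycle (with_proj ?T) es & 3 <= length es"
  then obtain u where u: "pre_digraph.awalk (with_proj ?T) u es u" "distinct (tl (pre_digraph.awalk_verts (with_proj ?T) u es))" "es ~= []"
    unfolding pre_digraph.cycle_def by auto
  hence c: "pre_digraph.cas (with_proj ?T) u es u" "set es <= parcs ?T" unfolding pre_digraph.awalk_def by auto
  note c' = cas_pairs[OF c(1)]
  define l where "l = length es"
  define s where "s j = (if Suc j < l then Suc j else 0)" for j
  have l: "l >= 3" using es unfolding l_def by simp
  have s: "s j < l" for j unfolding s_def using l by simp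
  have fs: "fst (es ! s j) = snd (es ! j)" if "j < l" for j
  proof (cases "Suc j < l")
   case True
   thus ?thesis using c' unfolding s_def l_def by simp
  next
   case False
   hence "j = length es - 1" using that unfolding l_def by simp
   thus ?thesis using False c' u(3) unfolding s_def by (simp add: last_conv_nth)
  qed
  have ds: "a = b" if "a < l" "b < l" "snd (es ! a) = snd (es ! b)" for a b using u(2) c' that unfolding l_def by (simp add: distinct_conv_nth) metis
  have "finite (snd ` set es)" "snd ` set es ~= {}" using u(3) by auto
  then obtain m where m: "m:snd ` set es" "ALL x:snd ` set es. x <= m" using Max_in Max_ge by metis
  obtain a where a: "a < l" "snd (es ! a) = m" using m(1) unfolding l_def by (auto simp: in_set_conv_nth)
  have up: "p m = j" if "(j, m):parcs ?T | (m, j):parcs ?T" "j <= m" for j using that p A by (metis leD)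
  have le: "snd (es ! j) <= m" if "j < l" for j using m(2) that unfolding l_def by simp
  have arc: "es ! j:parcs ?T" if "j < l" for j using c(2) that unfolding l_def by auto
  have sj: "EX b<l. s b = j" if "j < l" for j using that unfolding s_def by (intro exI[of _ "if j = 0 then l - 1 else j - 1"]) auto
  obtain b where b: "b < l" "s b = a" using sj[OF a(1)] by auto
  have 1: "p m = snd (es ! b)" using fs[OF b(1)] b(2) arc[OF a(1)] a(2) up le[OF b(1)] by (metis prod.collapse)
  have "b = s (s b)" using arc[OF s[of a]] fs[OF a(1)] a(2) up le[OF s] ds[OF b(1) s] 1 b(2) by auto
  thus False using l unfolding s_def by (auto split: if_splits)
 qed
 ultimately show "undirected_tree ?T" unfolding undirected_tree_def using pg by simp
qed

lemma treewidth_le: assumes G: "pair_graph G" and b: "bags (parcs G) w (pverts G) X n p beta" shows "treewidth G <= w"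
proof -
 interpret pair_graph G by (rule G)
 have p: "par n p" using b unfolding bags_def by simp
 let ?T = "nat_tree n p"
 have V: "pverts ?T = {..<n}" unfolding nat_tree_def by simp
 have "tree_decomposition G ?T beta" unfolding tree_decomposition_def V
 proof (intro conjI ballI)
  show "undirected_tree ?T" by (rule undirected_tree_nat_tree[OF p])
  show "(UN s:{..<n}. beta s) = pverts G" using b unfolding bags_def by simp
 next
  fix e
  assume e: "e:parcs G"
  obtain u v where uv: "e = (u, v)" by (cases e)
  show "case e of (u, v) => EX s:{..<n}. u:beta s & v:beta s" using e in_arcsD1 in_arcsD2 unfolding uv using b unfolding bags_def by (simp add: Bex_def)
 next
  fix v
  assume v: "v:pverts G"
  then obtain r where r: "r < n" "v:beta r" "ALL i<n. v:beta i --> i = r | (0 < i & v:beta (p i))" using b unfolding bags_def by auto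
  have "ALL i:{s : {..<n}. v:beta s}. i = r | (0 < i & p i : {s : {..<n}. v:beta s})" using r p unfolding par_def by auto
  thus "Digraph_Component.connected (with_proj ?T \<restriction> {s : {..<n}. v:beta s})" by (intro undirected_tree_nat_tree(2)[OF p, of _ r]) (use r in auto)
 qed
 hence "treewidth G <= width ?T beta" unfolding treewidth_def by (intro Least_le) blast
 moreover have "Max ((%s. card (beta s)) ` {..<n}) <= w" using b unfolding bags_def par_def by (intro Max.boundedI) auto
 ultimately show ?thesis unfolding width_def V by simp
qed

theorem large_treewidth_bramble:
  assumes G: "pair_graph G" and tw: "treewidth G > 4 * k" and k: "k >= 1"
  shows "EX \<B>. bramble (parcs G) (pverts G) (Suc k) \<B>"
proof (rule ccontr)
 interpret pair_graph G by (rule G)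
 assume n: "~?thesis"
 have E: "sym (parcs G)" "parcs G <= pverts G \<times> pverts G" "finite (pverts G)" using sym_arcs in_arcsD1 in_arcsD2 unfolding symmetric_def by auto
 have "dec (parcs G) (4 * k) (pverts G) {}" by (rule bramble_or_dec[OF E k]) (use n in auto)
 thus False using dec_bags[OF _ E(1)] treewidth_le[OF G] tw by (metis not_less)
qed

subsection \<open>Hassles\<close>

lemma leg_path_graph:
  assumes L: "ipath E L" "sym E" and lh: "lo <= hi" "hi < length L"
  shows "path_graph (with_proj (gr (set L) (E Int set L \<times> set L)) \<restriction> (%i. L ! i) ` {lo..hi})"
proof -
 define xs where "xs = map (%i. L ! i) [lo..<Suc hi]"
 have d: "distinct L" and p: "path E L" and ind: "!!i j. i < length L ==> j < length L ==> (L ! i, L ! j):E ==> j = Suc i | i = Suc j" using L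
   unfolding ipath_def path_def by auto
 have s: "set xs = (%i. L ! i) ` {lo..hi}" unfolding xs_def by auto
 have len: "length xs = Suc hi - lo" unfolding xs_def by auto
 have nth: "xs ! i = L ! (lo + i)" if "i < length xs" for i using that unfolding xs_def by (simp del: upt_Suc)
 have "distinct xs" unfolding xs_def distinct_map using d lh(2) by (simp add: inj_on_def nth_eq_iff_index_eq del: upt_Suc)
 have adj: "(xs ! i, xs ! j):E \<longleftrightarrow> j = Suc i | i = Suc j" if "i < length xs" "j < length xs" for i j
 proof -
  have b: "lo + i < length L" "lo + j < length L" using that len lh by auto
  show ?thesis using ind[OF b] path_nth[OF p, of "lo + i"] path_nth[OF p, of "lo + j"] b symD[OF L(2)] unfolding nth[OF that(1)] nth[OF that(2)] by auto
 qed
 have "arcs_ends (with_proj (gr (set L) (E Int set L \<times> set L)) \<restriction> set xs) = {(u, v):E. u:set xs & v:set xs}" unfolding arcs_ends_conv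
   using lh(2) unfolding s by auto
 also have "... = {(xs ! i, xs ! j) | i j. i < length xs & j < length xs & (j = Suc i | i = Suc j)}" using adj by (auto simp: in_set_conv_nth)
 finally show ?thesis unfolding path_graph_def s[symmetric] using \<open>distinct xs\<close> len lh(1) by (intro exI[of _ xs] conjI) auto
qed

text \<open>The walk on a leg starts at the far end, turns around at the vertex next to the neck and returns.\<close>

lemma spider_hassle:
  fixes G :: "'a pair_pre_digraph"
  assumes G: "pair_graph G" and x: "x:pverts G" and sp: "spider (parcs G) (pverts G) c c x"
  shows "EX H :: 'a pair_pre_digraph. hassle c H & contains G H"
proof -
 interpret pair_graph G by (rule G)
 have E: "sym (parcs G)" "irrefl (parcs G)" using sym_arcs no_loops unfolding symmetric_def irrefl_def by fastforce+
 obtain L where L: "ALL i<c. ipath (parcs G) (x # L i) & length (L i) = Suc c & set (L i) <= pverts G" "ALL i<c. ALL j<c. i ~= j --> set (L i) Int set (L j) =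
   {}" using sp unfolding spider_def by auto
 define W where "W i = gr (set (L i)) (parcs G Int set (L i) \<times> set (L i))" for i
 define X where "X = insert x (UN i<c. set (L i))"
 define H where "H = gr X (parcs G Int X \<times> X)"
 define d where "d k = (if k <= Suc c then Suc c - k else k - Suc c)" for k
 define phi where "phi i k = L i ! d k" for i k
 define n where "n = 2 * c + 1"
 have XV: "X <= pverts G" unfolding X_def using L(1) x by auto
 have pg: "pair_graph (gr Y (parcs G Int Y \<times> Y))" if "finite Y" for Y using that E by (intro pair_graph_gr) (auto simp: irrefl_def intro!: sym_restr)
 have Wv: "pverts (W i) = set (L i)" for i unfolding W_def by simp
 have p: "ipath (parcs G) (x # L i)" "length (L i) = Suc c" "set (L i) <= X" if "i < c" for i using that L(1) unfolding X_def by auto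
 have xL: "x~:set (L i)" if "i < c" for i using p(1)[OF that] unfolding ipath_def path_def by simp
 have iL: "ipath (parcs G) (L i)" if "i < c" for i
 proof -
  have "path (parcs G) (L i)" using p[OF that] path_appendD2[of _ "[x]" "L i"] unfolding ipath_def by fastforce
  moreover have "b = Suc a | a = Suc b" if "a < length (L i)" "b < length (L i)" "(L i ! a, L i ! b):parcs G" for a b
    using p(1)[OF \<open>i < c\<close>] that unfolding ipath_def by (metis Suc_less_eq length_Cons nat.inject nth_Cons_Suc)
  ultimately show ?thesis unfolding ipath_def by simp
 qed
 have xn: "(x, L i ! k):parcs G \<longleftrightarrow> k = 0" if "i < c" "k < Suc c" for i k
 proof
  assume "(x, L i ! k):parcs G"
  thus "k = 0" using p[OF that(1)] that(2) unfolding ipath_def by fastforce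
 next
  assume "k = 0"
  thus "(x, L i ! k):parcs G" using path_nth[OF ipath_path[OF p(1)[OF that(1)]], of 0] p(2)[OF that(1)] by simp
 qed
 have dk: "d k < Suc c" if "1 <= k" "k <= n" for k using that unfolding d_def n_def by auto
 have dim: "EX lo hi. lo <= hi & hi < Suc c & d ` {a..b} = {lo..hi}" if ab: "1 <= a" "a <= b" "b <= n" for a b
 proof -
  consider "b <= Suc c" | "Suc c <= a" | "a <= Suc c" "Suc c <= b" by linarith
  thus ?thesis
  proof cases
   case 1
   have "d ` {a..b} = {Suc c - b..Suc c - a}"
   proof (intro equalityI subsetI)
    fix y
    assume "y : {Suc c - b..Suc c - a}"
    thus "y:d ` {a..b}" using 1 ab unfolding d_def by (intro image_eqI[of _ _ "Suc c - y"]) auto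
   qed (use 1 ab in \<open>auto simp: d_def\<close>)
   thus ?thesis using ab by (intro exI[of _ "Suc c - b"] exI[of _ "Suc c - a"]) auto
  next
   case 2
   have "d ` {a..b} = {a - Suc c..b - Suc c}"
   proof (intro equalityI subsetI)
    fix y
    assume "y : {a - Suc c..b - Suc c}"
    thus "y:d ` {a..b}" using 2 ab unfolding d_def by (intro image_eqI[of _ _ "Suc c + y"]) auto
   qed (use 2 ab in \<open>auto simp: d_def\<close>)
   thus ?thesis using ab unfolding n_def by (intro exI[of _ "a - Suc c"] exI[of _ "b - Suc c"]) auto
  next
   case 3
   have "d ` {a..b} = {0..max (Suc c - a) (b - Suc c)}"
   proof (intro equalityI subsetI)
    fix y
    assume "y : {0..max (Suc c - a) (b - Suc c)}"
    then consider "y <= Suc c - a" | "y <= b - Suc c" by fastforce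
    thus "y:d ` {a..b}"
    proof cases
     case 1
     thus ?thesis using 3 unfolding d_def by (intro image_eqI[of _ _ "Suc c - y"]) auto
    next
     case 2
     thus ?thesis using 3 unfolding d_def by (intro image_eqI[of _ _ "Suc c + y"]) auto
    qed
   qed (use 3 ab in \<open>auto simp: d_def\<close>)
   thus ?thesis using ab unfolding n_def by simp
  qed
 qed
 have "graph_walk (W i) n (phi i)" if i: "i < c" for i
 proof -
  have "d ` {1..n} = {0..c}"
  proof (intro equalityI subsetI)
   fix y
   assume "y : {0..c}"
   thus "y:d ` {1..n}" unfolding d_def n_def by (intro image_eqI[of _ _ "Suc c - y"]) auto
  qed (use dk in \<open>auto simp: less_Suc_eq_le\<close>)
  hence "phi i ` {1..n} = (%k. L i ! k) ` {0..c}" unfolding phi_def by (metis image_image)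
  also have "... = set (L i)" using p(2)[OF i] by (auto simp: in_set_conv_nth less_Suc_eq_le)
  finally have 1: "phi i ` {1..n} = pverts (W i)" unfolding Wv .
  have "(phi i k, phi i (Suc k)):parcs (W i)" if k: "1 <= k" "k < n" for k
  proof -
   have "d k = Suc (d (Suc k)) | d (Suc k) = Suc (d k)" unfolding d_def by auto
   moreover have "d k < Suc c" "d (Suc k) < Suc c" using dk k by auto
   ultimately show ?thesis using path_nth[OF ipath_path[OF iL[OF i]]] p(2)[OF i] symD[OF E(1)] unfolding W_def phi_def by auto
  qed
  thus ?thesis unfolding graph_walk_def using 1 pg[of "set (L i)"] unfolding W_def by simp
 qed
 moreover have "stretched c (W i) n (phi i)" if i: "i < c" for i unfolding stretched_def
 proof (intro allI impI)
  fix a b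
  assume ab: "1 <= a & a <= b & b <= n & card {a..b} <= c"
  then obtain lo hi where lh: "lo <= hi" "hi < Suc c" "d ` {a..b} = {lo..hi}" using dim[of a b] by auto
  have "phi i ` {a..b} = (%k. L i ! k) ` {lo..hi}" unfolding phi_def lh(3)[symmetric] by auto
  thus "path_graph (with_proj (W i) \<restriction> phi i ` {a..b})" using leg_path_graph[OF iL[OF i] E(1) lh(1)] lh(2) p(2)[OF i] unfolding W_def by simp
 qed
 moreover have "with_proj H \<restriction> pverts (W i) = with_proj (W i)" if i: "i < c" for i using p(3)[OF i]
   unfolding induce_subgraph_def H_def W_def with_proj_def by auto
 moreover have "EX v:pverts (W i). (x, v):parcs H" if i: "i < c" for i
 proof -
  have "L i ! 0:set (L i)" using p(2)[OF i] by simp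
  moreover have "x:X" unfolding X_def by simp
  ultimately show ?thesis using xn[OF i, of 0] unfolding H_def using p(3)[OF i] unfolding Wv by auto
 qed
 moreover have "(x, v)~:parcs H" if i: "i < c" and v: "v:first_verts c n (phi i) Un last_verts c n (phi i)" for i v using v xn[OF i]
   unfolding first_verts_def last_verts_def phi_def H_def d_def n_def by auto
 moreover have "pair_graph H" unfolding H_def using pg finite_subset[OF XV] by simp
 moreover have "pverts H = insert x (UN i<c. pverts (W i))" unfolding H_def Wv X_def by simp
 moreover have "ALL i<c. ALL j<c. i ~= j --> pverts (W i) Int pverts (W j) = {}" unfolding Wv by (rule L(2))
 moreover have "x~:(UN i<c. pverts (W i))" unfolding Wv using xL by simp
 ultimately have "hassle c H" unfolding hassle_def by (intro conjI exI[of _ c] exI[of _ W] exI[of _ "%_. n"] exI[of _ phi] exI[of _ x]) simp_all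
 moreover have "contains G H" unfolding H_def by (rule contains_induced[OF G XV])
 ultimately show ?thesis by auto
qed

lemma clean_no_clique: assumes G: "pair_graph G" and c: "clean t G" shows "~clique (parcs G) (pverts G) (Suc t)"
proof
 interpret pair_graph G by (rule G)
 assume "clique (parcs G) (pverts G) (Suc t)"
 then obtain C where C: "C <= pverts G" "card C = Suc t" "ALL u:C. ALL v:C. u ~= v --> (u, v):parcs G" unfolding clique_def by auto
 have "parcs G Int C \<times> C = {(u, v). (u, v):C \<times> C & u ~= v}" using C(3) no_loops' by auto
 hence "complete_digraph (t + 1) (with_proj (gr C (parcs G Int C \<times> C)))" unfolding complete_digraph_pair_def using C(2) by (simp add: card_ge_0_finite)
 hence "basic_obstruction t (gr C (parcs G Int C \<times> C))" unfolding basic_obstruction_def by simp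
 thus False using c contains_induced[OF G C(1)] unfolding clean_def by simp
qed

lemma clean_no_biclique: assumes G: "pair_graph G" and c: "clean t G" shows "~biclique (parcs G) (pverts G) t"
proof
 interpret pair_graph G by (rule G)
 assume "biclique (parcs G) (pverts G) t"
 then obtain A B where A: "A <= pverts G" "B <= pverts G" "A Int B = {}" "card A = t" "card B = t" "stable (parcs G) A" "stable (parcs G) B" "ALL a:A. ALL b:B.
   (a, b):parcs G" unfolding biclique_def by auto
 define X where "X = A Un B"
 have X: "X <= pverts G" using A unfolding X_def by simp
 have "(b, a):parcs G" if "a:A" "b:B" for a b using A(8) that sym_arcs unfolding symmetric_def by (auto dest: symD)
 hence "parcs G Int X \<times> X = A \<times> B Un B \<times> A" using A(6-8) unfolding X_def stable_def by auto
 hence "complete_bipartite_digraph t t (with_proj (gr X (parcs G Int X \<times> X)))" unfolding complete_bipartite_digraph_pair_def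
   using A finite_subset[OF X] unfolding X_def by auto
 hence "basic_obstruction t (gr X (parcs G Int X \<times> X))" unfolding basic_obstruction_def by simp
 thus False using c contains_induced[OF G X] unfolding clean_def by simp
qed

lemma bramble_delete:
  fixes E :: "'a rel"
  assumes E: "sym E" "E <= V \<times> V" "finite V" and b: "bramble E V (theta + m) \<B>" and h: "card {v. hub E V K \<B> v} <= m"
  obtains V' \<B>' where "V' <= V" "bramble (E Int V' \<times> V') V' theta \<B>'" "ALL v:V'. EX X. v:X & tame (E Int V' \<times> V') V' K \<B>' X"
proof -
 define D where "D = {v. hub E V K \<B> v}"
 define V' where "V' = V - D"
 define F where "F = E Int V' \<times> V'"
 define \<B>' where "\<B>' = {B:\<B>. B Int D = {}}"
 have fD: "finite D" using E(3) unfolding D_def hub_def by auto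
 have BV: "B <= V'" "conn F B" if "B:\<B>'" for B using that b conn_restrict[of E B V'] unfolding bramble_def \<B>'_def V'_def F_def by auto
 have "bramble F V' theta \<B>'" unfolding bramble_def
 proof (intro conjI ballI allI impI)
  fix A B
  assume AB: "A:\<B>'" "B:\<B>'"
  hence "touch E A B" using b unfolding bramble_def \<B>'_def by simp
  thus "touch F A B" using BV(1)[OF AB(1)] BV(1)[OF AB(2)] unfolding touch_def F_def by auto
 next
  fix T :: "'a set"
  assume T: "finite T & card T < theta"
  obtain B where "B:\<B>" "B Int (T Un D) = {}" using T fD h card_Un_le[of T D] unfolding D_def using b unfolding bramble_def by auto
  thus "EX B:\<B>'. B Int T = {}" unfolding \<B>'_def by auto
 qed (use BV in blast)+
 moreover have "EX X. v:X & tame F V' K \<B>' X" if v: "v:V'" for v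
 proof -
  obtain X where X: "v:X" "tame E V K \<B> X" using v unfolding V'_def D_def hub_def by auto
  define Y where "Y = compo E (X - D) v"
  have vX: "v:X - D" using X(1) v unfolding V'_def by simp
  have YX: "Y <= X - D" unfolding Y_def by (rule compo_in[OF vX])
  have YV: "Y <= V'" using YX X(2) unfolding tame_def V'_def by auto
  have "conn F Y" unfolding F_def using conn_restrict[OF compo_conn[OF E(1) vX] YV[unfolded Y_def]] unfolding Y_def .
  moreover have "nbs F Y <= nbs E X" using compo_closed vX YX unfolding nbs_def F_def Y_def V'_def by fastforce
  hence "card (nbs F Y) < K" using X(2) card_mono[of "nbs E X" "nbs F Y"] finite_subset[of "nbs E X" V] E(2,3) unfolding tame_def nbs_def by fastforce
  ultimately have "tame F V' K \<B>' Y" using X(2) YX unfolding tame_def \<B>'_def using YV by blast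
  moreover have "v:Y" unfolding Y_def by simp
  ultimately show ?thesis by auto
 qed
 ultimately show ?thesis using that[of V' \<B>'] unfolding F_def V'_def by simp
qed

theorem theorem6p1:
  "\<forall>c t :: nat. \<exists>\<Gamma> :: nat. \<forall>G :: 'a pair_pre_digraph.
     pair_graph G \<and> clean t G \<and> treewidth G > \<Gamma> \<longrightarrow>
     (\<exists>H :: 'a pair_pre_digraph. hassle c H \<and> contains G H)"
proof (intro allI)
 fix c t :: nat
 show "EX \<Gamma> :: nat. ALL G :: 'a pair_pre_digraph. pair_graph G & clean t G & treewidth G > \<Gamma> --> (EX H :: 'a pair_pre_digraph. hassle c H &
   contains G H)"
 proof (cases "t >= 2")
  case True
  obtain m K where K: "K >= 1" and m: "ALL (E :: 'a rel) V \<B>. sym E --> irrefl E --> finite V --> E <= V \<times> V --> (ALL B:\<B>. conn E B & B <= V) -->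
    (ALL A:\<B>. ALL B:\<B>. touch E A B) --> ~clique E V (Suc t) --> ~biclique E V t --> (ALL x:V. ~spider E V c c x) --> card {v. hub E V K \<B> v} < m"
    using few_hubs[of t c, where 'a = 'a] by auto
  obtain theta where theta: "ALL (E :: 'a rel) V \<B>. finite V --> E <= V \<times> V --> sym E --> irrefl E --> bramble E V theta \<B> --> (ALL v:V. EX X. v:X
    & tame E V K \<B> X) --> (EX X<=V. obstructs (wall t) E X)" using tame_obstruction[OF True K, where 'a = 'a] by auto
  show ?thesis
  proof (rule exI[of _ "4 * (theta + m + 1)"], intro allI impI)
   fix G :: "'a pair_pre_digraph"
   assume a: "pair_graph G & clean t G & treewidth G > 4 * (theta + m + 1)"
   have aG: "pair_graph G" and aC: "clean t G" using a by auto
   interpret pair_graph G by (rule aG)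
   have E: "sym (parcs G)" "irrefl (parcs G)" "finite (pverts G)" "parcs G <= pverts G \<times> pverts G" using sym_arcs no_loops in_arcsD1 in_arcsD2
     unfolding symmetric_def irrefl_def by fastforce+
   have "EX x:pverts G. spider (parcs G) (pverts G) c c x"
   proof (rule ccontr)
    assume sp: "~?thesis"
    obtain \<B> where "bramble (parcs G) (pverts G) (Suc (theta + m + 1)) \<B>" using large_treewidth_bramble[of G "theta + m + 1"] a by auto
    hence b: "bramble (parcs G) (pverts G) (theta + m) \<B>" by (rule bramble_mono) simp
    have "card {v. hub (parcs G) (pverts G) K \<B> v} < m" by (rule m[rule_format, OF E]) (use b clean_no_clique[OF aG aC] clean_no_biclique[OF aG aC] sp in
      \<open>simp_all add: bramble_def\<close>)
    then obtain V \<B>' where V: "V <= pverts G" "bramble (parcs G Int V \<times> V) V theta \<B>'" "ALL v:V. EX X. v:X & tame (parcs G Int V \<times> V) V K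
      \<B>' X" by (rule bramble_delete[OF E(1,4,3) b less_imp_le])
    have "irrefl (parcs G Int V \<times> V)" using E(2) unfolding irrefl_def by simp
    then obtain X S where X: "X <= V" "subdivision_pair (wall t) S" "digraph_iso (with_proj S) (with_proj (gr X (parcs G Int V \<times> V Int X \<times> X))) |
      digraph_iso (with_proj (line_graph S)) (with_proj (gr X (parcs G Int V \<times> V Int X \<times> X)))"
      using theta[rule_format, OF finite_subset[OF V(1) E(3)] _ sym_restr[OF E(1)] _ V(2)] V(3) by auto
    have "parcs G Int V \<times> V Int X \<times> X = parcs G Int X \<times> X" using X(1) by auto
    hence "basic_obstruction t (gr X (parcs G Int X \<times> X))" unfolding basic_obstruction_def using X(2,3) by auto
    thus False using contains_induced[of G X] a X(1) V(1) unfolding clean_def by auto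
   qed
   thus "EX H :: 'a pair_pre_digraph. hassle c H & contains G H" using spider_hassle[OF aG] by auto
  qed
 next
  case False
  show ?thesis
  proof (rule exI[of _ "4 * 1"], intro allI impI)
   fix G :: "'a pair_pre_digraph"
   assume a: "pair_graph G & clean t G & treewidth G > 4 * 1"
   have aG: "pair_graph G" and aC: "clean t G" using a by auto
   interpret pair_graph G by (rule aG)
   obtain \<B> where b: "bramble (parcs G) (pverts G) (Suc 1) \<B>" using large_treewidth_bramble[of G 1] a by auto
   have av: "EX B:\<B>. B Int T = {} & conn (parcs G) B & B <= pverts G" if "finite T" "card T < 2" for T using b that unfolding bramble_def by simp
   obtain B v where B: "B:\<B>" "v:B" "conn (parcs G) B" "B <= pverts G" using av[of "{}"] conn_nonempty by fastforce
   obtain B' where B': "B':\<B>" "v~:B'" "B' <= pverts G" using av[of "{v}"] by auto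
   have nc: "~clique (parcs G) (pverts G) (Suc t)" by (rule clean_no_clique[OF aG aC])
   have "EX u w. (u, w):parcs G"
   proof (cases "B Int B' = {}")
    case True
    show ?thesis using b B(1) B'(1) unfolding bramble_def using True unfolding touch_def by metis
   next
    case False
    then obtain w where "w:B" "w ~: - B'" by auto
    thus ?thesis using conn_cut[OF B(3,2), of "- B'" w] B'(2) by blast
   qed
   then obtain u w where uw: "(u, w):parcs G" by auto
   have "u ~= w" "u:pverts G" "w:pverts G" "(w, u):parcs G" using uw no_loops' in_arcsD2 sym_arcs unfolding symmetric_def by (auto dest: symD)
   hence "clique (parcs G) (pverts G) 2" unfolding clique_def using uw by (intro exI[of _ "{u, w}"]) auto
   moreover have "clique (parcs G) (pverts G) 1" unfolding clique_def using B(2,4) by (intro exI[of _ "{v}"]) auto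
   moreover have "t = 0 | t = 1" using False by auto
   ultimately show "EX H :: 'a pair_pre_digraph. hassle c H & contains G H" using nc by (auto simp: numeral_2_eq_2)
  qed
 qed
qed

end
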